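(* Let $A$ be a commutative involutive stereotype algebra whose involutive spectrum $M=\mathrm{Spec}(A)$ is a paracompact locally compact space. Then its Gelfand transform $\mathcal{G}_A:A\to C(M)$ is its continuous envelope, its Kuznetsova envelope, and its envelope in the classes $\mathrm{Mor}$ of all morphisms and $\mathrm{Epi}$ of all epimorphisms of the category $\mathtt{InvSte}^\circledast$ with respect to the class $\mathtt{C}^*$ of $C^*$-algebras: $$C(M)=\mathrm{Env}_{\mathtt{C}^*}^{\mathrm{DEpi}}A=\mathrm{Env}_{\mathtt{C}^*}^{\mathrm{Epi}}A=\mathrm{Env}_{\mathtt{C}^*}^{\mathrm{Mor}}A=\varprojlim\mathcal{C}_A .$$
   Context: All locally convex spaces are Hausdorff and over $\mathbb{C}$. For a locally convex space $X$, $X^\star$ is the space of continuous linear functionals with the topology of uniform convergence on totally bounded sets; $X$ is stereotype if the natural map $X\to(X^\star)^\star$ is an isomorphism of locally convex spaces. A stereotype algebra is a stereotype space $A$ with a unital associative algebra structure such that for every compact $K\subseteq A$ and neighbourhood of zero $U$ there is a neighbourhood of zero $V$ with $K\cdot V\subseteq U$, $V\cdot K\subseteq U$. It is involutive if it carries a continuous involution $x\mapsto\overline{x}$. $\mathtt{InvSte}^\circledast$ is the category of involutive stereotype algebras and continuous unital involutive homomorphisms; (unital) $C^*$-algebras are objects of it. Involutive spectrum $\mathrm{Spec}(A)$: the set of all continuous unital involutive homomorphisms $\chi:A\to\mathbb{C}$ with the topology of uniform convergence on totally bounded sets in $A$. For paracompact locally compact $M$, $C(M)$ is the algebra of continuous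 functions $M\to\mathbb{C}$ with the topology of uniform convergence on compact sets (it is a stereotype algebra). Gelfand transform: $\mathcal{G}_A(x)(t)=t(x)$, $x\in A$, $t\in M$. Envelope: for classes $\varOmega,\varPhi$ of morphisms, $\sigma:X\to X'$ is an extension of $X$ in $\varOmega$ with respect to $\varPhi$ if $\sigma\in\varOmega$ and for every $\varphi:X\to B$ in $\varPhi$ there is a unique morphism $\varphi':X'\to B$ with $\varphi=\varphi'\circ\sigma$; an extension $\rho:X\to E$ is an envelope, $E=\mathrm{Env}_\varPhi^\varOmega X$, if for every extension $\sigma:X\to X'$ there is a unique $\upsilon:X'\to E$ with $\rho=\upsilon\circ\sigma$. $\mathrm{Env}_{\mathtt{C}^*}^{\varOmega}$ is the envelope in $\varOmega$ with respect to the class of all morphisms with values in $C^*$-algebras. $\mathrm{DEpi}$ is the class of morphisms $\varphi:A\to B$ with $\varphi(A)$ dense in $B$. The continuous envelope of $A$ is its envelope in $\mathrm{DEpi}$ with respect to $\mathtt{C}^*$. Kuznetsova envelope: a $C^*$-neighbourhood in $A$ is a closed absolutely convex neighbourhood of zero $U$ whose Minkowski functional $p$ satisfies $p(x\cdot\overline{x})=p(x)^2$ for all $x\in A$. Put $\mathrm{Ker}\,U=\bigcap_{\epsilon>0}\epsilon U$ and let $A/U$ be the $C^*$-algebra obtained by completing $A/\mathrm{Ker}\,U$ with the norm whose unit ball is $U+\mathrm{Ker}\,U$. The natural maps $\rho_U:A\to A/U$ form a cone over the system of natural maps $A/V\to A/U$ ($V\subseteq U$), and the Kuznetsova envelope is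 the induced morphism $\varprojlim\mathcal{C}_A:A\to\varprojlim_U A/U$ into the projective limit in $\mathtt{InvSte}^\circledast$ (the same name and notation being used for its range). *)

theory Defs
  imports "HOL-Analysis.Analysis" "HOL-Algebra.QuotRing" "HOL-Algebra.Module"
begin

section \<open>Locally convex spaces over the complex numbers\<close>

definition complex_ring :: "complex ring" where
  "complex_ring = \<lparr>carrier = UNIV, mult = (*), one = 1, zero = 0, add = (+)\<rparr>"

text \<open>Vector spaces are rendered as modules over \<^const>\<open>complex_ring\<close>.  The fields
  \<^term>\<open>mult\<close> and \<^term>\<open>one\<close>, which come with every module record, play no role for a
  space that is not considered as an algebra.\<close>

record 'a lcs = "(complex, 'a) module" +
  topol :: "'a topology"

definition zero_nbhd :: "('a, 'm) lcs_scheme \<Rightarrow> 'a set \<Rightarrow> bool" where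
  "zero_nbhd X U \<longleftrightarrow>
     U \<subseteq> carrier X \<and> (\<exists>W. openin (topol X) W \<and> \<zero>\<^bsub>X\<^esub> \<in> W \<and> W \<subseteq> U)"

definition convex_in :: "('a, 'm) lcs_scheme \<Rightarrow> 'a set \<Rightarrow> bool" where
  "convex_in X U \<longleftrightarrow>
     (\<forall>x\<in>U. \<forall>y\<in>U. \<forall>t\<in>{0..1::real}.
        complex_of_real (1 - t) \<odot>\<^bsub>X\<^esub> x \<oplus>\<^bsub>X\<^esub> complex_of_real t \<odot>\<^bsub>X\<^esub> y \<in> U)"

definition absolutely_convex_in :: "('a, 'm) lcs_scheme \<Rightarrow> 'a set \<Rightarrow> bool" where
  "absolutely_convex_in X U \<longleftrightarrow>
     (\<forall>x\<in>U. \<forall>y\<in>U. \<forall>a b. cmod a + cmod b \<le> 1 \<longrightarrow> a \<odot>\<^bsub>X\<^esub> x \<oplus>\<^bsub>X\<^esub> b \<odot>\<^bsub>X\<^esub> y \<in> U)"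

definition locally_convex_space :: "('a, 'm) lcs_scheme \<Rightarrow> bool" where
  "locally_convex_space X \<longleftrightarrow>
     module complex_ring X \<and>
     topspace (topol X) = carrier X \<and>
     Hausdorff_space (topol X) \<and>
     continuous_map (prod_topology (topol X) (topol X)) (topol X) (\<lambda>(x, y). x \<oplus>\<^bsub>X\<^esub> y) \<and>
     continuous_map (prod_topology euclidean (topol X)) (topol X) (\<lambda>(c, x). c \<odot>\<^bsub>X\<^esub> x) \<and>
     (\<forall>U. zero_nbhd X U \<longrightarrow> (\<exists>V. zero_nbhd X V \<and> convex_in X V \<and> V \<subseteq> U))"

definition totally_bounded_in :: "('a, 'm) lcs_scheme \<Rightarrow> 'a set \<Rightarrow> bool" where
  "totally_bounded_in X S \<longleftrightarrow>
     S \<subseteq> carrier X \<and>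
     (\<forall>U. zero_nbhd X U \<longrightarrow> (\<exists>F. finite F \<and> F \<subseteq> carrier X \<and> S \<subseteq> F <+>\<^bsub>X\<^esub> U))"

definition linear_on :: "('a, 'm) lcs_scheme \<Rightarrow> ('b, 'n) lcs_scheme \<Rightarrow> ('a \<Rightarrow> 'b) \<Rightarrow> bool" where
  "linear_on X Y f \<longleftrightarrow>
     f \<in> carrier X \<rightarrow> carrier Y \<and>
     (\<forall>x\<in>carrier X. \<forall>y\<in>carrier X. f (x \<oplus>\<^bsub>X\<^esub> y) = f x \<oplus>\<^bsub>Y\<^esub> f y) \<and>
     (\<forall>c. \<forall>x\<in>carrier X. f (c \<odot>\<^bsub>X\<^esub> x) = c \<odot>\<^bsub>Y\<^esub> f x)"

definition lcs_isomorphism :: "('a, 'm) lcs_scheme \<Rightarrow> ('b, 'n) lcs_scheme \<Rightarrow> ('a \<Rightarrow> 'b) \<Rightarrow> bool" where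
  "lcs_isomorphism X Y f \<longleftrightarrow> linear_on X Y f \<and> homeomorphic_map (topol X) (topol Y) f"


section \<open>Uniform convergence on a family of sets\<close>

text \<open>The topology on the function set \<^term>\<open>F\<close> of uniform convergence on the members of
  \<^term>\<open>\<S>\<close>.  Finite unions of members of \<^term>\<open>\<S>\<close> are used so that no directedness of
  \<^term>\<open>\<S>\<close> is needed.\<close>

definition uniform_topology :: "'a set set \<Rightarrow> ('a \<Rightarrow> complex) set \<Rightarrow> ('a \<Rightarrow> complex) topology" where
  "uniform_topology \<S> F = topology (\<lambda>W. W \<subseteq> F \<and>
     (\<forall>f\<in>W. \<exists>\<T> \<epsilon>. finite \<T> \<and> \<T> \<subseteq> \<S> \<and> \<epsilon> > 0 \<and>
        (\<forall>g\<in>F. (\<forall>x\<in>\<Union>\<T>. dist (g x) (f x) < \<epsilon>) \<longrightarrow> g \<in> W)))"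

lemma openin_uniform_topology:
  "openin (uniform_topology \<S> F) W \<longleftrightarrow> W \<subseteq> F \<and>
     (\<forall>f\<in>W. \<exists>\<T> \<epsilon>. finite \<T> \<and> \<T> \<subseteq> \<S> \<and> \<epsilon> > 0 \<and>
        (\<forall>g\<in>F. (\<forall>x\<in>\<Union>\<T>. dist (g x) (f x) < \<epsilon>) \<longrightarrow> g \<in> W))"
proof -
  let ?near = "\<lambda>f W \<T> \<epsilon>. finite \<T> \<and> \<T> \<subseteq> \<S> \<and> \<epsilon> > 0 \<and>
        (\<forall>g\<in>F. (\<forall>x\<in>\<Union>\<T>. dist (g x) (f x) < \<epsilon>) \<longrightarrow> g \<in> W)"
  let ?P = "\<lambda>W. W \<subseteq> F \<and> (\<forall>f\<in>W. \<exists>\<T> (\<epsilon>::real). ?near f W \<T> \<epsilon>)"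
  have "istopology ?P"
    unfolding istopology_def
  proof (intro conjI allI impI)
    fix V W assume V: "?P V" and W: "?P W"
    show "V \<inter> W \<subseteq> F" using V by blast
    show "\<forall>f\<in>V \<inter> W. \<exists>\<T> \<epsilon>. ?near f (V \<inter> W) \<T> \<epsilon>"
    proof
      fix f assume f: "f \<in> V \<inter> W"
      then have "\<exists>\<T> \<epsilon>. ?near f V \<T> \<epsilon>" "\<exists>\<T> \<epsilon>. ?near f W \<T> \<epsilon>" using V W by auto
      then obtain \<T>1 \<epsilon>1 \<T>2 \<epsilon>2 where 1: "?near f V \<T>1 \<epsilon>1" and 2: "?near f W \<T>2 \<epsilon>2" by blast
      have "?near f (V \<inter> W) (\<T>1 \<union> \<T>2) (min \<epsilon>1 \<epsilon>2)"
        using 1 2 by (simp add: ball_Un Ball_def)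
      then show "\<exists>\<T> \<epsilon>. ?near f (V \<inter> W) \<T> \<epsilon>" by blast
    qed
  next
    fix \<K> assume K: "\<forall>W\<in>\<K>. ?P W"
    show "\<Union>\<K> \<subseteq> F" using K by blast
    show "\<forall>f\<in>\<Union>\<K>. \<exists>\<T> \<epsilon>. ?near f (\<Union>\<K>) \<T> \<epsilon>"
    proof
      fix f assume "f \<in> \<Union>\<K>"
      then obtain W where W: "W \<in> \<K>" "f \<in> W" by blast
      then have "\<exists>\<T> \<epsilon>. ?near f W \<T> \<epsilon>" using K by auto
      then obtain \<T> \<epsilon> where "?near f W \<T> \<epsilon>" by blast
      then have "?near f (\<Union>\<K>) \<T> \<epsilon>" using W by blast
      then show "\<exists>\<T> \<epsilon>. ?near f (\<Union>\<K>) \<T> \<epsilon>" by blast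
    qed
  qed
  then show ?thesis by (simp add: uniform_topology_def topology_inverse')
qed

lemma topspace_uniform_topology [simp]: "topspace (uniform_topology \<S> F) = F"
proof
  show "topspace (uniform_topology \<S> F) \<subseteq> F"
    using openin_topspace[of "uniform_topology \<S> F"] unfolding openin_uniform_topology by blast
  have "openin (uniform_topology \<S> F) F"
    unfolding openin_uniform_topology by (auto intro!: exI[of _ "{}"] exI[of _ "1::real"])
  then show "F \<subseteq> topspace (uniform_topology \<S> F)" by (rule openin_subset)
qed


section \<open>Stereotype spaces\<close>

definition continuous_functionals :: "('a, 'm) lcs_scheme \<Rightarrow> ('a \<Rightarrow> complex) set" where
  "continuous_functionals X = {f \<in> extensional (carrier X).
     (\<forall>x\<in>carrier X. \<forall>y\<in>carrier X. f (x \<oplus>\<^bsub>X\<^esub> y) = f x + f y) \<and>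
     (\<forall>c. \<forall>x\<in>carrier X. f (c \<odot>\<^bsub>X\<^esub> x) = c * f x) \<and>
     continuous_map (topol X) euclidean f}"

definition dual_space :: "('a, 'm) lcs_scheme \<Rightarrow> ('a \<Rightarrow> complex) lcs" where
  "dual_space X =
     \<lparr>carrier = continuous_functionals X,
      mult = \<lambda>_ _. undefined,
      one = undefined,
      zero = \<lambda>x\<in>carrier X. 0,
      add = \<lambda>f g. \<lambda>x\<in>carrier X. f x + g x,
      smult = \<lambda>c f. \<lambda>x\<in>carrier X. c * f x,
      topol = uniform_topology {S. totally_bounded_in X S} (continuous_functionals X)\<rparr>"

definition stereotype :: "('a, 'm) lcs_scheme \<Rightarrow> bool" where
  "stereotype X \<longleftrightarrow>
     locally_convex_space X \<and>
     lcs_isomorphism X (dual_space (dual_space X))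
       (\<lambda>x\<in>carrier X. \<lambda>f\<in>carrier (dual_space X). f x)"


section \<open>Involutive stereotype algebras and their morphisms\<close>

record 'a ialg = "'a lcs" +
  star :: "'a \<Rightarrow> 'a"

definition star_algebra :: "'a ialg \<Rightarrow> bool" where
  "star_algebra A \<longleftrightarrow>
     module complex_ring A \<and> ring A \<and>
     (\<forall>c. \<forall>x\<in>carrier A. \<forall>y\<in>carrier A.
        (c \<odot>\<^bsub>A\<^esub> x) \<otimes>\<^bsub>A\<^esub> y = c \<odot>\<^bsub>A\<^esub> (x \<otimes>\<^bsub>A\<^esub> y) \<and> x \<otimes>\<^bsub>A\<^esub> (c \<odot>\<^bsub>A\<^esub> y) = c \<odot>\<^bsub>A\<^esub> (x \<otimes>\<^bsub>A\<^esub> y)) \<and>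
     star A \<in> carrier A \<rightarrow> carrier A \<and>
     (\<forall>x\<in>carrier A. star A (star A x) = x) \<and>
     (\<forall>x\<in>carrier A. \<forall>y\<in>carrier A. star A (x \<oplus>\<^bsub>A\<^esub> y) = star A x \<oplus>\<^bsub>A\<^esub> star A y) \<and>
     (\<forall>c. \<forall>x\<in>carrier A. star A (c \<odot>\<^bsub>A\<^esub> x) = cnj c \<odot>\<^bsub>A\<^esub> star A x) \<and>
     (\<forall>x\<in>carrier A. \<forall>y\<in>carrier A. star A (x \<otimes>\<^bsub>A\<^esub> y) = star A y \<otimes>\<^bsub>A\<^esub> star A x)"

definition involutive_stereotype_algebra :: "'a ialg \<Rightarrow> bool" where
  "involutive_stereotype_algebra A \<longleftrightarrow>
     star_algebra A \<and> stereotype A \<and>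
     (\<forall>K U. compactin (topol A) K \<and> zero_nbhd A U \<longrightarrow>
        (\<exists>V. zero_nbhd A V \<and> K <#>\<^bsub>A\<^esub> V \<subseteq> U \<and> V <#>\<^bsub>A\<^esub> K \<subseteq> U)) \<and>
     continuous_map (topol A) (topol A) (star A)"

definition commutative_algebra :: "'a ialg \<Rightarrow> bool" where
  "commutative_algebra A \<longleftrightarrow> (\<forall>x\<in>carrier A. \<forall>y\<in>carrier A. x \<otimes>\<^bsub>A\<^esub> y = y \<otimes>\<^bsub>A\<^esub> x)"

text \<open>Maps are normalised to be \<^const>\<open>undefined\<close> outside the carrier of their domain,
  so that equality of morphisms is equality of functions.\<close>

definition involutive_homs :: "'a ialg \<Rightarrow> 'b ialg \<Rightarrow> ('a \<Rightarrow> 'b) set" where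
  "involutive_homs A B = {f \<in> ring_hom A B \<inter> extensional (carrier A).
     (\<forall>c. \<forall>x\<in>carrier A. f (c \<odot>\<^bsub>A\<^esub> x) = c \<odot>\<^bsub>B\<^esub> f x) \<and>
     (\<forall>x\<in>carrier A. f (star A x) = star B (f x)) \<and>
     continuous_map (topol A) (topol B) f}"

definition morphism :: "'a ialg \<Rightarrow> 'b ialg \<Rightarrow> ('a \<Rightarrow> 'b) \<Rightarrow> bool" where
  "morphism A B f \<longleftrightarrow>
     involutive_stereotype_algebra A \<and> involutive_stereotype_algebra B \<and> f \<in> involutive_homs A B"

text \<open>The value outside the carrier is fixed only to make this a distance function in the
  sense of \<^locale>\<open>Metric_space\<close>.\<close>

definition norm_dist :: "('a, 'm) ring_scheme \<Rightarrow> ('a \<Rightarrow> real) \<Rightarrow> 'a \<Rightarrow> 'a \<Rightarrow> real" where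
  "norm_dist X N x y = (if x \<in> carrier X \<and> y \<in> carrier X then N (x \<ominus>\<^bsub>X\<^esub> y) else 0)"

definition C_star_norm :: "'a ialg \<Rightarrow> ('a \<Rightarrow> real) \<Rightarrow> bool" where
  "C_star_norm A N \<longleftrightarrow>
     (\<forall>x\<in>carrier A. N x \<ge> 0 \<and> (N x = 0 \<longleftrightarrow> x = \<zero>\<^bsub>A\<^esub>)) \<and>
     (\<forall>x\<in>carrier A. \<forall>y\<in>carrier A. N (x \<oplus>\<^bsub>A\<^esub> y) \<le> N x + N y) \<and>
     (\<forall>c. \<forall>x\<in>carrier A. N (c \<odot>\<^bsub>A\<^esub> x) = cmod c * N x) \<and>
     (\<forall>x\<in>carrier A. \<forall>y\<in>carrier A. N (x \<otimes>\<^bsub>A\<^esub> y) \<le> N x * N y) \<and>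
     (\<forall>x\<in>carrier A. N (x \<otimes>\<^bsub>A\<^esub> star A x) = (N x)\<^sup>2)"

definition C_star_algebra :: "'a ialg \<Rightarrow> bool" where
  "C_star_algebra A \<longleftrightarrow>
     star_algebra A \<and>
     (\<exists>N. C_star_norm A N \<and>
        Metric_space.mcomplete (carrier A) (norm_dist A N) \<and>
        topol A = Metric_space.mtopology (carrier A) (norm_dist A N))"


section \<open>Spectrum, function algebras, Gelfand transform\<close>

definition complex_alg :: "complex ialg" where
  "complex_alg =
     \<lparr>carrier = UNIV, mult = (*), one = 1, zero = 0, add = (+), smult = (*),
      topol = euclidean, star = cnj\<rparr>"

definition Spec :: "'a ialg \<Rightarrow> ('a \<Rightarrow> complex) topology" where
  "Spec A = uniform_topology {S. totally_bounded_in A S} (involutive_homs A complex_alg)"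

definition paracompact_space :: "'m topology \<Rightarrow> bool" where
  "paracompact_space M \<longleftrightarrow>
     Hausdorff_space M \<and>
     (\<forall>\<U>. (\<forall>U\<in>\<U>. openin M U) \<and> \<Union>\<U> = topspace M \<longrightarrow>
        (\<exists>\<V>. (\<forall>V\<in>\<V>. openin M V) \<and> \<Union>\<V> = topspace M \<and>
             (\<forall>V\<in>\<V>. \<exists>U\<in>\<U>. V \<subseteq> U) \<and> locally_finite_in M \<V>))"

definition continuous_functions :: "'m topology \<Rightarrow> ('m \<Rightarrow> complex) set" where
  "continuous_functions M = {f \<in> extensional (topspace M). continuous_map M euclidean f}"

definition function_algebra :: "'m topology \<Rightarrow> ('m \<Rightarrow> complex) ialg" where
  "function_algebra M =
     \<lparr>carrier = continuous_functions M,
      mult = \<lambda>f g. \<lambda>t\<in>topspace M. f t * g t,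
      one = \<lambda>t\<in>topspace M. 1,
      zero = \<lambda>t\<in>topspace M. 0,
      add = \<lambda>f g. \<lambda>t\<in>topspace M. f t + g t,
      smult = \<lambda>c f. \<lambda>t\<in>topspace M. c * f t,
      topol = uniform_topology {K. compactin M K} (continuous_functions M),
      star = \<lambda>f. \<lambda>t\<in>topspace M. cnj (f t)\<rparr>"

definition gelfand_transform :: "'a ialg \<Rightarrow> 'a \<Rightarrow> ('a \<Rightarrow> complex) \<Rightarrow> complex" where
  "gelfand_transform A = (\<lambda>x\<in>carrier A. \<lambda>t\<in>topspace (Spec A). t x)"


section \<open>Envelopes with respect to C*-algebras\<close>

text \<open>HOL has no quantification over types inside a formula.  The objects over which the
  universal properties quantify are therefore those whose carrier is a subset of a type
  \<^typ>\<open>'u\<close>, which is passed as an argument and stays arbitrary.  The algebra \<^term>\<open>A\<close> and its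
  envelope may live on other types; they correspond to objects of the category over \<^typ>\<open>'u\<close>
  as soon as their types embed into \<^typ>\<open>'u\<close>.\<close>

datatype morphism_class = All_Mor | Epi | DEpi

definition epimorphism :: "'u itself \<Rightarrow> 'a ialg \<Rightarrow> 'b ialg \<Rightarrow> ('a \<Rightarrow> 'b) \<Rightarrow> bool" where
  "epimorphism _ A B f \<longleftrightarrow>
     morphism A B f \<and>
     (\<forall>(C :: 'u ialg) g h. morphism B C g \<and> morphism B C h \<and>
        compose (carrier A) g f = compose (carrier A) h f \<longrightarrow> g = h)"

definition dense_morphism :: "'a ialg \<Rightarrow> 'b ialg \<Rightarrow> ('a \<Rightarrow> 'b) \<Rightarrow> bool" where
  "dense_morphism A B f \<longleftrightarrow>
     morphism A B f \<and> topol B closure_of (f ` carrier A) = carrier B"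

definition in_class ::
    "'u itself \<Rightarrow> morphism_class \<Rightarrow> 'a ialg \<Rightarrow> 'b ialg \<Rightarrow> ('a \<Rightarrow> 'b) \<Rightarrow> bool" where
  "in_class u \<Omega> A B f \<longleftrightarrow>
     (case \<Omega> of
        All_Mor \<Rightarrow> morphism A B f
      | Epi \<Rightarrow> epimorphism u A B f
      | DEpi \<Rightarrow> dense_morphism A B f)"

definition C_star_extension ::
    "'u itself \<Rightarrow> morphism_class \<Rightarrow> 'a ialg \<Rightarrow> 'b ialg \<Rightarrow> ('a \<Rightarrow> 'b) \<Rightarrow> bool" where
  "C_star_extension u \<Omega> A X \<sigma> \<longleftrightarrow>
     in_class u \<Omega> A X \<sigma> \<and>
     (\<forall>(B :: 'u ialg) \<phi>. C_star_algebra B \<and> morphism A B \<phi> \<longrightarrow>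
        (\<exists>!\<phi>'. morphism X B \<phi>' \<and> \<phi> = compose (carrier A) \<phi>' \<sigma>))"

definition C_star_envelope ::
    "'u itself \<Rightarrow> morphism_class \<Rightarrow> 'a ialg \<Rightarrow> 'b ialg \<Rightarrow> ('a \<Rightarrow> 'b) \<Rightarrow> bool" where
  "C_star_envelope u \<Omega> A E \<rho> \<longleftrightarrow>
     C_star_extension u \<Omega> A E \<rho> \<and>
     (\<forall>(X :: 'u ialg) \<sigma>. C_star_extension u \<Omega> A X \<sigma> \<longrightarrow>
        (\<exists>!\<upsilon>. morphism X E \<upsilon> \<and> \<rho> = compose (carrier A) \<upsilon> \<sigma>))"


section \<open>The Kuznetsova envelope\<close>

definition minkowski :: "'a ialg \<Rightarrow> 'a set \<Rightarrow> 'a \<Rightarrow> real" where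
  "minkowski A U x = Inf {t. t > 0 \<and> (\<exists>u\<in>U. x = complex_of_real t \<odot>\<^bsub>A\<^esub> u)}"

definition C_star_nbhd :: "'a ialg \<Rightarrow> 'a set \<Rightarrow> bool" where
  "C_star_nbhd A U \<longleftrightarrow>
     zero_nbhd A U \<and> closedin (topol A) U \<and> absolutely_convex_in A U \<and>
     (\<forall>x\<in>carrier A. minkowski A U (x \<otimes>\<^bsub>A\<^esub> star A x) = (minkowski A U x)\<^sup>2)"

definition Ker :: "'a ialg \<Rightarrow> 'a set \<Rightarrow> 'a set" where
  "Ker A U = (\<Inter>\<epsilon>\<in>{0<..}. (\<lambda>u. complex_of_real \<epsilon> \<odot>\<^bsub>A\<^esub> u) ` U)"

text \<open>The norm on \<open>A / Ker U\<close> whose unit ball is \<open>U + Ker U\<close>, i.e. the Minkowski functional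
  of the set of the cosets of the elements of \<^term>\<open>U\<close>.\<close>

definition quotient_norm :: "'a ialg \<Rightarrow> 'a set \<Rightarrow> 'a set \<Rightarrow> real" where
  "quotient_norm A U X =
     Inf {t. t > 0 \<and> (\<exists>u\<in>U. X = Ker A U +>\<^bsub>A\<^esub> (complex_of_real t \<odot>\<^bsub>A\<^esub> u))}"

text \<open>Scalar multiplication is not the image of the coset, which is wrong for the scalar 0.\<close>

definition quotient_algebra :: "'a ialg \<Rightarrow> 'a set \<Rightarrow> 'a set ialg" where
  "quotient_algebra A U =
     \<lparr>carrier = carrier (A Quot Ker A U),
      mult = mult (A Quot Ker A U),
      one = one (A Quot Ker A U),
      zero = zero (A Quot Ker A U),
      add = add (A Quot Ker A U),
      smult = \<lambda>c X. \<Union>x\<in>X. Ker A U +>\<^bsub>A\<^esub> (c \<odot>\<^bsub>A\<^esub> x),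
      topol = Metric_space.mtopology (carrier (A Quot Ker A U))
                (norm_dist (A Quot Ker A U) (quotient_norm A U)),
      star = \<lambda>X. \<Union>x\<in>X. Ker A U +>\<^bsub>A\<^esub> star A x\<rparr>"

text \<open>Completion of a normed involutive algebra: Cauchy sequences modulo sequences at
  distance tending to 0.\<close>

definition cauchy_seqs :: "'a ialg \<Rightarrow> ('a \<Rightarrow> real) \<Rightarrow> (nat \<Rightarrow> 'a) set" where
  "cauchy_seqs Q N = {s. Metric_space.MCauchy (carrier Q) (norm_dist Q N) s}"

definition cauchy_class :: "'a ialg \<Rightarrow> ('a \<Rightarrow> real) \<Rightarrow> (nat \<Rightarrow> 'a) \<Rightarrow> (nat \<Rightarrow> 'a) set" where
  "cauchy_class Q N s = {t \<in> cauchy_seqs Q N. (\<lambda>n. norm_dist Q N (s n) (t n)) \<longlonglongrightarrow> 0}"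

definition completion_dist ::
    "'a ialg \<Rightarrow> ('a \<Rightarrow> real) \<Rightarrow> (nat \<Rightarrow> 'a) set \<Rightarrow> (nat \<Rightarrow> 'a) set \<Rightarrow> real" where
  "completion_dist Q N X Y =
     (if X \<in> cauchy_class Q N ` cauchy_seqs Q N \<and> Y \<in> cauchy_class Q N ` cauchy_seqs Q N
      then THE r. \<forall>s\<in>X. \<forall>t\<in>Y. (\<lambda>n. norm_dist Q N (s n) (t n)) \<longlonglongrightarrow> r
      else 0)"

definition completion :: "'a ialg \<Rightarrow> ('a \<Rightarrow> real) \<Rightarrow> (nat \<Rightarrow> 'a) set ialg" where
  "completion Q N =
     \<lparr>carrier = cauchy_class Q N ` cauchy_seqs Q N,
      mult = \<lambda>X Y. \<Union>s\<in>X. \<Union>t\<in>Y. cauchy_class Q N (\<lambda>n. s n \<otimes>\<^bsub>Q\<^esub> t n),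
      one = cauchy_class Q N (\<lambda>_. \<one>\<^bsub>Q\<^esub>),
      zero = cauchy_class Q N (\<lambda>_. \<zero>\<^bsub>Q\<^esub>),
      add = \<lambda>X Y. \<Union>s\<in>X. \<Union>t\<in>Y. cauchy_class Q N (\<lambda>n. s n \<oplus>\<^bsub>Q\<^esub> t n),
      smult = \<lambda>c X. \<Union>s\<in>X. cauchy_class Q N (\<lambda>n. c \<odot>\<^bsub>Q\<^esub> s n),
      topol = Metric_space.mtopology (cauchy_class Q N ` cauchy_seqs Q N) (completion_dist Q N),
      star = \<lambda>X. \<Union>s\<in>X. cauchy_class Q N (\<lambda>n. star Q (s n))\<rparr>"

definition C_star_quotient :: "'a ialg \<Rightarrow> 'a set \<Rightarrow> (nat \<Rightarrow> 'a set) set ialg" where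
  "C_star_quotient A U = completion (quotient_algebra A U) (quotient_norm A U)"

definition C_star_quotient_map :: "'a ialg \<Rightarrow> 'a set \<Rightarrow> 'a \<Rightarrow> (nat \<Rightarrow> 'a set) set" where
  "C_star_quotient_map A U =
     (\<lambda>x\<in>carrier A.
        cauchy_class (quotient_algebra A U) (quotient_norm A U) (\<lambda>_. Ker A U +>\<^bsub>A\<^esub> x))"

text \<open>The natural map \<open>A/V \<rightarrow> A/U\<close> for \<open>V \<subseteq> U\<close>: a coset of \<open>Ker V\<close> goes to the coset of
  \<open>Ker U\<close> that contains it, and this is applied termwise to Cauchy sequences.\<close>

definition C_star_connecting_map ::
    "'a ialg \<Rightarrow> 'a set \<Rightarrow> 'a set \<Rightarrow> (nat \<Rightarrow> 'a set) set \<Rightarrow> (nat \<Rightarrow> 'a set) set" where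
  "C_star_connecting_map A V U =
     (\<lambda>X\<in>carrier (C_star_quotient A V).
        \<Union>s\<in>X. cauchy_class (quotient_algebra A U) (quotient_norm A U)
                  (\<lambda>n. Ker A U <+>\<^bsub>A\<^esub> s n))"

definition C_star_cone ::
    "'a ialg \<Rightarrow> 'b ialg \<Rightarrow> ('a set \<Rightarrow> 'b \<Rightarrow> (nat \<Rightarrow> 'a set) set) \<Rightarrow> bool" where
  "C_star_cone A X \<pi> \<longleftrightarrow>
     (\<forall>U. C_star_nbhd A U \<longrightarrow> morphism X (C_star_quotient A U) (\<pi> U)) \<and>
     (\<forall>U V. C_star_nbhd A U \<and> C_star_nbhd A V \<and> V \<subseteq> U \<longrightarrow>
        compose (carrier X) (C_star_connecting_map A V U) (\<pi> V) = \<pi> U)"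

definition projective_limit ::
    "'u itself \<Rightarrow> 'a ialg \<Rightarrow> 'b ialg \<Rightarrow> ('a set \<Rightarrow> 'b \<Rightarrow> (nat \<Rightarrow> 'a set) set) \<Rightarrow> bool" where
  "projective_limit _ A L \<pi> \<longleftrightarrow>
     involutive_stereotype_algebra L \<and> C_star_cone A L \<pi> \<and>
     (\<forall>(X :: 'u ialg) \<tau>. involutive_stereotype_algebra X \<and> C_star_cone A X \<tau> \<longrightarrow>
        (\<exists>!h. morphism X L h \<and>
              (\<forall>U. C_star_nbhd A U \<longrightarrow> compose (carrier X) (\<pi> U) h = \<tau> U)))"

definition kuznetsova_envelope ::
    "'u itself \<Rightarrow> 'a ialg \<Rightarrow> 'b ialg \<Rightarrow> ('a \<Rightarrow> 'b) \<Rightarrow> bool" where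
  "kuznetsova_envelope u A L \<kappa> \<longleftrightarrow>
     (\<exists>\<pi>. projective_limit u A L \<pi> \<and> morphism A L \<kappa> \<and>
          (\<forall>U. C_star_nbhd A U \<longrightarrow> compose (carrier A) (\<pi> U) \<kappa> = C_star_quotient_map A U))"

end

theory Submission
  imports Defs
begin

text \<open>A C*-seminorm on \<open>A\<close> is the supremum of the absolute values of the characters that it dominates, and these
  form a compact set \<open>K\<close>. Compact sets of characters are equicontinuous because \<open>A\<close> is stereotype, so by
  Stone--Weierstrass \<open>A\<close> is dense in every \<open>C(K)\<close> and its C*-quotients are exactly the \<open>C(K)\<close>. Hence a
  morphism from \<open>A\<close> to a C*-algebra extends to \<open>C(M)\<close> through some \<open>C(K)\<close>; conversely, compatible
  morphisms into all the \<open>C(K)\<close> glue to one into \<open>C(M)\<close>, because continuity on \<open>M\<close> and convergence in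
  \<open>C(M)\<close> are tested on compact sets.\<close>

subsection \<open>Topologies of uniform convergence\<close>

text \<open>Two obstacles shape the proof. First, the characters that compute a C*-seminorm have to
  be found in an algebra that need be neither normed nor complete, where spectral radii and
  resolvents are not at hand. They come from a minimal seminorm below the given one, which turns out
  to be multiplicative, and from a proof of the Gelfand-Mazur theorem that uses only estimates for
  the seminorm and square roots of scalars.

  Secondly, \<open>C(M)\<close> has to be shown to be stereotype. Surjectivity onto the bidual
  follows from approximation of functionals by finite combinations of point evaluations. Continuity
  of the evaluation map amounts to equicontinuity of totally bounded sets of functionals; locally
  finite refinements enter here, to give such a set a common compact carrier.

  The universal properties range over algebras on a type \<open>'u\<close>, while
  \<open>C(K)\<close> and the quotients \<open>A/U\<close> live on types of functions and of classes
  of Cauchy sequences. They are compared by moving the structure of a function algebra along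
  explicit isomorphisms.\<close>

lemma openin_uniform_ball:
  fixes e :: real
  assumes "finite \<T>" "\<T> \<subseteq> \<S>"
  shows "openin (uniform_topology \<S> F) {g\<in>F. \<exists>r<e. \<forall>x\<in>\<Union>\<T>. dist (g x) (f x) \<le> r}"
proof -
  \<comment> \<open>A bound \<open>r < e\<close> valid on all of \<open>\<Union>\<T>\<close> is
    demanded, because the functions that are pointwise at distance less than \<open>e\<close> from
    \<open>f\<close> need not form an open set: the supremum of the distances may equal
    \<open>e\<close>.\<close>
  let ?B = "{g\<in>F. \<exists>r<e. \<forall>x\<in>\<Union>\<T>. dist (g x) (f x) \<le> r}"
  have "\<exists>\<T>' \<eta>. finite \<T>' \<and> \<T>' \<subseteq> \<S> \<and> \<eta> > 0 \<and>
        (\<forall>h\<in>F. (\<forall>x\<in>\<Union>\<T>'. dist (h x) (g x) < \<eta>) \<longrightarrow> h \<in> ?B)" if g: "g \<in> ?B" for g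
  proof -
    from g obtain r where d: "r < e" "\<forall>x\<in>\<Union>\<T>. dist (g x) (f x) \<le> r" by blast
    \<comment> \<open>A move by less than half of the gap \<open>e - r\<close> leaves the uniform
      bound \<open>(e+r)/2\<close>, still below \<open>e\<close>.\<close>
    have "h \<in> ?B" if h: "h \<in> F" "\<forall>x\<in>\<Union>\<T>. dist (h x) (g x) < (e-r)/2" for h
    proof -
      have "dist (h x) (f x) \<le> (e+r)/2" if "x \<in> \<Union>\<T>" for x
      proof -
        have "dist (h x) (f x) \<le> dist (h x) (g x) + dist (g x) (f x)" by (rule dist_triangle)
        also have "\<dots> \<le> (e-r)/2 + r" using h d that by (intro add_mono) (auto intro: less_imp_le)
        finally show ?thesis by (simp add: field_simps)
      qed
      then show ?thesis using h(1) d(1) by (intro CollectI conjI exI[of _ "(e+r)/2"]) simp_all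
    qed
    note near = this
    show ?thesis
    proof (intro exI conjI ballI impI)
      show "(e-r)/2 > 0" using d(1) by simp
    qed (fact assms near)+
  qed
  then show ?thesis unfolding openin_uniform_topology
    by (intro conjI ballI) (rule Collect_restrict)
qed

lemma uniform_nbhd_iff:
  "(\<exists>W. openin (uniform_topology \<S> F) W \<and> f \<in> W \<and> W \<subseteq> U) \<longleftrightarrow> f \<in> F \<and>
    (\<exists>\<T> e. finite \<T> \<and> \<T> \<subseteq> \<S> \<and> e > 0 \<and>
        (\<forall>g\<in>F. (\<forall>x\<in>\<Union>\<T>. dist (g x) (f x) < e) \<longrightarrow> g \<in> U))" (is "?L \<longleftrightarrow> ?R")
proof
  assume ?L
  then obtain W where W: "openin (uniform_topology \<S> F) W" "f \<in> W" "W \<subseteq> U" by blast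
  then have "f \<in> F" "\<exists>\<T> e. finite \<T> \<and> \<T> \<subseteq> \<S> \<and> e > 0 \<and>
        (\<forall>g\<in>F. (\<forall>x\<in>\<Union>\<T>. dist (g x) (f x) < e) \<longrightarrow> g \<in> W)"
    unfolding openin_uniform_topology by auto
  then show ?R using W(3) by (meson subsetD)
next
  assume ?R
  then obtain \<T> e where f: "f \<in> F" and T: "finite \<T>" "\<T> \<subseteq> \<S>" "e > 0"
    "\<forall>g\<in>F. (\<forall>x\<in>\<Union>\<T>. dist (g x) (f x) < e) \<longrightarrow> g \<in> U" by blast
  let ?B = "{g\<in>F. \<exists>r<e. \<forall>x\<in>\<Union>\<T>. dist (g x) (f x) \<le> r}"
  have "f \<in> ?B" using f T(3) by (auto intro!: exI[of _ 0])
  moreover have "?B \<subseteq> U" using T(4) by (auto intro: le_less_trans)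
  ultimately show ?L using openin_uniform_ball[OF T(1,2), of F e f] by blast
qed

text \<open>In a family closed under finite unions a single member replaces the finite subfamily of
  the definition. Compact sets and totally bounded sets form such families.\<close>

lemma uniform_nbhd_directed_iff:
  assumes "\<And>\<T>. finite \<T> \<Longrightarrow> \<T> \<subseteq> \<S> \<Longrightarrow> \<Union>\<T> \<in> \<S>"
  shows "(\<exists>W. openin (uniform_topology \<S> F) W \<and> f \<in> W \<and> W \<subseteq> U) \<longleftrightarrow> f \<in> F \<and>
    (\<exists>S\<in>\<S>. \<exists>e>0. (\<forall>g\<in>F. (\<forall>x\<in>S. dist (g x) (f x) < e) \<longrightarrow> g \<in> U))" (is "_ \<longleftrightarrow> ?R")
  unfolding uniform_nbhd_iff
proof (safe, goal_cases)
  case (1 \<T> e)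
  then show ?case by (intro bexI[of _ "\<Union>\<T>"] exI[of _ e]) (auto simp: assms)
next
  case (2 S e)
  then show ?case by (intro exI[of _ "{S}"] exI[of _ e]) auto
qed

lemma continuous_map_into_uniform:
  "continuous_map X (uniform_topology \<S> F) h \<longleftrightarrow> h \<in> topspace X \<rightarrow> F \<and>
     (\<forall>x\<in>topspace X. \<forall>S\<in>\<S>. \<forall>e>0. \<exists>N. openin X N \<and> x \<in> N \<and> (\<forall>y\<in>N. \<forall>s\<in>S. dist (h y s) (h x s) < e))"
  (is "?L \<longleftrightarrow> ?R")
proof
  assume L: ?L
  then have hF: "h \<in> topspace X \<rightarrow> F" by (auto simp: continuous_map_def)
  moreover have "\<exists>N. openin X N \<and> x \<in> N \<and> (\<forall>y\<in>N. \<forall>s\<in>S. dist (h y s) (h x s) < e)"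
    if x: "x \<in> topspace X" and S: "S \<in> \<S>" and e: "e > 0" for x S e
  proof -
    let ?B = "{g\<in>F. \<exists>r<e. \<forall>s\<in>\<Union>{S}. dist (g s) (h x s) \<le> r}"
    have "openin (uniform_topology \<S> F) ?B" by (rule openin_uniform_ball) (use S in auto)
    with L have "openin X {y\<in>topspace X. h y \<in> ?B}" by (rule openin_continuous_map_preimage)
    moreover have "x \<in> {y\<in>topspace X. h y \<in> ?B}" using x hF e by (auto intro!: exI[of _ 0])
    moreover have "\<forall>y\<in>{y\<in>topspace X. h y \<in> ?B}. \<forall>s\<in>S. dist (h y s) (h x s) < e"
      by (auto intro: le_less_trans)
    ultimately show ?thesis by blast
  qed
  ultimately show ?R by blast
next
  assume R: ?R
  have "openin X {x\<in>topspace X. h x \<in> W}" if W: "openin (uniform_topology \<S> F) W" for W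
  proof (subst openin_subopen, intro ballI)
    fix x assume x: "x \<in> {x\<in>topspace X. h x \<in> W}"
    then have x': "x \<in> topspace X" by simp
    from x W obtain \<T> e where T: "finite \<T>" "\<T> \<subseteq> \<S>" "e > 0"
      "\<forall>g\<in>F. (\<forall>s\<in>\<Union>\<T>. dist (g s) (h x s) < e) \<longrightarrow> g \<in> W"
    proof -
      from x have "h x \<in> W" by simp
      with W have "\<exists>\<T> e. finite \<T> \<and> \<T> \<subseteq> \<S> \<and> e > 0 \<and>
        (\<forall>g\<in>F. (\<forall>s\<in>\<Union>\<T>. dist (g s) (h x s) < e) \<longrightarrow> g \<in> W)"
        unfolding openin_uniform_topology by simp
      with that show thesis by blast
    qed
    have "\<forall>S\<in>\<T>. \<exists>N. openin X N \<and> x \<in> N \<and> (\<forall>y\<in>N. \<forall>s\<in>S. dist (h y s) (h x s) < e)"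
      using R x' T by blast
    then obtain N where N: "\<And>S. S \<in> \<T> \<Longrightarrow> openin X (N S) \<and> x \<in> N S \<and> (\<forall>y\<in>N S. \<forall>s\<in>S. dist (h y s) (h x s) < e)"
      by metis
    \<comment> \<open>The factor \<open>topspace X\<close> covers empty \<open>\<T>\<close>, for
      which the intersection alone is the whole type.\<close>
    let ?N = "topspace X \<inter> \<Inter>(N ` \<T>)"
    have "openin X ?N"
      using N T(1) by (cases "\<T> = {}") (auto intro!: openin_Int openin_INT2)
    moreover have "x \<in> ?N" using x' N by blast
    moreover have "?N \<subseteq> {x\<in>topspace X. h x \<in> W}"
    proof
      fix y assume y: "y \<in> ?N"
      then have "h y \<in> F" using R by auto
      moreover have "\<forall>s\<in>\<Union>\<T>. dist (h y s) (h x s) < e" using y N by blast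
      ultimately show "y \<in> {x\<in>topspace X. h x \<in> W}" using T(4) y by auto
    qed
    ultimately show "\<exists>T. openin X T \<and> x \<in> T \<and> T \<subseteq> {x \<in> topspace X. h x \<in> W}" by blast
  qed
  then show ?L using R by (auto simp: continuous_map_def)
qed

lemma continuous_map_into_complex:
  fixes h :: "'a \<Rightarrow> complex"
  shows "continuous_map X euclidean h \<longleftrightarrow>
     (\<forall>x\<in>topspace X. \<forall>r>0. \<exists>N. openin X N \<and> x \<in> N \<and> (\<forall>y\<in>N. dist (h y) (h x) < r))"
  (is "?L \<longleftrightarrow> ?R")
proof
  assume L: ?L
  show ?R
  proof (intro ballI allI impI)
    fix x and r :: real assume x: "x \<in> topspace X" "r > 0"
    have "openin X {y\<in>topspace X. h y \<in> ball (h x) r}"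
      using L by (intro openin_continuous_map_preimage[where Y=euclidean]) auto
    then show "\<exists>N. openin X N \<and> x \<in> N \<and> (\<forall>y\<in>N. dist (h y) (h x) < r)"
      using x by (intro exI[of _ "{y\<in>topspace X. h y \<in> ball (h x) r}"]) (auto simp: dist_commute)
  qed
next
  assume R: ?R
  have "openin X {x\<in>topspace X. h x \<in> W}" if W: "open W" for W
  proof (subst openin_subopen, intro ballI)
    fix x assume x: "x \<in> {x\<in>topspace X. h x \<in> W}"
    then have "x \<in> topspace X" "h x \<in> W" by auto
    from W this(2) obtain e where e: "e > 0" "ball (h x) e \<subseteq> W" by (rule openE)
    obtain N where N: "openin X N" "x \<in> N" "\<forall>y\<in>N. dist (h y) (h x) < e"
      using R[rule_format, OF \<open>x \<in> topspace X\<close> e(1)] by blast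
    have "N \<subseteq> {x\<in>topspace X. h x \<in> W}"
    proof
      fix y assume "y \<in> N"
      then have "h y \<in> ball (h x) e" using N(3) by (simp add: dist_commute[of "h x"])
      then show "y \<in> {x\<in>topspace X. h x \<in> W}" using e(2) openin_subset[OF N(1)] \<open>y \<in> N\<close> by blast
    qed
    then show "\<exists>T. openin X T \<and> x \<in> T \<and> T \<subseteq> {x \<in> topspace X. h x \<in> W}" using N by blast
  qed
  then show ?L by (auto simp: continuous_map_def)
qed

lemma continuous_map_eval_uniform:
  assumes "{x} \<in> \<S>"
  shows "continuous_map (uniform_topology \<S> F) euclidean (\<lambda>f. f x)"
  unfolding continuous_map_into_complex topspace_uniform_topology
proof (intro ballI allI impI)
  fix f and e :: real assume f: "f \<in> F" and e: "e > 0"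
  have "\<exists>W. openin (uniform_topology \<S> F) W \<and> f \<in> W \<and> W \<subseteq> {g. dist (g x) (f x) < e}"
    unfolding uniform_nbhd_iff using f e assms by (auto intro!: exI[of _ "{{x}}"])
  then show "\<exists>N. openin (uniform_topology \<S> F) N \<and> f \<in> N \<and> (\<forall>y\<in>N. dist (y x) (f x) < e)"
    by blast
qed

text \<open>Distinct members of \<open>F\<close> differ at a point of \<open>D\<close>, since they
  are normalised outside \<open>D\<close>. Evaluation at this point is continuous and pulls back
  disjoint neighbourhoods of the two values.\<close>

lemma Hausdorff_uniform_topology:
  assumes "F \<subseteq> extensional D" "\<And>x. x \<in> D \<Longrightarrow> {x} \<in> \<S>"
  shows "Hausdorff_space (uniform_topology \<S> F)"
  unfolding Hausdorff_space_def topspace_uniform_topology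
proof (intro allI impI)
  fix f g assume fg: "f \<in> F \<and> g \<in> F \<and> f \<noteq> g"
  then obtain x where x: "x \<in> D" "f x \<noteq> g x" using extensionalityI[of f D g] assms(1) by blast
  have c: "continuous_map (uniform_topology \<S> F) euclidean (\<lambda>f. f x)"
    by (rule continuous_map_eval_uniform) (rule assms(2)[OF x(1)])
  obtain U V where UV: "open U" "open V" "f x \<in> U" "g x \<in> V" "U \<inter> V = {}"
    using hausdorff[OF x(2)] by blast
  show "\<exists>U V. openin (uniform_topology \<S> F) U \<and> openin (uniform_topology \<S> F) V \<and> f \<in> U \<and> g \<in> V \<and> disjnt U V"
    using openin_continuous_map_preimage[OF c, of U] openin_continuous_map_preimage[OF c, of V] UV fg
    by (intro exI[of _ "{h\<in>F. h x \<in> U}"] exI[of _ "{h\<in>F. h x \<in> V}"]) (auto simp: disjnt_def)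
qed

subsection \<open>Locally convex spaces\<close>

lemma mem_set_add_iff: "x \<in> A <+>\<^bsub>X\<^esub> B \<longleftrightarrow> (\<exists>a\<in>A. \<exists>b\<in>B. x = a \<oplus>\<^bsub>X\<^esub> b)"
  by (auto simp: set_add_def')

lemma complex_ring_simps [simp]:
  "carrier complex_ring = UNIV" "mult complex_ring = (*)" "one complex_ring = 1"
  "zero complex_ring = 0" "add complex_ring = (+)"
  by (simp_all add: complex_ring_def)

lemma cring_complex_ring: "cring complex_ring"
proof (rule cringI)
  show "abelian_group complex_ring"
    by (rule abelian_groupI) (auto simp: algebra_simps intro: exI[of _ "- x" for x])
  show "Group.comm_monoid complex_ring"
    by (rule Group.comm_monoidI) (auto simp: algebra_simps)
qed (auto simp: algebra_simps)

lemma a_inv_complex_ring [simp]: "\<ominus>\<^bsub>complex_ring\<^esub> c = - c"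
proof -
  interpret cring complex_ring by (rule cring_complex_ring)
  show ?thesis by (rule minus_equality) auto
qed

locale complex_module =
  fixes X :: "('a, 'm) lcs_scheme" (structure)
  assumes is_module: "module complex_ring X"
begin

sublocale module complex_ring X
  by (rule is_module)

lemma smult_cclosed [simp, intro]: "x \<in> carrier X \<Longrightarrow> c \<odot> x \<in> carrier X"
  by (rule smult_closed) auto

lemma smult_zero_left [simp]: "x \<in> carrier X \<Longrightarrow> 0 \<odot> x = \<zero>"
  using smult_l_null by simp

lemma smult_zero_right [simp]: "c \<odot> \<zero> = \<zero>"
  using smult_r_null[of c] by simp

lemma smult_one_left [simp]: "x \<in> carrier X \<Longrightarrow> 1 \<odot> x = x"
  using smult_one by simp

lemma smult_smult: "x \<in> carrier X \<Longrightarrow> a \<odot> (b \<odot> x) = (a * b) \<odot> x"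
  using smult_assoc1[of a b x] by simp

lemma smult_add_left: "x \<in> carrier X \<Longrightarrow> (a + b) \<odot> x = a \<odot> x \<oplus> b \<odot> x"
  using smult_l_distr[of a b x] by simp

lemma smult_add_right: "x \<in> carrier X \<Longrightarrow> y \<in> carrier X \<Longrightarrow> a \<odot> (x \<oplus> y) = a \<odot> x \<oplus> a \<odot> y"
  using smult_r_distr[of a x y] by simp

lemma smult_minus_one: "x \<in> carrier X \<Longrightarrow> (-1) \<odot> x = \<ominus> x"
  using smult_l_minus[of 1 x] by simp

end

locale complex_lcs = complex_module +
  assumes lcs: "locally_convex_space X"
begin

lemma topspace_topol [simp]: "topspace (topol X) = carrier X"
  using lcs by (simp add: locally_convex_space_def)

lemma continuous_add:
  assumes "continuous_map T (topol X) f" "continuous_map T (topol X) g"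
  shows "continuous_map T (topol X) (\<lambda>t. f t \<oplus> g t)"
proof -
  have "continuous_map (prod_topology (topol X) (topol X)) (topol X) (\<lambda>(x, y). x \<oplus> y)"
    using lcs by (simp add: locally_convex_space_def)
  moreover have "continuous_map T (prod_topology (topol X) (topol X)) (\<lambda>t. (f t, g t))"
    using assms by (intro continuous_map_pairedI)
  ultimately have "continuous_map T (topol X) ((\<lambda>(x, y). x \<oplus> y) \<circ> (\<lambda>t. (f t, g t)))"
    by (meson continuous_map_compose)
  then show ?thesis by (simp add: o_def)
qed

lemma continuous_smult:
  assumes "continuous_map T euclidean c" "continuous_map T (topol X) g"
  shows "continuous_map T (topol X) (\<lambda>t. c t \<odot> g t)"
proof -
  have "continuous_map (prod_topology euclidean (topol X)) (topol X) (\<lambda>(c, x). c \<odot> x)"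
    using lcs by (simp add: locally_convex_space_def)
  moreover have "continuous_map T (prod_topology euclidean (topol X)) (\<lambda>t. (c t, g t))"
    using assms by (intro continuous_map_pairedI)
  ultimately have "continuous_map T (topol X) ((\<lambda>(c, x). c \<odot> x) \<circ> (\<lambda>t. (c t, g t)))"
    by (meson continuous_map_compose)
  then show ?thesis by (simp add: o_def)
qed

lemma zero_nbhd_preimage:
  assumes "continuous_map (topol X) (topol X) h" "h \<zero> = \<zero>" "zero_nbhd X U"
  shows "zero_nbhd X {x\<in>carrier X. h x \<in> U}"
proof -
  obtain W where W: "openin (topol X) W" "\<zero> \<in> W" "W \<subseteq> U" using assms(3) by (auto simp: zero_nbhd_def)
  have "openin (topol X) {x\<in>carrier X. h x \<in> W}"
    using openin_continuous_map_preimage[OF assms(1) W(1)] by simp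
  then show ?thesis using W assms(2) unfolding zero_nbhd_def
    by (intro conjI exI[of _ "{x\<in>carrier X. h x \<in> W}"]) auto
qed

lemma zero_nbhd_subset: "zero_nbhd X U \<Longrightarrow> U \<subseteq> carrier X"
  by (simp add: zero_nbhd_def)

lemma zero_nbhd_zero: "zero_nbhd X U \<Longrightarrow> \<zero> \<in> U"
  by (auto simp: zero_nbhd_def)

lemma zero_nbhd_mono: "zero_nbhd X U \<Longrightarrow> U \<subseteq> V \<Longrightarrow> V \<subseteq> carrier X \<Longrightarrow> zero_nbhd X V"
  unfolding zero_nbhd_def by (meson order_trans)

lemma zero_nbhd_smult:
  assumes "zero_nbhd X U" shows "zero_nbhd X {x\<in>carrier X. c \<odot> x \<in> U}"
  by (rule zero_nbhd_preimage) (use assms in \<open>auto intro!: continuous_smult\<close>)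

text \<open>Continuity of scalar multiplication at the scalar zero, with \<open>x\<close> fixed. It
  makes the set of scales in a Minkowski functional nonempty.\<close>

lemma zero_nbhd_absorbing:
  assumes U: "zero_nbhd X U" and x: "x \<in> carrier X"
  obtains r where "r > 0" "\<And>c. cmod c < r \<Longrightarrow> c \<odot> x \<in> U"
proof -
  obtain W where W: "openin (topol X) W" "\<zero> \<in> W" "W \<subseteq> U" using U by (auto simp: zero_nbhd_def)
  have "continuous_map euclidean (topol X) (\<lambda>c. c \<odot> x)"
    using x by (intro continuous_smult) auto
  from openin_continuous_map_preimage[OF this W(1)] have "open {c. c \<odot> x \<in> W}" by simp
  moreover have "0 \<in> {c. c \<odot> x \<in> W}" using W x by simp
  ultimately obtain r where "r > 0" "ball 0 r \<subseteq> {c. c \<odot> x \<in> W}" by (meson open_contains_ball)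
  then show ?thesis using W by (intro that[of r]) (auto simp: subset_iff)
qed

text \<open>Translations are continuous, so continuity of an additive map at any point reduces to an
  estimate on a neighbourhood of zero.\<close>

lemma zero_nbhd_translate:
  assumes U: "zero_nbhd X U" and x: "x \<in> carrier X"
  obtains N where "openin (topol X) N" "x \<in> N" "\<And>y. y \<in> N \<Longrightarrow> y \<ominus> x \<in> U"
proof -
  obtain W where W: "openin (topol X) W" "\<zero> \<in> W" "W \<subseteq> U" using U by (auto simp: zero_nbhd_def)
  have c: "continuous_map (topol X) (topol X) (\<lambda>y. y \<oplus> \<ominus> x)"
    using x by (intro continuous_add) auto
  show ?thesis
  proof (rule that[of "{y\<in>carrier X. y \<oplus> \<ominus> x \<in> W}"])
    show "openin (topol X) {y\<in>carrier X. y \<oplus> \<ominus> x \<in> W}"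
      using openin_continuous_map_preimage[OF c W(1)] by simp
  qed (use x W in \<open>auto simp: a_minus_def r_neg\<close>)
qed

lemma totally_bounded_empty: "totally_bounded_in X {}"
  unfolding totally_bounded_in_def by (intro conjI allI impI exI[of _ "{}"]) simp_all

lemma totally_bounded_Un:
  assumes "totally_bounded_in X S" "totally_bounded_in X T"
  shows "totally_bounded_in X (S \<union> T)"
  unfolding totally_bounded_in_def
proof (intro conjI allI impI)
  fix U assume U: "zero_nbhd X U"
  obtain F G where F: "finite F" "F \<subseteq> carrier X" "S \<subseteq> F <+>\<^bsub>X\<^esub> U"
    and G: "finite G" "G \<subseteq> carrier X" "T \<subseteq> G <+>\<^bsub>X\<^esub> U"
    using assms U unfolding totally_bounded_in_def by meson
  have "S \<union> T \<subseteq> (F \<union> G) <+>\<^bsub>X\<^esub> U"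
  proof
    fix x assume "x \<in> S \<union> T"
    then have "x \<in> F <+>\<^bsub>X\<^esub> U \<or> x \<in> G <+>\<^bsub>X\<^esub> U" using F(3) G(3) by blast
    then show "x \<in> (F \<union> G) <+>\<^bsub>X\<^esub> U" unfolding mem_set_add_iff by blast
  qed
  then show "\<exists>F. finite F \<and> F \<subseteq> carrier X \<and> S \<union> T \<subseteq> F <+>\<^bsub>X\<^esub> U"
    using F(1,2) G(1,2) by (intro exI[of _ "F \<union> G"]) simp
qed (use assms in \<open>auto simp: totally_bounded_in_def\<close>)

lemma totally_bounded_Union:
  "finite \<T> \<Longrightarrow> \<T> \<subseteq> {S. totally_bounded_in X S} \<Longrightarrow> totally_bounded_in X (\<Union>\<T>)"
  by (induction \<T> rule: finite_induct) (auto simp: totally_bounded_empty totally_bounded_Un)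

lemma totally_bounded_singleton:
  assumes "x \<in> carrier X" shows "totally_bounded_in X {x}"
  unfolding totally_bounded_in_def
proof (intro conjI allI impI)
  fix U assume U: "zero_nbhd X U"
  show "\<exists>F. finite F \<and> F \<subseteq> carrier X \<and> {x} \<subseteq> F <+>\<^bsub>X\<^esub> U"
    by (rule exI[of _ "{x}"]) (use assms zero_nbhd_zero[OF U] in \<open>force simp: mem_set_add_iff\<close>)
qed (use assms in auto)

lemma totally_bounded_near:
  assumes "totally_bounded_in X S" "zero_nbhd X U"
  obtains F where "finite F" "F \<subseteq> carrier X" "\<And>s. s \<in> S \<Longrightarrow> \<exists>f\<in>F. \<exists>u\<in>U. s = f \<oplus> u"
proof -
  from assms obtain F where F: "finite F" "F \<subseteq> carrier X" "S \<subseteq> F <+>\<^bsub>X\<^esub> U"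
    unfolding totally_bounded_in_def by meson
  show thesis
  proof (rule that[OF F(1,2)])
    fix s assume "s \<in> S"
    with F(3) have "s \<in> F <+>\<^bsub>X\<^esub> U" by (rule subsetD)
    then show "\<exists>f\<in>F. \<exists>u\<in>U. s = f \<oplus> u" unfolding mem_set_add_iff .
  qed
qed

end

lemma complex_lcsI: "locally_convex_space X \<Longrightarrow> complex_lcs X"
  by (intro complex_lcs.intro complex_module.intro complex_lcs_axioms.intro)
    (simp_all add: locally_convex_space_def)

subsection \<open>Characters of commutative involutive algebras\<close>

text \<open>Only algebra enters at this level. Characters are obtained from seminorms, and their
  continuity follows later from domination by a continuous seminorm.\<close>

locale comm_star_algebra =
  fixes A :: "'a ialg" (structure)
  assumes star_algebra: "star_algebra A" and commutative: "commutative_algebra A"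
begin

sublocale complex_module A
  by (rule complex_module.intro) (use star_algebra in \<open>simp add: star_algebra_def\<close>)

sublocale cring A
proof (rule cring.intro)
  show ring: "ring A" using star_algebra by (simp add: star_algebra_def)
  show "Group.comm_monoid A"
    using commutative by (intro monoid.monoid_comm_monoidI ring.is_monoid[OF ring]) (auto simp: commutative_algebra_def)
qed

lemma smult_mult_left: "x \<in> carrier A \<Longrightarrow> y \<in> carrier A \<Longrightarrow> (c \<odot> x) \<otimes> y = c \<odot> (x \<otimes> y)"
  and smult_mult_right: "x \<in> carrier A \<Longrightarrow> y \<in> carrier A \<Longrightarrow> x \<otimes> (c \<odot> y) = c \<odot> (x \<otimes> y)"
  and star_closed [simp, intro]: "x \<in> carrier A \<Longrightarrow> star A x \<in> carrier A"
  and star_star [simp]: "x \<in> carrier A \<Longrightarrow> star A (star A x) = x"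
  and star_add: "x \<in> carrier A \<Longrightarrow> y \<in> carrier A \<Longrightarrow> star A (x \<oplus> y) = star A x \<oplus> star A y"
  and star_smult: "x \<in> carrier A \<Longrightarrow> star A (c \<odot> x) = cnj c \<odot> star A x"
  and star_mult: "x \<in> carrier A \<Longrightarrow> y \<in> carrier A \<Longrightarrow> star A (x \<otimes> y) = star A y \<otimes> star A x"
  using star_algebra by (auto simp: star_algebra_def Pi_iff)

lemma star_one [simp]: "star A \<one> = \<one>"
proof -
  have "star A \<one> = star A \<one> \<otimes> star A (star A \<one>)" by simp
  also have "\<dots> = star A (star A \<one> \<otimes> \<one>)" by (subst star_mult) (auto simp: m_comm)
  also have "\<dots> = \<one>" by simp
  finally show ?thesis .
qed

lemma add_smult_one_assoc: "x \<in> carrier A \<Longrightarrow> (x \<oplus> a \<odot> \<one>) \<oplus> b \<odot> \<one> = x \<oplus> (a + b) \<odot> \<one>"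
  by (simp add: a_assoc smult_add_left)

text \<open>Serves twice: for the factorisations in \<open>m_disc\<close> and, with imaginary
  \<open>s\<close> and self-adjoint \<open>z\<close>, for the product of
  \<open>z \<oplus> s \<odot> \<one>\<close> with its adjoint.\<close>

lemma diff_of_squares:
  assumes z: "z \<in> carrier A"
  shows "(z \<oplus> s \<odot> \<one>) \<otimes> (z \<oplus> (- s) \<odot> \<one>) = z \<otimes> z \<oplus> (- (s * s)) \<odot> \<one>"
proof -
  have "(z \<oplus> s \<odot> \<one>) \<otimes> (z \<oplus> (- s) \<odot> \<one>) =
     z \<otimes> z \<oplus> s \<odot> z \<oplus> ((- s) \<odot> z \<oplus> (- (s * s)) \<odot> \<one>)"
    using z by (simp add: l_distr r_distr smult_mult_left smult_mult_right smult_add_right smult_smult)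
  also have "\<dots> = z \<otimes> z \<oplus> (s \<odot> z \<oplus> (- s) \<odot> z) \<oplus> (- (s * s)) \<odot> \<one>"
    using z by (simp add: a_assoc)
  also have "s \<odot> z \<oplus> (- s) \<odot> z = \<zero>" using z by (simp add: smult_add_left[symmetric])
  finally show ?thesis using z by simp
qed

text \<open>The Gelfand--Mazur theorem for a multiplicative seminorm, in Ostrowski's way: if the distance
  \<open>r\<close> from \<open>y\<close> to the scalars is positive and attained at \<open>0\<close>, the factorisation of \<open>y ^ N - c ^ N\<close>,
  taken for powers of two, shows that it is attained on the whole disc \<open>\<bar>c\<bar> < r\<close>.\<close>

definition multiplicative_seminorm :: "('a \<Rightarrow> real) \<Rightarrow> bool" where
  "multiplicative_seminorm m \<longleftrightarrow>
     (\<forall>x\<in>carrier A. 0 \<le> m x) \<and>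
     (\<forall>x\<in>carrier A. \<forall>y\<in>carrier A. m (x \<oplus> y) \<le> m x + m y) \<and>
     (\<forall>c. \<forall>x\<in>carrier A. m (c \<odot> x) = cmod c * m x) \<and>
     (\<forall>x\<in>carrier A. \<forall>y\<in>carrier A. m (x \<otimes> y) = m x * m y) \<and> m \<one> = 1"

context
  fixes m :: "'a \<Rightarrow> real"
  assumes m: "multiplicative_seminorm m"
begin

lemma
  shows m_nonneg: "x \<in> carrier A \<Longrightarrow> 0 \<le> m x"
    and m_add: "x \<in> carrier A \<Longrightarrow> y \<in> carrier A \<Longrightarrow> m (x \<oplus> y) \<le> m x + m y"
    and m_smult: "x \<in> carrier A \<Longrightarrow> m (c \<odot> x) = cmod c * m x"
    and m_mult: "x \<in> carrier A \<Longrightarrow> y \<in> carrier A \<Longrightarrow> m (x \<otimes> y) = m x * m y"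
    and m_one: "m \<one> = 1"
  using m by (auto simp: multiplicative_seminorm_def)

lemma m_scalar: "m (c \<odot> \<one>) = cmod c"
  by (simp add: m_smult m_one)

lemma m_add_scalar_lower: "x \<in> carrier A \<Longrightarrow> m (x \<oplus> c \<odot> \<one>) \<ge> cmod c - m x"
proof -
  assume x: "x \<in> carrier A"
  have "c \<odot> \<one> = (x \<oplus> c \<odot> \<one>) \<oplus> (-1) \<odot> x" using x by (simp add: smult_minus_one a_ac r_neg1 r_neg2)
  then have "m (c \<odot> \<one>) \<le> m (x \<oplus> c \<odot> \<one>) + m ((-1) \<odot> x)" using m_add[of "x \<oplus> c \<odot> \<one>" "(-1) \<odot> x"] x by simp
  then show ?thesis using x m_smult[of x "-1"] by (simp add: m_scalar)
qed

lemma m_power: "x \<in> carrier A \<Longrightarrow> m (x [^] (n::nat)) = m x ^ n"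
  by (induction n) (auto simp: m_one m_mult)

lemma m_disc:
  assumes y: "y \<in> carrier A" and r: "m y = r" "r > 0" and low: "\<And>c. m (y \<oplus> c \<odot> \<one>) \<ge> r"
    and c: "cmod c < r"
  shows "m (y \<oplus> c \<odot> \<one>) = r"
proof -
  have pw: "y [^] (2 ^ Suc k :: nat) = y [^] (2 ^ k :: nat) \<otimes> y [^] (2 ^ k :: nat)" for k
    using y by (simp add: nat_pow_mult mult_2)
  \<comment> \<open>Since \<open>- d\<close> has a complex square root, each level splits into two
    factors of the same form one level down. At the bottom there are linear factors, all of seminorm
    at least \<open>r\<close>.\<close>
  have low_pow: "m (y [^] (2 ^ k :: nat) \<oplus> d \<odot> \<one>) \<ge> r ^ 2 ^ k" for k d
  proof (induction k arbitrary: d)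
    case 0
    then show ?case using low y by simp
  next
    case (Suc k)
    define s where "s = csqrt (- d)"
    let ?z = "y [^] (2 ^ k :: nat)"
    have z: "?z \<in> carrier A" using y by simp
    have ss: "s * s = - d" using power2_csqrt[of "- d"] by (simp add: s_def power2_eq_square)
    have "y [^] (2 ^ Suc k :: nat) \<oplus> d \<odot> \<one> = (?z \<oplus> s \<odot> \<one>) \<otimes> (?z \<oplus> (- s) \<odot> \<one>)"
      unfolding pw using diff_of_squares[OF z, of s] by (simp add: ss)
    then have "m (y [^] (2 ^ Suc k :: nat) \<oplus> d \<odot> \<one>) = m (?z \<oplus> s \<odot> \<one>) * m (?z \<oplus> (- s) \<odot> \<one>)"
      using z by (simp add: m_mult)
    also have "\<dots> \<ge> r ^ 2 ^ k * r ^ 2 ^ k"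
      using Suc[of s] Suc[of "-s"] r by (intro mult_mono) (auto intro: order_trans[rotated])
    finally show ?case by (simp add: mult_2 power_add)
  qed
  \<comment> \<open>The linear factor \<open>y \<oplus> c \<odot> \<one>\<close> is split off and
    the remaining \<open>2 ^ k - 1\<close> factors are bounded below by \<open>r\<close>. The extra
    \<open>r\<close> on the left avoids a subtraction in the exponent.\<close>
  have fac: "r * m (y [^] (2 ^ k :: nat) \<oplus> (- ((- c) ^ 2 ^ k)) \<odot> \<one>) \<ge> r ^ 2 ^ k * m (y \<oplus> c \<odot> \<one>)" for k
  proof (induction k)
    case 0
    then show ?case using y by simp
  next
    case (Suc k)
    define s where "s = (- c) ^ 2 ^ k"
    let ?z = "y [^] (2 ^ k :: nat)"
    have z: "?z \<in> carrier A" using y by simp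
    have ss: "s * s = (- c) ^ 2 ^ Suc k" by (simp add: s_def power_add[symmetric] mult_2)
    have "y [^] (2 ^ Suc k :: nat) \<oplus> (- ((- c) ^ 2 ^ Suc k)) \<odot> \<one> = (?z \<oplus> s \<odot> \<one>) \<otimes> (?z \<oplus> (- s) \<odot> \<one>)"
      unfolding pw using diff_of_squares[OF z, of s] by (simp only: ss)
    then have "r * m (y [^] (2 ^ Suc k :: nat) \<oplus> (- ((- c) ^ 2 ^ Suc k)) \<odot> \<one>) =
       m (?z \<oplus> s \<odot> \<one>) * (r * m (?z \<oplus> (- s) \<odot> \<one>))"
      using z by (simp add: m_mult)
    also have "\<dots> \<ge> r ^ 2 ^ k * (r ^ 2 ^ k * m (y \<oplus> c \<odot> \<one>))"
    proof (rule mult_mono)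
      show "r ^ 2 ^ k * m (y \<oplus> c \<odot> \<one>) \<le> r * m (?z \<oplus> (- s) \<odot> \<one>)"
        using Suc unfolding s_def .
      show "r ^ 2 ^ k \<le> m (?z \<oplus> s \<odot> \<one>)" by (rule low_pow)
    qed (use r y z in \<open>auto intro!: m_nonneg mult_nonneg_nonneg\<close>)
    finally show ?case by (simp add: mult_2 power_add mult.assoc)
  qed
  \<comment> \<open>From above, the triangle inequality bounds the whole product by
    \<open>r ^ 2 ^ k + cmod c ^ 2 ^ k\<close>. After division by \<open>r ^ 2 ^ k\<close> the
    surplus over \<open>r\<close> is a multiple of a power of \<open>cmod c / r < 1\<close>, which
    vanishes in the limit.\<close>
  have le: "m (y \<oplus> c \<odot> \<one>) \<le> r + r * (cmod c / r) ^ 2 ^ k" for k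
  proof -
    have "m (y [^] (2 ^ k :: nat) \<oplus> (- ((- c) ^ 2 ^ k)) \<odot> \<one>) \<le> r ^ 2 ^ k + cmod c ^ 2 ^ k"
      using m_add[of "y [^] (2 ^ k :: nat)" "(- ((- c) ^ 2 ^ k)) \<odot> \<one>"] y r
      by (simp add: m_power m_scalar norm_power)
    then have "r * m (y [^] (2 ^ k :: nat) \<oplus> (- ((- c) ^ 2 ^ k)) \<odot> \<one>) \<le> r * (r ^ 2 ^ k + cmod c ^ 2 ^ k)"
      using r by simp
    with fac[of k] have "r ^ 2 ^ k * m (y \<oplus> c \<odot> \<one>) \<le> r * (r ^ 2 ^ k + cmod c ^ 2 ^ k)" by linarith
    then have "m (y \<oplus> c \<odot> \<one>) \<le> r * (r ^ 2 ^ k + cmod c ^ 2 ^ k) / r ^ 2 ^ k"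
      using r by (simp add: pos_le_divide_eq mult.commute)
    also have "\<dots> = r + r * (cmod c / r) ^ 2 ^ k"
      using r by (simp add: power_divide field_simps)
    finally show ?thesis .
  qed
  have sm: "strict_mono (\<lambda>k. 2 ^ k :: nat)" by (rule strict_monoI) simp
  have "(\<lambda>n. (cmod c / r) ^ n) \<longlonglongrightarrow> 0" using c r by (intro LIMSEQ_power_zero) simp
  from LIMSEQ_subseq_LIMSEQ[OF this sm] have "(\<lambda>k. (cmod c / r) ^ 2 ^ k) \<longlonglongrightarrow> 0" by (simp add: o_def)
  then have "(\<lambda>k. r + r * (cmod c / r) ^ 2 ^ k) \<longlonglongrightarrow> r + r * 0" by (intro tendsto_intros)
  then have "m (y \<oplus> c \<odot> \<one>) \<le> r" using le by (intro LIMSEQ_le_const) auto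
  then show ?thesis using low by (simp add: order_antisym)
qed

text \<open>The distance from \<open>x\<close> to a scalar depends continuously on the scalar and
  grows with it, so a minimum \<open>r\<close> is attained. If \<open>r\<close> were positive,
  \<open>m_disc\<close> applied again and again would carry the value \<open>r\<close> along steps
  of length \<open>r/2\<close> to arbitrarily large scalars, against the growth.\<close>

lemma m_scalar_near:
  assumes x: "x \<in> carrier A"
  obtains c where "m (x \<oplus> c \<odot> \<one>) = 0"
proof -
  let ?f = "\<lambda>c. m (x \<oplus> c \<odot> \<one>)"
  have lip: "?f c \<le> ?f d + dist c d" for c d
  proof -
    have "x \<oplus> c \<odot> \<one> = (x \<oplus> d \<odot> \<one>) \<oplus> (c - d) \<odot> \<one>" using x by (simp add: add_smult_one_assoc)
    then show ?thesis using m_add[of "x \<oplus> d \<odot> \<one>" "(c - d) \<odot> \<one>"] x by (simp add: m_scalar dist_norm)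
  qed
  have cont: "continuous_on UNIV ?f"
    unfolding continuous_on_iff
  proof (intro ballI allI impI)
    fix c :: complex and e :: real assume "e > 0"
    moreover have "dist (?f d) (?f c) \<le> dist d c" for d
      using lip[of c d] lip[of d c] by (auto simp: dist_real_def dist_commute)
    ultimately show "\<exists>d>0. \<forall>x'\<in>UNIV. dist x' c < d \<longrightarrow> dist (?f x') (?f c) < e"
      by (meson le_less_trans)
  qed
  \<comment> \<open>Outside this disc the seminorm exceeds \<open>m x\<close>, its value at the
    scalar zero, so a minimum over the disc is global.\<close>
  let ?B = "cball 0 (2 * m x + 1) :: complex set"
  have "0 \<in> ?B" using m_nonneg[OF x] by simp
  then have "?B \<noteq> {}" by blast
  then have "\<exists>c0\<in>?B. \<forall>c\<in>?B. ?f c0 \<le> ?f c"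
    by (rule continuous_attains_inf[OF compact_cball]) (rule continuous_on_subset[OF cont subset_UNIV])
  then obtain c0 where c0: "c0 \<in> ?B" "\<And>c. c \<in> ?B \<Longrightarrow> ?f c0 \<le> ?f c" by blast
  have min: "?f c0 \<le> ?f c" for c
  proof (cases "c \<in> ?B")
    case False
    then have "?f c \<ge> m x" using m_add_scalar_lower[OF x, of c] by simp
    moreover have "?f c0 \<le> m x" using c0(2)[OF \<open>0 \<in> ?B\<close>] x by simp
    ultimately show ?thesis by simp
  qed (rule c0)
  define r where "r = ?f c0"
  have "r = 0"
  proof (rule ccontr)
    assume "r \<noteq> 0"
    then have r: "r > 0" using m_nonneg x by (simp add: r_def order_less_le)
    have "?f (c0 + of_real (real n * (r/2))) = r" for n
    proof (induction n)
      case 0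
      then show ?case by (simp add: r_def)
    next
      case (Suc n)
      let ?c = "c0 + of_real (real n * (r/2))"
      have "m ((x \<oplus> ?c \<odot> \<one>) \<oplus> of_real (r/2) \<odot> \<one>) = r"
      proof (rule m_disc)
        show "r \<le> m ((x \<oplus> ?c \<odot> \<one>) \<oplus> d \<odot> \<one>)" for d
          unfolding add_smult_one_assoc[OF x] r_def by (rule min)
      qed (use x r Suc in auto)
      then show ?case unfolding add_smult_one_assoc[OF x] by (simp add: algebra_simps add_divide_distrib)
    qed
    moreover have "0 < r / 2" using r by simp
    from reals_Archimedean3[OF this] obtain n :: nat where "real n * (r/2) > r + m x + cmod c0" by blast
    moreover have "?f (c0 + of_real (real n * (r/2))) \<ge> real n * (r/2) - cmod c0 - m x" for n
    proof -
      have "cmod (of_real (real n * (r/2))) \<le> cmod (c0 + of_real (real n * (r/2))) + cmod c0"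
        using norm_triangle_ineq4[of "c0 + of_real (real n * (r/2))" c0] by simp
      moreover have "cmod (of_real (real n * (r/2))) = real n * (r/2)" using r by (simp only: norm_of_real) simp
      ultimately show ?thesis using m_add_scalar_lower[OF x, of "c0 + of_real (real n * (r/2))"] by linarith
    qed
    ultimately have "r \<ge> real n * (r/2) - cmod c0 - m x" "real n * (r/2) > r + m x + cmod c0" by metis+
    then show False by linarith
  qed
  then show thesis using that[of c0] by (simp add: r_def)
qed

text \<open>Each \<open>x\<close> is at \<open>m\<close>-distance zero from exactly one scalar
  \<open>phi x\<close>, because distinct scalars are at positive distance from each other. Every law
  for \<open>phi\<close> follows from this uniqueness once the expected value is seen to be at
  distance zero.\<close>

lemma character_of_multiplicative_seminorm:
  shows "\<exists>phi. (\<forall>x\<in>carrier A. \<forall>y\<in>carrier A. phi (x \<oplus> y) = phi x + phi y) \<and>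
    (\<forall>x\<in>carrier A. \<forall>y\<in>carrier A. phi (x \<otimes> y) = phi x * phi y) \<and>
    (\<forall>c. \<forall>x\<in>carrier A. phi (c \<odot> x) = c * phi x) \<and>
    phi \<one> = (1::complex) \<and> (\<forall>x\<in>carrier A. cmod (phi x) = m x)"
proof -
  define phi where "phi x = (SOME c. m (x \<oplus> (- c) \<odot> \<one>) = 0)" for x
  have chi: "m (x \<oplus> (- phi x) \<odot> \<one>) = 0" if x: "x \<in> carrier A" for x
  proof -
    obtain c where "m (x \<oplus> c \<odot> \<one>) = 0" using m_scalar_near[OF x] .
    then have "m (x \<oplus> (- (- c)) \<odot> \<one>) = 0" by simp
    then show ?thesis unfolding phi_def by (rule someI)
  qed
  have uniq: "phi x = c" if x: "x \<in> carrier A" and c: "m (x \<oplus> (- c) \<odot> \<one>) \<le> 0" for x c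
  proof -
    have "(c - phi x) \<odot> \<one> = (x \<oplus> (- phi x) \<odot> \<one>) \<oplus> (-1) \<odot> (x \<oplus> (- c) \<odot> \<one>)"
    proof -
      have "(x \<oplus> (- phi x) \<odot> \<one>) \<oplus> (-1) \<odot> (x \<oplus> (- c) \<odot> \<one>) = (x \<oplus> (-1) \<odot> x) \<oplus> ((- phi x) \<odot> \<one> \<oplus> c \<odot> \<one>)"
        using x by (simp add: smult_add_right smult_smult a_ac)
      then show ?thesis using x by (simp add: smult_minus_one r_neg smult_add_left[symmetric])
    qed
    then have "m ((c - phi x) \<odot> \<one>) \<le> m (x \<oplus> (- phi x) \<odot> \<one>) + m ((-1) \<odot> (x \<oplus> (- c) \<odot> \<one>))"
      using m_add x by simp
    also have "\<dots> \<le> 0" using chi[OF x] c x m_smult[of "x \<oplus> (- c) \<odot> \<one>" "-1"] by simp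
    finally show ?thesis by (simp add: m_scalar)
  qed
  show ?thesis
  proof (intro exI[of _ phi] conjI ballI allI)
    fix x y assume xy: "x \<in> carrier A" "y \<in> carrier A"
    have "(x \<oplus> y) \<oplus> (- (phi x + phi y)) \<odot> \<one> = (x \<oplus> (- phi x) \<odot> \<one>) \<oplus> (y \<oplus> (- phi y) \<odot> \<one>)"
      using xy smult_add_left[of \<one> "- phi x" "- phi y"] by (simp add: a_ac)
    then have "m ((x \<oplus> y) \<oplus> (- (phi x + phi y)) \<odot> \<one>) \<le> 0"
      using m_add[of "x \<oplus> (- phi x) \<odot> \<one>" "y \<oplus> (- phi y) \<odot> \<one>"] chi xy by simp
    then show "phi (x \<oplus> y) = phi x + phi y" using uniq xy by simp
    \<comment> \<open>The usual splitting of a difference of products; both summands are annihilated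
      by \<open>m\<close>, the first because \<open>m\<close> is multiplicative.\<close>
    have "(x \<otimes> y) \<oplus> (- (phi x * phi y)) \<odot> \<one> = (x \<oplus> (- phi x) \<odot> \<one>) \<otimes> y \<oplus> phi x \<odot> (y \<oplus> (- phi y) \<odot> \<one>)"
    proof -
      have "(x \<oplus> (- phi x) \<odot> \<one>) \<otimes> y \<oplus> phi x \<odot> (y \<oplus> (- phi y) \<odot> \<one>) =
         x \<otimes> y \<oplus> ((- phi x) \<odot> y \<oplus> phi x \<odot> y) \<oplus> (- (phi x * phi y)) \<odot> \<one>"
        using xy by (simp add: l_distr smult_mult_left smult_add_right smult_smult a_assoc)
      also have "(- phi x) \<odot> y \<oplus> phi x \<odot> y = \<zero>" using xy by (simp add: smult_add_left[symmetric])
      finally show ?thesis using xy by simp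
    qed
    then have "m ((x \<otimes> y) \<oplus> (- (phi x * phi y)) \<odot> \<one>) \<le> 0"
      using m_add[of "(x \<oplus> (- phi x) \<odot> \<one>) \<otimes> y" "phi x \<odot> (y \<oplus> (- phi y) \<odot> \<one>)"] chi xy
      by (simp add: m_mult m_smult)
    then show "phi (x \<otimes> y) = phi x * phi y" using uniq xy by simp
  next
    fix c x assume x: "x \<in> carrier A"
    have "c \<odot> x \<oplus> (- (c * phi x)) \<odot> \<one> = c \<odot> (x \<oplus> (- phi x) \<odot> \<one>)"
      using x by (simp add: smult_add_right smult_smult)
    then have "m (c \<odot> x \<oplus> (- (c * phi x)) \<odot> \<one>) \<le> 0" using chi x by (simp add: m_smult)
    then show "phi (c \<odot> x) = c * phi x" using uniq x by simp
  next
    have "\<one> \<oplus> (- 1) \<odot> \<one> = \<zero>" by (simp add: smult_minus_one r_neg)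
    then show "phi \<one> = 1" using uniq[of \<one> 1] m_smult[of \<one> 0] by simp
  next
    fix x assume x: "x \<in> carrier A"
    have "m x \<le> m (x \<oplus> (- phi x) \<odot> \<one>) + m (phi x \<odot> \<one>)"
      using m_add[of "x \<oplus> (- phi x) \<odot> \<one>" "phi x \<odot> \<one>"] x by (simp add: add_smult_one_assoc)
    moreover have "cmod (phi x) \<le> m (x \<oplus> (- phi x) \<odot> \<one>) + m x"
      using m_add_scalar_lower[OF x, of "- phi x"] by simp
    ultimately show "cmod (phi x) = m x" using chi[OF x] by (simp add: m_scalar)
  qed
qed

end

text \<open>The bounded elements of the Berkovich spectrum: a minimal \<open>square_seminorm\<close> is multiplicative,
  since \<open>shift q a\<close> lies below \<open>q\<close> and is multiplicative with respect to \<open>a\<close>.\<close>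

definition square_seminorm :: "('a \<Rightarrow> real) \<Rightarrow> bool" where
  "square_seminorm q \<longleftrightarrow> q \<in> extensional (carrier A) \<and>
     (\<forall>x\<in>carrier A. 0 \<le> q x) \<and>
     (\<forall>x\<in>carrier A. \<forall>y\<in>carrier A. q (x \<oplus> y) \<le> q x + q y) \<and>
     (\<forall>c. \<forall>x\<in>carrier A. q (c \<odot> x) \<le> cmod c * q x) \<and>
     (\<forall>x\<in>carrier A. \<forall>y\<in>carrier A. q (x \<otimes> y) \<le> q x * q y) \<and>
     (\<forall>x\<in>carrier A. (q x)\<^sup>2 \<le> q (x \<otimes> x)) \<and> 1 \<le> q \<one>"

definition shift :: "('a \<Rightarrow> real) \<Rightarrow> 'a \<Rightarrow> 'a \<Rightarrow> real" where
  "shift q a = (\<lambda>x\<in>carrier A. lim (\<lambda>n. q (a [^] (n::nat) \<otimes> x) / q a ^ n))"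

context
  fixes q :: "'a \<Rightarrow> real"
  assumes q: "square_seminorm q"
begin

lemma
  shows q_nonneg: "x \<in> carrier A \<Longrightarrow> 0 \<le> q x"
    and q_add: "x \<in> carrier A \<Longrightarrow> y \<in> carrier A \<Longrightarrow> q (x \<oplus> y) \<le> q x + q y"
    and q_smult_le: "x \<in> carrier A \<Longrightarrow> q (c \<odot> x) \<le> cmod c * q x"
    and q_mult: "x \<in> carrier A \<Longrightarrow> y \<in> carrier A \<Longrightarrow> q (x \<otimes> y) \<le> q x * q y"
    and q_square: "x \<in> carrier A \<Longrightarrow> (q x)\<^sup>2 \<le> q (x \<otimes> x)"
    and q_one_ge: "1 \<le> q \<one>"
  using q by (auto simp: square_seminorm_def)

lemma square_seminorm_one: "q \<one> = 1"
proof -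
  have "(q \<one>)\<^sup>2 \<le> q \<one>" using q_square[of \<one>] by simp
  then have "q \<one> * q \<one> \<le> q \<one> * 1" by (simp add: power2_eq_square)
  then show ?thesis using q_one_ge by (simp add: mult_le_cancel_left)
qed

text \<open>The inequality of the definition, applied to \<open>inverse c\<close> as well, becomes
  an equality. Hence only the inequality has to be verified for \<open>shift\<close> and for infima
  of chains.\<close>

lemma square_seminorm_smult:
  assumes x: "x \<in> carrier A" shows "q (c \<odot> x) = cmod c * q x"
proof (cases "c = 0")
  case True
  then show ?thesis using q_smult_le[OF x, of c] q_nonneg[of "c \<odot> x"] x by simp
next
  case False
  have "q x = q (inverse c \<odot> (c \<odot> x))" using False x by (simp add: smult_smult)
  also have "\<dots> \<le> cmod (inverse c) * q (c \<odot> x)" using x by (intro q_smult_le) simp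
  finally have "q x \<le> inverse (cmod c) * q (c \<odot> x)" by (simp only: norm_inverse)
  then have "cmod c * q x \<le> q (c \<odot> x)" using False by (simp add: field_simps)
  then show ?thesis using q_smult_le[OF x, of c] by simp
qed

text \<open>The square inequality gives the exponents \<open>2 ^ k\<close>. An arbitrary
  \<open>n\<close> is completed to the exponent \<open>2 ^ n\<close>, and submultiplicativity
  applied to the complementary power leaves the lower bound for the \<open>n\<close>-th
  power.\<close>

lemma square_seminorm_power:
  assumes x: "x \<in> carrier A" and pos: "q x > 0" shows "q (x [^] (n::nat)) = q x ^ n"
proof -
  have le: "q (x [^] (n::nat)) \<le> q x ^ n" for n
  proof (induction n)
    case (Suc n)
    have "q (x [^] (Suc n)) \<le> q (x [^] n) * q x" using q_mult x by simp
    also have "\<dots> \<le> q x ^ n * q x" using Suc pos by (intro mult_right_mono) auto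
    finally show ?case by (simp add: mult.commute)
  qed (simp add: square_seminorm_one)
  have two: "q x ^ 2 ^ k \<le> q (x [^] (2 ^ k :: nat))" for k
  proof (induction k)
    case (Suc k)
    have "q x ^ 2 ^ Suc k = (q x ^ 2 ^ k)\<^sup>2" by (simp add: power_mult[symmetric] mult.commute)
    also have "\<dots> \<le> (q (x [^] (2 ^ k :: nat)))\<^sup>2" using Suc pos by (intro power_mono) auto
    also have "\<dots> \<le> q (x [^] (2 ^ k :: nat) \<otimes> x [^] (2 ^ k :: nat))" using x by (intro q_square) simp
    also have "x [^] (2 ^ k :: nat) \<otimes> x [^] (2 ^ k :: nat) = x [^] (2 ^ Suc k :: nat)"
      using x by (simp add: nat_pow_mult mult_2)
    finally show ?case .
  qed (use x in simp)
  have n: "n + (2 ^ n - n) = (2::nat) ^ n" using less_exp[of n] by simp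
  have "q x ^ n * q x ^ (2 ^ n - n) \<le> q (x [^] n) * q x ^ (2 ^ n - n)"
  proof -
    have "q x ^ n * q x ^ (2 ^ n - n) = q x ^ 2 ^ n" by (simp add: power_add[symmetric] n)
    also have "\<dots> \<le> q (x [^] (n + (2 ^ n - n)))" unfolding n by (rule two)
    also have "\<dots> = q (x [^] n \<otimes> x [^] (2 ^ n - n))" using x by (simp add: nat_pow_mult)
    also have "\<dots> \<le> q (x [^] n) * q (x [^] (2 ^ n - n))" using x by (intro q_mult) auto
    also have "\<dots> \<le> q (x [^] n) * q x ^ (2 ^ n - n)" using x by (intro mult_left_mono le q_nonneg) auto
    finally show ?thesis .
  qed
  then have "q x ^ n \<le> q (x [^] n)" using pos by (simp add: mult_le_cancel_right)
  then show ?thesis using le by (simp add: order_antisym)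
qed

context
  fixes a assumes a: "a \<in> carrier A" and a_pos: "q a > 0"
begin

text \<open>By submultiplicativity the quotients decrease, and they are bounded below by zero. The
  term at \<open>n = 0\<close> is \<open>q x\<close>, which gives the comparison with
  \<open>q\<close>.\<close>

lemma shift_limit:
  assumes x: "x \<in> carrier A"
  shows "(\<lambda>n. q (a [^] (n::nat) \<otimes> x) / q a ^ n) \<longlonglongrightarrow> shift q a x" and "shift q a x \<le> q x"
proof -
  let ?S = "\<lambda>n. q (a [^] (n::nat) \<otimes> x) / q a ^ n"
  have "?S (Suc n) \<le> ?S n" for n
  proof -
    have "a [^] Suc n \<otimes> x = a \<otimes> (a [^] n \<otimes> x)" using a x by (simp add: m_ac)
    then have "q (a [^] Suc n \<otimes> x) \<le> q a * q (a [^] n \<otimes> x)" using q_mult[of a "a [^] n \<otimes> x"] a x by simp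
    then show ?thesis using a_pos by (simp add: divide_simps) (simp add: ac_simps)
  qed
  then have dec: "decseq ?S" by (rule decseq_SucI)
  have "\<forall>i. 0 \<le> ?S i" using a x a_pos q_nonneg by simp
  with dec obtain L where L: "?S \<longlonglongrightarrow> L" "\<forall>i. L \<le> ?S i" by (rule decseq_convergent)
  have s: "shift q a x = L" using limI[OF L(1)] x by (simp add: shift_def)
  show "?S \<longlonglongrightarrow> shift q a x" using L(1) s by simp
  show "shift q a x \<le> q x" using L(2)[rule_format, of 0] x s by simp
qed

text \<open>Termwise passage to the limit. The lemma preserves the side condition that fixes the
  value at \<open>x0\<close> in the Zorn argument, so that a shifted competitor is again a
  competitor.\<close>

lemma shift_mult_lower:
  assumes x0: "x0 \<in> carrier A" and s: "\<And>y. y \<in> carrier A \<Longrightarrow> s * q y \<le> q (x0 \<otimes> y)" and y: "y \<in> carrier A"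
  shows "s * shift q a y \<le> shift q a (x0 \<otimes> y)"
proof (rule LIMSEQ_le)
  show "(\<lambda>n. s * (q (a [^] (n::nat) \<otimes> y) / q a ^ n)) \<longlonglongrightarrow> s * shift q a y"
    by (intro tendsto_intros shift_limit y)
  show "(\<lambda>n. q (a [^] (n::nat) \<otimes> (x0 \<otimes> y)) / q a ^ n) \<longlonglongrightarrow> shift q a (x0 \<otimes> y)"
    using x0 y by (intro shift_limit) simp
  have "s * (q (a [^] n \<otimes> y) / q a ^ n) \<le> q (a [^] n \<otimes> (x0 \<otimes> y)) / q a ^ n" for n :: nat
  proof -
    have "a [^] n \<otimes> (x0 \<otimes> y) = x0 \<otimes> (a [^] n \<otimes> y)" using a x0 y by (simp add: m_ac)
    then have "s * q (a [^] n \<otimes> y) \<le> q (a [^] n \<otimes> (x0 \<otimes> y))" using s[of "a [^] n \<otimes> y"] a y by simp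
    then show ?thesis using a_pos by (simp add: divide_right_mono)
  qed
  then show "\<exists>N. \<forall>n\<ge>N. s * (q (a [^] n \<otimes> y) / q a ^ n) \<le> q (a [^] n \<otimes> (x0 \<otimes> y)) / q a ^ n" by blast
qed

text \<open>The defining sequence for \<open>a \<otimes> y\<close> is that for \<open>y\<close>,
  moved by one index and multiplied by \<open>q a\<close>.\<close>

lemma shift_mult_self:
  assumes y: "y \<in> carrier A"
  shows "q a * shift q a y \<le> shift q a (a \<otimes> y)"
proof -
  have "(\<lambda>n. q a * (q (a [^] Suc n \<otimes> y) / q a ^ Suc n)) \<longlonglongrightarrow> q a * shift q a y"
    by (intro tendsto_intros LIMSEQ_Suc[OF shift_limit(1)[OF y]])
  moreover have "q a * (q (a [^] Suc n \<otimes> y) / q a ^ Suc n) = q (a [^] n \<otimes> (a \<otimes> y)) / q a ^ n" for n :: nat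
    using a y a_pos by (simp add: m_assoc)
  ultimately have "(\<lambda>n. q (a [^] n \<otimes> (a \<otimes> y)) / q a ^ n) \<longlonglongrightarrow> q a * shift q a y" by (simp only:)
  moreover have "(\<lambda>n. q (a [^] (n::nat) \<otimes> (a \<otimes> y)) / q a ^ n) \<longlonglongrightarrow> shift q a (a \<otimes> y)"
    using a y by (intro shift_limit) simp
  ultimately have "q a * shift q a y = shift q a (a \<otimes> y)" by (rule LIMSEQ_unique)
  then show ?thesis by simp
qed

text \<open>Sums and scalar multiples pass to the limit termwise. For products the sequence is taken
  along the even indices, where the power of \<open>a\<close> can be divided equally between the two
  factors. The value at the unit does not drop below one because \<open>q\<close> is multiplicative
  on the powers of \<open>a\<close>.\<close>

lemma square_seminorm_shift: "square_seminorm (shift q a)"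
  unfolding square_seminorm_def
proof (intro conjI ballI allI)
  show "shift q a \<in> extensional (carrier A)" by (simp add: shift_def)
  have double: "a [^] (n + n) \<otimes> (x \<otimes> y) = (a [^] n \<otimes> x) \<otimes> (a [^] n \<otimes> y)"
    if "x \<in> carrier A" "y \<in> carrier A" for x y and n :: nat
    using that a by (simp add: nat_pow_mult[symmetric] m_ac)
  have sm: "strict_mono (\<lambda>n::nat. n + n)" by (rule strict_monoI) simp
  have double_lim: "(\<lambda>n. q ((a [^] n \<otimes> x) \<otimes> (a [^] n \<otimes> y)) / (q a ^ n * q a ^ n)) \<longlonglongrightarrow> shift q a (x \<otimes> y)"
    if "x \<in> carrier A" "y \<in> carrier A" for x y
    using LIMSEQ_subseq_LIMSEQ[OF shift_limit(1)[of "x \<otimes> y"] sm] that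
    by (simp add: o_def double power_add)
  show "0 \<le> shift q a x" if x: "x \<in> carrier A" for x
    using shift_limit(1)[OF x] a x a_pos q_nonneg by (intro LIMSEQ_le_const) auto
  show "shift q a (x \<oplus> y) \<le> shift q a x + shift q a y" if xy: "x \<in> carrier A" "y \<in> carrier A" for x y
  proof (rule LIMSEQ_le)
    show "(\<lambda>n. q (a [^] (n::nat) \<otimes> x) / q a ^ n + q (a [^] (n::nat) \<otimes> y) / q a ^ n)
       \<longlonglongrightarrow> shift q a x + shift q a y"
      by (intro tendsto_intros shift_limit xy)
    show "(\<lambda>n. q (a [^] (n::nat) \<otimes> (x \<oplus> y)) / q a ^ n) \<longlonglongrightarrow> shift q a (x \<oplus> y)"
      using xy by (intro shift_limit) simp
    have "q (a [^] n \<otimes> (x \<oplus> y)) / q a ^ n \<le> q (a [^] n \<otimes> x) / q a ^ n + q (a [^] n \<otimes> y) / q a ^ n" for n :: nat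
      using q_add[of "a [^] n \<otimes> x" "a [^] n \<otimes> y"] a xy a_pos
      by (simp add: r_distr add_divide_distrib[symmetric] divide_right_mono)
    then show "\<exists>N. \<forall>n\<ge>N. q (a [^] n \<otimes> (x \<oplus> y)) / q a ^ n \<le> q (a [^] n \<otimes> x) / q a ^ n + q (a [^] n \<otimes> y) / q a ^ n"
      by blast
  qed
  show "shift q a (c \<odot> x) \<le> cmod c * shift q a x" if x: "x \<in> carrier A" for c x
  proof (rule LIMSEQ_le)
    show "(\<lambda>n. cmod c * (q (a [^] (n::nat) \<otimes> x) / q a ^ n)) \<longlonglongrightarrow> cmod c * shift q a x"
      by (intro tendsto_intros shift_limit x)
    show "(\<lambda>n. q (a [^] (n::nat) \<otimes> (c \<odot> x)) / q a ^ n) \<longlonglongrightarrow> shift q a (c \<odot> x)"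
      using x by (intro shift_limit) simp
    have "q (a [^] n \<otimes> (c \<odot> x)) / q a ^ n \<le> cmod c * (q (a [^] n \<otimes> x) / q a ^ n)" for n :: nat
      using a x by (simp add: smult_mult_right square_seminorm_smult)
    then show "\<exists>N. \<forall>n\<ge>N. q (a [^] n \<otimes> (c \<odot> x)) / q a ^ n \<le> cmod c * (q (a [^] n \<otimes> x) / q a ^ n)"
      by blast
  qed
  show "shift q a (x \<otimes> y) \<le> shift q a x * shift q a y" if xy: "x \<in> carrier A" "y \<in> carrier A" for x y
  proof (rule LIMSEQ_le)
    show "(\<lambda>n. (q (a [^] (n::nat) \<otimes> x) / q a ^ n) * (q (a [^] (n::nat) \<otimes> y) / q a ^ n))
       \<longlonglongrightarrow> shift q a x * shift q a y"
      by (intro tendsto_intros shift_limit xy)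
    have "q ((a [^] n \<otimes> x) \<otimes> (a [^] n \<otimes> y)) / (q a ^ n * q a ^ n)
       \<le> (q (a [^] n \<otimes> x) / q a ^ n) * (q (a [^] n \<otimes> y) / q a ^ n)" for n :: nat
      using q_mult[of "a [^] n \<otimes> x" "a [^] n \<otimes> y"] a xy a_pos by (simp add: divide_right_mono)
    then show "\<exists>N. \<forall>n\<ge>N. q ((a [^] n \<otimes> x) \<otimes> (a [^] n \<otimes> y)) / (q a ^ n * q a ^ n)
       \<le> (q (a [^] n \<otimes> x) / q a ^ n) * (q (a [^] n \<otimes> y) / q a ^ n)" by blast
  qed (rule double_lim[OF xy])
  show "(shift q a x)\<^sup>2 \<le> shift q a (x \<otimes> x)" if x: "x \<in> carrier A" for x
  proof (rule LIMSEQ_le)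
    show "(\<lambda>n. (q (a [^] (n::nat) \<otimes> x) / q a ^ n)\<^sup>2) \<longlonglongrightarrow> (shift q a x)\<^sup>2"
      by (intro tendsto_intros shift_limit x)
    have "(q (a [^] n \<otimes> x) / q a ^ n)\<^sup>2 \<le> q ((a [^] n \<otimes> x) \<otimes> (a [^] n \<otimes> x)) / (q a ^ n * q a ^ n)" for n :: nat
      using q_square[of "a [^] n \<otimes> x"] a x a_pos
      by (simp add: power_divide divide_right_mono power2_eq_square[of "q a ^ n"])
    then show "\<exists>N. \<forall>n\<ge>N. (q (a [^] n \<otimes> x) / q a ^ n)\<^sup>2
        \<le> q ((a [^] n \<otimes> x) \<otimes> (a [^] n \<otimes> x)) / (q a ^ n * q a ^ n)" by blast
  qed (rule double_lim[OF x x])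
  have "q (a [^] n \<otimes> \<one>) / q a ^ n = 1" for n :: nat
    using a a_pos by (simp add: square_seminorm_power[OF a a_pos])
  then have "(\<lambda>n::nat. q (a [^] n \<otimes> \<one>) / q a ^ n) = (\<lambda>_. 1)" by (rule ext)
  with shift_limit(1)[OF one_closed] have "(\<lambda>n::nat. 1) \<longlonglongrightarrow> shift q a \<one>" by (simp only:)
  from LIMSEQ_unique[OF tendsto_const this] show "1 \<le> shift q a \<one>" by simp
qed

end

end

text \<open>Zorn's lemma provides a minimal seminorm, but minimality alone would lose the value at
  \<open>x0\<close>. The competitors are therefore required to satisfy
  \<open>p x0 * q y \<le> q (x0 \<otimes> y)\<close>, which at \<open>y = \<one>\<close> keeps
  \<open>q x0\<close> at least \<open>p x0\<close>; \<open>shift p x0\<close> is one of them. A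
  minimal competitor coincides with all its shifts, and then \<open>shift_mult_self\<close> supplies
  the missing half of multiplicativity.\<close>

lemma multiplicative_seminorm_below:
  assumes p: "square_seminorm p" and x0: "x0 \<in> carrier A" "p x0 > 0"
  shows "\<exists>m. multiplicative_seminorm m \<and> (\<forall>x\<in>carrier A. m x \<le> p x) \<and> m x0 = p x0"
proof -
  define Q where "Q = {q. square_seminorm q \<and> (\<forall>x\<in>carrier A. q x \<le> p x) \<and>
     (\<forall>y\<in>carrier A. p x0 * q y \<le> q (x0 \<otimes> y))}"
  \<comment> \<open>The order is reversed, because Zorn's lemma is available for maximal
    elements.\<close>
  define P where "P = (\<lambda>q1 q2. \<forall>x\<in>carrier A. q2 x \<le> (q1 x :: real))"
  have Qsq: "square_seminorm q" if "q \<in> Q" for q using that by (simp add: Q_def)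
  have start: "shift p x0 \<in> Q"
    unfolding Q_def
    using square_seminorm_shift[OF p x0] shift_limit(2)[OF p x0] shift_mult_self[OF p x0] by blast
  have "\<exists>m\<in>Q. \<forall>a\<in>Q. P m a \<longrightarrow> a = m"
  proof (rule predicate_Zorn)
    show "partial_order_on Q (relation_of P Q)"
    proof (rule partial_order_on_relation_ofI)
      fix q1 q2 assume "q1 \<in> Q" "q2 \<in> Q" "P q1 q2" "P q2 q1"
      then show "q1 = q2"
        by (intro extensionalityI[of _ "carrier A"]) (auto simp: Q_def P_def square_seminorm_def intro: order_antisym)
    qed (auto simp: P_def intro: order_trans)
  next
    fix C assume C: "C \<in> Chains (relation_of P Q)"
    then have CQ: "C \<subseteq> Q" by (rule Chains_relation_of)
    show "\<exists>u\<in>Q. \<forall>a\<in>C. P a u"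
    proof (cases "C = {}")
      case True
      then show ?thesis using start by blast
    next
      case False
      \<comment> \<open>Of two members of the chain the smaller serves for both, so the two infima
        in a sum or in a product may be approached independently.\<close>
      have chain: "\<exists>q\<in>C. (\<forall>x\<in>carrier A. q x \<le> q1 x) \<and> (\<forall>x\<in>carrier A. q x \<le> q2 x)"
        if "q1 \<in> C" "q2 \<in> C" for q1 q2
      proof -
        from C that have "P q1 q2 \<or> P q2 q1" by (auto simp: Chains_def relation_of_def)
        then show ?thesis using that by (auto simp: P_def)
      qed
      define u where "u = (\<lambda>x\<in>carrier A. INF q\<in>C. q x)"
      have ule: "u x \<le> q x" if "x \<in> carrier A" "q \<in> C" for x q
      proof -
        have "bdd_below ((\<lambda>q. q x) ` C)"
          using that(1) CQ Qsq by (intro bdd_belowI2[of _ 0]) (auto simp: square_seminorm_def)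
        then show ?thesis using that by (auto simp: u_def intro: cINF_lower)
      qed
      have uge: "b \<le> u x" if "x \<in> carrier A" "\<And>q. q \<in> C \<Longrightarrow> b \<le> q x" for x b
        using that False by (auto simp: u_def intro: cINF_greatest)
      have u0: "0 \<le> u x" if "x \<in> carrier A" for x
        using that CQ Qsq by (intro uge) (auto simp: square_seminorm_def)
      have "square_seminorm u"
        unfolding square_seminorm_def
      proof (intro conjI ballI allI u0)
        show "u \<in> extensional (carrier A)" by (simp add: u_def)
        fix x assume x: "x \<in> carrier A"
        show "(u x)\<^sup>2 \<le> u (x \<otimes> x)"
        proof (rule uge)
          fix q assume q: "q \<in> C"
          have "(u x)\<^sup>2 \<le> (q x)\<^sup>2" using ule[OF x q] u0[OF x] by (intro power_mono)
          also have "\<dots> \<le> q (x \<otimes> x)" using q CQ Qsq x by (auto simp: square_seminorm_def)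
          finally show "(u x)\<^sup>2 \<le> q (x \<otimes> x)" .
        qed (use x in simp)
        show "u (c \<odot> x) \<le> cmod c * u x" for c
        proof (cases "c = 0")
          case True
          obtain q where q: "q \<in> C" using False by blast
          have "u \<zero> \<le> q \<zero>" by (rule ule) (use q in auto)
          also have "\<dots> = 0" using square_seminorm_smult[of q \<zero> 0] q CQ Qsq by auto
          finally show ?thesis using True x by simp
        next
          case c: False
          have "u (c \<odot> x) / cmod c \<le> u x"
          proof (rule uge[OF x])
            fix q assume q: "q \<in> C"
            have "u (c \<odot> x) \<le> q (c \<odot> x)" using q x by (intro ule) auto
            also have "\<dots> = cmod c * q x" using square_seminorm_smult[of q x c] q CQ Qsq x by auto
            finally show "u (c \<odot> x) / cmod c \<le> q x" using c by (simp add: field_simps)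
          qed
          then show ?thesis using c by (simp add: field_simps)
        qed
        fix y assume y: "y \<in> carrier A"
        have add: "u (x \<oplus> y) \<le> q1 x + q2 y" if q12: "q1 \<in> C" "q2 \<in> C" for q1 q2
        proof -
          obtain q where q: "q \<in> C" "\<forall>x\<in>carrier A. q x \<le> q1 x" "\<forall>x\<in>carrier A. q x \<le> q2 x"
            using chain[OF q12] by blast
          have "u (x \<oplus> y) \<le> q (x \<oplus> y)" using q x y by (intro ule) auto
          also have "\<dots> \<le> q x + q y" using q(1) CQ Qsq x y by (auto simp: square_seminorm_def)
          also have "\<dots> \<le> q1 x + q2 y" using q x y by (intro add_mono) auto
          finally show ?thesis .
        qed
        have "u (x \<oplus> y) - q1 x \<le> u y" if "q1 \<in> C" for q1
          using add[OF that] by (intro uge[OF y]) (simp add: algebra_simps)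
        then have "u (x \<oplus> y) - u y \<le> u x" by (intro uge[OF x]) (simp add: algebra_simps)
        then show "u (x \<oplus> y) \<le> u x + u y" by simp
        have mult: "u (x \<otimes> y) \<le> q1 x * q2 y" if q12: "q1 \<in> C" "q2 \<in> C" for q1 q2
        proof -
          obtain q where q: "q \<in> C" "\<forall>x\<in>carrier A. q x \<le> q1 x" "\<forall>x\<in>carrier A. q x \<le> q2 x"
            using chain[OF q12] by blast
          have q0: "0 \<le> q z" if "z \<in> carrier A" for z using q(1) CQ Qsq that by (auto simp: square_seminorm_def)
          have "u (x \<otimes> y) \<le> q (x \<otimes> y)" using q x y by (intro ule) auto
          also have "\<dots> \<le> q x * q y" using q(1) CQ Qsq x y by (auto simp: square_seminorm_def)
          also have "\<dots> \<le> q1 x * q2 y" using q x y q0 by (intro mult_mono) (auto intro: order_trans)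
          finally show ?thesis .
        qed
        \<comment> \<open>For sums the infima were taken one after the other by subtraction. Here
          this would mean division by a factor that may vanish, so both infima are approximated up
          to \<open>e\<close> instead.\<close>
        have "u (x \<otimes> y) \<le> (u x + e) * (u y + e)" if e: "e > 0" for e
        proof -
          have "\<exists>q\<in>C. q z < u z + e" if z: "z \<in> carrier A" for z
          proof (rule ccontr)
            assume "\<not> ?thesis"
            then have "u z + e \<le> u z" by (intro uge[OF z]) (auto simp: not_less)
            then show False using e by simp
          qed
          then obtain q1 q2 where q12: "q1 \<in> C" "q1 x < u x + e" "q2 \<in> C" "q2 y < u y + e" using x y by metis
          have "0 \<le> q2 y" using q12(3) CQ Qsq y by (auto simp: square_seminorm_def)
          then have "q1 x * q2 y \<le> (u x + e) * (u y + e)"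
            using q12 u0[OF x] e by (intro mult_mono) auto
          then show ?thesis using mult[OF q12(1,3)] by simp
        qed
        then have "u (x \<otimes> y) \<le> (u x + inverse (real (Suc n))) * (u y + inverse (real (Suc n)))" for n by simp
        moreover have "(\<lambda>n. (u x + inverse (real (Suc n))) * (u y + inverse (real (Suc n)))) \<longlonglongrightarrow> (u x + 0) * (u y + 0)"
          by (intro tendsto_intros LIMSEQ_inverse_real_of_nat)
        ultimately show "u (x \<otimes> y) \<le> u x * u y" by (intro LIMSEQ_le_const[of _ "u x * u y"]) auto
      next
        show "1 \<le> u \<one>" using CQ Qsq by (intro uge) (auto simp: square_seminorm_def)
      qed
      moreover have "u x \<le> p x" if "x \<in> carrier A" for x
      proof -
        obtain q where "q \<in> C" using False by blast
        then show ?thesis using ule[OF that] CQ that by (force simp: Q_def)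
      qed
      moreover have "p x0 * u y \<le> u (x0 \<otimes> y)" if y: "y \<in> carrier A" for y
      proof (rule uge)
        fix q assume q: "q \<in> C"
        have "p x0 * u y \<le> p x0 * q y" using ule[OF y q] x0 by simp
        also have "\<dots> \<le> q (x0 \<otimes> y)" using q CQ y by (auto simp: Q_def)
        finally show "p x0 * u y \<le> q (x0 \<otimes> y)" .
      qed (use x0 y in simp)
      ultimately have "u \<in> Q" by (simp add: Q_def)
      then show ?thesis using ule by (auto simp: P_def)
    qed
  qed
  then obtain m where m: "m \<in> Q" and min: "\<And>q. q \<in> Q \<Longrightarrow> P m q \<Longrightarrow> q = m" by blast
  have msq: "square_seminorm m" using m by (rule Qsq)
  have mle: "m x \<le> p x" if "x \<in> carrier A" for x using m that by (simp add: Q_def)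
  have shift_eq: "shift m a = m" if a: "a \<in> carrier A" "m a > 0" for a
  proof (rule min)
    show "shift m a \<in> Q" unfolding Q_def
    proof (intro CollectI conjI ballI)
      show "square_seminorm (shift m a)" by (rule square_seminorm_shift[OF msq a])
      show "shift m a x \<le> p x" if "x \<in> carrier A" for x
        using shift_limit(2)[OF msq a that] mle[OF that] by simp
      show "p x0 * shift m a y \<le> shift m a (x0 \<otimes> y)" if "y \<in> carrier A" for y
        by (rule shift_mult_lower[OF msq a x0(1) _ that]) (use m in \<open>auto simp: Q_def\<close>)
    qed
    show "P m (shift m a)" unfolding P_def using shift_limit(2)[OF msq a] by blast
  qed
  have mult: "m (a \<otimes> x) = m a * m x" if a: "a \<in> carrier A" and x: "x \<in> carrier A" for a x
  proof -
    have le: "m (a \<otimes> x) \<le> m a * m x" using q_mult[OF msq a x] .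
    show ?thesis
    proof (cases "m a = 0")
      case True
      then show ?thesis using le q_nonneg[OF msq, of "a \<otimes> x"] a x by simp
    next
      case False
      then have pos: "m a > 0" using q_nonneg[OF msq a] by simp
      show ?thesis using le shift_mult_self[OF msq a pos x] by (simp add: shift_eq[OF a pos])
    qed
  qed
  show ?thesis
  proof (intro exI conjI ballI)
    show "multiplicative_seminorm m"
      unfolding multiplicative_seminorm_def
      using q_nonneg[OF msq] q_add[OF msq] square_seminorm_smult[OF msq] mult square_seminorm_one[OF msq] by blast
    have "p x0 * m \<one> \<le> m (x0 \<otimes> \<one>)" using m by (auto simp: Q_def)
    then show "m x0 = p x0" using mle[OF x0(1)] x0 by (simp add: square_seminorm_one[OF msq])
  qed (rule mle)
qed

section \<open>Characters dominated by a C*-seminorm\<close>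

definition C_star_seminorm :: "('a \<Rightarrow> real) \<Rightarrow> bool" where
  "C_star_seminorm p \<longleftrightarrow>
     (\<forall>x\<in>carrier A. 0 \<le> p x) \<and>
     (\<forall>x\<in>carrier A. \<forall>y\<in>carrier A. p (x \<oplus> y) \<le> p x + p y) \<and>
     (\<forall>c. \<forall>x\<in>carrier A. p (c \<odot> x) = cmod c * p x) \<and>
     (\<forall>x\<in>carrier A. \<forall>y\<in>carrier A. p (x \<otimes> y) \<le> p x * p y) \<and>
     (\<forall>x\<in>carrier A. p (x \<otimes> star A x) = (p x)\<^sup>2)"

text \<open>In a commutative algebra the C*-identity makes \<open>p\<close> exact on squares, so
  \<open>p\<close> is a \<open>square_seminorm\<close> and there is a multiplicative seminorm below
  it with the same value at \<open>x0\<close>. Its character respects the involution by an argument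
  of Arens.\<close>

lemma character_of_C_star_seminorm:
  assumes p: "C_star_seminorm p" and x0: "x0 \<in> carrier A" "p x0 > 0"
  shows "\<exists>phi. (\<forall>x\<in>carrier A. \<forall>y\<in>carrier A. phi (x \<oplus> y) = phi x + phi y) \<and>
    (\<forall>x\<in>carrier A. \<forall>y\<in>carrier A. phi (x \<otimes> y) = phi x * phi y) \<and>
    (\<forall>c. \<forall>x\<in>carrier A. phi (c \<odot> x) = c * phi x) \<and>
    phi \<one> = (1::complex) \<and> (\<forall>x\<in>carrier A. phi (star A x) = cnj (phi x)) \<and>
    (\<forall>x\<in>carrier A. cmod (phi x) \<le> p x) \<and> cmod (phi x0) = p x0"
proof -
  have nonneg: "x \<in> carrier A \<Longrightarrow> 0 \<le> p x"
    and add: "x \<in> carrier A \<Longrightarrow> y \<in> carrier A \<Longrightarrow> p (x \<oplus> y) \<le> p x + p y"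
    and smult: "x \<in> carrier A \<Longrightarrow> p (c \<odot> x) = cmod c * p x"
    and mult: "x \<in> carrier A \<Longrightarrow> y \<in> carrier A \<Longrightarrow> p (x \<otimes> y) \<le> p x * p y"
    and pstar: "x \<in> carrier A \<Longrightarrow> p (x \<otimes> star A x) = (p x)\<^sup>2" for x y c
    using p by (auto simp: C_star_seminorm_def)
  \<comment> \<open>With \<open>?y = x \<otimes> star A x\<close> self-adjoint, the C*-identity for
    \<open>x \<otimes> x\<close> and commutativity express the square of the left-hand side through
    \<open>?y \<otimes> star A ?y\<close>; two more applications of the identity give the fourth
    power of \<open>p x\<close>.\<close>
  have sq: "p (x \<otimes> x) = (p x)\<^sup>2" if x: "x \<in> carrier A" for x
  proof -
    let ?y = "x \<otimes> star A x"
    have y: "?y \<in> carrier A" "star A ?y = ?y" using x by (auto simp: star_mult)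
    have "(p (x \<otimes> x))\<^sup>2 = p ((x \<otimes> x) \<otimes> star A (x \<otimes> x))" using x by (simp add: pstar)
    also have "(x \<otimes> x) \<otimes> star A (x \<otimes> x) = ?y \<otimes> star A ?y" using x by (simp add: y star_mult m_ac)
    also have "p \<dots> = ((p x)\<^sup>2)\<^sup>2" using pstar[OF y(1)] pstar[OF x] by simp
    finally show ?thesis by (rule power2_eq_imp_eq) (use nonneg x in auto)
  qed
  have "p x0 * 1 \<le> p x0 * p \<one>" using mult[OF x0(1), of \<one>] x0 by simp
  then have one: "1 \<le> p \<one>" using x0 by (simp add: mult_le_cancel_left)
  have sqp: "square_seminorm (restrict p (carrier A))"
    unfolding square_seminorm_def using nonneg add smult mult sq one by auto
  have pos: "restrict p (carrier A) x0 > 0" using x0 by simp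
  obtain m where "multiplicative_seminorm m"
    "\<forall>x\<in>carrier A. m x \<le> restrict p (carrier A) x" "m x0 = restrict p (carrier A) x0"
    using multiplicative_seminorm_below[OF sqp x0(1) pos] by blast
  then have m: "multiplicative_seminorm m" "\<And>x. x \<in> carrier A \<Longrightarrow> m x \<le> p x" "m x0 = p x0"
    using x0 by auto
  obtain phi where "\<forall>x\<in>carrier A. \<forall>y\<in>carrier A. phi (x \<oplus> y) = phi x + phi y"
    "\<forall>x\<in>carrier A. \<forall>y\<in>carrier A. phi (x \<otimes> y) = phi x * phi y"
    "\<forall>c. \<forall>x\<in>carrier A. phi (c \<odot> x) = c * phi x"
    "phi \<one> = (1::complex)" "\<forall>x\<in>carrier A. cmod (phi x) = m x"
    using character_of_multiplicative_seminorm[OF m(1)] by (elim exE conjE)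
  note phi = this[rule_format]
  have le: "cmod (phi x) \<le> p x" if "x \<in> carrier A" for x using phi(5) m(2) that by simp
  have p1: "p \<one> \<le> 1"
  proof -
    have "p \<one> * p \<one> = p \<one>" using sq[of \<one>] by (simp add: power2_eq_square)
    then show ?thesis using one by auto
  qed
  \<comment> \<open>Arens' argument: along the line \<open>h + i t\<close> the square of
    \<open>cmod (phi ?z)\<close> contains the term \<open>2 * Im (phi h) * t\<close>, linear in
    \<open>t\<close>, while \<open>(p ?z)\<^sup>2\<close> exceeds \<open>t\<^sup>2\<close> by at
    most the constant \<open>(p h)\<^sup>2\<close>.\<close>
  have real: "Im (phi h) = 0" if h: "h \<in> carrier A" "star A h = h" for h
  proof (rule ccontr)
    assume nz: "Im (phi h) \<noteq> 0"
    \<comment> \<open>The choice makes the linear term equal to \<open>(p h)\<^sup>2 + 1\<close>,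
      just more than the estimate allows.\<close>
    define t where "t = ((p h)\<^sup>2 + 1) / (2 * Im (phi h))"
    let ?s = "\<i> * of_real t"
    let ?z = "h \<oplus> ?s \<odot> \<one>"
    have z: "?z \<in> carrier A" using h by simp
    have "star A ?z = h \<oplus> (- ?s) \<odot> \<one>" using h by (simp add: star_add star_smult)
    then have "?z \<otimes> star A ?z = h \<otimes> h \<oplus> (of_real (t\<^sup>2)) \<odot> \<one>"
      using diff_of_squares[OF h(1), of ?s] by (simp add: power2_eq_square algebra_simps)
    then have "(p ?z)\<^sup>2 = p (h \<otimes> h \<oplus> (of_real (t\<^sup>2)) \<odot> \<one>)" using pstar[OF z] by simp
    also have "\<dots> \<le> p (h \<otimes> h) + p ((of_real (t\<^sup>2)) \<odot> \<one>)" using h by (intro add) auto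
    also have "\<dots> \<le> (p h)\<^sup>2 + t\<^sup>2 * 1"
      using h p1 sq[OF h(1)] by (simp add: smult norm_power mult_left_le del: of_real_power)
    finally have "(p ?z)\<^sup>2 \<le> (p h)\<^sup>2 + t\<^sup>2" by simp
    moreover have "(cmod (phi ?z))\<^sup>2 \<le> (p ?z)\<^sup>2" using le[OF z] by (intro power_mono) auto
    moreover have "phi ?z = phi h + ?s" using h phi by simp
    moreover have "(cmod (phi h + ?s))\<^sup>2 = (Re (phi h))\<^sup>2 + (Im (phi h) + t)\<^sup>2" by (simp add: cmod_power2)
    ultimately have "(Re (phi h))\<^sup>2 + (Im (phi h) + t)\<^sup>2 \<le> (p h)\<^sup>2 + t\<^sup>2" by simp
    then have "(Re (phi h))\<^sup>2 + (Im (phi h))\<^sup>2 + 2 * Im (phi h) * t \<le> (p h)\<^sup>2" by (simp add: power2_sum)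
    moreover have "2 * Im (phi h) * t = (p h)\<^sup>2 + 1" using nz by (simp add: t_def)
    ultimately show False using zero_le_power2[of "Re (phi h)"] zero_le_power2[of "Im (phi h)"] by linarith
  qed
  have star: "phi (star A x) = cnj (phi x)" if x: "x \<in> carrier A" for x
  proof -
    have "Im (phi (x \<oplus> star A x)) = 0" by (rule real) (use x in \<open>auto simp: star_add a_comm\<close>)
    then have 1: "Im (phi x) + Im (phi (star A x)) = 0" using x phi by simp
    have "star A (\<i> \<odot> x \<oplus> (- \<i>) \<odot> star A x) = \<i> \<odot> x \<oplus> (- \<i>) \<odot> star A x"
      using x by (simp add: star_add star_smult a_comm)
    then have "Im (phi (\<i> \<odot> x \<oplus> (- \<i>) \<odot> star A x)) = 0" by (intro real) (use x in auto)
    then have 2: "Re (phi x) - Re (phi (star A x)) = 0" using x phi by simp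
    show ?thesis using 1 2 by (simp add: complex_eq_iff)
  qed
  show ?thesis
    by (rule exI[of _ phi]) (use phi star le m(3) x0 in simp)
qed

end

subsection \<open>Algebras of continuous functions\<close>

lemma continuous_map_complex_mult:
  fixes f g :: "'m \<Rightarrow> complex"
  shows "continuous_map M euclidean f \<Longrightarrow> continuous_map M euclidean g
     \<Longrightarrow> continuous_map M euclidean (\<lambda>t. f t * g t)"
  by (simp add: continuous_map_atin tendsto_mult)

lemma continuous_map_of_real:
  "continuous_map M euclideanreal f \<Longrightarrow> continuous_map M euclidean (\<lambda>t. complex_of_real (f t))"
  by (simp add: continuous_map_atin tendsto_of_real)

lemma continuous_map_complex_cnj:
  "continuous_map M euclidean f \<Longrightarrow> continuous_map M euclidean (\<lambda>t. cnj (f t))"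
  by (simp add: continuous_map_atin tendsto_cnj)

lemma function_algebra_simps [simp]:
  "carrier (function_algebra M) = continuous_functions M"
  "mult (function_algebra M) = (\<lambda>f g. \<lambda>t\<in>topspace M. f t * g t)"
  "one (function_algebra M) = (\<lambda>t\<in>topspace M. 1)"
  "zero (function_algebra M) = (\<lambda>t\<in>topspace M. 0)"
  "add (function_algebra M) = (\<lambda>f g. \<lambda>t\<in>topspace M. f t + g t)"
  "smult (function_algebra M) = (\<lambda>c f. \<lambda>t\<in>topspace M. c * f t)"
  "topol (function_algebra M) = uniform_topology {K. compactin M K} (continuous_functions M)"
  "star (function_algebra M) = (\<lambda>f. \<lambda>t\<in>topspace M. cnj (f t))"
  by (simp_all add: function_algebra_def)

lemma continuous_functionsD:
  "f \<in> continuous_functions M \<Longrightarrow> continuous_map M euclidean f"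
  "f \<in> continuous_functions M \<Longrightarrow> f \<in> extensional (topspace M)"
  by (simp_all add: continuous_functions_def)

lemma restrict_in_continuous_functions:
  assumes "continuous_map M euclidean f" shows "(\<lambda>t\<in>topspace M. f t) \<in> continuous_functions M"
  unfolding continuous_functions_def using continuous_map_eq[OF assms] by simp

lemma continuous_functions_add:
    "f \<in> continuous_functions M \<Longrightarrow> g \<in> continuous_functions M \<Longrightarrow> (\<lambda>t\<in>topspace M. f t + g t) \<in> continuous_functions M"
  and continuous_functions_diff:
    "f \<in> continuous_functions M \<Longrightarrow> g \<in> continuous_functions M \<Longrightarrow> (\<lambda>t\<in>topspace M. f t - g t) \<in> continuous_functions M"
  and continuous_functions_mult:
    "f \<in> continuous_functions M \<Longrightarrow> g \<in> continuous_functions M \<Longrightarrow> (\<lambda>t\<in>topspace M. f t * g t) \<in> continuous_functions M"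
  and continuous_functions_smult:
    "f \<in> continuous_functions M \<Longrightarrow> (\<lambda>t\<in>topspace M. c * f t) \<in> continuous_functions M"
  and continuous_functions_cnj:
    "f \<in> continuous_functions M \<Longrightarrow> (\<lambda>t\<in>topspace M. cnj (f t)) \<in> continuous_functions M"
  by (auto intro!: restrict_in_continuous_functions continuous_map_add continuous_map_diff
      continuous_map_complex_mult continuous_map_complex_cnj dest: continuous_functionsD)

lemmas continuous_functions_closed = continuous_functions_add continuous_functions_diff
  continuous_functions_mult continuous_functions_smult continuous_functions_cnj

lemma const_in_continuous_functions: "(\<lambda>t\<in>topspace M. c) \<in> continuous_functions M"
  by (rule restrict_in_continuous_functions) simp

lemma continuous_functions_eqI:
  "f \<in> continuous_functions M \<Longrightarrow> g \<in> continuous_functions M \<Longrightarrow>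
    (\<And>t. t \<in> topspace M \<Longrightarrow> f t = g t) \<Longrightarrow> f = g"
  by (rule extensionalityI[of _ "topspace M"]) (auto dest: continuous_functionsD)

lemma restrict_continuous_functions_eq:
  "f \<in> continuous_functions M \<Longrightarrow> (\<And>t. t \<in> topspace M \<Longrightarrow> g t = f t) \<Longrightarrow> (\<lambda>t\<in>topspace M. g t) = f"
  by (rule extensionalityI[of _ "topspace M"]) (auto dest: continuous_functionsD)

lemma continuous_functions_bounded:
  assumes f: "f \<in> continuous_functions M" and K: "compactin M K"
  obtains B where "B > 0" "\<And>t. t \<in> K \<Longrightarrow> cmod (f t) \<le> B"
proof -
  have "compactin euclidean (f ` K)" using image_compactin[OF K continuous_functionsD(1)[OF f]] .
  then have "bounded (f ` K)" by (simp add: compact_imp_bounded)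
  then obtain B where "B > 0" "\<forall>x\<in>f ` K. norm x \<le> B" unfolding bounded_pos by blast
  then show ?thesis using that by blast
qed

lemma abelian_group_function_algebra: "abelian_group (function_algebra M)"
proof (rule abelian_groupI)
  fix f assume f: "f \<in> carrier (function_algebra M)"
  show "\<exists>g\<in>carrier (function_algebra M). g \<oplus>\<^bsub>function_algebra M\<^esub> f = \<zero>\<^bsub>function_algebra M\<^esub>"
  proof
    show "(\<lambda>t\<in>topspace M. (-1) * f t) \<in> carrier (function_algebra M)"
      using f continuous_functions_smult[of f M "-1"] by simp
    show "(\<lambda>t\<in>topspace M. (-1) * f t) \<oplus>\<^bsub>function_algebra M\<^esub> f = \<zero>\<^bsub>function_algebra M\<^esub>"
      unfolding function_algebra_simps by (rule restrict_ext) simp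
  qed
  show "\<zero>\<^bsub>function_algebra M\<^esub> \<oplus>\<^bsub>function_algebra M\<^esub> f = f"
    unfolding function_algebra_simps by (rule restrict_continuous_functions_eq) (use f in auto)
qed (auto intro!: continuous_functions_closed const_in_continuous_functions restrict_ext simp: algebra_simps)

lemma module_function_algebra: "module complex_ring (function_algebra M)"
proof (rule moduleI)
  show "\<one>\<^bsub>complex_ring\<^esub> \<odot>\<^bsub>function_algebra M\<^esub> f = f" if "f \<in> carrier (function_algebra M)" for f
    unfolding function_algebra_simps by (rule restrict_continuous_functions_eq) (use that in auto)
qed (auto intro!: continuous_functions_closed restrict_ext
      simp: cring_complex_ring abelian_group_function_algebra algebra_simps)

lemma ring_function_algebra: "ring (function_algebra M)"
proof (rule ringI)
  show "monoid (function_algebra M)"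
  proof (rule monoidI)
    fix f assume f: "f \<in> carrier (function_algebra M)"
    show "\<one>\<^bsub>function_algebra M\<^esub> \<otimes>\<^bsub>function_algebra M\<^esub> f = f"
      unfolding function_algebra_simps by (rule restrict_continuous_functions_eq) (use f in auto)
    show "f \<otimes>\<^bsub>function_algebra M\<^esub> \<one>\<^bsub>function_algebra M\<^esub> = f"
      unfolding function_algebra_simps by (rule restrict_continuous_functions_eq) (use f in auto)
  qed (auto intro!: continuous_functions_closed const_in_continuous_functions restrict_ext simp: algebra_simps)
qed (auto intro!: restrict_ext simp: abelian_group_function_algebra algebra_simps)

lemma star_algebra_function_algebra: "star_algebra (function_algebra M)"
  unfolding star_algebra_def
proof (intro conjI ballI allI module_function_algebra ring_function_algebra)
  show "star (function_algebra M) \<in> carrier (function_algebra M) \<rightarrow> carrier (function_algebra M)"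
    by (auto simp: continuous_functions_closed)
  show "star (function_algebra M) (star (function_algebra M) f) = f"
    if "f \<in> carrier (function_algebra M)" for f
    unfolding function_algebra_simps by (rule restrict_continuous_functions_eq) (use that in auto)
qed (auto intro!: restrict_ext simp: algebra_simps)

lemma compactin_directed:
  "finite \<T> \<Longrightarrow> \<T> \<subseteq> {K. compactin M K} \<Longrightarrow> \<Union>\<T> \<in> {K. compactin M K}"
  by (auto intro: compactin_Union)

text \<open>Common to \<open>C(M)\<close> and to dual spaces: their zero vanishes on every set of
  \<open>\<S>\<close>, so distances from zero become absolute values.\<close>

lemma uniform_nbhd_zero_iff:
  assumes dir: "\<And>\<T>. finite \<T> \<Longrightarrow> \<T> \<subseteq> \<S> \<Longrightarrow> \<Union>\<T> \<in> \<S>"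
    and z: "z \<in> F" "\<And>S x. S \<in> \<S> \<Longrightarrow> x \<in> S \<Longrightarrow> z x = 0"
  shows "(\<exists>W. openin (uniform_topology \<S> F) W \<and> z \<in> W \<and> W \<subseteq> U) \<longleftrightarrow>
    (\<exists>S e. S \<in> \<S> \<and> e > 0 \<and> (\<forall>g\<in>F. (\<forall>x\<in>S. cmod (g x) < e) \<longrightarrow> g \<in> U))"
proof -
  have eq: "(\<forall>x\<in>S. dist (g x) (z x) < e) \<longleftrightarrow> (\<forall>x\<in>S. cmod (g x) < e)" if "S \<in> \<S>" for S g and e :: real
    using z(2)[OF that] by (intro ball_cong) auto
  have "(\<exists>S\<in>\<S>. \<exists>e>0. \<forall>g\<in>F. (\<forall>x\<in>S. dist (g x) (z x) < e) \<longrightarrow> g \<in> U) \<longleftrightarrow>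
     (\<exists>S\<in>\<S>. \<exists>e>0. \<forall>g\<in>F. (\<forall>x\<in>S. cmod (g x) < e) \<longrightarrow> g \<in> U)"
    by (rule bex_cong[OF refl]) (simp only: eq)
  moreover have "(\<exists>W. openin (uniform_topology \<S> F) W \<and> z \<in> W \<and> W \<subseteq> U) \<longleftrightarrow> z \<in> F \<and>
     (\<exists>S\<in>\<S>. \<exists>e>0. \<forall>g\<in>F. (\<forall>x\<in>S. dist (g x) (z x) < e) \<longrightarrow> g \<in> U)"
    by (rule uniform_nbhd_directed_iff) (rule dir)
  ultimately show ?thesis using z(1) by (simp add: Bex_def)
qed

lemma zero_nbhd_function_algebra:
  "zero_nbhd (function_algebra M) U \<longleftrightarrow> U \<subseteq> continuous_functions M \<and>
     (\<exists>K e. compactin M K \<and> e > 0 \<and> (\<forall>g\<in>continuous_functions M. (\<forall>t\<in>K. cmod (g t) < e) \<longrightarrow> g \<in> U))"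
proof -
  have "(\<exists>W. openin (uniform_topology {K. compactin M K} (continuous_functions M)) W
      \<and> (\<lambda>t\<in>topspace M. 0) \<in> W \<and> W \<subseteq> U) \<longleftrightarrow>
    (\<exists>S e. S \<in> {K. compactin M K} \<and> e > 0 \<and>
       (\<forall>g\<in>continuous_functions M. (\<forall>x\<in>S. cmod (g x) < e) \<longrightarrow> g \<in> U))"
    by (rule uniform_nbhd_zero_iff)
      (auto simp: const_in_continuous_functions compactin_Union subset_iff dest: compactin_subset_topspace)
  then show ?thesis
    unfolding zero_nbhd_def function_algebra_simps by simp
qed

lemma zero_nbhd_ball:
  assumes "compactin M K" "e > 0"
  shows "zero_nbhd (function_algebra M) {f\<in>continuous_functions M. \<forall>t\<in>K. cmod (f t) < e}"
  unfolding zero_nbhd_function_algebra using assms by blast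

lemma openin_function_ball:
  assumes K: "compactin M K" and f: "f \<in> continuous_functions M" and e: "e > 0"
  obtains N where "openin (topol (function_algebra M)) N" "f \<in> N"
    "\<And>g. g \<in> N \<Longrightarrow> g \<in> continuous_functions M" "\<And>g t. g \<in> N \<Longrightarrow> t \<in> K \<Longrightarrow> cmod (g t - f t) < e"
proof (rule that)
  let ?N = "{g\<in>continuous_functions M. \<exists>r<e. \<forall>t\<in>\<Union>{K}. dist (g t) (f t) \<le> r}"
  show "openin (topol (function_algebra M)) ?N"
    unfolding function_algebra_simps by (rule openin_uniform_ball) (use K in auto)
  show "f \<in> ?N" using f e by (auto intro!: exI[of _ 0])
  show "cmod (g t - f t) < e" if "g \<in> ?N" "t \<in> K" for g t
    using that by (auto simp: dist_norm intro: le_less_trans)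
qed auto

lemma lcs_function_algebra: "locally_convex_space (function_algebra M)"
  unfolding locally_convex_space_def
proof (intro conjI module_function_algebra allI impI)
  let ?C = "function_algebra M"
  let ?T = "uniform_topology {K. compactin M K} (continuous_functions M)"
  show "topspace (topol ?C) = carrier ?C" by simp
  show "Hausdorff_space (topol ?C)"
    unfolding function_algebra_simps
    by (rule Hausdorff_uniform_topology[of _ "topspace M"]) (auto dest: continuous_functionsD)
  show "continuous_map (prod_topology (topol ?C) (topol ?C)) (topol ?C) (\<lambda>(x, y). x \<oplus>\<^bsub>?C\<^esub> y)"
    unfolding function_algebra_simps(7) continuous_map_into_uniform
  proof (intro conjI ballI allI impI)
    fix x K and e :: real
    assume x: "x \<in> topspace (prod_topology ?T ?T)" and K: "K \<in> {K. compactin M K}" and e: "e > 0"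
    obtain f g where fg: "x = (f, g)" "f \<in> continuous_functions M" "g \<in> continuous_functions M"
      using x by (cases x) auto
    have KM: "K \<subseteq> topspace M" using K by (auto dest: compactin_subset_topspace)
    have e2: "e/2 > 0" using e by simp
    from K have K': "compactin M K" by simp
    obtain N1 where N1: "openin (topol ?C) N1" "f \<in> N1" "\<And>h. h \<in> N1 \<Longrightarrow> h \<in> continuous_functions M"
      "\<And>h t. h \<in> N1 \<Longrightarrow> t \<in> K \<Longrightarrow> cmod (h t - f t) < e/2"
      using openin_function_ball[OF K' fg(2) e2] by metis
    obtain N2 where N2: "openin (topol ?C) N2" "g \<in> N2" "\<And>h. h \<in> N2 \<Longrightarrow> h \<in> continuous_functions M"
      "\<And>h t. h \<in> N2 \<Longrightarrow> t \<in> K \<Longrightarrow> cmod (h t - g t) < e/2"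
      using openin_function_ball[OF K' fg(3) e2] by metis
    have "dist ((case y of (x, y) \<Rightarrow> x \<oplus>\<^bsub>?C\<^esub> y) t) ((case x of (x, y) \<Rightarrow> x \<oplus>\<^bsub>?C\<^esub> y) t) < e"
      if y: "y \<in> N1 \<times> N2" and t: "t \<in> K" for y t
    proof -
      obtain f' g' where y': "y = (f', g')" "f' \<in> N1" "g' \<in> N2" using y by auto
      have "cmod ((f' t + g' t) - (f t + g t)) = cmod ((f' t - f t) + (g' t - g t))" by (simp add: algebra_simps)
      also have "\<dots> \<le> cmod (f' t - f t) + cmod (g' t - g t)" by (rule norm_triangle_ineq)
      also have "\<dots> < e/2 + e/2" using N1(4)[OF y'(2) t] N2(4)[OF y'(3) t] by (rule add_strict_mono)
      finally show ?thesis using t KM by (auto simp: y' fg dist_norm)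
    qed
    then show "\<exists>N. openin (prod_topology ?T ?T) N \<and> x \<in> N \<and>
       (\<forall>y\<in>N. \<forall>s\<in>K. dist ((case y of (x, y) \<Rightarrow> x \<oplus>\<^bsub>?C\<^esub> y) s) ((case x of (x, y) \<Rightarrow> x \<oplus>\<^bsub>?C\<^esub> y) s) < e)"
      using N1(1,2) N2(1,2) fg(1) by (intro exI[of _ "N1 \<times> N2"]) (simp add: openin_prod_Times_iff)
  qed (auto simp: continuous_functions_closed)
  show "continuous_map (prod_topology euclidean (topol ?C)) (topol ?C) (\<lambda>(c, x). c \<odot>\<^bsub>?C\<^esub> x)"
    unfolding function_algebra_simps(7) continuous_map_into_uniform
  proof (intro conjI ballI allI impI)
    fix x :: "complex \<times> ('a \<Rightarrow> complex)" and K and e :: real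
    assume x: "x \<in> topspace (prod_topology euclidean ?T)" and K: "K \<in> {K. compactin M K}" and e: "e > 0"
    obtain c f where fg: "x = (c, f)" "f \<in> continuous_functions M"
      using x by (cases x) auto
    have KM: "K \<subseteq> topspace M" using K by (auto dest: compactin_subset_topspace)
    from K have K': "compactin M K" by simp
    obtain B where B: "B > 0" "\<And>t. t \<in> K \<Longrightarrow> cmod (f t) \<le> B"
      using continuous_functions_bounded[OF fg(2) K'] by metis
    \<comment> \<open>In \<open>b g - c f = b (g - f) + (b - c) f\<close> the scalar may move by
      \<open>d\<close> and the function by \<open>\<eta>\<close>. The bound \<open>d \<le> 1\<close>
      keeps \<open>cmod b\<close> below \<open>C\<close>, and each summand receives half of
      \<open>e\<close>.\<close>
    define d where "d = min 1 (e / (2 * B))"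
    have d: "d > 0" "d \<le> 1" "d * B \<le> e/2"
    proof -
      show "d > 0" "d \<le> 1" using e B by (auto simp: d_def)
      have "d * B \<le> e / (2 * B) * B" using B by (intro mult_right_mono) (auto simp: d_def)
      then show "d * B \<le> e/2" using B by simp
    qed
    define C where "C = cmod c + 1"
    define \<eta> where "\<eta> = e / (2 * C)"
    have c1: "C > 0" using norm_ge_zero[of c] unfolding C_def by linarith
    have eta: "\<eta> > 0" "C * \<eta> = e/2" using e c1 by (auto simp: \<eta>_def)
    obtain N2 where N2: "openin (topol ?C) N2" "f \<in> N2" "\<And>h. h \<in> N2 \<Longrightarrow> h \<in> continuous_functions M"
      "\<And>h t. h \<in> N2 \<Longrightarrow> t \<in> K \<Longrightarrow> cmod (h t - f t) < \<eta>"
      using openin_function_ball[OF K' fg(2) eta(1)] by metis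
    have "dist ((case y of (c, x) \<Rightarrow> c \<odot>\<^bsub>?C\<^esub> x) t) ((case x of (c, x) \<Rightarrow> c \<odot>\<^bsub>?C\<^esub> x) t) < e"
      if y: "y \<in> ball c d \<times> N2" and t: "t \<in> K" for y t
    proof -
      obtain b g where y': "y = (b, g)" "b \<in> ball c d" "g \<in> N2" using y by auto
      have bc: "cmod (b - c) < d" using y'(2) by (simp add: dist_norm norm_minus_commute)
      have "cmod b \<le> C" using bc d(2) norm_triangle_ineq2[of b c] unfolding C_def by linarith
      have "cmod (b * g t - c * f t) = cmod (b * (g t - f t) + (b - c) * f t)" by (simp add: algebra_simps)
      also have "\<dots> \<le> cmod b * cmod (g t - f t) + cmod (b - c) * cmod (f t)"
        using norm_triangle_ineq[of "b * (g t - f t)" "(b - c) * f t"] by (simp add: norm_mult)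
      also have "\<dots> < e/2 + e/2"
      proof (rule add_less_le_mono)
        have "cmod b * cmod (g t - f t) \<le> C * cmod (g t - f t)"
          using \<open>cmod b \<le> C\<close> by (rule mult_right_mono) simp
        also have "\<dots> < C * \<eta>" using N2(4)[OF y'(3) t] c1 by simp
        finally show "cmod b * cmod (g t - f t) < e/2" using eta by simp
        have "cmod (b - c) * cmod (f t) \<le> d * B" using bc B(2)[OF t] d by (intro mult_mono) auto
        then show "cmod (b - c) * cmod (f t) \<le> e/2" using d by simp
      qed
      finally show ?thesis using t KM by (auto simp: y' fg dist_norm)
    qed
    then show "\<exists>N. openin (prod_topology euclidean ?T) N \<and> x \<in> N \<and>
       (\<forall>y\<in>N. \<forall>s\<in>K. dist ((case y of (c, x) \<Rightarrow> c \<odot>\<^bsub>?C\<^esub> x) s) ((case x of (c, x) \<Rightarrow> c \<odot>\<^bsub>?C\<^esub> x) s) < e)"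
      using N2(1,2) fg(1) d(1) by (intro exI[of _ "ball c d \<times> N2"]) (simp add: openin_prod_Times_iff)
  qed (auto simp: continuous_functions_closed)
  fix U assume U: "zero_nbhd ?C U"
  then obtain K e where K: "compactin M K" "e > 0" "\<And>g. g\<in>continuous_functions M \<Longrightarrow> (\<forall>t\<in>K. cmod (g t) < e) \<Longrightarrow> g \<in> U"
    unfolding zero_nbhd_function_algebra by blast
  let ?V = "{f\<in>continuous_functions M. \<forall>t\<in>K. cmod (f t) < e}"
  have KM: "K \<subseteq> topspace M" using K by (auto dest: compactin_subset_topspace)
  have "convex_in ?C ?V"
    unfolding convex_in_def
  proof (intro ballI)
    fix x y and t :: real assume xy: "x \<in> ?V" "y \<in> ?V" and t: "t \<in> {0..1}"
    let ?z = "of_real (1 - t) \<odot>\<^bsub>?C\<^esub> x \<oplus>\<^bsub>?C\<^esub> of_real t \<odot>\<^bsub>?C\<^esub> y"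
    have "?z \<in> continuous_functions M"
      unfolding function_algebra_simps
      by (intro continuous_functions_add continuous_functions_smult) (use xy in auto)
    moreover have "cmod (?z s) < e" if s: "s \<in> K" for s
    proof -
      have "?z s = complex_of_real (1 - t) * x s + complex_of_real t * y s" using s KM by auto
      then have "cmod (?z s) \<le> (1 - t) * cmod (x s) + t * cmod (y s)"
        using norm_triangle_ineq[of "complex_of_real (1 - t) * x s" "complex_of_real t * y s"] t
        by (simp only: norm_mult norm_of_real) simp
      also have "\<dots> < e" by (rule convex_bound_lt) (use xy t s in auto)
      finally show ?thesis .
    qed
    ultimately show "?z \<in> ?V" by blast
  qed
  then show "\<exists>V. zero_nbhd ?C V \<and> convex_in ?C V \<and> V \<subseteq> U"
    using zero_nbhd_ball[OF K(1,2)] K(3) by blast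
qed

text \<open>The sets \<open>?O n\<close> of functions with supremum over \<open>K\<close> below
  \<open>n\<close> are open and cover the algebra, so a compact set lies in finitely many of them.
  The resulting bound is what continuity of multiplication on compact sets requires.\<close>

lemma compactin_function_algebra_bounded:
  assumes S: "compactin (topol (function_algebra M)) S" and K: "compactin M K"
  obtains B where "B > 0" "\<And>f t. f \<in> S \<Longrightarrow> t \<in> K \<Longrightarrow> cmod (f t) \<le> B"
proof -
  let ?O = "\<lambda>n::nat. {g\<in>continuous_functions M. \<exists>r<real n. \<forall>t\<in>\<Union>{K}. dist (g t) 0 \<le> r}"
  have op: "openin (topol (function_algebra M)) U" if "U \<in> range ?O" for U
  proof -
    from that obtain n where U: "U = ?O n" by blast
    show ?thesis unfolding U function_algebra_simps
      by (rule openin_uniform_ball[of "{K}" _ _ _ "\<lambda>_. 0"]) (use K in auto)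
  qed
  have "S \<subseteq> \<Union>(range ?O)"
  proof
    fix f assume "f \<in> S"
    then have f: "f \<in> continuous_functions M" using compactin_subset_topspace[OF S] by auto
    obtain B where B: "B > 0" "\<And>t. t \<in> K \<Longrightarrow> cmod (f t) \<le> B" using continuous_functions_bounded[OF f K] by metis
    obtain n where "B < real n" using reals_Archimedean2 by blast
    then have "f \<in> ?O n" using f B by auto
    then show "f \<in> \<Union>(range ?O)" by blast
  qed
  from compactinD[OF S op this] obtain \<F> where F: "finite \<F>" "\<F> \<subseteq> range ?O" "S \<subseteq> \<Union>\<F>" by meson
  from F(1,2) obtain I where I: "finite I" "\<F> = ?O ` I" by (meson finite_subset_image)
  show thesis
  proof (rule that[of "real (Max (insert 1 I))"])
    \<comment> \<open>Inserting \<open>1\<close> makes the maximum meaningful for empty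
      \<open>I\<close> and positive in every case.\<close>
    show "0 < real (Max (insert 1 I))" using I by (simp add: Max_gr_iff)
    fix f t assume "f \<in> S" "t \<in> K"
    then obtain n where n: "n \<in> I" "f \<in> ?O n" using F(3) I(2) by blast
    then obtain r where d: "r < real n" "\<forall>t\<in>\<Union>{K}. dist (f t) 0 \<le> r" by blast
    then have "cmod (f t) \<le> real n" using \<open>t \<in> K\<close> by (force simp: dist_norm)
    also have "\<dots> \<le> real (Max (insert 1 I))" using n I by simp
    finally show "cmod (f t) \<le> real (Max (insert 1 I))" .
  qed
qed

lemma function_algebra_mult_continuous:
  assumes S: "compactin (topol (function_algebra M)) S" and U: "zero_nbhd (function_algebra M) U"
  shows "\<exists>V. zero_nbhd (function_algebra M) V \<and> S <#>\<^bsub>function_algebra M\<^esub> V \<subseteq> U \<and> V <#>\<^bsub>function_algebra M\<^esub> S \<subseteq> U"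
proof -
  from U obtain K e where K: "compactin M K" "e > 0" "\<And>g. g\<in>continuous_functions M \<Longrightarrow> (\<forall>t\<in>K. cmod (g t) < e) \<Longrightarrow> g \<in> U"
    unfolding zero_nbhd_function_algebra by blast
  have KM: "K \<subseteq> topspace M" using K by (auto dest: compactin_subset_topspace)
  obtain B where B: "B > 0" "\<And>f t. f \<in> S \<Longrightarrow> t \<in> K \<Longrightarrow> cmod (f t) \<le> B"
    using compactin_function_algebra_bounded[OF S K(1)] by metis
  let ?V = "{f\<in>continuous_functions M. \<forall>t\<in>K. cmod (f t) < e / B}"
  have SC: "S \<subseteq> continuous_functions M" using compactin_subset_topspace[OF S] by simp
  have *: "f \<otimes>\<^bsub>function_algebra M\<^esub> g \<in> U" "g \<otimes>\<^bsub>function_algebra M\<^esub> f \<in> U" if f: "f \<in> S" and g: "g \<in> ?V" for f g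
  proof -
    have fC: "f \<in> continuous_functions M" using f SC by blast
    have b: "cmod (f t) * cmod (g t) < e" if t: "t \<in> K" for t
    proof -
      have "cmod (f t) * cmod (g t) \<le> B * cmod (g t)" using B(2)[OF f t] by (rule mult_right_mono) simp
      also have "\<dots> < B * (e / B)" using g t B(1) by (intro mult_strict_left_mono) auto
      finally show ?thesis using B(1) by simp
    qed
    show "f \<otimes>\<^bsub>function_algebra M\<^esub> g \<in> U"
      by (rule K(3)) (use b fC g KM continuous_functions_mult[of f M g] in \<open>auto simp: norm_mult subset_iff\<close>)
    show "g \<otimes>\<^bsub>function_algebra M\<^esub> f \<in> U"
      by (rule K(3)) (use b fC g KM continuous_functions_mult[of g M f] in \<open>auto simp: norm_mult subset_iff mult.commute\<close>)
  qed
  show ?thesis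
  proof (intro exI conjI)
    show "zero_nbhd (function_algebra M) ?V" using zero_nbhd_ball[OF K(1)] K(2) B(1) by simp
    show "S <#>\<^bsub>function_algebra M\<^esub> ?V \<subseteq> U"
      unfolding set_mult_def by (intro UN_least) (use *(1) in blast)
    show "?V <#>\<^bsub>function_algebra M\<^esub> S \<subseteq> U"
      unfolding set_mult_def by (intro UN_least) (use *(2) in blast)
  qed
qed

lemma function_algebra_star_continuous:
  "continuous_map (topol (function_algebra M)) (topol (function_algebra M)) (star (function_algebra M))"
  unfolding function_algebra_simps(7) continuous_map_into_uniform
proof (intro conjI ballI allI impI)
  fix f K and e :: real
  assume f: "f \<in> topspace (uniform_topology {K. compactin M K} (continuous_functions M))"
    and K: "K \<in> {K. compactin M K}" and e: "e > 0"
  have KM: "K \<subseteq> topspace M" using K by (auto dest: compactin_subset_topspace)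
  from f K have fC: "f \<in> continuous_functions M" and K': "compactin M K" by simp_all
  obtain N where N: "openin (topol (function_algebra M)) N" "f \<in> N" "\<And>h. h \<in> N \<Longrightarrow> h \<in> continuous_functions M"
      "\<And>h t. h \<in> N \<Longrightarrow> t \<in> K \<Longrightarrow> cmod (h t - f t) < e"
    using openin_function_ball[OF K' fC e] by metis
  have "dist (cnj a) (cnj b) = cmod (a - b)" for a b
    by (metis complex_cnj_diff complex_mod_cnj dist_norm)
  then show "\<exists>N. openin (uniform_topology {K. compactin M K} (continuous_functions M)) N \<and> f \<in> N \<and>
       (\<forall>g\<in>N. \<forall>s\<in>K. dist (star (function_algebra M) g s) (star (function_algebra M) f s) < e)"
    using N KM by (intro exI[of _ N]) (auto simp: subset_iff)
qed (auto simp: continuous_functions_closed)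

subsection \<open>Continuous functionals on \<open>C(M)\<close>\<close>

lemma dual_space_simps [simp]:
  "carrier (dual_space X) = continuous_functionals X"
  "zero (dual_space X) = (\<lambda>x\<in>carrier X. 0)"
  "add (dual_space X) = (\<lambda>f g. \<lambda>x\<in>carrier X. f x + g x)"
  "smult (dual_space X) = (\<lambda>c f. \<lambda>x\<in>carrier X. c * f x)"
  "topol (dual_space X) = uniform_topology {S. totally_bounded_in X S} (continuous_functionals X)"
  by (simp_all add: dual_space_def)

lemma continuous_functionalsD:
  assumes "f \<in> continuous_functionals X"
  shows "f \<in> extensional (carrier X)" "continuous_map (topol X) euclidean f"
    "x \<in> carrier X \<Longrightarrow> y \<in> carrier X \<Longrightarrow> f (x \<oplus>\<^bsub>X\<^esub> y) = f x + f y"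
    "x \<in> carrier X \<Longrightarrow> f (c \<odot>\<^bsub>X\<^esub> x) = c * f x"
  using assms by (simp_all add: continuous_functionals_def)

lemma functional_zero_nbhd:
  assumes f: "f \<in> continuous_functionals X" and top: "topspace (topol X) = carrier X"
    and zero: "\<zero>\<^bsub>X\<^esub> \<in> carrier X" "f \<zero>\<^bsub>X\<^esub> = 0" and e: "e > 0"
  shows "zero_nbhd X {x\<in>carrier X. cmod (f x) < e}"
proof -
  have "openin (topol X) {x\<in>topspace (topol X). f x \<in> ball 0 e}"
    by (rule openin_continuous_map_preimage[OF continuous_functionalsD(2)[OF f]]) simp
  then show ?thesis using zero e unfolding zero_nbhd_def top
    by (intro conjI exI[of _ "{x\<in>carrier X. f x \<in> ball 0 e}"]) auto
qed

context complex_lcs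
begin

lemma functional_zero: "f \<in> continuous_functionals X \<Longrightarrow> f \<zero> = 0"
  using continuous_functionalsD(4)[of f X \<zero> 0] by simp

lemma functional_minus:
  assumes f: "f \<in> continuous_functionals X" and x: "x \<in> carrier X" shows "f (\<ominus> x) = - f x"
  using continuous_functionalsD(4)[OF f x, of "-1"] x by (simp add: smult_minus_one)

lemma functional_diff:
  assumes f: "f \<in> continuous_functionals X" and x: "x \<in> carrier X" "y \<in> carrier X"
  shows "f (x \<ominus> y) = f x - f y"
  using x by (simp add: a_minus_def continuous_functionalsD(3)[OF f] functional_minus[OF f])

lemma functional_ball_zero_nbhd:
  "f \<in> continuous_functionals X \<Longrightarrow> e > 0 \<Longrightarrow> zero_nbhd X {x\<in>carrier X. cmod (f x) < e}"
  by (rule functional_zero_nbhd) (auto simp: functional_zero)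

lemma continuous_functionals_closed:
  assumes "f \<in> continuous_functionals X" "g \<in> continuous_functionals X"
  shows "(\<lambda>x\<in>carrier X. f x + g x) \<in> continuous_functionals X"
    and "(\<lambda>x\<in>carrier X. c * f x) \<in> continuous_functionals X"
proof -
  note D = continuous_functionalsD[OF assms(1)] continuous_functionalsD[OF assms(2)]
  have "continuous_map (topol X) euclidean (\<lambda>x\<in>carrier X. f x + g x)"
    by (rule continuous_map_eq[OF continuous_map_add[OF D(2) D(6)]]) simp
  then show "(\<lambda>x\<in>carrier X. f x + g x) \<in> continuous_functionals X"
    unfolding continuous_functionals_def by (simp add: D algebra_simps)
  have "continuous_map (topol X) euclidean (\<lambda>x. c * f x)"
    by (rule continuous_map_complex_mult[OF _ D(2)]) simp
  then have "continuous_map (topol X) euclidean (\<lambda>x\<in>carrier X. c * f x)"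
    by (rule continuous_map_eq) simp
  then show "(\<lambda>x\<in>carrier X. c * f x) \<in> continuous_functionals X"
    unfolding continuous_functionals_def by (simp add: D algebra_simps)
qed

lemma zero_in_continuous_functionals: "(\<lambda>x\<in>carrier X. 0) \<in> continuous_functionals X"
proof -
  have "continuous_map (topol X) euclidean (\<lambda>x\<in>carrier X. 0)"
    by (rule continuous_map_eq[of _ _ "\<lambda>_. 0"]) auto
  then show ?thesis by (simp add: continuous_functionals_def)
qed

lemma sum_in_continuous_functionals:
  assumes "finite J" "\<And>j. j \<in> J \<Longrightarrow> f j \<in> continuous_functionals X"
  shows "(\<lambda>x\<in>carrier X. \<Sum>j\<in>J. c j * f j x) \<in> continuous_functionals X"
  using assms
proof (induction J rule: finite_induct)
  case empty
  show ?case unfolding sum.empty by (rule zero_in_continuous_functionals)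
next
  case (insert i J)
  have "(\<lambda>x\<in>carrier X. (\<lambda>x\<in>carrier X. c i * f i x) x + (\<lambda>x\<in>carrier X. \<Sum>j\<in>J. c j * f j x) x) \<in> continuous_functionals X"
    using insert by (intro continuous_functionals_closed(1) continuous_functionals_closed(2)[of "f i" "f i"]) auto
  moreover have "(\<lambda>x\<in>carrier X. (\<lambda>x\<in>carrier X. c i * f i x) x + (\<lambda>x\<in>carrier X. \<Sum>j\<in>J. c j * f j x) x)
     = (\<lambda>x\<in>carrier X. \<Sum>j\<in>insert i J. c j * f j x)"
    using insert by (intro restrict_ext) simp
  ultimately show ?case by (simp only:)
qed

text \<open>Linearity is applied later to finite combinations of point evaluations, where it
  expresses the value of \<open>F\<close> through its values at the evaluations.\<close>

lemma bidual_functional_sum: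
  assumes F: "F \<in> continuous_functionals (dual_space X)"
    and J: "finite J" "\<And>j. j \<in> J \<Longrightarrow> f j \<in> continuous_functionals X"
  shows "F (\<lambda>x\<in>carrier X. \<Sum>j\<in>J. c j * f j x) = (\<Sum>j\<in>J. c j * F (f j))"
  using J
proof (induction J rule: finite_induct)
  case empty
  have "F (0 \<odot>\<^bsub>dual_space X\<^esub> (\<lambda>x\<in>carrier X. 0)) = 0"
    by (subst continuous_functionalsD(4)[OF F]) (auto simp: zero_in_continuous_functionals)
  moreover have "0 \<odot>\<^bsub>dual_space X\<^esub> (\<lambda>x\<in>carrier X. 0) = (\<lambda>x\<in>carrier X. 0)"
    by (auto simp: restrict_def)
  ultimately show ?case by (simp only: sum.empty)
next
  case (insert i J)
  let ?f = "\<lambda>x\<in>carrier X. c i * f i x" and ?g = "\<lambda>x\<in>carrier X. \<Sum>j\<in>J. c j * f j x"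
  have fi: "f i \<in> continuous_functionals X" using insert by simp
  have f: "?f \<in> carrier (dual_space X)" using continuous_functionals_closed(2)[OF fi fi] by simp
  have "?g \<in> continuous_functionals X"
    by (rule sum_in_continuous_functionals) (use insert in auto)
  then have g: "?g \<in> carrier (dual_space X)" unfolding dual_space_simps .
  have "(\<lambda>x\<in>carrier X. \<Sum>j\<in>insert i J. c j * f j x) = ?f \<oplus>\<^bsub>dual_space X\<^esub> ?g"
    using insert by (auto simp: restrict_def)
  then have "F (\<lambda>x\<in>carrier X. \<Sum>j\<in>insert i J. c j * f j x) = F ?f + F ?g"
    using continuous_functionalsD(3)[OF F f g] by simp
  also have "F ?f = c i * F (f i)"
    using continuous_functionalsD(4)[OF F, of "f i" "c i"] fi by simp
  also have "F ?g = (\<Sum>j\<in>J. c j * F (f j))" by (rule insert.IH) (use insert.prems in simp)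
  finally show ?case using insert by simp
qed

lemma zero_nbhd_dual_space:
  "zero_nbhd (dual_space X) U \<longleftrightarrow> U \<subseteq> continuous_functionals X \<and>
     (\<exists>S e. totally_bounded_in X S \<and> e > 0 \<and> (\<forall>g\<in>continuous_functionals X. (\<forall>x\<in>S. cmod (g x) < e) \<longrightarrow> g \<in> U))"
proof -
  have "(\<exists>W. openin (uniform_topology {S. totally_bounded_in X S} (continuous_functionals X)) W
      \<and> (\<lambda>x\<in>carrier X. 0) \<in> W \<and> W \<subseteq> U) \<longleftrightarrow>
    (\<exists>S e. S \<in> {S. totally_bounded_in X S} \<and> e > 0 \<and>
       (\<forall>g\<in>continuous_functionals X. (\<forall>x\<in>S. cmod (g x) < e) \<longrightarrow> g \<in> U))"
  proof (rule uniform_nbhd_zero_iff)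
    fix S x assume "S \<in> {S. totally_bounded_in X S}" "x \<in> S"
    then show "(\<lambda>x\<in>carrier X. 0) x = 0" by (auto simp: totally_bounded_in_def)
  qed (simp_all add: totally_bounded_Union zero_in_continuous_functionals)
  then show ?thesis
    unfolding zero_nbhd_def dual_space_simps by simp
qed

text \<open>The difference of a functional and its approximant is the required element of the
  neighbourhood of zero. Total boundedness in the dual thus reduces to approximation by finitely
  many functionals, uniformly on each totally bounded set.\<close>

lemma totally_bounded_dualI:
  assumes T: "T \<subseteq> continuous_functionals X"
    and near: "\<And>S e. totally_bounded_in X S \<Longrightarrow> e > 0 \<Longrightarrow>
      \<exists>F. finite F \<and> F \<subseteq> continuous_functionals X \<and> (\<forall>f\<in>T. \<exists>g\<in>F. \<forall>x\<in>S. cmod (f x - g x) < e)"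
  shows "totally_bounded_in (dual_space X) T"
  unfolding totally_bounded_in_def
proof (intro conjI allI impI)
  show "T \<subseteq> carrier (dual_space X)" using T by simp
  fix U assume "zero_nbhd (dual_space X) U"
  then obtain S e where S: "totally_bounded_in X S" "e > 0"
    "\<And>g. g\<in>continuous_functionals X \<Longrightarrow> (\<forall>x\<in>S. cmod (g x) < e) \<Longrightarrow> g \<in> U"
    unfolding zero_nbhd_dual_space by blast
  obtain F where F: "finite F" "F \<subseteq> continuous_functionals X" "\<forall>f\<in>T. \<exists>g\<in>F. \<forall>x\<in>S. cmod (f x - g x) < e"
    using near[OF S(1,2)] by blast
  have "T \<subseteq> F <+>\<^bsub>dual_space X\<^esub> U"
  proof
    fix f assume f: "f \<in> T"
    then obtain g where g: "g \<in> F" "\<forall>x\<in>S. cmod (f x - g x) < e" using F(3) by blast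
    have fX: "f \<in> continuous_functionals X" and gX: "g \<in> continuous_functionals X" using f g T F by auto
    let ?h = "\<lambda>x\<in>carrier X. f x + (\<lambda>x\<in>carrier X. (-1) * g x) x"
    have h: "?h \<in> continuous_functionals X"
      by (intro continuous_functionals_closed(1) continuous_functionals_closed(2)[OF gX gX] fX)
    have "?h \<in> U" using h
    proof (rule S(3))
      show "\<forall>x\<in>S. cmod (?h x) < e" using g S(1) by (auto simp: totally_bounded_in_def subset_iff)
    qed
    moreover have "f = g \<oplus>\<^bsub>dual_space X\<^esub> ?h"
      using continuous_functionalsD(1)[OF fX] by (intro extensionalityI[of _ "carrier X"]) auto
    ultimately show "f \<in> F <+>\<^bsub>dual_space X\<^esub> U" unfolding mem_set_add_iff using g(1) by blast
  qed
  then show "\<exists>F. finite F \<and> F \<subseteq> carrier (dual_space X) \<and> T \<subseteq> F <+>\<^bsub>dual_space X\<^esub> U"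
    using F by auto
qed

text \<open>A finite net for the neighbourhood given by the point \<open>x\<close> bounds all the
  values at \<open>x\<close>. Pointwise boundedness is what the equicontinuity argument for
  \<open>C(M)\<close> starts from.\<close>

lemma totally_bounded_dual_pointwise:
  assumes T: "totally_bounded_in (dual_space X) T" and x: "x \<in> carrier X"
  obtains B where "\<And>f. f \<in> T \<Longrightarrow> cmod (f x) \<le> B"
proof -
  let ?U = "{f\<in>continuous_functionals X. cmod (f x) < 1}"
  have "zero_nbhd (dual_space X) ?U"
    unfolding zero_nbhd_dual_space using totally_bounded_singleton[OF x]
    by (intro conjI exI[of _ "{x}"] exI[of _ "1::real"]) auto
  with T[unfolded totally_bounded_in_def, THEN conjunct2, rule_format]
  have "\<exists>F. finite F \<and> F \<subseteq> carrier (dual_space X) \<and> T \<subseteq> F <+>\<^bsub>dual_space X\<^esub> ?U" .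
  then obtain F where F: "finite F" "F \<subseteq> continuous_functionals X" "T \<subseteq> F <+>\<^bsub>dual_space X\<^esub> ?U"
    unfolding dual_space_simps by (elim exE conjE)
  show thesis
  proof (rule that)
    fix f assume "f \<in> T"
    then have "f \<in> F <+>\<^bsub>dual_space X\<^esub> ?U" using F(3) by blast
    then obtain g u where gu: "g \<in> F" "u \<in> ?U" "f = g \<oplus>\<^bsub>dual_space X\<^esub> u" unfolding mem_set_add_iff by blast
    have "cmod (f x) \<le> cmod (g x) + cmod (u x)" using gu x norm_triangle_ineq by simp
    also have "cmod (g x) \<le> (\<Sum>g\<in>F. cmod (g x))" using gu F by (intro member_le_sum) auto
    also have "cmod (u x) \<le> 1" using gu by simp
    finally show "cmod (f x) \<le> (\<Sum>g\<in>F. cmod (g x)) + 1" by simp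
  qed
qed

lemma evaluation_in_bidual:
  assumes x: "x \<in> carrier X"
  shows "(\<lambda>f\<in>carrier (dual_space X). f x) \<in> continuous_functionals (dual_space X)"
proof -
  have "continuous_map (topol (dual_space X)) euclidean (\<lambda>f. f x)"
    unfolding dual_space_simps by (rule continuous_map_eval_uniform) (simp add: totally_bounded_singleton x)
  then have "continuous_map (topol (dual_space X)) euclidean (\<lambda>f\<in>carrier (dual_space X). f x)"
    by (rule continuous_map_eq) simp
  then show ?thesis using x unfolding continuous_functionals_def[of "dual_space X"]
    by (simp add: continuous_functionals_closed)
qed

lemma linear_evaluation:
  "linear_on X (dual_space (dual_space X)) (\<lambda>x\<in>carrier X. \<lambda>f\<in>carrier (dual_space X). f x)"
  (is "linear_on X (dual_space ?D) ?i")
  unfolding linear_on_def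
proof (intro conjI ballI allI)
  show "?i \<in> carrier X \<rightarrow> carrier (dual_space ?D)" using evaluation_in_bidual by simp
  fix x assume x: "x \<in> carrier X"
  show "?i (c \<odot> x) = c \<odot>\<^bsub>dual_space ?D\<^esub> ?i x" for c
    using x by (auto simp: restrict_def continuous_functionalsD(4))
  fix y assume y: "y \<in> carrier X"
  show "?i (x \<oplus> y) = ?i x \<oplus>\<^bsub>dual_space ?D\<^esub> ?i y"
    using x y by (auto simp: restrict_def continuous_functionalsD(3))
qed

text \<open>The evaluation map is bijective by \<open>inj\<close> and \<open>surj\<close>. By
  linearity its continuity and openness can be tested at zero: \<open>cont\<close> is equicontinuity
  of the totally bounded sets of functionals, and \<open>opn\<close> says that every neighbourhood
  of zero contains a multiple of the polar of such a set.\<close>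

lemma stereotypeI:
  assumes inj: "\<And>x y. x \<in> carrier X \<Longrightarrow> y \<in> carrier X \<Longrightarrow> \<forall>f\<in>continuous_functionals X. f x = f y \<Longrightarrow> x = y"
    and surj: "\<And>F. F \<in> continuous_functionals (dual_space X) \<Longrightarrow>
       \<exists>x\<in>carrier X. \<forall>f\<in>continuous_functionals X. F f = f x"
    and cont: "\<And>T. totally_bounded_in (dual_space X) T \<Longrightarrow> \<exists>U. zero_nbhd X U \<and> (\<forall>x\<in>U. \<forall>f\<in>T. cmod (f x) < 1)"
    and opn: "\<And>U. zero_nbhd X U \<Longrightarrow>
       \<exists>T e. totally_bounded_in (dual_space X) T \<and> e > 0 \<and> (\<forall>x\<in>carrier X. (\<forall>f\<in>T. cmod (f x) < e) \<longrightarrow> x \<in> U)"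
  shows "stereotype X"
  unfolding stereotype_def lcs_isomorphism_def
proof (intro conjI lcs)
  let ?D = "dual_space X" and ?i = "\<lambda>x\<in>carrier X. \<lambda>f\<in>carrier (dual_space X). f x"
  show "linear_on X (dual_space ?D) ?i" by (rule linear_evaluation)
  show "homeomorphic_map (topol X) (topol (dual_space ?D)) ?i"
  proof (rule bijective_open_imp_homeomorphic_map)
    show "continuous_map (topol X) (topol (dual_space ?D)) ?i"
      unfolding dual_space_simps(5)[of ?D] continuous_map_into_uniform
    proof (intro conjI ballI allI impI)
      show "?i \<in> topspace (topol X) \<rightarrow> continuous_functionals ?D" using evaluation_in_bidual by simp
      fix x T and e :: real assume x': "x \<in> topspace (topol X)" and T: "T \<in> {T. totally_bounded_in ?D T}" and e: "e > 0"
      then have x: "x \<in> carrier X" by simp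
      obtain U where U: "zero_nbhd X U" "\<forall>x\<in>U. \<forall>f\<in>T. cmod (f x) < 1" using cont T by blast
      have TX: "T \<subseteq> continuous_functionals X" using T by (simp add: totally_bounded_in_def)
      \<comment> \<open>Rescaling replaces the constant \<open>1\<close> in \<open>cont\<close> by
        \<open>e\<close>.\<close>
      define c where "c = complex_of_real (inverse e)"
      have V: "zero_nbhd X {x\<in>carrier X. c \<odot> x \<in> U}" using U(1) by (rule zero_nbhd_smult)
      obtain N where N: "openin (topol X) N" "x \<in> N" "\<And>y. y \<in> N \<Longrightarrow> y \<ominus> x \<in> {x\<in>carrier X. c \<odot> x \<in> U}"
        using zero_nbhd_translate[OF V x] by blast
      have "dist (?i y f) (?i x f) < e" if y: "y \<in> N" and f: "f \<in> T" for y f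
      proof -
        have yX: "y \<in> carrier X" using y openin_subset[OF N(1)] by auto
        have fX: "f \<in> continuous_functionals X" using f TX by blast
        have "cmod (f (c \<odot> (y \<ominus> x))) < 1" using U(2) N(3)[OF y] f by blast
        then have "cmod (c * (f y - f x)) < 1"
          using x yX by (simp add: continuous_functionalsD(4)[OF fX] functional_diff[OF fX])
        moreover have "cmod (c * (f y - f x)) = inverse e * cmod (f y - f x)"
          using e unfolding norm_mult c_def norm_of_real by simp
        ultimately have "inverse e * cmod (f y - f x) < 1" by (simp only:)
        with e have "e * (inverse e * cmod (f y - f x)) < e * 1" by simp
        then have "cmod (f y - f x) < e" using e by (simp add: mult.assoc[symmetric])
        then show ?thesis using x yX fX by (simp add: dist_norm)
      qed
      then show "\<exists>N. openin (topol X) N \<and> x \<in> N \<and> (\<forall>y\<in>N. \<forall>s\<in>T. dist (?i y s) (?i x s) < e)"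
        using N by blast
    qed
    show "open_map (topol X) (topol (dual_space ?D)) ?i"
      unfolding open_map_def
    proof (intro allI impI)
      fix W assume W: "openin (topol X) W"
      then have WX: "W \<subseteq> carrier X" using openin_subset by fastforce
      show "openin (topol (dual_space ?D)) (?i ` W)"
        unfolding dual_space_simps(5)[of ?D] openin_uniform_topology
      proof (intro conjI ballI)
        show "?i ` W \<subseteq> continuous_functionals ?D" using evaluation_in_bidual WX by auto
        fix F assume "F \<in> ?i ` W"
        then obtain x where x: "x \<in> W" "F = ?i x" by blast
        have xX: "x \<in> carrier X" using x WX by blast
        have ct: "continuous_map (topol X) (topol X) (\<lambda>y. y \<oplus> x)"
          using xX by (intro continuous_add) auto
        \<comment> \<open>Since \<open>opn\<close> speaks about neighbourhoods of zero, the open set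
          \<open>W\<close> is first translated by the point \<open>x\<close>.\<close>
        have "zero_nbhd X {y\<in>carrier X. y \<oplus> x \<in> W}"
          unfolding zero_nbhd_def using openin_continuous_map_preimage[OF ct W] xX x(1)
          by (intro conjI exI[of _ "{y\<in>carrier X. y \<oplus> x \<in> W}"]) auto
        then obtain T e where T: "totally_bounded_in ?D T" and e: "e > 0"
          and Tx: "\<forall>y\<in>carrier X. (\<forall>f\<in>T. cmod (f y) < e) \<longrightarrow> y \<in> {y\<in>carrier X. y \<oplus> x \<in> W}" using opn by blast
        have TX: "T \<subseteq> continuous_functionals X" using T by (simp add: totally_bounded_in_def)
        have "G \<in> ?i ` W" if G: "G \<in> continuous_functionals ?D" "\<forall>f\<in>\<Union>{T}. dist (G f) (F f) < e" for G
        proof -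
          obtain y where y: "y \<in> carrier X" "\<forall>f\<in>continuous_functionals X. G f = f y" using surj[OF G(1)] by blast
          have "cmod (f (y \<ominus> x)) < e" if f: "f \<in> T" for f
          proof -
            have fX: "f \<in> continuous_functionals X" using f TX by blast
            then have "dist (f y) (f x) < e" using G(2) f y x(2) xX by auto
            then show ?thesis using functional_diff[OF fX y(1) xX] by (simp add: dist_norm)
          qed
          then have "(y \<ominus> x) \<oplus> x \<in> W" using Tx y(1) xX by blast
          moreover have "(y \<ominus> x) \<oplus> x = y" using y(1) xX by (simp add: a_minus_def a_assoc l_neg)
          ultimately have "y \<in> W" by simp
          moreover have "G = ?i y"
            using y continuous_functionalsD(1)[OF G(1)] by (intro extensionalityI[of _ "carrier ?D"]) auto
          ultimately show ?thesis by blast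
        qed
        then show "\<exists>\<T> e. finite \<T> \<and> \<T> \<subseteq> {S. totally_bounded_in ?D S} \<and> e > 0 \<and>
           (\<forall>g\<in>continuous_functionals ?D. (\<forall>x\<in>\<Union>\<T>. dist (g x) (F x) < e) \<longrightarrow> g \<in> ?i ` W)"
          using T e by (intro exI[of _ "{T}"] exI[of _ e]) auto
      qed
    qed
    show "?i ` topspace (topol X) = topspace (topol (dual_space ?D))"
    proof
      show "?i ` topspace (topol X) \<subseteq> topspace (topol (dual_space ?D))" using evaluation_in_bidual by auto
      show "topspace (topol (dual_space ?D)) \<subseteq> ?i ` topspace (topol X)"
      proof
        fix F assume "F \<in> topspace (topol (dual_space ?D))"
        then have F: "F \<in> continuous_functionals ?D" by simp
        obtain y where y: "y \<in> carrier X" "\<forall>f\<in>continuous_functionals X. F f = f y" using surj[OF F] by blast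
        have "F = ?i y"
          using y continuous_functionalsD(1)[OF F] by (intro extensionalityI[of _ "carrier ?D"]) auto
        then show "F \<in> ?i ` topspace (topol X)" using y(1) by simp
      qed
    qed
    show "inj_on ?i (topspace (topol X))"
    proof (rule inj_onI)
      fix x y assume xy: "x \<in> topspace (topol X)" "y \<in> topspace (topol X)" "?i x = ?i y"
      have "f x = f y" if f: "f \<in> continuous_functionals X" for f
      proof -
        have "?i x f = ?i y f" by (simp only: xy(3))
        then show ?thesis using xy(1,2) f by simp
      qed
      then show "x = y" using inj xy by simp
    qed
  qed
qed

end

section \<open>Partitions of unity and local finiteness\<close>

lemma compactin_finite_subcover:
  assumes K: "compactin M K" and U: "\<And>x. x \<in> K \<Longrightarrow> openin M (U x) \<and> x \<in> U x"
  obtains J where "finite J" "J \<subseteq> K" "K \<subseteq> \<Union>(U ` J)"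
proof -
  have "\<exists>\<F>. finite \<F> \<and> \<F> \<subseteq> U ` K \<and> K \<subseteq> \<Union>\<F>"
    by (rule compactinD[OF K]) (use U in auto)
  then obtain \<F> where F: "finite \<F>" "\<F> \<subseteq> U ` K" "K \<subseteq> \<Union>\<F>" by (elim exE conjE)
  from finite_subset_image[OF F(1,2)] obtain J where "J \<subseteq> K" "finite J" "\<F> = U ` J" by blast
  then show thesis using that F(3) by simp
qed

lemma finite_partition_of_unity:
  assumes M: "completely_regular_space M" and K: "compactin M K"
    and N: "\<And>x. x \<in> K \<Longrightarrow> openin M (N x) \<and> x \<in> N x"
  shows "\<exists>J phi. finite J \<and> J \<subseteq> K \<and>
    (\<forall>j\<in>J. continuous_map M euclideanreal (phi j) \<and> (\<forall>t\<in>topspace M. 0 \<le> phi j t) \<and>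
       (\<forall>t\<in>topspace M - N j. phi j t = 0)) \<and>
    (\<forall>t\<in>K. (\<Sum>j\<in>J. phi j t) = 1)"
proof -
  have "\<exists>g. continuous_map M euclideanreal g \<and> g x = 1 \<and> (\<forall>t\<in>topspace M. 0 \<le> g t) \<and>
      (\<forall>t\<in>topspace M - N x. g t = 0)" if x: "x \<in> K" for x
  proof -
    have "closedin M (topspace M - N x)" "x \<in> topspace M - (topspace M - N x)"
      using N[OF x] openin_subset by auto
    then obtain f where f: "continuous_map M (top_of_set {0..1::real}) f" "f x = 0" "f ` (topspace M - N x) \<subseteq> {1}"
      using M unfolding completely_regular_space_def by meson
    have fc: "continuous_map M euclideanreal f" and f01: "f t \<in> {0..1}" if "t \<in> topspace M" for t
      using f(1) that by (auto simp: continuous_map_in_subtopology)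
    have fc: "continuous_map M euclideanreal f" using f(1) by (simp add: continuous_map_in_subtopology)
    have "continuous_map M euclideanreal (\<lambda>t. 1 - f t)" by (intro continuous_map_diff fc) simp
    then show ?thesis using f(2,3) f01 by (intro exI[of _ "\<lambda>t. 1 - f t"]) auto
  qed
  then obtain g where g: "\<And>x. x \<in> K \<Longrightarrow> continuous_map M euclideanreal (g x) \<and> g x x = 1 \<and>
     (\<forall>t\<in>topspace M. 0 \<le> g x t) \<and> (\<forall>t\<in>topspace M - N x. g x t = 0)" by metis
  let ?U = "\<lambda>x. {t\<in>topspace M. g x t \<in> {1/2<..}}"
  have KM: "K \<subseteq> topspace M" using K by (rule compactin_subset_topspace)
  have U: "openin M (?U x) \<and> x \<in> ?U x" if x: "x \<in> K" for x
  proof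
    show "openin M (?U x)"
      by (rule openin_continuous_map_preimage[where Y=euclideanreal]) (use g[OF x] in auto)
    show "x \<in> ?U x" using KM g[OF x] x by auto
  qed
  obtain J where J: "finite J" "J \<subseteq> K" "K \<subseteq> \<Union>(?U ` J)"
    by (rule compactin_finite_subcover[OF K U])
  \<comment> \<open>On \<open>K\<close> some bump exceeds \<open>1/2\<close>, so there the maximum
    is the sum itself. Elsewhere the constant keeps the denominator positive, and the quotients are
    continuous on all of \<open>M\<close>.\<close>
  define G where "G t = max (1/2) (\<Sum>j\<in>J. g j t)" for t
  have Gpos: "G t > 0" for t by (simp add: G_def)
  have Gc: "continuous_map M euclideanreal G"
    unfolding G_def using J g by (intro continuous_map_real_max continuous_map_sum) auto
  define phi where "phi j t = g j t / G t" for j t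
  show ?thesis
  proof (intro exI conjI ballI)
    fix j assume j: "j \<in> J"
    show "continuous_map M euclideanreal (phi j)"
      unfolding phi_def using j J g Gc Gpos by (intro continuous_map_real_divide) (auto simp: less_imp_neq[symmetric])
    show "0 \<le> phi j t" if "t \<in> topspace M" for t using g[of j] j J(2) that Gpos[of t] by (auto simp: phi_def)
    show "phi j t = 0" if "t \<in> topspace M - N j" for t using g[of j] j J(2) that by (auto simp: phi_def)
  next
    fix t assume t: "t \<in> K"
    then obtain i where i: "i \<in> J" "g i t > 1/2" using J(3) by auto
    have "0 \<le> g j t" if "j \<in> J" for j using g[of j] that J(2) t KM by blast
    then have "g i t \<le> (\<Sum>j\<in>J. g j t)"
      using i(1) J(1) by (intro member_le_sum) auto
    then have "G t = (\<Sum>j\<in>J. g j t)" using i by (simp add: G_def)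
    then show "(\<Sum>j\<in>J. phi j t) = 1" using Gpos[of t] by (simp add: phi_def sum_divide_distrib[symmetric])
  qed (use J in auto)
qed

lemma locally_finite_meets_compact:
  assumes lf: "locally_finite_in M \<V>" and K: "compactin M K"
  shows "finite {V\<in>\<V>. V \<inter> K \<noteq> {}}"
proof -
  have KM: "K \<subseteq> topspace M" using K by (rule compactin_subset_topspace)
  have "\<forall>x\<in>K. \<exists>W. openin M W \<and> x \<in> W \<and> finite {U\<in>\<V>. U \<inter> W \<noteq> {}}"
    using lf KM unfolding locally_finite_in_def by blast
  then obtain W where W: "\<And>x. x \<in> K \<Longrightarrow> openin M (W x) \<and> x \<in> W x \<and> finite {U\<in>\<V>. U \<inter> W x \<noteq> {}}" by metis
  then have "\<And>x. x \<in> K \<Longrightarrow> openin M (W x) \<and> x \<in> W x" by blast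
  from compactin_finite_subcover[OF K this]
  obtain J where J: "finite J" "J \<subseteq> K" "K \<subseteq> \<Union>(W ` J)" .
  have "{V\<in>\<V>. V \<inter> K \<noteq> {}} \<subseteq> (\<Union>j\<in>J. {U\<in>\<V>. U \<inter> W j \<noteq> {}})" using J(3) by blast
  moreover have "finite (\<Union>j\<in>J. {U\<in>\<V>. U \<inter> W j \<noteq> {}})" using J W by auto
  ultimately show ?thesis by (rule finite_subset)
qed

section \<open>Carriers of functionals and the bidual of \<open>C(M)\<close>\<close>

locale function_space =
  fixes M :: "'m topology"
begin

abbreviation "CM' \<equiv> continuous_functionals (function_algebra M)"

abbreviation "C \<equiv> continuous_functions M"
abbreviation "CM \<equiv> function_algebra M"

sublocale complex_lcs CM
  by (rule complex_lcsI) (rule lcs_function_algebra)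

lemma functional_add:
  "\<mu> \<in> CM' \<Longrightarrow> f \<in> C \<Longrightarrow> g \<in> C \<Longrightarrow> \<mu> (\<lambda>t\<in>topspace M. f t + g t) = \<mu> f + \<mu> g"
  using continuous_functionalsD(3)[of \<mu> CM f g] by simp

lemma functional_smult:
  "\<mu> \<in> CM' \<Longrightarrow> f \<in> C \<Longrightarrow> \<mu> (\<lambda>t\<in>topspace M. c * f t) = c * \<mu> f"
  using continuous_functionalsD(4)[of \<mu> CM f c] by simp

lemma functional_fdiff:
  assumes mu: "\<mu> \<in> CM'" and f: "f \<in> C" and g: "g \<in> C"
  shows "\<mu> (\<lambda>t\<in>topspace M. f t - g t) = \<mu> f - \<mu> g"
proof -
  let ?g = "\<lambda>t\<in>topspace M. (-1) * g t"
  have "(\<lambda>t\<in>topspace M. f t - g t) = (\<lambda>t\<in>topspace M. f t + ?g t)" by (rule restrict_ext) simp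
  then show ?thesis
    using functional_add[OF mu f continuous_functions_smult[OF g, of "-1"]] functional_smult[OF mu g, of "-1"]
    by (simp only:) simp
qed

lemma sum_in_continuous_functions:
  assumes "finite J" "\<And>j. j \<in> J \<Longrightarrow> f j \<in> C"
  shows "(\<lambda>t\<in>topspace M. \<Sum>j\<in>J. c j * f j t) \<in> C"
  using assms by (intro restrict_in_continuous_functions continuous_map_sum continuous_map_complex_mult)
    (auto dest: continuous_functionsD)

lemma functional_sum:
  assumes mu: "\<mu> \<in> CM'" and J: "finite J" "\<And>j. j \<in> J \<Longrightarrow> f j \<in> C"
  shows "\<mu> (\<lambda>t\<in>topspace M. \<Sum>j\<in>J. c j * f j t) = (\<Sum>j\<in>J. c j * \<mu> (f j))"
  using J
proof (induction J rule: finite_induct)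
  case empty
  have "\<mu> (\<lambda>t\<in>topspace M. 0) = 0" using functional_zero[OF mu] by simp
  then show ?case by (simp only: sum.empty)
next
  case (insert i J)
  let ?f = "\<lambda>t\<in>topspace M. c i * f i t" and ?g = "\<lambda>t\<in>topspace M. \<Sum>j\<in>J. c j * f j t"
  have f: "?f \<in> C" using insert.prems by (intro continuous_functions_smult) simp
  have g: "?g \<in> C" by (rule sum_in_continuous_functions) (use insert in auto)
  have "(\<lambda>t\<in>topspace M. \<Sum>j\<in>insert i J. c j * f j t) = (\<lambda>t\<in>topspace M. ?f t + ?g t)"
    using insert.hyps by (intro restrict_ext) simp
  then have "\<mu> (\<lambda>t\<in>topspace M. \<Sum>j\<in>insert i J. c j * f j t) = \<mu> ?f + \<mu> ?g"
    using functional_add[OF mu f g] by (simp only:)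
  also have "\<mu> ?f = c i * \<mu> (f i)" using functional_smult[OF mu] insert.prems by simp
  also have "\<mu> ?g = (\<Sum>j\<in>J. c j * \<mu> (f j))" by (rule insert.IH) (use insert.prems in simp)
  finally show ?case using insert.hyps by simp
qed

text \<open>The estimate by \<open>B\<close> times the supremum over \<open>K\<close>, with a
  positive majorant \<open>b\<close> in place of the supremum; this form also makes sense for empty
  \<open>K\<close>.\<close>

definition carried_by :: "(('m \<Rightarrow> complex) \<Rightarrow> complex) \<Rightarrow> 'm set \<Rightarrow> real \<Rightarrow> bool" where
  "carried_by \<mu> K B \<longleftrightarrow> (\<forall>f\<in>C. \<forall>b>0. (\<forall>t\<in>K. cmod (f t) \<le> b) \<longrightarrow> cmod (\<mu> f) \<le> B * b)"

lemma functional_carried: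
  assumes mu: "\<mu> \<in> CM'"
  obtains K B where "compactin M K" "B > 0" "carried_by \<mu> K B"
proof -
  have "zero_nbhd CM {f\<in>carrier CM. cmod (\<mu> f) < 1}" by (rule functional_ball_zero_nbhd[OF mu]) simp
  then obtain K e where K: "compactin M K" "e > 0"
    "\<And>g. g \<in> C \<Longrightarrow> (\<forall>t\<in>K. cmod (g t) < e) \<Longrightarrow> cmod (\<mu> g) < 1"
    unfolding zero_nbhd_function_algebra by auto
  have KM: "K \<subseteq> topspace M" using K(1) by (rule compactin_subset_topspace)
  have "cmod (\<mu> f) \<le> 2 / e * b" if f: "f \<in> C" and b: "b > 0" and fb: "\<forall>t\<in>K. cmod (f t) \<le> b" for f b
  proof -
    \<comment> \<open>The neighbourhood is given by a strict inequality, so \<open>f\<close> is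
      scaled until its bound on \<open>K\<close> is \<open>e/2\<close>; this accounts for the
      constant \<open>2 / e\<close>.\<close>
    define r where "r = e / (2 * b)"
    have r: "r > 0" "r * b < e" using K(2) b by (auto simp: r_def)
    let ?g = "\<lambda>t\<in>topspace M. complex_of_real r * f t"
    have "cmod (?g t) < e" if t: "t \<in> K" for t
    proof -
      have "cmod (?g t) = r * cmod (f t)" using t KM r by (auto simp: norm_mult)
      also have "\<dots> \<le> r * b" using fb t r by simp
      finally show ?thesis using r by simp
    qed
    then have "cmod (\<mu> ?g) < 1" by (intro K(3) continuous_functions_smult f) blast
    then have "r * cmod (\<mu> f) < 1" using r by (simp add: functional_smult[OF mu f] norm_mult)
    then show ?thesis using r K(2) b by (simp add: r_def field_simps)
  qed
  then have "carried_by \<mu> K (2/e)" unfolding carried_by_def by blast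
  then show thesis using that[of K "2/e"] K(1,2) by simp
qed

text \<open>The difference of the two functions vanishes on \<open>K\<close> and is bounded there by
  every positive \<open>b\<close>, so its image is arbitrarily small.\<close>

lemma carried_by_eq:
  assumes mu: "\<mu> \<in> CM'" and c: "carried_by \<mu> K B" and B: "B > 0"
    and K: "K \<subseteq> topspace M" and fg: "f \<in> C" "g \<in> C" "\<And>t. t \<in> K \<Longrightarrow> f t = g t"
  shows "\<mu> f = \<mu> g"
proof -
  let ?h = "\<lambda>t\<in>topspace M. f t - g t"
  have h: "?h \<in> C" using fg by (intro continuous_functions_diff)
  have "cmod (\<mu> ?h) \<le> B * b" if "b > 0" for b
  proof -
    have "\<forall>t\<in>K. cmod (?h t) \<le> b" using fg(3) K that by (auto simp: subset_iff)
    then show ?thesis using c h that unfolding carried_by_def by blast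
  qed
  then have "cmod (\<mu> ?h) \<le> e" if "e > 0" for e
    using B that by (metis divide_pos_pos nonzero_mult_div_cancel_left order_less_irrefl times_divide_eq_right)
  then have "cmod (\<mu> ?h) \<le> 0" by (rule field_le_epsilon) simp
  then show ?thesis by (simp add: functional_fdiff[OF mu fg(1,2)])
qed

text \<open>A third of \<open>e\<close> each for the perturbations at the two points and for the
  variation of a member of the finite net. The estimate is confined to \<open>K\<close>, since a
  neighbourhood of zero in \<open>C(M)\<close> controls the perturbations only on a compact
  set.\<close>

lemma totally_bounded_equicontinuous:
  assumes S: "totally_bounded_in CM S" and K: "compactin M K" and e: "e > 0" and x: "x \<in> K"
  obtains N where "openin M N" "x \<in> N" "\<And>f t. f \<in> S \<Longrightarrow> t \<in> N \<inter> K \<Longrightarrow> cmod (f t - f x) < e"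
proof -
  have KM: "K \<subseteq> topspace M" using K by (rule compactin_subset_topspace)
  define V where "V = {f\<in>C. \<forall>t\<in>K. cmod (f t) < e/3}"
  have "zero_nbhd CM V" unfolding V_def using K e by (intro zero_nbhd_ball) auto
  from totally_bounded_near[OF S this] obtain F where F: "finite F" "F \<subseteq> carrier CM"
    "\<And>s. s \<in> S \<Longrightarrow> \<exists>f\<in>F. \<exists>u\<in>V. s = f \<oplus>\<^bsub>CM\<^esub> u"
    by blast
  let ?N = "topspace M \<inter> (\<Inter>f\<in>F. {t\<in>topspace M. f t \<in> ball (f x) (e/3)})"
  have op: "openin M {t\<in>topspace M. f t \<in> ball (f x) (e/3)}" if "f \<in> F" for f
    by (rule openin_continuous_map_preimage[where Y=euclidean])
      (use that F(2) in \<open>auto dest: continuous_functionsD\<close>)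
  show thesis
  proof (rule that)
    show "openin M ?N"
      using op F(1) by (cases "F = {}") (auto intro!: openin_Int openin_INT2)
    show "x \<in> ?N" using x KM e by auto
    fix f t assume f: "f \<in> S" and t: "t \<in> ?N \<inter> K"
    obtain g u where gu: "g \<in> F" "u \<in> C" "\<forall>t\<in>K. cmod (u t) < e/3" "f = g \<oplus>\<^bsub>CM\<^esub> u"
      using F(3)[OF f] unfolding V_def by blast
    have f_eq: "f s = g s + u s" if "s \<in> K" for s using that gu(4) KM by auto
    have "cmod (f t - f x) = cmod ((g t - g x) + (u t - u x))" using f_eq x t by (simp add: algebra_simps)
    also have "\<dots> \<le> cmod (g t - g x) + cmod (u t - u x)" by (rule norm_triangle_ineq)
    also have "cmod (u t - u x) \<le> cmod (u t) + cmod (u x)" by (rule norm_triangle_ineq4)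
    also have "cmod (g t - g x) < e/3" using t gu(1) by (auto simp: dist_norm norm_minus_commute)
    also have "cmod (u t) + cmod (u x) \<le> e/3 + e/3" using gu(3) t x by (intro add_mono) (auto intro: less_imp_le)
    finally show "cmod (f t - f x) < e" by simp
  qed
qed

definition eval_functional :: "'m \<Rightarrow> ('m \<Rightarrow> complex) \<Rightarrow> complex" where
  "eval_functional t = (\<lambda>f\<in>C. f t)"

lemma eval_functional_apply [simp]: "f \<in> C \<Longrightarrow> eval_functional t f = f t"
  by (simp add: eval_functional_def)

lemma eval_functional_in:
  assumes "t \<in> topspace M" shows "eval_functional t \<in> CM'"
proof -
  have "continuous_map (topol CM) euclidean (\<lambda>f. f t)"
    unfolding function_algebra_simps by (rule continuous_map_eval_uniform) (use assms in simp)
  then have "continuous_map (topol CM) euclidean (eval_functional t)"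
    by (rule continuous_map_eq) simp
  then show ?thesis using assms unfolding continuous_functionals_def
    by (simp add: continuous_functions_closed) (simp add: eval_functional_def)
qed

text \<open>By equicontinuity of \<open>S\<close> on \<open>K\<close>, neighbouring points have
  evaluations that are close uniformly on \<open>S\<close>, and compactness of \<open>K\<close>
  yields a finite net of evaluations. Polars of these sets recover the neighbourhoods of zero in
  \<open>C(M)\<close>, as \<open>stereotypeI\<close> requires.\<close>

lemma eval_functionals_totally_bounded:
  assumes K: "compactin M K"
  shows "totally_bounded_in (dual_space CM) (eval_functional ` K)"
proof (rule totally_bounded_dualI)
  have KM: "K \<subseteq> topspace M" using K by (rule compactin_subset_topspace)
  show "eval_functional ` K \<subseteq> CM'" using KM eval_functional_in by auto
  fix S and e :: real assume S: "totally_bounded_in CM S" and e: "e > 0"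
  have "\<exists>N. openin M N \<and> x \<in> N \<and> (\<forall>f\<in>S. \<forall>t\<in>N \<inter> K. cmod (f t - f x) < e)" if "x \<in> K" for x
    using totally_bounded_equicontinuous[OF S K e that] by metis
  then obtain N where N: "\<And>x. x \<in> K \<Longrightarrow> openin M (N x) \<and> x \<in> N x \<and> (\<forall>f\<in>S. \<forall>t\<in>N x \<inter> K. cmod (f t - f x) < e)"
    by metis
  then have "\<And>x. x \<in> K \<Longrightarrow> openin M (N x) \<and> x \<in> N x" by blast
  from compactin_finite_subcover[OF K this]
  obtain J where J: "finite J" "J \<subseteq> K" "K \<subseteq> \<Union>(N ` J)" .
  have SC: "S \<subseteq> C" using S by (simp add: totally_bounded_in_def)
  show "\<exists>F. finite F \<and> F \<subseteq> CM' \<and>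
     (\<forall>f\<in>eval_functional ` K. \<exists>g\<in>F. \<forall>x\<in>S. cmod (f x - g x) < e)"
  proof (intro exI conjI ballI)
    show "finite (eval_functional ` J)" using J by simp
    show "eval_functional ` J \<subseteq> CM'" using J(2) KM eval_functional_in by auto
    fix f assume "f \<in> eval_functional ` K"
    then obtain t where t: "t \<in> K" "f = eval_functional t" by blast
    then obtain j where j: "j \<in> J" "t \<in> N j" using J(3) by blast
    have "\<forall>x\<in>S. cmod (f x - eval_functional j x) < e"
    proof
      fix x assume x: "x \<in> S"
      then have "cmod (x t - x j) < e" using N[of j] j J(2) t(1) by blast
      moreover have "x \<in> C" using x SC by blast
      ultimately show "cmod (f x - eval_functional j x) < e" by (simp add: t(2))
    qed
    then show "\<exists>g\<in>eval_functional ` J. \<forall>x\<in>S. cmod (f x - g x) < e" using j by blast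
  qed
qed

text \<open>Finitely supported measures approximate every functional, uniformly on totally bounded sets:
  by equicontinuity, \<open>f\<close> is close to \<open>\<Sum>j. f j * phi j\<close> on the carrier for a fine enough partition of unity.\<close>

lemma functional_approximation:
  assumes M: "completely_regular_space M" and mu: "\<mu> \<in> CM'"
    and S: "totally_bounded_in CM S" and e: "e > 0"
  obtains J c where "finite J" "J \<subseteq> topspace M" "\<And>f. f \<in> S \<Longrightarrow> cmod (\<mu> f - (\<Sum>j\<in>J. c j * f j)) < e"
proof -
  obtain K B where K: "compactin M K" "B > 0" "carried_by \<mu> K B" using functional_carried[OF mu] .
  have KM: "K \<subseteq> topspace M" using K(1) by (rule compactin_subset_topspace)
  \<comment> \<open>The tolerance on the carrier: \<open>\<mu>\<close> magnifies it at most by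
    \<open>B\<close>, which gives a total error of \<open>e/2\<close>.\<close>
  define r where "r = e / (2 * B)"
  have d: "r > 0" "B * r < e" using e K(2) by (auto simp: r_def)
  have "\<exists>N. openin M N \<and> x \<in> N \<and> (\<forall>f\<in>S. \<forall>t\<in>N \<inter> K. cmod (f t - f x) < r)" if "x \<in> K" for x
    using totally_bounded_equicontinuous[OF S K(1) d(1) that] by metis
  then obtain N where N: "\<And>x. x \<in> K \<Longrightarrow> openin M (N x) \<and> x \<in> N x \<and> (\<forall>f\<in>S. \<forall>t\<in>N x \<inter> K. cmod (f t - f x) < r)"
    by metis
  have "\<exists>J phi. finite J \<and> J \<subseteq> K \<and>
    (\<forall>j\<in>J. continuous_map M euclideanreal (phi j) \<and> (\<forall>t\<in>topspace M. 0 \<le> phi j t) \<and>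
       (\<forall>t\<in>topspace M - N j. phi j t = 0)) \<and>
    (\<forall>t\<in>K. (\<Sum>j\<in>J. phi j t) = 1)"
    by (rule finite_partition_of_unity[OF M K(1)]) (use N in blast)
  then obtain J phi where J: "finite J" "J \<subseteq> K"
    and P: "\<forall>j\<in>J. continuous_map M euclideanreal (phi j) \<and> (\<forall>t\<in>topspace M. 0 \<le> phi j t) \<and>
       (\<forall>t\<in>topspace M - N j. phi j t = 0)" and one: "\<And>t. t \<in> K \<Longrightarrow> (\<Sum>j\<in>J. phi j t) = 1"
    by (elim exE conjE) simp
  have phi: "continuous_map M euclideanreal (phi j)" "\<And>t. t \<in> topspace M \<Longrightarrow> 0 \<le> phi j t"
      "\<And>t. t \<in> topspace M - N j \<Longrightarrow> phi j t = 0" if "j \<in> J" for j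
    using P[rule_format, OF that] by blast+
  define psi where "psi j = (\<lambda>t\<in>topspace M. complex_of_real (phi j t))" for j
  have psi: "psi j \<in> C" if "j \<in> J" for j
    unfolding psi_def by (intro restrict_in_continuous_functions continuous_map_of_real phi that)
  have SC: "S \<subseteq> C" using S by (simp add: totally_bounded_in_def)
  show thesis
  \<comment> \<open>The weights are the masses that \<open>\<mu>\<close> assigns to the members of
    the partition of unity.\<close>
  proof (rule that[of J "\<lambda>j. \<mu> (psi j)"])
    show "J \<subseteq> topspace M" using J KM by blast
    fix f assume f: "f \<in> S"
    then have fC: "f \<in> C" using SC by blast
    let ?g = "\<lambda>t\<in>topspace M. \<Sum>j\<in>J. f j * psi j t"
    have g: "?g \<in> C" by (rule sum_in_continuous_functions[OF J(1) psi])
    let ?h = "\<lambda>t\<in>topspace M. f t - ?g t"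
    have h: "?h \<in> C" using fC g by (rule continuous_functions_diff)
    have "cmod (?h t) \<le> r" if t: "t \<in> K" for t
    proof -
      have tM: "t \<in> topspace M" using t KM by blast
      have "f t = (\<Sum>j\<in>J. f t * complex_of_real (phi j t))"
        using one[OF t] by (simp add: sum_distrib_left[symmetric] flip: of_real_sum)
      then have "?h t = (\<Sum>j\<in>J. (f t - f j) * complex_of_real (phi j t))"
        using tM by (simp add: psi_def sum_subtractf left_diff_distrib)
      also have "cmod \<dots> \<le> (\<Sum>j\<in>J. r * phi j t)"
      proof (rule sum_norm_le)
        fix j assume j: "j \<in> J"
        show "cmod ((f t - f j) * complex_of_real (phi j t)) \<le> r * phi j t"
        proof (cases "t \<in> N j")
          case True
          then have "cmod (f t - f j) \<le> r" using N[of j] j J(2) f t by (auto intro: less_imp_le)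
          then show ?thesis using phi(2)[OF j tM] by (simp add: norm_mult mult_right_mono)
        next
          case False
          then show ?thesis using phi(3)[OF j] tM by simp
        qed
      qed
      also have "\<dots> = r" using one[OF t] by (simp add: sum_distrib_left[symmetric])
      finally show ?thesis .
    qed
    then have "cmod (\<mu> ?h) \<le> B * r" using K(3) h d(1) unfolding carried_by_def by blast
    moreover have "\<mu> ?h = \<mu> f - (\<Sum>j\<in>J. f j * \<mu> (psi j))"
      using functional_fdiff[OF mu fC g] functional_sum[OF mu J(1) psi] by simp
    ultimately show "cmod (\<mu> f - (\<Sum>j\<in>J. \<mu> (psi j) * f j)) < e" using d(2) by (simp add: mult.commute)
  qed (rule J)
qed

lemma bidual_functional_bound:
  assumes F: "F \<in> continuous_functionals (dual_space CM)" and e: "e > 0"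
  obtains S r where "totally_bounded_in CM S" "r > 0"
    "\<And>\<mu>. \<mu> \<in> CM' \<Longrightarrow> (\<And>f. f \<in> S \<Longrightarrow> cmod (\<mu> f) < r) \<Longrightarrow> cmod (F \<mu>) < e"
proof -
  have "F (\<lambda>f\<in>carrier CM. \<Sum>j\<in>{}. 0 * eval_functional j f) = (\<Sum>j\<in>{}. 0 * F (eval_functional j))"
    by (rule bidual_functional_sum[OF F]) auto
  then have F0: "F (\<lambda>f\<in>carrier CM. 0) = 0" by (simp only: sum.empty)
  have "zero_nbhd (dual_space CM) {\<mu>\<in>carrier (dual_space CM). cmod (F \<mu>) < e}"
    by (rule functional_zero_nbhd[OF F _ _ _ e])
      (simp_all only: dual_space_simps topspace_uniform_topology F0 zero_in_continuous_functionals)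
  then obtain S r where S: "totally_bounded_in CM S" "r > 0"
    "\<forall>\<mu>\<in>CM'. (\<forall>f\<in>S. cmod (\<mu> f) < r) \<longrightarrow> \<mu> \<in> {\<mu>\<in>carrier (dual_space CM). cmod (F \<mu>) < e}"
    unfolding zero_nbhd_dual_space by blast
  then show thesis by (intro that[OF S(1,2)]) blast
qed

lemma bidual_functional_diff:
  assumes F: "F \<in> continuous_functionals (dual_space CM)"
    and mn: "\<mu> \<in> CM'" "\<nu> \<in> CM'"
  shows "F (\<lambda>f\<in>carrier CM. \<mu> f - \<nu> f) = F \<mu> - F \<nu>" "(\<lambda>f\<in>carrier CM. \<mu> f - \<nu> f) \<in> CM'"
proof -
  let ?n = "\<lambda>f\<in>carrier CM. (-1) * \<nu> f"
  have n: "?n \<in> CM'" by (rule continuous_functionals_closed(2)[OF mn(2,2)])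
  have eq: "(\<lambda>f\<in>carrier CM. \<mu> f - \<nu> f) = (\<lambda>f\<in>carrier CM. \<mu> f + ?n f)" by (rule restrict_ext) simp
  show "(\<lambda>f\<in>carrier CM. \<mu> f - \<nu> f) \<in> CM'"
    unfolding eq by (rule continuous_functionals_closed(1)[OF mn(1) n])
  have "F (\<lambda>f\<in>carrier CM. \<mu> f + ?n f) = F \<mu> + F ?n"
    using continuous_functionalsD(3)[OF F, of \<mu> ?n] mn n by (simp only: dual_space_simps)
  moreover have "F ?n = - F \<nu>"
    using continuous_functionalsD(4)[OF F, of \<nu> "-1"] mn by (simp only: dual_space_simps) simp
  ultimately show "F (\<lambda>f\<in>carrier CM. \<mu> f - \<nu> f) = F \<mu> - F \<nu>" unfolding eq by simp
qed

text \<open>Point evaluations leave only one candidate for the representing function, namely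
  \<open>t \<mapsto> F (eval_functional t)\<close>. It is continuous because the set
  \<open>S\<close> that controls \<open>F\<close> is equicontinuous on a compact neighbourhood of
  each point. The formula holds for combinations of evaluations and passes to every functional by
  \<open>functional_approximation\<close>.\<close>

lemma bidual_representation:
  assumes lc: "locally_compact_space M" and M: "completely_regular_space M"
    and F: "F \<in> continuous_functionals (dual_space CM)"
  shows "\<exists>g\<in>C. \<forall>\<mu>\<in>CM'. F \<mu> = \<mu> g"
proof -
  define g where "g = (\<lambda>t\<in>topspace M. F (eval_functional t))"
  have "continuous_map M euclidean (\<lambda>t. F (eval_functional t))"
    unfolding continuous_map_into_complex
  proof (intro ballI allI impI)
    fix x and e :: real assume x: "x \<in> topspace M" and e: "e > 0"
    obtain U K where UK: "openin M U" "compactin M K" "x \<in> U" "U \<subseteq> K"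
      using lc x unfolding locally_compact_space_def by blast
    obtain S r where S: "totally_bounded_in CM S" "r > 0"
      "\<And>\<mu>. \<mu> \<in> CM' \<Longrightarrow> (\<And>f. f \<in> S \<Longrightarrow> cmod (\<mu> f) < r) \<Longrightarrow> cmod (F \<mu>) < e"
      using bidual_functional_bound[OF F e] by metis
    have xK: "x \<in> K" using UK by blast
    obtain N where N: "openin M N" "x \<in> N" "\<And>f t. f \<in> S \<Longrightarrow> t \<in> N \<inter> K \<Longrightarrow> cmod (f t - f x) < r"
      using totally_bounded_equicontinuous[OF S(1) UK(2) S(2) xK] by metis
    have SC: "S \<subseteq> C" using S by (simp add: totally_bounded_in_def)
    have "dist (F (eval_functional t)) (F (eval_functional x)) < e" if t: "t \<in> N \<inter> U" for t
    proof -
      have tM: "t \<in> topspace M" using t openin_subset[OF N(1)] by blast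
      note ev = eval_functional_in[OF tM] eval_functional_in[OF x]
      have "cmod (F (\<lambda>f\<in>carrier CM. eval_functional t f - eval_functional x f)) < e"
      proof (rule S(3)[OF bidual_functional_diff(2)[OF F ev]])
        fix f assume f: "f \<in> S"
        then have "f \<in> C" using SC by blast
        then show "cmod ((\<lambda>f\<in>carrier CM. eval_functional t f - eval_functional x f) f) < r"
          using N(3)[OF f, of t] t UK(4) by auto
      qed
      then show ?thesis using bidual_functional_diff(1)[OF F ev] by (simp add: dist_norm)
    qed
    then show "\<exists>N. openin M N \<and> x \<in> N \<and> (\<forall>y\<in>N. dist (F (eval_functional y)) (F (eval_functional x)) < e)"
      using N UK by (intro exI[of _ "N \<inter> U"]) auto
  qed
  then have g: "g \<in> C" unfolding g_def by (rule restrict_in_continuous_functions)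
  have "F \<mu> = \<mu> g" if mu: "\<mu> \<in> CM'" for \<mu>
  proof -
    have "cmod (F \<mu> - \<mu> g) \<le> e" if e: "e > 0" for e
    proof -
      have e2: "e/2 > 0" using e by simp
      obtain S r where S: "totally_bounded_in CM S" "r > 0"
        "\<And>\<mu>. \<mu> \<in> CM' \<Longrightarrow> (\<And>f. f \<in> S \<Longrightarrow> cmod (\<mu> f) < r) \<Longrightarrow> cmod (F \<mu>) < e/2"
        using bidual_functional_bound[OF F e2] by metis
      \<comment> \<open>With \<open>g\<close> adjoined to \<open>S\<close>, one and the same
        combination of evaluations approximates \<open>\<mu>\<close> as seen by \<open>F\<close> and
        the number \<open>\<mu> g\<close>.\<close>
      have Sg: "totally_bounded_in CM (S \<union> {g})"
        by (intro totally_bounded_Un S(1) totally_bounded_singleton) (simp add: g)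
      have d: "min r (e/2) > 0" using S e by simp
      obtain J c where J: "finite J" "J \<subseteq> topspace M"
        "\<And>f. f \<in> S \<union> {g} \<Longrightarrow> cmod (\<mu> f - (\<Sum>j\<in>J. c j * f j)) < min r (e/2)"
        using functional_approximation[OF M mu Sg d] by metis
      have ev: "eval_functional j \<in> CM'" if "j \<in> J" for j
        using that J(2) by (intro eval_functional_in) blast
      let ?n = "\<lambda>f\<in>carrier CM. \<Sum>j\<in>J. c j * eval_functional j f"
      have n: "?n \<in> CM'" by (rule sum_in_continuous_functionals[OF J(1) ev])
      have SC: "S \<subseteq> C" using S by (simp add: totally_bounded_in_def)
      have n_eq: "?n f = (\<Sum>j\<in>J. c j * f j)" if "f \<in> C" for f using that by simp
      have "cmod (F (\<lambda>f\<in>carrier CM. \<mu> f - ?n f)) < e/2"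
      proof (rule S(3)[OF bidual_functional_diff(2)[OF F mu n]])
        fix f assume f: "f \<in> S"
        then have fC: "f \<in> C" using SC by blast
        have "cmod (\<mu> f - ?n f) < r" using J(3)[of f] f unfolding n_eq[OF fC] by simp
        then show "cmod ((\<lambda>f\<in>carrier CM. \<mu> f - ?n f) f) < r" using fC by simp
      qed
      moreover have "F (\<lambda>f\<in>carrier CM. \<mu> f - ?n f) = F \<mu> - F ?n" by (rule bidual_functional_diff(1)[OF F mu n])
      moreover have "F ?n = (\<Sum>j\<in>J. c j * F (eval_functional j))"
        by (rule bidual_functional_sum[OF F J(1) ev])
      moreover have "(\<Sum>j\<in>J. c j * F (eval_functional j)) = (\<Sum>j\<in>J. c j * g j)"
        using J(2) by (intro sum.cong) (auto simp: g_def)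
      ultimately have 1: "cmod (F \<mu> - (\<Sum>j\<in>J. c j * g j)) < e/2" by simp
      have 2: "cmod (\<mu> g - (\<Sum>j\<in>J. c j * g j)) < e/2" using J(3)[of g] by simp
      have "cmod (F \<mu> - \<mu> g) = cmod ((F \<mu> - (\<Sum>j\<in>J. c j * g j)) - (\<mu> g - (\<Sum>j\<in>J. c j * g j)))" by simp
      also have "\<dots> \<le> cmod (F \<mu> - (\<Sum>j\<in>J. c j * g j)) + cmod (\<mu> g - (\<Sum>j\<in>J. c j * g j))"
        by (rule norm_triangle_ineq4)
      finally show ?thesis using 1 2 by simp
    qed
    then have "cmod (F \<mu> - \<mu> g) \<le> 0" by (rule field_le_epsilon) simp
    then show ?thesis by simp
  qed
  then show ?thesis using g by blast
qed

end

section \<open>Equicontinuity of pointwise bounded sets of functionals\<close>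

context function_space
begin

text \<open>For open \<open>V\<close> this expresses, without measures, that \<open>V\<close> meets
  the support of \<open>\<mu>\<close>.\<close>

definition sees :: "(('m \<Rightarrow> complex) \<Rightarrow> complex) \<Rightarrow> 'm set \<Rightarrow> bool" where
  "sees \<mu> V \<longleftrightarrow> (\<exists>f\<in>C. (\<forall>t\<in>topspace M - V. f t = 0) \<and> \<mu> f \<noteq> 0)"

definition pointwise_bounded :: "(('m \<Rightarrow> complex) \<Rightarrow> complex) set \<Rightarrow> bool" where
  "pointwise_bounded T \<longleftrightarrow> T \<subseteq> CM' \<and> (\<forall>f\<in>C. \<exists>B. \<forall>\<mu>\<in>T. cmod (\<mu> f) \<le> B)"

lemma functional_vanishes:
  assumes mu: "\<mu> \<in> CM'" and c: "carried_by \<mu> K B" "B > 0"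
    and K: "K \<subseteq> topspace M" and f: "f \<in> C" "\<And>t. t \<in> K \<Longrightarrow> f t = 0"
  shows "\<mu> f = 0"
proof -
  have "\<mu> f = \<mu> (\<lambda>t\<in>topspace M. 0)"
    by (rule carried_by_eq[OF mu c K f(1) const_in_continuous_functions]) (use f K in auto)
  then show ?thesis using functional_zero[OF mu] by simp
qed

text \<open>A set that avoids the compact carrier of \<open>\<mu>\<close> cannot be seen by
  \<open>\<mu>\<close>, and the carrier meets only finitely many members of a locally finite
  family.\<close>

lemma sees_finite:
  assumes lf: "locally_finite_in M \<V>" and mu: "\<mu> \<in> CM'"
  shows "finite {V\<in>\<V>. sees \<mu> V}"
proof -
  obtain K B where K: "compactin M K" "B > 0" "carried_by \<mu> K B" using functional_carried[OF mu] .
  have KM: "K \<subseteq> topspace M" using K(1) by (rule compactin_subset_topspace)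
  have "V \<inter> K \<noteq> {}" if V: "sees \<mu> V" for V
  proof
    assume "V \<inter> K = {}"
    obtain f where f: "f \<in> C" "\<forall>t\<in>topspace M - V. f t = 0" "\<mu> f \<noteq> 0" using V unfolding sees_def by blast
    have "f t = 0" if "t \<in> K" for t using that f(2) \<open>V \<inter> K = {}\<close> KM by blast
    then show False using functional_vanishes[OF mu K(3,2) KM f(1)] f(3) by blast
  qed
  then have "{V\<in>\<V>. sees \<mu> V} \<subseteq> {V\<in>\<V>. V \<inter> K \<noteq> {}}" by blast
  then show ?thesis using locally_finite_meets_compact[OF lf K(1)] finite_subset by blast
qed

text \<open>Near every point and on every compact set only finitely many terms of the sum are
  nonzero; injectivity of \<open>W\<close> turns finitely many sets into finitely many indices. The
  conclusion allows any larger finite index set \<open>I\<close>, so that a functional can be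
  applied to as many terms as convenient.\<close>

lemma locally_finite_combination:
  assumes lf: "locally_finite_in M \<V>" and W: "inj W" "\<And>n::nat. W n \<in> \<V>"
    and g: "\<And>n. g n \<in> C" "\<And>n. \<forall>t\<in>topspace M - W n. g n t = 0"
  shows "\<exists>F\<in>C. \<forall>K. compactin M K \<longrightarrow>
    (\<exists>I0. finite I0 \<and> (\<forall>I. finite I \<longrightarrow> I0 \<subseteq> I \<longrightarrow> (\<forall>t\<in>K. F t = (\<Sum>k\<in>I. c k * g k t))))"
proof -
  define F where "F t = (\<Sum>k\<in>{k. g k t \<noteq> 0}. c k * g k t)" for t
  have fin: "finite {k. W k \<inter> N \<noteq> {}}" if "finite {V\<in>\<V>. V \<inter> N \<noteq> {}}" for N
  proof (rule finite_imageD[of W])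
    show "finite (W ` {k. W k \<inter> N \<noteq> {}})" by (rule finite_subset[OF _ that]) (use W(2) in auto)
    show "inj_on W {k. W k \<inter> N \<noteq> {}}" using W(1) by (rule inj_on_subset) simp
  qed
  have F_eq: "F t = (\<Sum>k\<in>I. c k * g k t)" if "t \<in> topspace M" "t \<in> N" "finite I" "{k. W k \<inter> N \<noteq> {}} \<subseteq> I" for t N I
  proof -
    have "{k. g k t \<noteq> 0} \<subseteq> I" using that g(2) by blast
    then show ?thesis unfolding F_def using that(3) by (intro sum.mono_neutral_left) auto
  qed
  have "continuous_map M euclidean F"
    unfolding continuous_map_into_complex
  proof (intro ballI allI impI)
    fix x and e :: real assume x: "x \<in> topspace M" and e: "e > 0"
    obtain N where N: "openin M N" "x \<in> N" "finite {V\<in>\<V>. V \<inter> N \<noteq> {}}"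
      using lf x unfolding locally_finite_in_def by blast
    define I where "I = {k. W k \<inter> N \<noteq> {}}"
    have I: "finite I" unfolding I_def by (rule fin[OF N(3)])
    have "continuous_map M euclidean (\<lambda>t. \<Sum>k\<in>I. c k * g k t)"
      using I g(1) by (intro continuous_map_sum continuous_map_complex_mult) (auto dest: continuous_functionsD)
    then obtain N' where N': "openin M N'" "x \<in> N'"
      "\<forall>y\<in>N'. dist (\<Sum>k\<in>I. c k * g k y) (\<Sum>k\<in>I. c k * g k x) < e"
      unfolding continuous_map_into_complex using x e by meson
    have eq: "F y = (\<Sum>k\<in>I. c k * g k y)" if "y \<in> N" for y
      using F_eq[of y N I] that openin_subset[OF N(1)] I by (auto simp: I_def)
    have "\<forall>y\<in>N \<inter> N'. dist (F y) (F x) < e" using N'(3) eq N(2) by simp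
    then show "\<exists>N. openin M N \<and> x \<in> N \<and> (\<forall>y\<in>N. dist (F y) (F x) < e)"
      using N N' by (intro exI[of _ "N \<inter> N'"]) auto
  qed
  then have FC: "restrict F (topspace M) \<in> C" by (rule restrict_in_continuous_functions)
  show ?thesis
  proof (intro bexI[OF _ FC] allI impI)
    fix K assume K: "compactin M K"
    have KM: "K \<subseteq> topspace M" using K by (rule compactin_subset_topspace)
    define I0 where "I0 = {k. W k \<inter> K \<noteq> {}}"
    have "finite I0" unfolding I0_def by (rule fin[OF locally_finite_meets_compact[OF lf K]])
    moreover have "restrict F (topspace M) t = (\<Sum>k\<in>I. c k * g k t)" if "finite I" "I0 \<subseteq> I" "t \<in> K" for I t
      using F_eq[of t K I] that KM by (auto simp: I0_def)
    ultimately show "\<exists>I0. finite I0 \<and> (\<forall>I. finite I \<longrightarrow> I0 \<subseteq> I \<longrightarrow> (\<forall>t\<in>K. restrict F (topspace M) t = (\<Sum>k\<in>I. c k * g k t)))"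
      by blast
  qed
qed

text \<open>A gliding hump: if infinitely many \<open>V\<close> were seen by \<open>T\<close>, some infinite combination \<open>F\<close> of functions
  supported in distinct members of \<open>\<V>\<close> would satisfy \<open>\<mu> n F = n\<close> for a sequence in \<open>T\<close>.\<close>

lemma pointwise_bounded_sees_finite:
  assumes lf: "locally_finite_in M \<V>" and T: "pointwise_bounded T"
  shows "finite {V\<in>\<V>. \<exists>\<mu>\<in>T. sees \<mu> V}"
proof (rule ccontr)
  define Z where "Z = {V\<in>\<V>. \<exists>\<mu>\<in>T. sees \<mu> V}"
  assume "infinite {V\<in>\<V>. \<exists>\<mu>\<in>T. sees \<mu> V}"
  then have inf: "infinite Z" by (simp add: Z_def)
  have TX: "T \<subseteq> CM'" using T by (simp add: pointwise_bounded_def)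
  have "\<forall>V\<in>Z. \<exists>\<mu>. \<mu> \<in> T \<and> sees \<mu> V" unfolding Z_def by blast
  then obtain \<mu> where mu: "\<And>V. V \<in> Z \<Longrightarrow> \<mu> V \<in> T" "\<And>V. V \<in> Z \<Longrightarrow> sees (\<mu> V) V" by metis
  have "\<forall>V\<in>Z. \<exists>f. f \<in> C \<and> (\<forall>t\<in>topspace M - V. f t = 0) \<and> \<mu> V f \<noteq> 0"
    using mu(2) unfolding sees_def by blast
  from bchoice[OF this] obtain f where f: "\<And>V. V \<in> Z \<Longrightarrow> f V \<in> C" "\<And>V t. V \<in> Z \<Longrightarrow> t \<in> topspace M - V \<Longrightarrow> f V t = 0"
    "\<And>V. V \<in> Z \<Longrightarrow> \<mu> V (f V) \<noteq> 0" by blast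
  \<comment> \<open>Each earlier functional sees only finitely many members of \<open>\<V>\<close>,
    so the next set can be chosen unseen by all of them. The matrix of the values
    \<open>\<nu> n (g k)\<close> is then triangular with nonzero diagonal.\<close>
  define P where "P W n V \<longleftrightarrow> V \<in> Z \<and> (\<forall>k<n. \<not> sees (\<mu> (W k)) V)"
    for W :: "nat \<Rightarrow> 'm set" and n V
  have "\<exists>W. \<forall>n. P W n (W n)"
  proof (rule dependent_wellorder_choice)
    show "P W n V = P W' n V" if "\<And>k. k < n \<Longrightarrow> W k = W' k" for V W W' n
      unfolding P_def using that by simp
  next
    fix n :: nat and W assume W: "\<And>k. k < n \<Longrightarrow> P W k (W k)"
    have "finite (\<Union>k\<in>{..<n}. {V\<in>\<V>. sees (\<mu> (W k)) V})"
    proof (intro finite_UN_I)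
      fix k assume "k \<in> {..<n}"
      then have "W k \<in> Z" using W unfolding P_def by blast
      then show "finite {V\<in>\<V>. sees (\<mu> (W k)) V}" using sees_finite[OF lf] mu(1) TX by blast
    qed simp
    then have "Z - (\<Union>k\<in>{..<n}. {V\<in>\<V>. sees (\<mu> (W k)) V}) \<noteq> {}"
      using inf Diff_infinite_finite infinite_imp_nonempty by blast
    then obtain V where "V \<in> Z" "V \<notin> (\<Union>k\<in>{..<n}. {V\<in>\<V>. sees (\<mu> (W k)) V})" by blast
    moreover have "V \<in> \<V>" using \<open>V \<in> Z\<close> by (simp add: Z_def)
    ultimately have "P W n V" unfolding P_def by blast
    then show "\<exists>V. P W n V" by blast
  qed
  then obtain W where W: "\<And>n. P W n (W n)" by blast
  have WZ: "W n \<in> Z" for n using W[of n] unfolding P_def by blast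
  have Wn: "\<not> sees (\<mu> (W k)) (W n)" if "k < n" for k n using W[of n] that unfolding P_def by blast
  have inj: "inj W"
  proof (rule linorder_injI)
    fix k n :: nat assume "k < n"
    then show "W k \<noteq> W n" using Wn mu(2)[OF WZ[of k]] by metis
  qed
  define g where "g n = f (W n)" for n
  define \<nu> where "\<nu> n = \<mu> (W n)" for n
  have nuT: "\<nu> n \<in> T" for n unfolding \<nu>_def using mu(1) WZ by blast
  have g: "g n \<in> C" "\<And>t. t \<in> topspace M - W n \<Longrightarrow> g n t = 0" "\<nu> n (g n) \<noteq> 0" for n
    unfolding g_def \<nu>_def using f WZ by blast+
  have goff: "\<forall>t\<in>topspace M - W n. g n t = 0" for n using g(2) by blast
  have off: "\<nu> k (g n) = 0" if "k < n" for k n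
  proof -
    have "\<not> sees (\<nu> k) (W n)" unfolding \<nu>_def by (rule Wn[OF that])
    then show ?thesis unfolding sees_def using g(1)[of n] goff[of n] by blast
  qed
  \<comment> \<open>Row \<open>n\<close> of the triangular system with right-hand side
    \<open>n\<close>, solved for its last coefficient.\<close>
  define Q where "Q c n r \<longleftrightarrow> r * \<nu> n (g n) + (\<Sum>k<n. c k * \<nu> n (g k)) = of_nat n"
    for c :: "nat \<Rightarrow> complex" and n r
  have "\<exists>c. \<forall>n. Q c n (c n)"
  proof (rule dependent_wellorder_choice)
    fix r and c d :: "nat \<Rightarrow> complex" and n :: nat assume "\<And>k. k < n \<Longrightarrow> c k = d k"
    then have "(\<Sum>k<n. c k * \<nu> n (g k)) = (\<Sum>k<n. d k * \<nu> n (g k))" by (intro sum.cong) auto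
    then show "Q c n r = Q d n r" by (simp add: Q_def)
  next
    fix n :: nat and c :: "nat \<Rightarrow> complex"
    have "Q c n ((of_nat n - (\<Sum>k<n. c k * \<nu> n (g k))) / \<nu> n (g n))"
      using g(3)[of n] by (simp add: Q_def)
    then show "\<exists>r. Q c n r" by blast
  qed
  then obtain c where c: "\<And>n. Q c n (c n)" by blast
  have WV: "W n \<in> \<V>" for n using WZ[of n] by (simp add: Z_def)
  from locally_finite_combination[OF lf inj WV g(1) goff, of c]
  obtain F where F: "F \<in> C" "\<forall>K. compactin M K \<longrightarrow>
    (\<exists>I0. finite I0 \<and> (\<forall>I. finite I \<longrightarrow> I0 \<subseteq> I \<longrightarrow> (\<forall>t\<in>K. F t = (\<Sum>k\<in>I. c k * g k t))))"
    by (elim bexE)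
  have val: "\<nu> n F = of_nat n" for n
  proof -
    have nu: "\<nu> n \<in> CM'" using nuT TX by blast
    obtain K B where K: "compactin M K" "B > 0" "carried_by (\<nu> n) K B" using functional_carried[OF nu] .
    have KM: "K \<subseteq> topspace M" using K(1) by (rule compactin_subset_topspace)
    obtain I0 where I0: "finite I0" "\<forall>I. finite I \<longrightarrow> I0 \<subseteq> I \<longrightarrow> (\<forall>t\<in>K. F t = (\<Sum>k\<in>I. c k * g k t))"
      using F(2)[THEN spec, THEN mp, OF K(1)] by (elim exE conjE)
    \<comment> \<open>The index set is enlarged to contain the complete row \<open>n\<close>; the
      terms with larger index are annihilated by \<open>\<nu> n\<close>.\<close>
    let ?I = "I0 \<union> {..n}"
    have I: "finite ?I" using I0 by simp
    have "\<nu> n F = \<nu> n (\<lambda>t\<in>topspace M. \<Sum>k\<in>?I. c k * g k t)"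
    proof (rule carried_by_eq[OF nu K(3,2) KM F(1)])
      show "(\<lambda>t\<in>topspace M. \<Sum>k\<in>?I. c k * g k t) \<in> C" by (rule sum_in_continuous_functions[OF I g(1)])
      show "F t = (\<lambda>t\<in>topspace M. \<Sum>k\<in>?I. c k * g k t) t" if "t \<in> K" for t
        using I0(2)[rule_format, OF I _ that] that KM by auto
    qed
    also have "\<dots> = (\<Sum>k\<in>?I. c k * \<nu> n (g k))" by (rule functional_sum[OF nu I g(1)])
    also have "\<dots> = (\<Sum>k\<in>{..n}. c k * \<nu> n (g k))"
      using I off by (intro sum.mono_neutral_right) auto
    also have "\<dots> = of_nat n" using c[of n] by (simp add: Q_def lessThan_Suc_atMost[symmetric] add.commute)
    finally show ?thesis .
  qed
  obtain B where B: "\<And>\<mu>. \<mu> \<in> T \<Longrightarrow> cmod (\<mu> F) \<le> B" using T F(1) unfolding pointwise_bounded_def by blast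
  obtain n where "B < real n" using reals_Archimedean2 by blast
  moreover have "real n \<le> B" using B[OF nuT[of n]] unfolding val by simp
  ultimately show False by simp
qed

text \<open>The cover by open sets with compact hulls is refined to a locally finite one, of which
  \<open>T\<close> sees only finitely many members; the union of their compact hulls is
  \<open>K\<close>. A function \<open>f\<close> that vanishes on \<open>K\<close> is cut into pieces
  \<open>h j\<close>, each supported in one member. If \<open>\<mu>\<close> did not annihilate a
  piece, that member would be seen and hence lie in \<open>K\<close>, where the piece
  vanishes.\<close>

lemma pointwise_bounded_compact_carrier:
  assumes lc: "locally_compact_space M" and pc: "paracompact_space M" and T: "pointwise_bounded T"
  obtains K where "compactin M K" "\<forall>\<mu>\<in>T. \<forall>f\<in>C. (\<forall>t\<in>K. f t = 0) \<longrightarrow> \<mu> f = 0"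
proof -
  have M: "completely_regular_space M"
    using lc pc by (intro locally_compact_regular_imp_completely_regular_space) (simp_all add: paracompact_space_def)
  define \<U> where "\<U> = {U. openin M U \<and> (\<exists>K. compactin M K \<and> U \<subseteq> K)}"
  have "\<Union>\<U> = topspace M"
  proof
    show "\<Union>\<U> \<subseteq> topspace M" unfolding \<U>_def using openin_subset by blast
    show "topspace M \<subseteq> \<Union>\<U>" unfolding \<U>_def using lc unfolding locally_compact_space_def by blast
  qed
  then have U: "(\<forall>U\<in>\<U>. openin M U) \<and> \<Union>\<U> = topspace M" by (simp add: \<U>_def)
  obtain \<V> where V: "\<forall>V\<in>\<V>. openin M V" "\<Union>\<V> = topspace M" "\<forall>V\<in>\<V>. \<exists>U\<in>\<U>. V \<subseteq> U"
    "locally_finite_in M \<V>"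
    using pc[unfolded paracompact_space_def, THEN conjunct2, THEN spec, THEN mp, OF U] by (elim exE conjE)
  have "\<forall>V\<in>\<V>. \<exists>K. compactin M K \<and> V \<subseteq> K"
  proof
    fix V assume "V \<in> \<V>"
    then obtain U where U: "U \<in> \<U>" "V \<subseteq> U" using V(3) by blast
    then have "\<exists>K. compactin M K \<and> U \<subseteq> K" by (simp add: \<U>_def)
    then show "\<exists>K. compactin M K \<and> V \<subseteq> K" using U(2) by blast
  qed
  from bchoice[OF this] obtain k where k: "\<And>V. V \<in> \<V> \<Longrightarrow> compactin M (k V)" "\<And>V. V \<in> \<V> \<Longrightarrow> V \<subseteq> k V" by blast
  define Z where "Z = {V\<in>\<V>. \<exists>\<mu>\<in>T. sees \<mu> V}"
  have Z: "finite Z" unfolding Z_def by (rule pointwise_bounded_sees_finite[OF V(4) T])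
  have ZV: "Z \<subseteq> \<V>" by (auto simp: Z_def)
  define K where "K = \<Union>(k ` Z)"
  have KM: "compactin M K" unfolding K_def using Z k(1) ZV by (intro compactin_Union) auto
  have "\<mu> f = 0" if mu: "\<mu> \<in> T" and f: "f \<in> C" "\<forall>t\<in>K. f t = 0" for \<mu> f
  proof -
    have muX: "\<mu> \<in> CM'" using mu T by (auto simp: pointwise_bounded_def)
    obtain L B where L: "compactin M L" "B > 0" "carried_by \<mu> L B" using functional_carried[OF muX] .
    have LM: "L \<subseteq> topspace M" using L(1) by (rule compactin_subset_topspace)
    have "\<forall>x\<in>L. \<exists>V. V \<in> \<V> \<and> x \<in> V" using LM V(2) by blast
    then obtain N where N: "\<And>x. x \<in> L \<Longrightarrow> N x \<in> \<V>" "\<And>x. x \<in> L \<Longrightarrow> x \<in> N x" by metis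
    have "\<exists>J phi. finite J \<and> J \<subseteq> L \<and>
      (\<forall>j\<in>J. continuous_map M euclideanreal (phi j) \<and> (\<forall>t\<in>topspace M. 0 \<le> phi j t) \<and>
         (\<forall>t\<in>topspace M - N j. phi j t = 0)) \<and>
      (\<forall>t\<in>L. (\<Sum>j\<in>J. phi j t) = 1)"
      by (rule finite_partition_of_unity[OF M L(1)]) (use N V(1) in blast)
    then obtain J phi where J: "finite J" "J \<subseteq> L"
      and P: "\<forall>j\<in>J. continuous_map M euclideanreal (phi j) \<and> (\<forall>t\<in>topspace M. 0 \<le> phi j t) \<and>
         (\<forall>t\<in>topspace M - N j. phi j t = 0)" and one: "\<And>t. t \<in> L \<Longrightarrow> (\<Sum>j\<in>J. phi j t) = 1"
      by (elim exE conjE) simp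
    define h where "h j = (\<lambda>t\<in>topspace M. complex_of_real (phi j t) * f t)" for j
    have h: "h j \<in> C" if "j \<in> J" for j
      unfolding h_def using P[rule_format, OF that] continuous_functionsD(1)[OF f(1)]
      by (intro restrict_in_continuous_functions continuous_map_complex_mult continuous_map_of_real) blast+
    have mu0: "\<mu> (h j) = 0" if j: "j \<in> J" for j
    proof (rule ccontr)
      assume nz: "\<mu> (h j) \<noteq> 0"
      have off: "\<forall>t\<in>topspace M - N j. h j t = 0" using P[rule_format, OF j] by (auto simp: h_def)
      then have "sees \<mu> (N j)" unfolding sees_def using h[OF j] nz by blast
      moreover have NV: "N j \<in> \<V>" using N j J by blast
      ultimately have "N j \<in> Z" unfolding Z_def using mu by blast
      then have "N j \<subseteq> K" unfolding K_def using k(2)[OF NV] by blast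
      have "h j t = 0" if "t \<in> topspace M" for t
      proof (cases "t \<in> N j")
        case True
        then show ?thesis using \<open>N j \<subseteq> K\<close> f(2) that by (auto simp: h_def)
      qed (use off that in blast)
      then have "\<mu> (h j) = 0" using LM by (intro functional_vanishes[OF muX L(3,2) LM h[OF j]]) blast
      then show False using nz by simp
    qed
    have "\<mu> f = \<mu> (\<lambda>t\<in>topspace M. \<Sum>j\<in>J. 1 * h j t)"
    proof (rule carried_by_eq[OF muX L(3,2) LM f(1)])
      show "(\<lambda>t\<in>topspace M. \<Sum>j\<in>J. 1 * h j t) \<in> C" by (rule sum_in_continuous_functions[OF J(1) h])
      show "f t = (\<lambda>t\<in>topspace M. \<Sum>j\<in>J. 1 * h j t) t" if t: "t \<in> L" for t
      proof -
        have tM: "t \<in> topspace M" using t LM by blast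
        have "(\<Sum>j\<in>J. 1 * h j t) = complex_of_real (\<Sum>j\<in>J. phi j t) * f t"
          using tM by (simp add: h_def sum_distrib_right)
        then show ?thesis using one[OF t] tM by simp
      qed
    qed
    also have "\<dots> = (\<Sum>j\<in>J. 1 * \<mu> (h j))" by (rule functional_sum[OF muX J(1) h])
    also have "\<dots> = 0" using mu0 by simp
    finally show ?thesis .
  qed
  then show thesis using that[OF KM] by blast
qed

text \<open>The uniform boundedness principle on the Banach space of bounded functions in \<open>C\<close>.\<close>

lemma pointwise_bounded_uniformly_bounded:
  assumes T: "pointwise_bounded T"
  obtains B where "B > 0" "\<forall>\<mu>\<in>T. \<forall>f\<in>C. (\<forall>t\<in>topspace M. cmod (f t) \<le> 1) \<longrightarrow> cmod (\<mu> f) \<le> B"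
proof -
  have TX: "T \<subseteq> CM'" using T by (simp add: pointwise_bounded_def)
  define m where "m = cfunspace M (euclidean_metric :: complex metric)"
  have mC: "f \<in> C" if "f \<in> mspace m" for f
    using that unfolding m_def continuous_functions_def by simp
  have Cm: "f \<in> mspace m" if "f \<in> C" "\<And>t. t \<in> topspace M \<Longrightarrow> cmod (f t) \<le> b" for f b
  proof -
    have "bounded (f ` topspace M)" using that(2) by (intro boundedI[of _ b]) auto
    then show ?thesis using that(1) unfolding m_def by (simp add: continuous_functions_def)
  qed
  interpret F: Metric_space "mspace m" "mdist m" by (rule Metric_space_mspace_mdist)
  have "Metric_space.mcomplete (UNIV::complex set) dist" using complete_UNIV by simp
  from Metric_space.mcomplete_cfunspace[OF Met_TC.Metric_space_axioms this, of M]
  have comp: "F.mcomplete" by (simp add: mcomplete_of_def m_def euclidean_metric_def Metric_space.Self_def[OF Met_TC.Metric_space_axioms])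
  \<comment> \<open>The sets for Baire's theorem: closed, because every functional is continuous for
    the uniform metric, and exhausting the space by pointwise boundedness.\<close>
  define E where "E n = {f\<in>mspace m. \<forall>\<mu>\<in>T. cmod (\<mu> f) \<le> real n}" for n
  have dist_le: "cmod (f t - g t) \<le> mdist m f g" if "f \<in> mspace m" "g \<in> mspace m" "t \<in> topspace M" for f g t
    using mdist_cfunspace_imp_mdist_le[of f M euclidean_metric g "mdist m f g" t] that
    unfolding m_def by (simp add: dist_norm)
  have closed: "closedin F.mtopology (E n)" for n
    unfolding closedin_def F.topspace_mtopology
  proof
    show "E n \<subseteq> mspace m" by (auto simp: E_def)
    show "openin F.mtopology (mspace m - E n)"
      unfolding F.openin_mtopology
    proof (intro conjI allI impI)
      fix f assume "f \<in> mspace m - E n"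
      then obtain \<mu> where mu: "\<mu> \<in> T" "cmod (\<mu> f) > real n" and fm: "f \<in> mspace m" unfolding E_def by force
      have muX: "\<mu> \<in> CM'" using mu TX by blast
      obtain K B where K: "compactin M K" "B > 0" "carried_by \<mu> K B" using functional_carried[OF muX] .
      have KM: "K \<subseteq> topspace M" using K(1) by (rule compactin_subset_topspace)
      define r where "r = (cmod (\<mu> f) - real n) / (2 * B)"
      have r: "r > 0" "B * r < cmod (\<mu> f) - real n" using mu K(2) by (auto simp: r_def)
      have "F.mball f r \<subseteq> mspace m - E n"
      proof
        fix g assume "g \<in> F.mball f r"
        then have g: "g \<in> mspace m" "mdist m f g < r" by auto
        let ?h = "\<lambda>t\<in>topspace M. f t - g t"
        have h: "?h \<in> C" using mC[OF fm] mC[OF g(1)] by (rule continuous_functions_diff)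
        have "\<forall>t\<in>K. cmod (?h t) \<le> r"
        proof
          fix t assume "t \<in> K"
          then have t: "t \<in> topspace M" using KM by blast
          then show "cmod (?h t) \<le> r" using dist_le[OF fm g(1) t] g(2) by simp
        qed
        then have "cmod (\<mu> ?h) \<le> B * r" using K(3) h r(1) unfolding carried_by_def by blast
        then have "cmod (\<mu> f - \<mu> g) \<le> B * r" using functional_fdiff[OF muX mC[OF fm] mC[OF g(1)]] by simp
        then have "cmod (\<mu> g) > real n" using r(2) norm_triangle_ineq2[of "\<mu> f" "\<mu> g"] by linarith
        then show "g \<in> mspace m - E n" using g(1) mu(1) unfolding E_def by force
      qed
      then show "\<exists>r>0. F.mball f r \<subseteq> mspace m - E n" using r(1) by blast
    qed blast
  qed
  have zm: "(\<lambda>t\<in>topspace M. 0) \<in> mspace m" by (rule Cm[OF const_in_continuous_functions, of _ 0]) simp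
  have UE: "\<Union>(range E) = mspace m"
  proof
    show "mspace m \<subseteq> \<Union>(range E)"
    proof
      fix f assume f: "f \<in> mspace m"
      obtain b where "\<forall>\<mu>\<in>T. cmod (\<mu> f) \<le> b" using T mC[OF f] unfolding pointwise_bounded_def by blast
      moreover obtain n where "b < real n" using reals_Archimedean2 by blast
      ultimately have "f \<in> E n" unfolding E_def using f by force
      then show "f \<in> \<Union>(range E)" by blast
    qed
  qed (auto simp: E_def)
  have "\<exists>n. F.mtopology interior_of (E n) \<noteq> {}"
  proof (rule ccontr)
    assume "\<not> ?thesis"
    then have "F.mtopology interior_of \<Union>(range E) = {}"
      by (intro F.metric_Baire_category_alt comp) (auto simp: closed)
    moreover have "F.mtopology interior_of (mspace m) = mspace m"
      using interior_of_topspace[of F.mtopology] by simp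
    ultimately show False using zm UE by auto
  qed
  then obtain n f0 where "f0 \<in> F.mtopology interior_of (E n)" by blast
  then obtain I where I: "openin F.mtopology I" "f0 \<in> I" "I \<subseteq> E n" unfolding interior_of_def by blast
  then obtain r where r: "r > 0" "F.mball f0 r \<subseteq> E n" unfolding F.openin_mtopology by (meson order_trans)
  have f0: "f0 \<in> mspace m" "f0 \<in> E n" using I by (auto simp: E_def)
  \<comment> \<open>Both \<open>f0\<close> and \<open>f0 + (r/2) g\<close> belong to
    \<open>E n\<close>, so \<open>\<mu>\<close> is bounded by \<open>2 n\<close> on their difference
    \<open>(r/2) g\<close>. Half the radius keeps the second function strictly inside the
    ball.\<close>
  have "cmod (\<mu> g) \<le> 4 * real n / r" if mu: "\<mu> \<in> T" and g: "g \<in> C" "\<forall>t\<in>topspace M. cmod (g t) \<le> 1" for \<mu> g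
  proof -
    have muX: "\<mu> \<in> CM'" using mu TX by blast
    let ?g = "\<lambda>t\<in>topspace M. complex_of_real (r/2) * g t"
    let ?h = "\<lambda>t\<in>topspace M. f0 t + ?g t"
    have gC: "?g \<in> C" using g(1) by (rule continuous_functions_smult)
    have hC: "?h \<in> C" using mC[OF f0(1)] gC by (rule continuous_functions_add)
    have gb: "cmod (?g t) \<le> r/2" if "t \<in> topspace M" for t
      using that g(2) r(1) by (simp add: norm_mult mult_left_le)
    obtain b where b: "\<And>t. t \<in> topspace M \<Longrightarrow> cmod (f0 t) \<le> b"
      using dist_le[OF f0(1) zm] by (metis (no_types, lifting) diff_zero restrict_apply')
    have hm: "?h \<in> mspace m"
    proof (rule Cm[OF hC])
      fix t assume t: "t \<in> topspace M"
      have "cmod (f0 t + ?g t) \<le> cmod (f0 t) + cmod (?g t)" by (rule norm_triangle_ineq)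
      then show "cmod (?h t) \<le> b + r/2" using b[OF t] gb[OF t] t by simp
    qed
    have "mdist m f0 ?h \<le> r/2"
      unfolding m_def
    proof (rule mdist_cfunspace_le)
      fix t assume t: "t \<in> topspace M"
      have "dist (f0 t) (?h t) = cmod (?g t)" using t by (simp add: dist_norm)
      then show "mdist euclidean_metric (f0 t) (?h t) \<le> r/2" using gb[OF t] by simp
    qed (use r in simp)
    then have "?h \<in> F.mball f0 r" using f0(1) hm r(1) by simp
    then have "?h \<in> E n" using r(2) by blast
    then have "cmod (\<mu> ?h) \<le> real n" using mu by (simp add: E_def)
    moreover have "cmod (\<mu> f0) \<le> real n" using f0(2) mu by (simp add: E_def)
    moreover have "\<mu> ?h = \<mu> f0 + \<mu> ?g" by (rule functional_add[OF muX mC[OF f0(1)] gC])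
    moreover have "cmod (\<mu> ?g) = r/2 * cmod (\<mu> g)"
      using functional_smult[OF muX g(1), of "complex_of_real (r/2)"] r(1)
      by (simp only: norm_mult norm_of_real)
    ultimately have "r/2 * cmod (\<mu> g) \<le> 2 * real n"
      using norm_triangle_ineq4[of "\<mu> f0 + \<mu> ?g" "\<mu> f0"] by simp
    then show ?thesis using r(1) by (simp add: field_simps)
  qed
  \<comment> \<open>The summand \<open>1\<close> keeps the constant positive when
    \<open>n = 0\<close>.\<close>
  then have "cmod (\<mu> f) \<le> 4 * real n / r + 1"
    if "\<mu> \<in> T" "f \<in> C" "\<forall>t\<in>topspace M. cmod (f t) \<le> 1" for \<mu> f using that by fastforce
  then have "\<forall>\<mu>\<in>T. \<forall>f\<in>C. (\<forall>t\<in>topspace M. cmod (f t) \<le> 1) \<longrightarrow> cmod (\<mu> f) \<le> 4 * real n / r + 1"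
    by blast
  moreover have "4 * real n / r + 1 > 0" using r(1) by (simp add: add_nonneg_pos)
  ultimately show thesis using that by blast
qed

text \<open>In effect \<open>C(M)\<close> is barrelled. On the compact carrier \<open>f\<close>
  agrees with \<open>b\<close> times its radial truncation \<open>g\<close>, and \<open>g\<close> is
  bounded by one on all of \<open>M\<close>, where the uniform bound applies.\<close>

lemma pointwise_bounded_equicontinuous:
  assumes lc: "locally_compact_space M" and pc: "paracompact_space M" and T: "pointwise_bounded T"
  obtains K B where "compactin M K" "B > 0" "\<forall>\<mu>\<in>T. carried_by \<mu> K B"
proof -
  have TX: "T \<subseteq> CM'" using T by (simp add: pointwise_bounded_def)
  obtain K where K: "compactin M K" "\<forall>\<mu>\<in>T. \<forall>f\<in>C. (\<forall>t\<in>K. f t = 0) \<longrightarrow> \<mu> f = 0"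
    using pointwise_bounded_compact_carrier[OF lc pc T] .
  obtain B where B: "B > 0" "\<forall>\<mu>\<in>T. \<forall>f\<in>C. (\<forall>t\<in>topspace M. cmod (f t) \<le> 1) \<longrightarrow> cmod (\<mu> f) \<le> B"
    using pointwise_bounded_uniformly_bounded[OF T] .
  have KM: "K \<subseteq> topspace M" using K(1) by (rule compactin_subset_topspace)
  have "cmod (\<mu> f) \<le> B * b" if mu: "\<mu> \<in> T" and f: "f \<in> C" and b: "b > 0" "\<forall>t\<in>K. cmod (f t) \<le> b" for \<mu> f b
  proof -
    have muX: "\<mu> \<in> CM'" using mu TX by blast
    define g where "g = (\<lambda>t\<in>topspace M. complex_of_real (inverse (max b (cmod (f t)))) * f t)"
    have pos: "max b (cmod (f t)) > 0" for t using b(1) by simp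
    have "continuous_map M euclideanreal (\<lambda>t. max b (cmod (f t)))"
      using continuous_functionsD(1)[OF f] by (intro continuous_map_real_max continuous_map_norm) auto
    then have "continuous_map M euclideanreal (\<lambda>t. inverse (max b (cmod (f t))))"
      by (intro continuous_map_real_inverse) (use pos in \<open>simp_all add: less_imp_neq[symmetric]\<close>)
    then have g: "g \<in> C"
      unfolding g_def using continuous_functionsD(1)[OF f]
      by (intro restrict_in_continuous_functions continuous_map_complex_mult continuous_map_of_real)
    have "cmod (g t) \<le> 1" if t: "t \<in> topspace M" for t
    proof -
      have "cmod (g t) = inverse (max b (cmod (f t))) * cmod (f t)"
        using t pos[of t] by (simp only: g_def restrict_apply' norm_mult norm_of_real) simp
      also have "\<dots> \<le> inverse (max b (cmod (f t))) * max b (cmod (f t))"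
        using pos[of t] by (intro mult_left_mono) auto
      also have "\<dots> = 1" using pos[of t] by simp
      finally show ?thesis .
    qed
    then have le: "cmod (\<mu> g) \<le> B" using B(2) mu g by blast
    let ?bg = "\<lambda>t\<in>topspace M. complex_of_real b * g t"
    have bg: "?bg \<in> C" using g by (rule continuous_functions_smult)
    let ?h = "\<lambda>t\<in>topspace M. f t - ?bg t"
    have h: "?h \<in> C" using f bg by (rule continuous_functions_diff)
    have "\<forall>t\<in>K. ?h t = 0"
    proof
      fix t assume t: "t \<in> K"
      then have "max b (cmod (f t)) = b" using b by simp
      then have "?bg t = f t" using t KM b(1) by (auto simp: g_def)
      then show "?h t = 0" using t KM by auto
    qed
    then have "\<mu> ?h = 0" using K(2) mu h by blast
    then have "\<mu> f = \<mu> ?bg" using functional_fdiff[OF muX f bg] by simp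
    also have "\<dots> = complex_of_real b * \<mu> g" by (rule functional_smult[OF muX g])
    finally have "cmod (\<mu> f) = b * cmod (\<mu> g)" using b(1) by (simp add: norm_mult)
    also have "\<dots> \<le> b * B" using le b(1) by simp
    finally show ?thesis by (simp add: mult.commute)
  qed
  then have "\<forall>\<mu>\<in>T. carried_by \<mu> K B" unfolding carried_by_def by blast
  then show thesis using that[OF K(1) B(1)] by blast
qed

lemma stereotype_function_algebra:
  assumes lc: "locally_compact_space M" and pc: "paracompact_space M"
  shows "stereotype CM"
proof (rule stereotypeI)
  have M: "completely_regular_space M"
    using lc pc by (intro locally_compact_regular_imp_completely_regular_space) (simp_all add: paracompact_space_def)
  show "f = g" if fg: "f \<in> carrier CM" "g \<in> carrier CM" "\<forall>\<mu>\<in>CM'. \<mu> f = \<mu> g" for f g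
  proof (rule continuous_functions_eqI)
    fix t assume "t \<in> topspace M"
    then have "eval_functional t f = eval_functional t g" using fg(3) eval_functional_in by blast
    then show "f t = g t" using fg(1,2) by simp
  qed (use fg in auto)
  show "\<exists>f\<in>carrier CM. \<forall>\<mu>\<in>CM'. F \<mu> = \<mu> f"
    if "F \<in> continuous_functionals (dual_space CM)" for F
    using bidual_representation[OF lc M that] by simp
  show "\<exists>U. zero_nbhd CM U \<and> (\<forall>f\<in>U. \<forall>\<mu>\<in>T. cmod (\<mu> f) < 1)" if TB: "totally_bounded_in (dual_space CM) T" for T
  proof -
    have "\<exists>B. \<forall>\<mu>\<in>T. cmod (\<mu> f) \<le> B" if "f \<in> C" for f
    proof -
      have "f \<in> carrier CM" using that by simp
      from totally_bounded_dual_pointwise[OF TB this] show ?thesis by metis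
    qed
    moreover have "T \<subseteq> CM'" using TB by (simp add: totally_bounded_in_def)
    ultimately have "pointwise_bounded T" unfolding pointwise_bounded_def by blast
    then obtain K B where K: "compactin M K" "B > 0" "\<forall>\<mu>\<in>T. carried_by \<mu> K B"
      using pointwise_bounded_equicontinuous[OF lc pc] by blast
    define b where "b = 1 / (2 * B)"
    have b: "b > 0" "B * b < 1" using K(2) by (auto simp: b_def)
    have "cmod (\<mu> f) < 1" if f: "f \<in> C" "\<forall>t\<in>K. cmod (f t) < b" and mu: "\<mu> \<in> T" for f \<mu>
    proof -
      have "\<forall>t\<in>K. cmod (f t) \<le> b" using f(2) by (simp add: less_imp_le)
      then have "cmod (\<mu> f) \<le> B * b" using K(3) mu f(1) b(1) unfolding carried_by_def by blast
      then show ?thesis using b(2) by simp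
    qed
    then show ?thesis
      using zero_nbhd_ball[OF K(1) b(1)] by (intro exI[of _ "{f\<in>C. \<forall>t\<in>K. cmod (f t) < b}"]) simp
  qed
  show "\<exists>T e. totally_bounded_in (dual_space CM) T \<and> e > 0 \<and>
      (\<forall>f\<in>carrier CM. (\<forall>\<mu>\<in>T. cmod (\<mu> f) < e) \<longrightarrow> f \<in> U)" if U: "zero_nbhd CM U" for U
  proof -
    obtain K e where K: "compactin M K" "e > 0" "\<And>g. g \<in> C \<Longrightarrow> (\<forall>t\<in>K. cmod (g t) < e) \<Longrightarrow> g \<in> U"
      using U unfolding zero_nbhd_function_algebra by blast
    have "f \<in> U" if f: "f \<in> carrier CM" "\<forall>\<mu>\<in>eval_functional ` K. cmod (\<mu> f) < e" for f
      using f by (intro K(3)) auto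
    then show ?thesis using eval_functionals_totally_bounded[OF K(1)] K(2) by blast
  qed
qed

end

subsection \<open>Transport along isomorphisms\<close>

text \<open>Keeping both maps makes the relation symmetric, so one proof serves both directions. The
  clauses about zero let it be used for dual spaces without first establishing their module
  laws.\<close>

definition lcs_inverse_isos ::
    "('a, 'm) lcs_scheme \<Rightarrow> ('b, 'n) lcs_scheme \<Rightarrow> ('a \<Rightarrow> 'b) \<Rightarrow> ('b \<Rightarrow> 'a) \<Rightarrow> bool" where
  "lcs_inverse_isos X Y f g \<longleftrightarrow>
     topspace (topol X) = carrier X \<and> topspace (topol Y) = carrier Y \<and>
     linear_on X Y f \<and> linear_on Y X g \<and>
     \<zero>\<^bsub>X\<^esub> \<in> carrier X \<and> \<zero>\<^bsub>Y\<^esub> \<in> carrier Y \<and> f \<zero>\<^bsub>X\<^esub> = \<zero>\<^bsub>Y\<^esub> \<and> g \<zero>\<^bsub>Y\<^esub> = \<zero>\<^bsub>X\<^esub> \<and>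
     (\<forall>x\<in>carrier X. g (f x) = x) \<and> (\<forall>y\<in>carrier Y. f (g y) = y) \<and>
     continuous_map (topol X) (topol Y) f \<and> continuous_map (topol Y) (topol X) g"

lemma lcs_inverse_isos_sym: "lcs_inverse_isos X Y f g \<longleftrightarrow> lcs_inverse_isos Y X g f"
  unfolding lcs_inverse_isos_def by blast

lemma lcs_inverse_isosD:
  assumes "lcs_inverse_isos X Y f g"
  shows "topspace (topol X) = carrier X" "topspace (topol Y) = carrier Y"
    "\<And>x. x \<in> carrier X \<Longrightarrow> f x \<in> carrier Y" "\<And>y. y \<in> carrier Y \<Longrightarrow> g y \<in> carrier X"
    "\<And>x. x \<in> carrier X \<Longrightarrow> g (f x) = x" "\<And>y. y \<in> carrier Y \<Longrightarrow> f (g y) = y"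
    "\<And>x y. x \<in> carrier X \<Longrightarrow> y \<in> carrier X \<Longrightarrow> f (x \<oplus>\<^bsub>X\<^esub> y) = f x \<oplus>\<^bsub>Y\<^esub> f y"
    "\<And>x y. x \<in> carrier Y \<Longrightarrow> y \<in> carrier Y \<Longrightarrow> g (x \<oplus>\<^bsub>Y\<^esub> y) = g x \<oplus>\<^bsub>X\<^esub> g y"
    "\<And>c x. x \<in> carrier X \<Longrightarrow> f (c \<odot>\<^bsub>X\<^esub> x) = c \<odot>\<^bsub>Y\<^esub> f x"
    "\<And>c x. x \<in> carrier Y \<Longrightarrow> g (c \<odot>\<^bsub>Y\<^esub> x) = c \<odot>\<^bsub>X\<^esub> g x"
    "continuous_map (topol X) (topol Y) f" "continuous_map (topol Y) (topol X) g"
  using assms unfolding lcs_inverse_isos_def linear_on_def by (simp_all add: Pi_iff)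

lemma zero_nbhd_image:
  assumes i: "lcs_inverse_isos X Y f g" and U: "zero_nbhd X U"
  shows "zero_nbhd Y (f ` U)"
proof -
  note I = lcs_inverse_isosD[OF i]
  obtain W where W: "openin (topol X) W" "\<zero>\<^bsub>X\<^esub> \<in> W" "W \<subseteq> U" and UX: "U \<subseteq> carrier X"
    using U unfolding zero_nbhd_def by blast
  have "openin (topol Y) {y\<in>topspace (topol Y). g y \<in> W}"
    by (rule openin_continuous_map_preimage[OF I(12) W(1)])
  moreover have "\<zero>\<^bsub>Y\<^esub> \<in> {y\<in>topspace (topol Y). g y \<in> W}"
    using i W(2) unfolding lcs_inverse_isos_def by simp
  moreover have "{y\<in>topspace (topol Y). g y \<in> W} \<subseteq> f ` U"
  proof
    fix y assume "y \<in> {y\<in>topspace (topol Y). g y \<in> W}"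
    then have "y = f (g y)" "g y \<in> U" using I(2,6) W(3) by auto
    then show "y \<in> f ` U" by (rule image_eqI)
  qed
  moreover have "f ` U \<subseteq> carrier Y" using UX I(3) by blast
  ultimately show ?thesis unfolding zero_nbhd_def by blast
qed

lemma totally_bounded_image:
  assumes i: "lcs_inverse_isos X Y f g" and S: "totally_bounded_in X S"
  shows "totally_bounded_in Y (f ` S)"
  unfolding totally_bounded_in_def
proof (intro conjI allI impI)
  note I = lcs_inverse_isosD[OF i]
  show "f ` S \<subseteq> carrier Y" using S I(3) by (auto simp: totally_bounded_in_def)
  fix V assume V: "zero_nbhd Y V"
  have VY: "V \<subseteq> carrier Y" using V by (simp add: zero_nbhd_def)
  have gV: "zero_nbhd X (g ` V)" by (rule zero_nbhd_image[OF lcs_inverse_isos_sym[THEN iffD1, OF i] V])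
  obtain F where F: "finite F" "F \<subseteq> carrier X" "S \<subseteq> F <+>\<^bsub>X\<^esub> (g ` V)"
    using S gV unfolding totally_bounded_in_def by meson
  have "f ` S \<subseteq> f ` F <+>\<^bsub>Y\<^esub> V"
  proof
    fix y assume "y \<in> f ` S"
    then obtain s where s: "s \<in> S" "y = f s" by blast
    then have "s \<in> F <+>\<^bsub>X\<^esub> (g ` V)" using F(3) by blast
    then obtain a v where av: "a \<in> F" "v \<in> V" "s = a \<oplus>\<^bsub>X\<^esub> g v" unfolding mem_set_add_iff by blast
    have "a \<in> carrier X" "v \<in> carrier Y" using av F(2) VY by auto
    then have "y = f a \<oplus>\<^bsub>Y\<^esub> v" using s(2) av(3) I by simp
    then show "y \<in> f ` F <+>\<^bsub>Y\<^esub> V" unfolding mem_set_add_iff using av by blast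
  qed
  then show "\<exists>F. finite F \<and> F \<subseteq> carrier Y \<and> f ` S \<subseteq> F <+>\<^bsub>Y\<^esub> V"
    using F I(3) by (intro exI[of _ "f ` F"]) auto
qed

definition dual_map :: "('a, 'm) lcs_scheme \<Rightarrow> ('b, 'n) lcs_scheme \<Rightarrow> ('b \<Rightarrow> 'a) \<Rightarrow> ('a \<Rightarrow> complex) \<Rightarrow> 'b \<Rightarrow> complex" where
  "dual_map X Y g = (\<lambda>phi. \<lambda>y\<in>carrier Y. phi (g y))"

lemma dual_map_in:
  assumes i: "lcs_inverse_isos X Y f g" and phi: "phi \<in> continuous_functionals X"
    and closed: "\<And>x y. x \<in> carrier Y \<Longrightarrow> y \<in> carrier Y \<Longrightarrow> x \<oplus>\<^bsub>Y\<^esub> y \<in> carrier Y"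
      "\<And>c x. x \<in> carrier Y \<Longrightarrow> c \<odot>\<^bsub>Y\<^esub> x \<in> carrier Y"
  shows "dual_map X Y g phi \<in> continuous_functionals Y"
proof -
  note I = lcs_inverse_isosD[OF i]
  note P = continuous_functionalsD[OF phi]
  have "continuous_map (topol Y) euclidean (phi \<circ> g)" by (rule continuous_map_compose[OF I(12) P(2)])
  then have "continuous_map (topol Y) euclidean (dual_map X Y g phi)"
    by (rule continuous_map_eq) (simp add: I(2) dual_map_def)
  then show ?thesis unfolding continuous_functionals_def
    by (simp add: dual_map_def closed I P)
qed

lemma dual_map_inverse:
  assumes i: "lcs_inverse_isos X Y f g" and phi: "phi \<in> continuous_functionals X"
  shows "dual_map Y X f (dual_map X Y g phi) = phi"
  using lcs_inverse_isosD[OF i] continuous_functionalsD(1)[OF phi]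
  by (intro extensionalityI[of _ "carrier X"]) (auto simp: dual_map_def)

lemma dual_map_continuous:
  assumes i: "lcs_inverse_isos X Y f g"
    and closed: "\<And>x y. x \<in> carrier Y \<Longrightarrow> y \<in> carrier Y \<Longrightarrow> x \<oplus>\<^bsub>Y\<^esub> y \<in> carrier Y"
      "\<And>c x. x \<in> carrier Y \<Longrightarrow> c \<odot>\<^bsub>Y\<^esub> x \<in> carrier Y"
  shows "continuous_map (topol (dual_space X)) (topol (dual_space Y)) (dual_map X Y g)"
  unfolding dual_space_simps continuous_map_into_uniform
proof (intro conjI ballI allI impI)
  note I = lcs_inverse_isosD[OF i]
  show "dual_map X Y g \<in> topspace (uniform_topology {S. totally_bounded_in X S} (continuous_functionals X))
     \<rightarrow> continuous_functionals Y"
    using dual_map_in[OF i _ closed] by simp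
  fix phi S and e :: real
  assume "phi \<in> topspace (uniform_topology {S. totally_bounded_in X S} (continuous_functionals X))"
    and S: "S \<in> {S. totally_bounded_in Y S}" and e: "e > 0"
  then have phi: "phi \<in> continuous_functionals X" by simp
  have SY: "S \<subseteq> carrier Y" using S by (simp add: totally_bounded_in_def)
  have gS: "totally_bounded_in X (g ` S)"
    by (rule totally_bounded_image[OF lcs_inverse_isos_sym[THEN iffD1, OF i]]) (use S in simp)
  let ?N = "{psi\<in>continuous_functionals X. \<exists>r<e. \<forall>x\<in>\<Union>{g ` S}. dist (psi x) (phi x) \<le> r}"
  show "\<exists>N. openin (uniform_topology {S. totally_bounded_in X S} (continuous_functionals X)) N \<and> phi \<in> N \<and>
     (\<forall>y\<in>N. \<forall>s\<in>S. dist (dual_map X Y g y s) (dual_map X Y g phi s) < e)"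
  proof (intro exI conjI ballI)
    show "openin (uniform_topology {S. totally_bounded_in X S} (continuous_functionals X)) ?N"
      by (rule openin_uniform_ball) (use gS in auto)
    show "phi \<in> ?N" using phi e by (auto intro!: exI[of _ 0])
    fix psi s assume psi: "psi \<in> ?N" and s: "s \<in> S"
    have "dist (psi (g s)) (phi (g s)) < e" using psi s by (auto intro: le_less_trans)
    then show "dist (dual_map X Y g psi s) (dual_map X Y g phi s) < e" using s SY by (auto simp: dual_map_def)
  qed
qed

lemma dual_map_linear:
  assumes X: "complex_lcs X" and Y: "complex_lcs Y" and i: "lcs_inverse_isos X Y f g"
  shows "linear_on (dual_space X) (dual_space Y) (dual_map X Y g)"
proof -
  interpret X: complex_lcs X by (rule X)
  interpret Y: complex_lcs Y by (rule Y)
  note I = lcs_inverse_isosD[OF i]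
  show ?thesis
    unfolding linear_on_def dual_space_simps
  proof (intro conjI ballI allI)
    show "dual_map X Y g \<in> continuous_functionals X \<rightarrow> continuous_functionals Y"
      using dual_map_in[OF i] by blast
    show "dual_map X Y g (\<lambda>x\<in>carrier X. phi x + psi x) = (\<lambda>x\<in>carrier Y. dual_map X Y g phi x + dual_map X Y g psi x)"
      for phi psi unfolding dual_map_def by (rule restrict_ext) (simp add: I(4))
    show "dual_map X Y g (\<lambda>x\<in>carrier X. c * phi x) = (\<lambda>x\<in>carrier Y. c * dual_map X Y g phi x)"
      for phi c unfolding dual_map_def by (rule restrict_ext) (simp add: I(4))
  qed
qed

lemma dual_lcs_inverse_isos:
  assumes X: "complex_lcs X" and Y: "complex_lcs Y" and i: "lcs_inverse_isos X Y f g"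
  shows "lcs_inverse_isos (dual_space X) (dual_space Y) (dual_map X Y g) (dual_map Y X f)"
proof -
  interpret X: complex_lcs X by (rule X)
  interpret Y: complex_lcs Y by (rule Y)
  note I = lcs_inverse_isosD[OF i]
  have i': "lcs_inverse_isos Y X g f" by (rule lcs_inverse_isos_sym[THEN iffD1, OF i])
  have z: "dual_map X Y g (\<lambda>x\<in>carrier X. 0) = (\<lambda>x\<in>carrier Y. 0)"
    "dual_map Y X f (\<lambda>x\<in>carrier Y. 0) = (\<lambda>x\<in>carrier X. 0)"
    unfolding dual_map_def by (rule restrict_ext, simp add: I(3,4))+
  show ?thesis
    unfolding lcs_inverse_isos_def
  proof (intro conjI ballI)
    show "continuous_map (topol (dual_space X)) (topol (dual_space Y)) (dual_map X Y g)"
      by (rule dual_map_continuous[OF i]) auto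
    show "continuous_map (topol (dual_space Y)) (topol (dual_space X)) (dual_map Y X f)"
      by (rule dual_map_continuous[OF i']) auto
    show "linear_on (dual_space X) (dual_space Y) (dual_map X Y g)" by (rule dual_map_linear[OF X Y i])
    show "linear_on (dual_space Y) (dual_space X) (dual_map Y X f)" by (rule dual_map_linear[OF Y X i'])
    show "dual_map Y X f (dual_map X Y g phi) = phi" if "phi \<in> carrier (dual_space X)" for phi
      using dual_map_inverse[OF i] that by simp
    show "dual_map X Y g (dual_map Y X f phi) = phi" if "phi \<in> carrier (dual_space Y)" for phi
      using dual_map_inverse[OF i'] that by simp
    show "\<zero>\<^bsub>dual_space X\<^esub> \<in> carrier (dual_space X)" unfolding dual_space_simps by (rule X.zero_in_continuous_functionals)
    show "\<zero>\<^bsub>dual_space Y\<^esub> \<in> carrier (dual_space Y)" unfolding dual_space_simps by (rule Y.zero_in_continuous_functionals)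
    show "dual_map X Y g \<zero>\<^bsub>dual_space X\<^esub> = \<zero>\<^bsub>dual_space Y\<^esub>" unfolding dual_space_simps by (rule z)
    show "dual_map Y X f \<zero>\<^bsub>dual_space Y\<^esub> = \<zero>\<^bsub>dual_space X\<^esub>" unfolding dual_space_simps by (rule z)
  qed (simp_all only: dual_space_simps topspace_uniform_topology)
qed

text \<open>Naturality of evaluation: the map of \<open>Y\<close> into its bidual is the map of
  \<open>X\<close>, preceded by \<open>g\<close> and followed by the double transpose, and all three
  are homeomorphisms.\<close>

lemma stereotype_transport:
  assumes X: "stereotype X" and Y: "complex_lcs Y" and i: "lcs_inverse_isos X Y f g"
  shows "stereotype Y"
proof -
  have XL: "complex_lcs X" using X by (auto simp: stereotype_def intro: complex_lcsI)
  interpret X: complex_lcs X by (rule XL)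
  interpret Y: complex_lcs Y by (rule Y)
  note I = lcs_inverse_isosD[OF i]
  let ?X = "dual_space X" and ?Y = "dual_space Y"
  let ?f = "dual_map X Y g" and ?g = "dual_map Y X f"
  have d: "lcs_inverse_isos ?X ?Y ?f ?g" by (rule dual_lcs_inverse_isos[OF XL Y i])
  have d': "lcs_inverse_isos ?Y ?X ?g ?f" by (rule lcs_inverse_isos_sym[THEN iffD1, OF d])
  have cX: "x \<in> carrier ?X \<Longrightarrow> y \<in> carrier ?X \<Longrightarrow> x \<oplus>\<^bsub>?X\<^esub> y \<in> carrier ?X"
    "x \<in> carrier ?X \<Longrightarrow> c \<odot>\<^bsub>?X\<^esub> x \<in> carrier ?X" for x y c
    by (simp_all add: X.continuous_functionals_closed)
  have cY: "x \<in> carrier ?Y \<Longrightarrow> y \<in> carrier ?Y \<Longrightarrow> x \<oplus>\<^bsub>?Y\<^esub> y \<in> carrier ?Y"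
    "x \<in> carrier ?Y \<Longrightarrow> c \<odot>\<^bsub>?Y\<^esub> x \<in> carrier ?Y" for x y c
    by (simp_all add: Y.continuous_functionals_closed)
  have F: "homeomorphic_maps (topol (dual_space ?X)) (topol (dual_space ?Y)) (dual_map ?X ?Y ?g) (dual_map ?Y ?X ?f)"
    unfolding homeomorphic_maps_def
    using dual_map_continuous[OF d cY] dual_map_continuous[OF d' cX] dual_map_inverse[OF d] dual_map_inverse[OF d']
    by simp
  have G: "homeomorphic_maps (topol Y) (topol X) g f"
    unfolding homeomorphic_maps_def using I(1,2,5,6,11,12) by simp
  let ?iX = "\<lambda>x\<in>carrier X. \<lambda>phi\<in>carrier ?X. phi x" and ?iY = "\<lambda>y\<in>carrier Y. \<lambda>phi\<in>carrier ?Y. phi y"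
  have iX: "homeomorphic_map (topol X) (topol (dual_space ?X)) ?iX"
    using X by (simp add: stereotype_def lcs_isomorphism_def)
  have "homeomorphic_map (topol Y) (topol (dual_space ?Y)) (dual_map ?X ?Y ?g \<circ> (?iX \<circ> g))"
    using homeomorphic_maps_imp_map[OF G] iX homeomorphic_maps_imp_map[OF F]
    by (intro homeomorphic_map_compose)
  moreover have "(dual_map ?X ?Y ?g \<circ> (?iX \<circ> g)) y = ?iY y" if "y \<in> topspace (topol Y)" for y
  proof -
    have y: "y \<in> carrier Y" using that by (simp add: I(2))
    have "dual_map ?X ?Y ?g (?iX (g y)) = (\<lambda>phi\<in>carrier ?Y. phi y)"
      unfolding dual_map_def[of ?X ?Y]
    proof (rule restrict_ext)
      fix phi assume "phi \<in> carrier ?Y"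
      then have phi: "phi \<in> continuous_functionals Y" by simp
      have "?g phi \<in> continuous_functionals X"
        by (rule dual_map_in[OF lcs_inverse_isos_sym[THEN iffD1, OF i] phi]) simp_all
      then have "?g phi \<in> carrier ?X" by simp
      then have "?iX (g y) (?g phi) = ?g phi (g y)" using y I(4) by simp
      also have "\<dots> = phi y" using y I(4,6) by (simp add: dual_map_def)
      finally show "?iX (g y) (?g phi) = phi y" .
    qed
    then show ?thesis using y by simp
  qed
  ultimately have "homeomorphic_map (topol Y) (topol (dual_space ?Y)) ?iY"
    by (rule homeomorphic_map_eq)
  then show ?thesis
    unfolding stereotype_def lcs_isomorphism_def using Y.lcs Y.linear_evaluation by simp
qed

text \<open>No algebraic laws are demanded of \<open>Z\<close>; they are pulled back along
  \<open>g\<close>. In this way completions and copies on other types become algebras without a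
  direct verification of the laws.\<close>

definition ialg_inverse_isos :: "'a ialg \<Rightarrow> 'b ialg \<Rightarrow> ('a \<Rightarrow> 'b) \<Rightarrow> ('b \<Rightarrow> 'a) \<Rightarrow> bool" where
  "ialg_inverse_isos B Z f g \<longleftrightarrow>
     topspace (topol Z) = carrier Z \<and>
     f \<in> carrier B \<rightarrow> carrier Z \<and> g \<in> carrier Z \<rightarrow> carrier B \<and>
     (\<forall>x\<in>carrier B. g (f x) = x) \<and> (\<forall>z\<in>carrier Z. f (g z) = z) \<and>
     f \<zero>\<^bsub>B\<^esub> = \<zero>\<^bsub>Z\<^esub> \<and> f \<one>\<^bsub>B\<^esub> = \<one>\<^bsub>Z\<^esub> \<and>
     (\<forall>x\<in>carrier B. \<forall>y\<in>carrier B. f (x \<oplus>\<^bsub>B\<^esub> y) = f x \<oplus>\<^bsub>Z\<^esub> f y) \<and>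
     (\<forall>x\<in>carrier B. \<forall>y\<in>carrier B. f (x \<otimes>\<^bsub>B\<^esub> y) = f x \<otimes>\<^bsub>Z\<^esub> f y) \<and>
     (\<forall>c. \<forall>x\<in>carrier B. f (c \<odot>\<^bsub>B\<^esub> x) = c \<odot>\<^bsub>Z\<^esub> f x) \<and>
     (\<forall>x\<in>carrier B. f (star B x) = star Z (f x)) \<and>
     continuous_map (topol B) (topol Z) f \<and> continuous_map (topol Z) (topol B) g"

context
  fixes B :: "'a ialg" and Z :: "'b ialg" and f g
  assumes iso: "ialg_inverse_isos B Z f g"
begin

lemma iso_carrier: "x \<in> carrier B \<Longrightarrow> f x \<in> carrier Z" "z \<in> carrier Z \<Longrightarrow> g z \<in> carrier B"
  and iso_inverse: "x \<in> carrier B \<Longrightarrow> g (f x) = x" "z \<in> carrier Z \<Longrightarrow> f (g z) = z"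
  and iso_zero: "\<zero>\<^bsub>Z\<^esub> = f \<zero>\<^bsub>B\<^esub>" and iso_one: "\<one>\<^bsub>Z\<^esub> = f \<one>\<^bsub>B\<^esub>"
  and iso_add: "x \<in> carrier B \<Longrightarrow> y \<in> carrier B \<Longrightarrow> f x \<oplus>\<^bsub>Z\<^esub> f y = f (x \<oplus>\<^bsub>B\<^esub> y)"
  and iso_mult: "x \<in> carrier B \<Longrightarrow> y \<in> carrier B \<Longrightarrow> f x \<otimes>\<^bsub>Z\<^esub> f y = f (x \<otimes>\<^bsub>B\<^esub> y)"
  and iso_smult: "x \<in> carrier B \<Longrightarrow> c \<odot>\<^bsub>Z\<^esub> f x = f (c \<odot>\<^bsub>B\<^esub> x)"
  and iso_star: "x \<in> carrier B \<Longrightarrow> star Z (f x) = f (star B x)"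
  and iso_continuous: "continuous_map (topol B) (topol Z) f" "continuous_map (topol Z) (topol B) g"
  and iso_topspace: "topspace (topol Z) = carrier Z"
  using iso unfolding ialg_inverse_isos_def by (simp_all add: Pi_iff)

lemma iso_ops:
  assumes "z \<in> carrier Z" "w \<in> carrier Z"
  shows "z \<oplus>\<^bsub>Z\<^esub> w = f (g z \<oplus>\<^bsub>B\<^esub> g w)" "z \<otimes>\<^bsub>Z\<^esub> w = f (g z \<otimes>\<^bsub>B\<^esub> g w)"
    "c \<odot>\<^bsub>Z\<^esub> z = f (c \<odot>\<^bsub>B\<^esub> g z)" "star Z z = f (star B (g z))"
  using iso_add[of "g z" "g w"] iso_mult[of "g z" "g w"] iso_smult[of "g z" c] iso_star[of "g z"]
    assms iso_carrier iso_inverse by simp_all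

lemma star_algebra_transport:
  assumes B: "star_algebra B"
  shows "star_algebra Z"
proof -
  interpret B: ring B using B by (simp add: star_algebra_def)
  interpret M: complex_module B
    by (rule complex_module.intro) (use B in \<open>simp add: star_algebra_def\<close>)
  have BS: "x \<in> carrier B \<Longrightarrow> star B x \<in> carrier B"
    "x \<in> carrier B \<Longrightarrow> star B (star B x) = x"
    "x \<in> carrier B \<Longrightarrow> y \<in> carrier B \<Longrightarrow> star B (x \<oplus>\<^bsub>B\<^esub> y) = star B x \<oplus>\<^bsub>B\<^esub> star B y"
    "x \<in> carrier B \<Longrightarrow> star B (c \<odot>\<^bsub>B\<^esub> x) = cnj c \<odot>\<^bsub>B\<^esub> star B x"
    "x \<in> carrier B \<Longrightarrow> y \<in> carrier B \<Longrightarrow> star B (x \<otimes>\<^bsub>B\<^esub> y) = star B y \<otimes>\<^bsub>B\<^esub> star B x"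
    "x \<in> carrier B \<Longrightarrow> y \<in> carrier B \<Longrightarrow> (c \<odot>\<^bsub>B\<^esub> x) \<otimes>\<^bsub>B\<^esub> y = c \<odot>\<^bsub>B\<^esub> (x \<otimes>\<^bsub>B\<^esub> y)"
    "x \<in> carrier B \<Longrightarrow> y \<in> carrier B \<Longrightarrow> x \<otimes>\<^bsub>B\<^esub> (c \<odot>\<^bsub>B\<^esub> y) = c \<odot>\<^bsub>B\<^esub> (x \<otimes>\<^bsub>B\<^esub> y)" for x y c
    using B by (auto simp: star_algebra_def Pi_iff)
  note ops = iso_carrier iso_inverse iso_zero iso_one iso_ops BS
  have ab: "abelian_group Z"
  proof (rule abelian_groupI)
    fix z assume z: "z \<in> carrier Z"
    show "\<exists>w\<in>carrier Z. w \<oplus>\<^bsub>Z\<^esub> z = \<zero>\<^bsub>Z\<^esub>"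
      by (rule bexI[of _ "f (\<ominus>\<^bsub>B\<^esub> g z)"]) (use z in \<open>simp_all add: ops B.l_neg\<close>)
  qed (simp_all add: ops B.a_ac)
  have ring: "ring Z"
  proof (rule ringI[OF ab])
    show "monoid Z" by (rule monoidI) (simp_all add: ops B.m_assoc)
  qed (simp_all add: ops B.l_distr B.r_distr)
  have mod: "module complex_ring Z"
    by (rule moduleI[OF cring_complex_ring ab])
      (simp_all add: ops M.smult_add_left M.smult_add_right M.smult_smult)
  show ?thesis
    unfolding star_algebra_def
    by (intro conjI ballI allI mod ring) (simp_all add: ops)
qed

lemma iso_lcs:
  assumes B: "complex_lcs B"
  shows "lcs_inverse_isos B Z f g"
proof -
  interpret B: complex_lcs B by (rule B)
  show ?thesis
    unfolding lcs_inverse_isos_def linear_on_def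
    by (intro conjI ballI allI iso_continuous) (simp_all add: iso_carrier iso_inverse iso_zero iso_add iso_smult iso_ops iso_topspace)
qed

lemma involutive_stereotype_algebra_transport:
  assumes B: "involutive_stereotype_algebra B"
  shows "involutive_stereotype_algebra Z"
proof -
  have sB: "star_algebra B" using B by (simp add: involutive_stereotype_algebra_def)
  have stB: "stereotype B" using B by (simp add: involutive_stereotype_algebra_def)
  then have lB: "complex_lcs B" by (auto simp: stereotype_def intro: complex_lcsI)
  interpret B: complex_lcs B by (rule lB)
  interpret R: ring B using sB by (simp add: star_algebra_def)
  have sZ: "star_algebra Z" by (rule star_algebra_transport[OF sB])
  have i: "lcs_inverse_isos B Z f g" by (rule iso_lcs[OF lB])
  then have i': "lcs_inverse_isos Z B g f" by (rule lcs_inverse_isos_sym[THEN iffD1])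
  have hm: "homeomorphic_maps (topol B) (topol Z) f g"
    unfolding homeomorphic_maps_def by (simp add: iso_continuous iso_topspace iso_inverse)
  have "locally_convex_space Z"
    unfolding locally_convex_space_def
  proof (intro conjI allI impI)
    show "module complex_ring Z" using sZ by (simp add: star_algebra_def)
    show "topspace (topol Z) = carrier Z" by (rule iso_topspace)
    have "Hausdorff_space (topol B)" using B.lcs by (simp add: locally_convex_space_def)
    then show "Hausdorff_space (topol Z)"
      using homeomorphic_Hausdorff_space hm homeomorphic_space_def by blast
    have g1: "continuous_map (prod_topology (topol Z) (topol Z)) (topol B) (\<lambda>p. g (fst p))"
      and g2: "continuous_map (prod_topology (topol Z) (topol Z)) (topol B) (\<lambda>p. g (snd p))"
      using continuous_map_compose[OF continuous_map_fst iso_continuous(2)]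
        continuous_map_compose[OF continuous_map_snd iso_continuous(2)] by (simp_all add: o_def)
    have "continuous_map (prod_topology (topol Z) (topol Z)) (topol Z) (f \<circ> (\<lambda>p. g (fst p) \<oplus>\<^bsub>B\<^esub> g (snd p)))"
      by (rule continuous_map_compose[OF B.continuous_add[OF g1 g2] iso_continuous(1)])
    then show "continuous_map (prod_topology (topol Z) (topol Z)) (topol Z) (\<lambda>(x, y). x \<oplus>\<^bsub>Z\<^esub> y)"
      by (rule continuous_map_eq) (auto simp: iso_ops iso_topspace)
    have g3: "continuous_map (prod_topology euclidean (topol Z)) (topol B) (\<lambda>p. g (snd p))"
      using continuous_map_compose[OF continuous_map_snd iso_continuous(2)] by (simp add: o_def)
    have c: "continuous_map (prod_topology euclidean (topol Z)) euclidean (\<lambda>p. fst p :: complex)"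
      by (rule continuous_map_fst)
    have "continuous_map (prod_topology euclidean (topol Z)) (topol Z) (f \<circ> (\<lambda>p. fst p \<odot>\<^bsub>B\<^esub> g (snd p)))"
      by (rule continuous_map_compose[OF B.continuous_smult[OF c g3] iso_continuous(1)])
    then show "continuous_map (prod_topology euclidean (topol Z)) (topol Z) (\<lambda>(c, x). c \<odot>\<^bsub>Z\<^esub> x)"
      by (rule continuous_map_eq) (auto simp: iso_ops iso_topspace)
    fix U assume U: "zero_nbhd Z U"
    have "zero_nbhd B (g ` U)" by (rule zero_nbhd_image[OF i' U])
    then obtain V where V: "zero_nbhd B V" "convex_in B V" "V \<subseteq> g ` U"
      using B.lcs unfolding locally_convex_space_def by blast
    have VB: "V \<subseteq> carrier B" using V(1) by (simp add: zero_nbhd_def)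
    have UZ: "U \<subseteq> carrier Z" using U by (simp add: zero_nbhd_def)
    have "convex_in Z (f ` V)"
      unfolding convex_in_def
    proof (intro ballI)
      fix x y and t :: real assume "x \<in> f ` V" "y \<in> f ` V" and t: "t \<in> {0..1}"
      then obtain a b where ab: "a \<in> V" "b \<in> V" "x = f a" "y = f b" by blast
      have "of_real (1 - t) \<odot>\<^bsub>Z\<^esub> x \<oplus>\<^bsub>Z\<^esub> of_real t \<odot>\<^bsub>Z\<^esub> y =
         f (of_real (1 - t) \<odot>\<^bsub>B\<^esub> a \<oplus>\<^bsub>B\<^esub> of_real t \<odot>\<^bsub>B\<^esub> b)"
        using ab VB by (simp add: iso_smult iso_add subset_iff)
      moreover have "of_real (1 - t) \<odot>\<^bsub>B\<^esub> a \<oplus>\<^bsub>B\<^esub> of_real t \<odot>\<^bsub>B\<^esub> b \<in> V"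
        using V(2) ab(1,2) t unfolding convex_in_def by blast
      ultimately show "of_real (1 - t) \<odot>\<^bsub>Z\<^esub> x \<oplus>\<^bsub>Z\<^esub> of_real t \<odot>\<^bsub>Z\<^esub> y \<in> f ` V" by simp
    qed
    moreover have "f ` V \<subseteq> U"
    proof
      fix z assume "z \<in> f ` V"
      then obtain u where "u \<in> U" "z = f (g u)" using V(3) by blast
      then show "z \<in> U" using iso_inverse(2) UZ by auto
    qed
    ultimately show "\<exists>V. zero_nbhd Z V \<and> convex_in Z V \<and> V \<subseteq> U"
      using zero_nbhd_image[OF i V(1)] by blast
  qed
  then have lZ: "complex_lcs Z" by (rule complex_lcsI)
  show ?thesis
    unfolding involutive_stereotype_algebra_def
  proof (intro conjI allI impI sZ)
    show "stereotype Z" by (rule stereotype_transport[OF stB lZ i])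
    have "continuous_map (topol B) (topol B) (star B)" using B by (simp add: involutive_stereotype_algebra_def)
    from continuous_map_compose[OF continuous_map_compose[OF iso_continuous(2) this] iso_continuous(1)]
    have "continuous_map (topol Z) (topol Z) (f \<circ> (star B \<circ> g))" .
    then show "continuous_map (topol Z) (topol Z) (star Z)"
      by (rule continuous_map_eq) (simp add: iso_ops iso_topspace)
    fix K U assume KU: "compactin (topol Z) K \<and> zero_nbhd Z U"
    have "compactin (topol B) (g ` K)" using KU image_compactin iso_continuous(2) by blast
    moreover have "zero_nbhd B (g ` U)" using zero_nbhd_image[OF i'] KU by blast
    ultimately obtain V where V: "zero_nbhd B V" "(g ` K) <#>\<^bsub>B\<^esub> V \<subseteq> g ` U" "V <#>\<^bsub>B\<^esub> (g ` K) \<subseteq> g ` U"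
      using B unfolding involutive_stereotype_algebra_def by blast
    have VB: "V \<subseteq> carrier B" using V(1) by (simp add: zero_nbhd_def)
    have UZ: "U \<subseteq> carrier Z" using KU by (simp add: zero_nbhd_def)
    have KZ: "K \<subseteq> carrier Z" using KU compactin_subset_topspace iso_topspace by blast
    have fU: "f x \<in> U" if "x \<in> g ` U" for x using that iso_inverse(2) UZ by auto
    have "k \<otimes>\<^bsub>Z\<^esub> f v \<in> U" "f v \<otimes>\<^bsub>Z\<^esub> k \<in> U" if k: "k \<in> K" and v: "v \<in> V" for k v
    proof -
      have kv: "k \<in> carrier Z" "v \<in> carrier B" using k v KZ VB by auto
      have "g k \<otimes>\<^bsub>B\<^esub> v \<in> g ` U" using V(2) k v unfolding set_mult_def by blast
      then show "k \<otimes>\<^bsub>Z\<^esub> f v \<in> U" using fU kv by (simp add: iso_ops iso_carrier iso_inverse)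
      have "v \<otimes>\<^bsub>B\<^esub> g k \<in> g ` U" using V(3) k v unfolding set_mult_def by blast
      then show "f v \<otimes>\<^bsub>Z\<^esub> k \<in> U" using fU kv by (simp add: iso_ops iso_carrier iso_inverse)
    qed
    then have "K <#>\<^bsub>Z\<^esub> (f ` V) \<subseteq> U" "(f ` V) <#>\<^bsub>Z\<^esub> K \<subseteq> U" unfolding set_mult_def by auto
    then show "\<exists>V. zero_nbhd Z V \<and> K <#>\<^bsub>Z\<^esub> V \<subseteq> U \<and> V <#>\<^bsub>Z\<^esub> K \<subseteq> U"
      using zero_nbhd_image[OF i V(1)] by blast
  qed
qed

end

subsection \<open>The involutive spectrum and the Gelfand transform\<close>

text \<open>The library's Stone--Weierstrass theorem needs a type of class \<^class>\<open>t2_space\<close>, of which the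
  function type is no instance for an uncountable domain.\<close>

datatype 'a pointwise = Pointwise (eval_at: "'a \<Rightarrow> complex")

instantiation pointwise :: (type) t2_space
begin

definition open_pointwise :: "'a pointwise set \<Rightarrow> bool" where
  "open_pointwise S \<longleftrightarrow> open (Pointwise -` S)"

instance
proof
  show "open (UNIV :: 'a pointwise set)" by (simp add: open_pointwise_def)
  show "open (S \<inter> T)" if "open S" "open T" for S T :: "'a pointwise set"
    using that by (simp add: open_pointwise_def vimage_Int open_Int)
  show "open (\<Union>K)" if "\<forall>S\<in>K. open S" for K :: "'a pointwise set set"
    using that by (auto simp: open_pointwise_def vimage_Union)
  fix f g :: "'a pointwise" assume "f \<noteq> g"
  then have "eval_at f \<noteq> eval_at g" by (auto dest: pointwise.expand)
  then obtain x where x: "eval_at f x \<noteq> eval_at g x" by blast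
  obtain U V where UV: "open U" "open V" "eval_at f x \<in> U" "eval_at g x \<in> V" "U \<inter> V = {}"
    using hausdorff[OF x] by (elim exE conjE)
  have *: "open ((\<lambda>h. eval_at h x) -` W)" if "open W" for W
  proof -
    have "open ((\<lambda>h. h x) -` W)" using open_vimage[OF that continuous_on_product_coordinates] .
    moreover have "Pointwise -` ((\<lambda>h. eval_at h x) -` W) = (\<lambda>h. h x) -` W" by auto
    ultimately show ?thesis by (simp add: open_pointwise_def)
  qed
  show "\<exists>U V. open U \<and> open V \<and> f \<in> U \<and> g \<in> V \<and> U \<inter> V = {}"
    using *[OF UV(1)] *[OF UV(2)] UV(3-5)
    by (intro exI[of _ "(\<lambda>h. eval_at h x) -` U"] exI[of _ "(\<lambda>h. eval_at h x) -` V"]) auto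
qed

end

lemma continuous_on_Pointwise: "continuous_on UNIV Pointwise"
  unfolding continuous_on_open_vimage[OF open_UNIV] by (simp add: open_pointwise_def)

lemma continuous_on_eval_at: "continuous_on UNIV eval_at"
  unfolding continuous_on_open_vimage[OF open_UNIV] by (simp add: open_pointwise_def vimage_def)

lemma complex_alg_simps [simp]:
  "carrier complex_alg = UNIV" "mult complex_alg = (*)" "one complex_alg = 1"
  "zero complex_alg = 0" "add complex_alg = (+)" "smult complex_alg = (*)"
  "topol complex_alg = euclidean" "star complex_alg = cnj"
  by (simp_all add: complex_alg_def)

lemma involutive_homs_complex_iff:
  "phi \<in> involutive_homs A complex_alg \<longleftrightarrow> phi \<in> extensional (carrier A) \<and>
     (\<forall>x\<in>carrier A. \<forall>y\<in>carrier A. phi (x \<oplus>\<^bsub>A\<^esub> y) = phi x + phi y) \<and>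
     (\<forall>x\<in>carrier A. \<forall>y\<in>carrier A. phi (x \<otimes>\<^bsub>A\<^esub> y) = phi x * phi y) \<and> phi \<one>\<^bsub>A\<^esub> = 1 \<and>
     (\<forall>c. \<forall>x\<in>carrier A. phi (c \<odot>\<^bsub>A\<^esub> x) = c * phi x) \<and>
     (\<forall>x\<in>carrier A. phi (star A x) = cnj (phi x)) \<and>
     continuous_map (topol A) euclidean phi"
  unfolding involutive_homs_def ring_hom_def by (auto simp: Pi_def)

lemma involutive_homsD:
  assumes "f \<in> involutive_homs A B"
  shows "f \<in> extensional (carrier A)" "continuous_map (topol A) (topol B) f"
    "x \<in> carrier A \<Longrightarrow> f x \<in> carrier B"
    "x \<in> carrier A \<Longrightarrow> y \<in> carrier A \<Longrightarrow> f (x \<oplus>\<^bsub>A\<^esub> y) = f x \<oplus>\<^bsub>B\<^esub> f y"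
    "x \<in> carrier A \<Longrightarrow> y \<in> carrier A \<Longrightarrow> f (x \<otimes>\<^bsub>A\<^esub> y) = f x \<otimes>\<^bsub>B\<^esub> f y" "f \<one>\<^bsub>A\<^esub> = \<one>\<^bsub>B\<^esub>"
    "x \<in> carrier A \<Longrightarrow> f (c \<odot>\<^bsub>A\<^esub> x) = c \<odot>\<^bsub>B\<^esub> f x"
    "x \<in> carrier A \<Longrightarrow> f (star A x) = star B (f x)"
  using assms unfolding involutive_homs_def ring_hom_def by auto

lemma involutive_homsI:
  assumes "f \<in> extensional (carrier A)" "continuous_map (topol A) (topol B) f"
    "\<And>x. x \<in> carrier A \<Longrightarrow> f x \<in> carrier B"
    "\<And>x y. x \<in> carrier A \<Longrightarrow> y \<in> carrier A \<Longrightarrow> f (x \<oplus>\<^bsub>A\<^esub> y) = f x \<oplus>\<^bsub>B\<^esub> f y"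
    "\<And>x y. x \<in> carrier A \<Longrightarrow> y \<in> carrier A \<Longrightarrow> f (x \<otimes>\<^bsub>A\<^esub> y) = f x \<otimes>\<^bsub>B\<^esub> f y" "f \<one>\<^bsub>A\<^esub> = \<one>\<^bsub>B\<^esub>"
    "\<And>c x. x \<in> carrier A \<Longrightarrow> f (c \<odot>\<^bsub>A\<^esub> x) = c \<odot>\<^bsub>B\<^esub> f x"
    "\<And>x. x \<in> carrier A \<Longrightarrow> f (star A x) = star B (f x)"
  shows "f \<in> involutive_homs A B"
  using assms unfolding involutive_homs_def ring_hom_def by auto

section \<open>Compact sets of continuous characters\<close>

locale commutative_stereotype_algebra =
  fixes A :: "'a ialg" (structure)
  assumes A: "involutive_stereotype_algebra A" and commutative_algebra: "commutative_algebra A"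
begin

sublocale comm_star_algebra A
  by (rule comm_star_algebra.intro)
    (use A commutative_algebra in \<open>simp_all add: involutive_stereotype_algebra_def\<close>)

sublocale complex_lcs A
  by (rule complex_lcsI) (use A in \<open>simp add: involutive_stereotype_algebra_def stereotype_def\<close>)

abbreviation H where "H \<equiv> involutive_homs A complex_alg"

abbreviation CH where "CH \<equiv> function_algebra (Spec A)"

abbreviation Gelfand ("\<G>") where "\<G> \<equiv> gelfand_transform A"

abbreviation CF where "CF \<equiv> continuous_functions (Spec A)"

abbreviation "CK K \<equiv> function_algebra (subtopology (Spec A) K)"

lemma topspace_Spec [simp]: "topspace (Spec A) = H"
  by (simp add: Spec_def)

lemma character:
  assumes "phi \<in> H"
  shows "phi \<in> extensional (carrier A)" "continuous_map (topol A) euclidean phi"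
    "x \<in> carrier A \<Longrightarrow> y \<in> carrier A \<Longrightarrow> phi (x \<oplus> y) = phi x + phi y"
    "x \<in> carrier A \<Longrightarrow> y \<in> carrier A \<Longrightarrow> phi (x \<otimes> y) = phi x * phi y" "phi \<one> = 1"
    "x \<in> carrier A \<Longrightarrow> phi (c \<odot> x) = c * phi x"
    "x \<in> carrier A \<Longrightarrow> phi (star A x) = cnj (phi x)"
  using assms unfolding involutive_homs_complex_iff by auto

lemma character_functional: "phi \<in> H \<Longrightarrow> phi \<in> continuous_functionals A"
  unfolding continuous_functionals_def by (simp add: character)

lemma character_zero: "phi \<in> H \<Longrightarrow> phi \<zero> = 0"
  by (rule functional_zero[OF character_functional])

lemma character_minus: "phi \<in> H \<Longrightarrow> x \<in> carrier A \<Longrightarrow> y \<in> carrier A \<Longrightarrow> phi (x \<ominus> y) = phi x - phi y"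
  by (rule functional_diff[OF character_functional])

lemma zero_nbhd_scaled:
  assumes U: "zero_nbhd A U" and e: "e > 0"
    and h: "\<And>c x. x \<in> carrier A \<Longrightarrow> h (c \<odot> x) = cmod c * (h x :: real)"
    and lt: "\<And>x. x \<in> U \<Longrightarrow> h x < 1"
  shows "zero_nbhd A {x\<in>carrier A. h x < e}"
proof (rule zero_nbhd_mono[OF zero_nbhd_smult[OF U, of "complex_of_real (inverse e)"]])
  show "{x\<in>carrier A. of_real (inverse e) \<odot> x \<in> U} \<subseteq> {x\<in>carrier A. h x < e}"
  proof
    fix x assume x: "x \<in> {x\<in>carrier A. of_real (inverse e) \<odot> x \<in> U}"
    then have "h (of_real (inverse e) \<odot> x) < 1" using lt by blast
    moreover have "h (of_real (inverse e) \<odot> x) = inverse e * h x"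
      using x h[of x "complex_of_real (inverse e)"] e by (simp only: norm_of_real mem_Collect_eq) simp
    ultimately have "inverse e * h x < 1" by (simp only:)
    with e have "e * (inverse e * h x) < e * 1" by simp
    then show "x \<in> {x\<in>carrier A. h x < e}" using x e by (simp add: mult.assoc[symmetric])
  qed
qed blast

text \<open>The spectrum carries the uniform topology of the dual, so a finite subcover by uniform
  balls around characters is a finite net.\<close>

lemma compact_characters_totally_bounded:
  assumes K: "compactin (Spec A) K"
  shows "totally_bounded_in (dual_space A) K"
proof (rule totally_bounded_dualI)
  have KH: "K \<subseteq> H" using compactin_subset_topspace[OF K] by simp
  then show "K \<subseteq> continuous_functionals A" using character_functional by blast
  fix S and e :: real assume S: "totally_bounded_in A S" and e: "e > 0"
  define W where "W phi = {psi\<in>H. \<exists>r<e. \<forall>x\<in>\<Union>{S}. dist (psi x) (phi x) \<le> r}" for phi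
  have "openin (Spec A) (W phi) \<and> phi \<in> W phi" if "phi \<in> K" for phi
  proof
    show "openin (Spec A) (W phi)" unfolding W_def Spec_def by (rule openin_uniform_ball) (use S in auto)
    show "phi \<in> W phi" unfolding W_def using that KH e by (auto intro!: exI[of _ 0])
  qed
  from compactin_finite_subcover[OF K this]
  obtain J where J: "finite J" "J \<subseteq> K" "K \<subseteq> \<Union>(W ` J)" .
  have "\<exists>psi\<in>J. \<forall>x\<in>S. cmod (phi x - psi x) < e" if phi: "phi \<in> K" for phi
  proof -
    obtain psi where "psi \<in> J" "phi \<in> W psi" using J(3) phi by blast
    then show ?thesis unfolding W_def by (auto simp: dist_norm intro: le_less_trans)
  qed
  then show "\<exists>F. finite F \<and> F \<subseteq> continuous_functionals A \<and> (\<forall>phi\<in>K. \<exists>psi\<in>F. \<forall>x\<in>S. cmod (phi x - psi x) < e)"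
    using J character_functional KH by (intro exI[of _ J]) blast
qed

text \<open>Stereotypy makes the evaluation map into the bidual continuous. Its continuity at zero,
  tested on the totally bounded set \<open>K\<close> of functionals, is the equicontinuity of
  \<open>K\<close>.\<close>

lemma compact_characters_equicontinuous:
  assumes K: "compactin (Spec A) K" and e: "e > 0"
  obtains U where "zero_nbhd A U" "\<forall>x\<in>U. \<forall>phi\<in>K. cmod (phi x) < e"
proof -
  let ?D = "dual_space A" and ?i = "\<lambda>x\<in>carrier A. \<lambda>f\<in>carrier (dual_space A). f x"
  have KH: "K \<subseteq> H" using compactin_subset_topspace[OF K] by simp
  have "homeomorphic_map (topol A) (topol (dual_space ?D)) ?i"
    using A by (simp add: involutive_stereotype_algebra_def stereotype_def lcs_isomorphism_def)
  then have "continuous_map (topol A) (topol (dual_space ?D)) ?i" by (rule homeomorphic_imp_continuous_map)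
  then have "\<forall>x\<in>topspace (topol A). \<forall>S\<in>{S. totally_bounded_in ?D S}. \<forall>e>0.
     \<exists>N. openin (topol A) N \<and> x \<in> N \<and> (\<forall>y\<in>N. \<forall>s\<in>S. dist (?i y s) (?i x s) < e)"
    unfolding dual_space_simps(5)[of ?D] continuous_map_into_uniform by (rule conjunct2)
  from this[rule_format, of \<zero> K e] compact_characters_totally_bounded[OF K] e
  obtain N where N: "openin (topol A) N" "\<zero> \<in> N" "\<forall>y\<in>N. \<forall>s\<in>K. dist (?i y s) (?i \<zero> s) < e" by auto
  have NA: "N \<subseteq> carrier A" using openin_subset[OF N(1)] by simp
  have "cmod (phi x) < e" if x: "x \<in> N" and chi: "phi \<in> K" for x phi
  proof -
    have "dist (?i x phi) (?i \<zero> phi) < e" using N(3) x chi by blast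
    moreover have "phi \<in> H" using chi KH by blast
    ultimately show ?thesis using x NA character_functional[of phi] character_zero[of phi] by (auto simp: dist_norm)
  qed
  moreover have "zero_nbhd A N" using N NA unfolding zero_nbhd_def by blast
  ultimately show thesis using that by blast
qed

lemma gelfand_transform_apply [simp]:
  "x \<in> carrier A \<Longrightarrow> t \<in> H \<Longrightarrow> \<G> x t = t x"
  by (simp add: gelfand_transform_def)

lemma gelfand_transform_in:
  assumes x: "x \<in> carrier A" shows "\<G> x \<in> CF"
proof -
  have "continuous_map (Spec A) euclidean (\<lambda>t. t x)"
    unfolding Spec_def by (rule continuous_map_eval_uniform) (simp add: totally_bounded_singleton x)
  from restrict_in_continuous_functions[OF this] show ?thesis
    using x by (simp add: gelfand_transform_def)
qed

lemma gelfand_transform_hom: "\<G> \<in> involutive_homs A CH"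
proof (rule involutive_homsI)
  show "\<G> \<in> extensional (carrier A)" by (simp add: gelfand_transform_def)
  show "\<G> x \<in> carrier CH" if "x \<in> carrier A" for x
    using gelfand_transform_in[OF that] by simp
  show "continuous_map (topol A) (topol CH) (\<G>)"
    unfolding function_algebra_simps(7) continuous_map_into_uniform
  proof (intro conjI ballI allI impI)
    show "\<G> \<in> topspace (topol A) \<rightarrow> CF"
      using gelfand_transform_in by simp
    fix x K and e :: real assume "x \<in> topspace (topol A)" and "K \<in> {K. compactin (Spec A) K}" and e: "e > 0"
    then have x: "x \<in> carrier A" and K: "compactin (Spec A) K" by simp_all
    have KH: "K \<subseteq> H" using compactin_subset_topspace[OF K] by simp
    obtain U where U: "zero_nbhd A U" "\<forall>x\<in>U. \<forall>phi\<in>K. cmod (phi x) < e"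
      using compact_characters_equicontinuous[OF K e] .
    obtain N where N: "openin (topol A) N" "x \<in> N" "\<And>y. y \<in> N \<Longrightarrow> y \<ominus> x \<in> U"
      using zero_nbhd_translate[OF U(1) x] by blast
    have "dist (\<G> y t) (\<G> x t) < e" if y: "y \<in> N" and t: "t \<in> K" for y t
    proof -
      have yA: "y \<in> carrier A" and tH: "t \<in> H" using y t KH openin_subset[OF N(1)] by auto
      have "cmod (t (y \<ominus> x)) < e" using U(2) N(3)[OF y] t by blast
      then show ?thesis using yA tH x by (simp add: character_minus dist_norm)
    qed
    then show "\<exists>N. openin (topol A) N \<and> x \<in> N \<and>
       (\<forall>y\<in>N. \<forall>s\<in>K. dist (\<G> y s) (\<G> x s) < e)" using N by blast
  qed
qed (auto intro!: restrict_ext simp: gelfand_transform_def character)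

text \<open>All characters have the same value \<open>undefined\<close> off the carrier, so the
  coordinates there are constant and do not disturb the comparison with the product topology of the
  whole function type.\<close>

lemma continuous_map_Spec_euclidean: "continuous_map (Spec A) euclidean (\<lambda>t. t)"
proof -
  have "continuous_map (Spec A) euclidean (\<lambda>t. t x)" for x
  proof (cases "x \<in> carrier A")
    case True
    then show ?thesis
      unfolding Spec_def by (intro continuous_map_eval_uniform) (simp add: totally_bounded_singleton)
  next
    case False
    then have eq: "undefined = t x" if "t \<in> topspace (Spec A)" for t
      using that character(1)[of t] by (auto simp: extensional_def)
    have "continuous_map (Spec A) euclidean (\<lambda>t::'a \<Rightarrow> complex. undefined :: complex)" by simp
    then show ?thesis by (rule continuous_map_eq) (rule eq)
  qed
  then have "continuous_map (Spec A) (product_topology (\<lambda>i. euclidean) UNIV) (\<lambda>t. t)"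
    by (rule continuous_map_coordinatewise_then_product) simp_all
  then show ?thesis by (simp add: euclidean_product_topology)
qed

text \<open>On a compact set of characters the topology of the spectrum is that of pointwise convergence.\<close>

lemma compact_characters_continuous_on:
  assumes K: "compactin (Spec A) K"
    and f: "continuous_map (subtopology (Spec A) K) euclidean (f :: ('a \<Rightarrow> complex) \<Rightarrow> complex)"
  shows "compact K" "continuous_on K f"
proof -
  have KH: "K \<subseteq> topspace (Spec A)" using compactin_subset_topspace[OF K] .
  have "compactin euclidean ((\<lambda>t. t) ` K)" by (rule image_compactin[OF K continuous_map_Spec_euclidean])
  then show "compact K" by simp
  let ?X = "subtopology (Spec A) K"
  \<comment> \<open>A continuous bijection from a compact space onto a Hausdorff space is a
    homeomorphism.\<close>
  have "homeomorphic_map ?X (top_of_set K) (\<lambda>t. t)"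
  proof (rule continuous_imp_homeomorphic_map)
    show "continuous_map ?X (top_of_set K) (\<lambda>t. t)"
      by (intro continuous_map_into_subtopology continuous_map_from_subtopology continuous_map_Spec_euclidean) auto
    show "compact_space ?X" using K by (simp add: compact_space_subtopology)
    have "Hausdorff_space (product_topology (\<lambda>i::'a. euclidean :: complex topology) UNIV)"
      by (simp add: Hausdorff_space_product_topology)
    then show "Hausdorff_space (top_of_set K)"
      by (simp add: euclidean_product_topology Hausdorff_space_subtopology)
    show "(\<lambda>t. t) ` topspace ?X = topspace (top_of_set K)" using KH by auto
  qed auto
  then obtain g where "homeomorphic_maps ?X (top_of_set K) (\<lambda>t. t) g" by (auto simp: homeomorphic_map_maps)
  then have g: "continuous_map (top_of_set K) ?X g" "\<forall>t\<in>K. g t = t"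
    using KH by (auto simp: homeomorphic_maps_def)
  have "continuous_map (top_of_set K) euclidean (f \<circ> g)"
    by (rule continuous_map_compose[OF g(1) f])
  then have "continuous_map (top_of_set K) euclidean f"
    by (rule continuous_map_eq) (use g(2) in simp)
  then show "continuous_on K f" by simp
qed

text \<open>The real Stone-Weierstrass theorem is applied to the real functions on \<open>K\<close>
  that are given by elements of \<open>A\<close>. They contain the real parts of all transforms,
  since \<open>(1/2) \<odot> (x \<oplus> star A x)\<close> represents the real part of
  \<open>x\<close>. The real and imaginary parts of \<open>f\<close> are approximated separately,
  hence the two errors of \<open>e/2\<close>.\<close>

lemma gelfand_transform_approximates:
  assumes K: "compactin (Spec A) K" and fc: "continuous_map (subtopology (Spec A) K) euclidean f" and e: "e > 0"
  obtains x where "x \<in> carrier A" "\<forall>t\<in>K. cmod (t x - f t) < e"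
proof -
  have KH: "K \<subseteq> H" using compactin_subset_topspace[OF K] by simp
  let ?K = "Pointwise ` K"
  define R where "R = {g. continuous_on ?K g \<and> (\<exists>x\<in>carrier A. \<forall>t\<in>K. complex_of_real (g (Pointwise t)) = t x)}"
  have RI: "g \<in> R" if "continuous_on ?K g" "x \<in> carrier A" "\<And>t. t \<in> K \<Longrightarrow> complex_of_real (g (Pointwise t)) = t x" for g x
    unfolding R_def using that by blast
  have RE: "\<exists>x\<in>carrier A. \<forall>t\<in>K. complex_of_real (g (Pointwise t)) = t x" "continuous_on ?K g" if "g \<in> R" for g
    using that unfolding R_def by blast+
  have eval: "continuous_on ?K (\<lambda>s. eval_at s x)" for x
    by (rule continuous_on_compose2[OF continuous_on_product_coordinates
          continuous_on_subset[OF continuous_on_eval_at]]) auto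
  interpret SW: function_ring_on R ?K
  proof
    show "compact ?K"
      by (rule compact_continuous_image[OF continuous_on_subset[OF continuous_on_Pointwise]])
        (auto intro: compact_characters_continuous_on[OF K fc])
    show "continuous_on ?K g" if "g \<in> R" for g by (rule RE(2)[OF that])
    fix g h assume gh: "g \<in> R" "h \<in> R"
    obtain x where x: "x \<in> carrier A" "\<forall>t\<in>K. complex_of_real (g (Pointwise t)) = t x" using RE(1)[OF gh(1)] by blast
    obtain y where y: "y \<in> carrier A" "\<forall>t\<in>K. complex_of_real (h (Pointwise t)) = t y" using RE(1)[OF gh(2)] by blast
    note c = RE(2)[OF gh(1)] RE(2)[OF gh(2)]
    show "(\<lambda>t. g t + h t) \<in> R"
      by (rule RI[of _ "x \<oplus> y"]) (use c x y KH in \<open>auto intro: continuous_on_add simp: character subset_iff\<close>)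
    show "(\<lambda>t. g t * h t) \<in> R"
      by (rule RI[of _ "x \<otimes> y"]) (use c x y KH in \<open>auto intro: continuous_on_mult simp: character subset_iff\<close>)
  next
    fix c :: real
    show "(\<lambda>_. c) \<in> R"
      by (rule RI[of _ "of_real c \<odot> \<one>"]) (use KH in \<open>auto simp: character subset_iff\<close>)
  next
    fix s' t' assume st': "s' \<in> ?K" "t' \<in> ?K" "s' \<noteq> t'"
    then obtain s t where st: "s \<in> K" "t \<in> K" "s \<noteq> t" "s' = Pointwise s" "t' = Pointwise t" by blast
    have re: "(\<lambda>s. Re (eval_at s x)) \<in> R" if x: "x \<in> carrier A" for x
    proof (rule RI[of _ "(1/2) \<odot> (x \<oplus> star A x)"])
      show "continuous_on ?K (\<lambda>s. Re (eval_at s x))" by (rule continuous_on_Re[OF eval])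
      show "complex_of_real (Re (eval_at (Pointwise t) x)) = t ((1/2) \<odot> (x \<oplus> star A x))" if "t \<in> K" for t
        using that KH x by (auto simp: character complex_eq_iff subset_iff)
    qed (use x in auto)
    have sH: "s \<in> H" and tH: "t \<in> H" using st KH by auto
    obtain x where x: "x \<in> carrier A" "s x \<noteq> t x"
      using st(3) extensionalityI[of s "carrier A" t] character(1)[OF sH] character(1)[OF tH] by blast
    show "\<exists>f\<in>R. f s' \<noteq> f t'"
    proof (cases "Re (s x) = Re (t x)")
      case True
      then have ne: "Im (s x) \<noteq> Im (t x)" using x(2) by (simp add: complex_eq_iff)
      \<comment> \<open>Characters that differ only in the imaginary part at \<open>x\<close> differ
        in the real part at \<open>\<i> \<odot> x\<close>.\<close>
      have "Re (s (\<i> \<odot> x)) \<noteq> Re (t (\<i> \<odot> x))" using ne x(1) sH tH by (simp add: character)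
      then show ?thesis using x(1) st(4,5) by (intro bexI[OF _ re[of "\<i> \<odot> x"]]) auto
    next
      case False
      then show ?thesis using st(4,5) by (intro bexI[OF _ re[OF x(1)]]) auto
    qed
  qed
  have "continuous_on K f" by (rule compact_characters_continuous_on[OF K fc])
  then have fK: "continuous_on ?K (\<lambda>s. f (eval_at s))"
    by (rule continuous_on_compose2[OF _ continuous_on_subset[OF continuous_on_eval_at]]) auto
  have e2: "e/2 > 0" using e by simp
  obtain g where g: "g \<in> R" "\<forall>t\<in>?K. \<bar>Re (f (eval_at t)) - g t\<bar> < e/2"
    using SW.Stone_Weierstrass_basic[OF continuous_on_Re[OF fK] e2] by blast
  obtain h where h: "h \<in> R" "\<forall>t\<in>?K. \<bar>Im (f (eval_at t)) - h t\<bar> < e/2"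
    using SW.Stone_Weierstrass_basic[OF continuous_on_Im[OF fK] e2] by blast
  obtain x where x: "x \<in> carrier A" "\<forall>t\<in>K. complex_of_real (g (Pointwise t)) = t x" using RE(1)[OF g(1)] by blast
  obtain y where y: "y \<in> carrier A" "\<forall>t\<in>K. complex_of_real (h (Pointwise t)) = t y" using RE(1)[OF h(1)] by blast
  show thesis
  proof (rule that)
    show "x \<oplus> \<i> \<odot> y \<in> carrier A" using x y by simp
    show "\<forall>t\<in>K. cmod (t (x \<oplus> \<i> \<odot> y) - f t) < e"
    proof
      fix t assume t: "t \<in> K"
      then have tH: "t \<in> H" using KH by blast
      let ?t = "Pointwise t"
      have gh: "\<bar>Re (f t) - g ?t\<bar> < e/2" "\<bar>Im (f t) - h ?t\<bar> < e/2" using g(2) h(2) t by auto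
      have "t (x \<oplus> \<i> \<odot> y) = complex_of_real (g ?t) + \<i> * complex_of_real (h ?t)"
        using x y t tH by (simp add: character)
      then have "cmod (t (x \<oplus> \<i> \<odot> y) - f t) \<le> \<bar>g ?t - Re (f t)\<bar> + \<bar>h ?t - Im (f t)\<bar>"
        using cmod_le[of "t (x \<oplus> \<i> \<odot> y) - f t"] by simp
      also have "\<dots> < e/2 + e/2"
        using gh by (intro add_strict_mono) (simp_all add: abs_minus_commute)
      finally show "cmod (t (x \<oplus> \<i> \<odot> y) - f t) < e" by simp
    qed
  qed
qed

lemma gelfand_transform_dense:
  "topol CH closure_of (\<G> ` carrier A) = carrier CH"
proof
  show "topol CH closure_of (\<G> ` carrier A) \<subseteq> carrier CH"
    using closure_of_subset_topspace[of "topol CH"] by simp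
  show "carrier CH \<subseteq> topol CH closure_of (\<G> ` carrier A)"
  proof
    fix f assume "f \<in> carrier CH"
    then have f: "f \<in> CF" by simp
    have "\<exists>y\<in>\<G> ` carrier A. y \<in> T"
      if T: "f \<in> T" "openin (topol CH) T" for T
    proof -
      have "\<exists>W. openin (uniform_topology {K. compactin (Spec A) K} CF) W \<and> f \<in> W \<and> W \<subseteq> T"
        using T by auto
      then have "\<exists>\<T> e. finite \<T> \<and> \<T> \<subseteq> {K. compactin (Spec A) K} \<and> e > 0 \<and>
        (\<forall>g\<in>CF. (\<forall>x\<in>\<Union>\<T>. dist (g x) (f x) < e) \<longrightarrow> g \<in> T)"
        unfolding uniform_nbhd_iff by (rule conjunct2)
      then obtain \<T> e where Te: "finite \<T>" "\<T> \<subseteq> {K. compactin (Spec A) K}" "e > 0"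
        "\<forall>g\<in>CF. (\<forall>x\<in>\<Union>\<T>. dist (g x) (f x) < e) \<longrightarrow> g \<in> T"
        by (elim exE conjE)
      have K: "compactin (Spec A) (\<Union>\<T>)" using compactin_directed[OF Te(1,2)] by simp
      have KH: "\<Union>\<T> \<subseteq> H" using compactin_subset_topspace[OF K] by simp
      obtain x where x: "x \<in> carrier A" "\<forall>t\<in>\<Union>\<T>. cmod (t x - f t) < e"
        using gelfand_transform_approximates[OF K continuous_map_from_subtopology[OF continuous_functionsD(1)[OF f]] Te(3)] .
      have "\<forall>t\<in>\<Union>\<T>. dist (\<G> x t) (f t) < e"
      proof
        fix t assume t: "t \<in> \<Union>\<T>"
        then have "t \<in> H" using KH by blast
        moreover have "cmod (t x - f t) < e" using x(2) t by blast
        ultimately show "dist (\<G> x t) (f t) < e" using x(1) by (simp add: dist_norm)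
      qed
      then have "\<G> x \<in> T" using Te(4) gelfand_transform_in[OF x(1)] by blast
      then show ?thesis using x(1) by blast
    qed
    then show "f \<in> topol CH closure_of (\<G> ` carrier A)"
      unfolding in_closure_of using f by simp
  qed
qed

section \<open>Characters dominated by a continuous C*-seminorm\<close>

definition char_ball :: "('a \<Rightarrow> real) \<Rightarrow> ('a \<Rightarrow> complex) set" where
  "char_ball p = {phi\<in>H. \<forall>x\<in>carrier A. cmod (phi x) \<le> p x}"

context
  fixes p assumes p: "C_star_seminorm p" and p_cont: "zero_nbhd A {x\<in>carrier A. p x < 1}"
begin

lemma p_smult: "x \<in> carrier A \<Longrightarrow> p (c \<odot> x) = cmod c * p x"
  using p by (auto simp: C_star_seminorm_def)

lemma p_nbhd: "e > 0 \<Longrightarrow> zero_nbhd A {x\<in>carrier A. p x < e}"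
  by (rule zero_nbhd_scaled[OF p_cont]) (auto simp: p_smult)

lemma bounded_functional_continuous:
  assumes add: "\<And>x y. x \<in> carrier A \<Longrightarrow> y \<in> carrier A \<Longrightarrow> phi (x \<oplus> y) = phi x + phi y"
    and le: "\<And>x. x \<in> carrier A \<Longrightarrow> cmod (phi x) \<le> p x"
  shows "continuous_map (topol A) euclidean phi"
  unfolding continuous_map_into_complex
proof (intro ballI allI impI)
  fix x and e :: real assume x': "x \<in> topspace (topol A)" and e: "e > 0"
  then have x: "x \<in> carrier A" by simp
  obtain N where N: "openin (topol A) N" "x \<in> N" "\<And>y. y \<in> N \<Longrightarrow> y \<ominus> x \<in> {x\<in>carrier A. p x < e}"
    using zero_nbhd_translate[OF p_nbhd[OF e] x] by blast
  have "dist (phi y) (phi x) < e" if y: "y \<in> N" for y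
  proof -
    have yA: "y \<in> carrier A" using y openin_subset[OF N(1)] by auto
    have "phi ((y \<ominus> x) \<oplus> x) = phi (y \<ominus> x) + phi x" using x yA by (intro add) auto
    moreover have "(y \<ominus> x) \<oplus> x = y" using x yA by (simp add: a_minus_def a_assoc l_neg)
    ultimately have "phi y - phi x = phi (y \<ominus> x)" by simp
    moreover have "cmod (phi (y \<ominus> x)) \<le> p (y \<ominus> x)" using x yA by (intro le) simp
    moreover have "p (y \<ominus> x) < e" using N(3)[OF y] by simp
    ultimately show ?thesis by (simp add: dist_norm)
  qed
  then show "\<exists>N. openin (topol A) N \<and> x \<in> N \<and> (\<forall>y\<in>N. dist (phi y) (phi x) < e)" using N by blast
qed

lemma char_ball_attains:
  assumes x: "x \<in> carrier A" "p x > 0"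
  obtains t where "t \<in> char_ball p" "cmod (t x) = p x"
proof -
  obtain phi where "\<forall>x\<in>carrier A. \<forall>y\<in>carrier A. phi (x \<oplus> y) = phi x + phi y"
    "\<forall>x\<in>carrier A. \<forall>y\<in>carrier A. phi (x \<otimes> y) = phi x * phi y"
    "\<forall>c. \<forall>x\<in>carrier A. phi (c \<odot> x) = c * phi x"
    "phi \<one> = (1::complex)" "\<forall>x\<in>carrier A. phi (star A x) = cnj (phi x)"
    "\<forall>x\<in>carrier A. cmod (phi x) \<le> p x" "cmod (phi x) = p x"
    using character_of_C_star_seminorm[OF p x] by (elim exE conjE)
  note phi = this[rule_format]
  have "continuous_map (topol A) euclidean phi"
    by (rule bounded_functional_continuous) (use phi in auto)
  then have "continuous_map (topol A) euclidean (restrict phi (carrier A))"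
    by (rule continuous_map_eq) simp
  then have "restrict phi (carrier A) \<in> H"
    unfolding involutive_homs_complex_iff using phi by simp
  then have "restrict phi (carrier A) \<in> char_ball p" unfolding char_ball_def using phi by simp
  then show thesis using that phi(7) x by simp
qed

text \<open>Where \<open>p\<close> is positive it is attained by a character. The assumption
  \<open>0 \<le> e\<close> covers the points where \<open>p\<close> vanishes, and with them an empty
  \<open>char_ball p\<close>.\<close>

lemma p_le_of_char_ball:
  assumes x: "x \<in> carrier A" and e: "0 \<le> e" "\<forall>t\<in>char_ball p. cmod (t x) \<le> e"
  shows "p x \<le> e"
proof (cases "p x > 0")
  case True
  then obtain phi where "phi \<in> char_ball p" "cmod (phi x) = p x" using char_ball_attains[OF x] by blast
  then show ?thesis using e by force
qed (use e in simp)

text \<open>Continuity disappears from the description of the characters, as it follows from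
  domination by \<open>p\<close>. What remains is a product of discs cut down by closed conditions,
  as in the Banach-Alaoglu theorem; the factors \<open>{undefined}\<close> encode the normalisation
  off the carrier.\<close>

lemma char_ball_eq:
  "char_ball p = (PiE UNIV (\<lambda>x. if x \<in> carrier A then cball 0 (p x) else {undefined})) \<inter>
     ((\<Inter>x\<in>carrier A. \<Inter>y\<in>carrier A. {t. t (x \<oplus> y) = t x + t y}) \<inter>
      (\<Inter>x\<in>carrier A. \<Inter>y\<in>carrier A. {t. t (x \<otimes> y) = t x * t y}) \<inter> {t. t \<one> = 1} \<inter>
      (\<Inter>c. \<Inter>x\<in>carrier A. {t. t (c \<odot> x) = c * t x}) \<inter>
      (\<Inter>x\<in>carrier A. {t. t (star A x) = cnj (t x)}))" (is "_ = ?R")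
proof
  show "char_ball p \<subseteq> ?R"
  proof
    fix t assume t: "t \<in> char_ball p"
    then have tH: "t \<in> H" and le: "\<And>x. x \<in> carrier A \<Longrightarrow> cmod (t x) \<le> p x" by (auto simp: char_ball_def)
    have "t \<in> PiE UNIV (\<lambda>x. if x \<in> carrier A then cball 0 (p x) else {undefined})"
    proof (rule PiE_I)
      show "t x \<in> (if x \<in> carrier A then cball 0 (p x) else {undefined})" for x
        using le[of x] character(1)[OF tH] by (cases "x \<in> carrier A") (auto simp: extensional_def)
    qed simp
    then show "t \<in> ?R" by (simp add: character[OF tH])
  qed
  show "?R \<subseteq> char_ball p"
  proof
    fix t assume t: "t \<in> ?R"
    have cb: "t x \<in> (if x \<in> carrier A then cball 0 (p x) else {undefined})" for x
      by (rule PiE_mem[OF IntD1[OF t]]) simp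
    have "t x = undefined" if "x \<notin> carrier A" for x using cb[of x] that by simp
    then have ext: "t \<in> extensional (carrier A)" by (simp add: extensional_def)
    have le: "cmod (t x) \<le> p x" if "x \<in> carrier A" for x using cb[of x] that by simp
    have add: "t (x \<oplus> y) = t x + t y" if "x \<in> carrier A" "y \<in> carrier A" for x y
      using IntD2[OF t] that by simp
    have "continuous_map (topol A) euclidean t" by (rule bounded_functional_continuous[OF add le])
    then have "t \<in> H" unfolding involutive_homs_complex_iff using ext IntD2[OF t] by simp
    then show "t \<in> char_ball p" unfolding char_ball_def using le by simp
  qed
qed

text \<open>Tychonoff's theorem gives compactness for pointwise convergence. Domination by
  \<open>p\<close> makes the set equicontinuous, so pointwise convergence on it is already uniform
  on totally bounded sets, and compactness passes to the topology of the spectrum.\<close>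

lemma compactin_char_ball: "compactin (Spec A) (char_ball p)"
proof -
  let ?S = "PiE UNIV (\<lambda>x. if x \<in> carrier A then cball 0 (p x) else {undefined :: complex})"
  have "compactin (product_topology (\<lambda>i. euclidean) UNIV) ?S"
    unfolding compactin_PiE by auto
  then have S: "compact ?S" by (simp add: euclidean_product_topology)
  have ev: "continuous_on UNIV (\<lambda>t::'a \<Rightarrow> complex. t x)" for x by simp
  have "closed ((\<Inter>x\<in>carrier A. \<Inter>y\<in>carrier A. {t. t (x \<oplus> y) = t x + t y}) \<inter>
      (\<Inter>x\<in>carrier A. \<Inter>y\<in>carrier A. {t. t (x \<otimes> y) = t x * t y}) \<inter> {t. t \<one> = (1::complex)} \<inter>
      (\<Inter>c. \<Inter>x\<in>carrier A. {t. t (c \<odot> x) = c * t x}) \<inter>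
      (\<Inter>x\<in>carrier A. {t. t (star A x) = cnj (t x)}))"
    by (intro closed_Int closed_INT ballI closed_Collect_eq continuous_on_add continuous_on_mult
        continuous_on_const continuous_on_cnj ev)
  then have cpt: "compact (char_ball p)" unfolding char_ball_eq by (intro compact_Int_closed S)
  have "continuous_map (top_of_set (char_ball p)) (Spec A) (\<lambda>t. t)"
    unfolding Spec_def continuous_map_into_uniform
  proof (intro conjI ballI allI impI)
    show "(\<lambda>t. t) \<in> topspace (top_of_set (char_ball p)) \<rightarrow> H" by (auto simp: char_ball_def)
    fix t T and e :: real assume "t \<in> topspace (top_of_set (char_ball p))"
      and "T \<in> {S. totally_bounded_in A S}" and e: "e > 0"
    then have t: "t \<in> char_ball p" and T: "totally_bounded_in A T" by simp_all
    define V where "V = {x\<in>carrier A. p x < e/4}"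
    have "zero_nbhd A V" unfolding V_def by (rule p_nbhd) (use e in simp)
    from totally_bounded_near[OF T this]
    obtain F where F: "finite F" "F \<subseteq> carrier A" "\<And>s. s \<in> T \<Longrightarrow> \<exists>f\<in>F. \<exists>u\<in>V. s = f \<oplus> u" by blast
    define N where "N = char_ball p \<inter> (\<Inter>y\<in>F. (\<lambda>s. s y) -` ball (t y) (e/4))"
    have "open (\<Inter>y\<in>F. (\<lambda>s::'a \<Rightarrow> complex. s y) -` ball (t y) (e/4))"
      using F(1) by (intro open_INT ballI open_vimage open_ball ev)
    then have "openin (top_of_set (char_ball p)) N" unfolding N_def by (rule openin_open_Int)
    moreover have "t \<in> N" using t e by (simp add: N_def)
    moreover have "dist (s x) (t x) < e" if s: "s \<in> N" and x: "x \<in> T" for s x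
    proof -
      obtain y u where yu: "y \<in> F" "u \<in> V" "x = y \<oplus> u" using F(3)[OF x] by blast
      have yA: "y \<in> carrier A" and uA: "u \<in> carrier A" and pu: "p u < e/4" using yu F(2) by (auto simp: V_def)
      have sH: "s \<in> H" and tH: "t \<in> H" and su: "cmod (s u) \<le> p u" and tu: "cmod (t u) \<le> p u"
        using s t uA by (auto simp: N_def char_ball_def)
      have sy: "cmod (s y - t y) < e/4" using s yu(1) by (auto simp: N_def dist_norm norm_minus_commute)
      have "s x - t x = (s y - t y) + (s u - t u)" using yu(3) yA uA sH tH by (simp add: character)
      then have "cmod (s x - t x) \<le> cmod (s y - t y) + cmod (s u - t u)" by (simp add: norm_triangle_ineq)
      also have "cmod (s u - t u) \<le> cmod (s u) + cmod (t u)" by (rule norm_triangle_ineq4)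
      finally show ?thesis using sy su tu pu e by (simp add: dist_norm)
    qed
    ultimately show "\<exists>N. openin (top_of_set (char_ball p)) N \<and> t \<in> N \<and> (\<forall>y\<in>N. \<forall>s\<in>T. dist (y s) (t s) < e)"
      by blast
  qed
  moreover have "compactin (top_of_set (char_ball p)) (char_ball p)"
    using cpt by (simp add: compactin_subtopology)
  ultimately have "compactin (Spec A) ((\<lambda>t. t) ` char_ball p)" by (rule image_compactin[rotated])
  then show ?thesis by simp
qed

end

end

subsection \<open>Extending morphisms into C*-algebras\<close>

lemma involutive_stereotype_function_algebra:
  assumes "locally_compact_space M" "paracompact_space M"
  shows "involutive_stereotype_algebra (function_algebra M)"
  unfolding involutive_stereotype_algebra_def
  using star_algebra_function_algebra function_space.stereotype_function_algebra[OF assms]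
    function_algebra_mult_continuous function_algebra_star_continuous by blast

lemma involutive_stereotype_algebraD:
  assumes "involutive_stereotype_algebra B"
  shows "complex_lcs B" "ring B" "star_algebra B" "Hausdorff_space (topol B)"
  using assms
  by (auto simp: involutive_stereotype_algebra_def stereotype_def star_algebra_def locally_convex_space_def
      intro!: complex_lcsI)

section \<open>Norm and distance in a C*-algebra\<close>

locale C_star_algebra_norm =
  fixes B :: "'b ialg" (structure) and N :: "'b \<Rightarrow> real"
  assumes star_algebra: "star_algebra B" and norm: "C_star_norm B N"
begin

sublocale complex_module B
  by (rule complex_module.intro) (use star_algebra in \<open>simp add: star_algebra_def\<close>)

sublocale ring B
  using star_algebra by (simp add: star_algebra_def)

lemma smult_mult_left: "x \<in> carrier B \<Longrightarrow> y \<in> carrier B \<Longrightarrow> (c \<odot> x) \<otimes> y = c \<odot> (x \<otimes> y)"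
  and star_closed [simp, intro]: "x \<in> carrier B \<Longrightarrow> star B x \<in> carrier B"
  and star_star [simp]: "x \<in> carrier B \<Longrightarrow> star B (star B x) = x"
  and star_add: "x \<in> carrier B \<Longrightarrow> y \<in> carrier B \<Longrightarrow> star B (x \<oplus> y) = star B x \<oplus> star B y"
  and star_smult: "x \<in> carrier B \<Longrightarrow> star B (c \<odot> x) = cnj c \<odot> star B x"
  using star_algebra by (auto simp: star_algebra_def Pi_iff)

lemma N_nonneg: "x \<in> carrier B \<Longrightarrow> 0 \<le> N x"
  and N_eq_0: "x \<in> carrier B \<Longrightarrow> N x = 0 \<longleftrightarrow> x = \<zero>"
  and N_add: "x \<in> carrier B \<Longrightarrow> y \<in> carrier B \<Longrightarrow> N (x \<oplus> y) \<le> N x + N y"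
  and N_smult: "x \<in> carrier B \<Longrightarrow> N (c \<odot> x) = cmod c * N x"
  and N_mult: "x \<in> carrier B \<Longrightarrow> y \<in> carrier B \<Longrightarrow> N (x \<otimes> y) \<le> N x * N y"
  and N_star_mult: "x \<in> carrier B \<Longrightarrow> N (x \<otimes> star B x) = (N x)\<^sup>2"
  using norm by (auto simp: C_star_norm_def)

text \<open>The C*-identity and submultiplicativity bound \<open>N x\<close> by
  \<open>N (star B x)\<close>; the reverse bound is the same statement for
  \<open>star B x\<close>.\<close>

lemma N_star: "x \<in> carrier B \<Longrightarrow> N (star B x) = N x"
proof -
  have le: "N x \<le> N (star B x)" if x: "x \<in> carrier B" for x
  proof (cases "N x = 0")
    case False
    then have pos: "N x > 0" using N_nonneg[OF x] by simp
    have "N x * N x \<le> N x * N (star B x)"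
      using N_mult[of x "star B x"] N_star_mult[OF x] x by (simp add: power2_eq_square)
    then show ?thesis using pos by simp
  qed (use x N_nonneg in simp)
  show "x \<in> carrier B \<Longrightarrow> N (star B x) = N x" using le[of x] le[of "star B x"] by simp
qed

abbreviation "d \<equiv> norm_dist B N"

lemma d_eq: "x \<in> carrier B \<Longrightarrow> y \<in> carrier B \<Longrightarrow> d x y = N (x \<ominus> y)"
  by (simp add: norm_dist_def)

lemma minus_smult: "y \<in> carrier B \<Longrightarrow> x \<ominus> y = x \<oplus> (-1) \<odot> y"
  by (simp add: a_minus_def smult_minus_one)

lemma d_smult:
  assumes "x \<in> carrier B" "y \<in> carrier B" shows "d (c \<odot> x) (c \<odot> y) = cmod c * d x y"
proof -
  have "c \<odot> x \<ominus> c \<odot> y = c \<odot> (x \<ominus> y)"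
    using assms by (simp add: minus_smult smult_add_right smult_smult)
  then show ?thesis using assms by (simp add: d_eq N_smult)
qed

lemma d_add:
  assumes "x \<in> carrier B" "y \<in> carrier B" "x' \<in> carrier B" "y' \<in> carrier B"
  shows "d (x \<oplus> y) (x' \<oplus> y') \<le> d x x' + d y y'"
proof -
  have "(x \<oplus> y) \<ominus> (x' \<oplus> y') = (x \<ominus> x') \<oplus> (y \<ominus> y')"
    using assms by (simp add: minus_smult smult_add_right a_ac)
  then show ?thesis using N_add[of "x \<ominus> x'" "y \<ominus> y'"] assms by (simp add: d_eq)
qed

lemma d_triangle:
  assumes "x \<in> carrier B" "y \<in> carrier B" "z \<in> carrier B" shows "d x z \<le> d x y + d y z"
proof -
  have "(x \<ominus> y) \<oplus> (y \<ominus> z) = x \<ominus> z"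
    using assms by (simp add: a_minus_def a_assoc r_neg1)
  then show ?thesis using N_add[of "x \<ominus> y" "y \<ominus> z"] assms by (simp add: d_eq)
qed

lemma d_commute: "d x y = d y x"
proof (cases "x \<in> carrier B \<and> y \<in> carrier B")
  case True
  have "(-1) \<odot> (y \<ominus> x) = x \<ominus> y" using True by (simp add: minus_smult smult_add_right smult_smult a_comm)
  then show ?thesis using N_smult[of "y \<ominus> x" "-1"] True by (simp add: d_eq)
qed (auto simp: norm_dist_def)

lemma d_mult:
  assumes "x \<in> carrier B" "y \<in> carrier B" "x' \<in> carrier B" "y' \<in> carrier B"
  shows "d (x \<otimes> y) (x' \<otimes> y') \<le> N x * d y y' + d x x' * N y'"
proof -
  have "(x \<otimes> y) \<ominus> (x' \<otimes> y') = x \<otimes> (y \<ominus> y') \<oplus> (x \<ominus> x') \<otimes> y'"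
    using assms by (simp add: a_minus_def r_distr l_distr r_minus l_minus a_assoc r_neg1)
  then have "d (x \<otimes> y) (x' \<otimes> y') \<le> N (x \<otimes> (y \<ominus> y')) + N ((x \<ominus> x') \<otimes> y')"
    using N_add[of "x \<otimes> (y \<ominus> y')" "(x \<ominus> x') \<otimes> y'"] assms by (simp add: d_eq)
  also have "\<dots> \<le> N x * N (y \<ominus> y') + N (x \<ominus> x') * N y'"
    using assms by (intro add_mono N_mult) auto
  finally show ?thesis using assms by (simp add: d_eq)
qed

lemma d_star:
  assumes "x \<in> carrier B" "y \<in> carrier B" shows "d (star B x) (star B y) = d x y"
proof -
  have "star B x \<ominus> star B y = star B (x \<ominus> y)"
    using assms by (simp add: minus_smult star_add star_smult)
  then show ?thesis using assms by (simp add: d_eq N_star)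
qed

lemma metric: "Metric_space (carrier B) d"
proof
  show "0 \<le> d x y" for x y by (auto simp: norm_dist_def intro!: N_nonneg)
  show "d x y = d y x" for x y by (rule d_commute)
  show "(d x y = 0) = (x = y)" if xy: "x \<in> carrier B" "y \<in> carrier B" for x y
  proof -
    have "(x \<ominus> y) \<oplus> y = x" using xy by (simp add: a_minus_def a_assoc l_neg)
    then have "x \<ominus> y = \<zero> \<longleftrightarrow> x = y" using xy by (auto simp: a_minus_def r_neg)
    then show ?thesis using xy by (simp add: d_eq N_eq_0)
  qed
  show "d x z \<le> d x y + d y z" if "x \<in> carrier B" "y \<in> carrier B" "z \<in> carrier B" for x y z
    using that by (rule d_triangle)
qed

end

context commutative_stereotype_algebra
begin

text \<open>A morphism \<open>phi\<close> into a C*-algebra is isometric for the supremum over the compact set \<open>hom_chars\<close> of the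
  characters dominated by \<open>N \<circ> phi\<close>; \<open>limit_at\<close> relates \<open>f \<in> C(M)\<close> to the limit of \<open>phi\<close> along
  approximations of \<open>f\<close> on \<open>hom_chars\<close>.\<close>

context
  fixes B :: "'b ialg" and N and phi
  assumes B: "star_algebra B" "C_star_norm B N"
    and complete: "Metric_space.mcomplete (carrier B) (norm_dist B N)"
    and topol: "topol B = Metric_space.mtopology (carrier B) (norm_dist B N)"
    and hom: "phi \<in> involutive_homs A B"
begin

interpretation B: C_star_algebra_norm B N
  by (rule C_star_algebra_norm.intro[OF B])

interpretation MB: Metric_space "carrier B" "norm_dist B N"
  by (rule B.metric)

lemma phi_diff: "x \<in> carrier A \<Longrightarrow> y \<in> carrier A \<Longrightarrow> phi (x \<ominus> y) = phi x \<ominus>\<^bsub>B\<^esub> phi y"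
proof -
  assume xy: "x \<in> carrier A" "y \<in> carrier A"
  have "x \<ominus> y = x \<oplus> (-1) \<odot> y" using xy by (simp add: a_minus_def smult_minus_one)
  then show ?thesis
    using xy involutive_homsD[OF hom] by (simp add: B.minus_smult)
qed

definition hom_seminorm :: "'a \<Rightarrow> real" where
  "hom_seminorm x = N (phi x)"

lemma hom_seminorm_C_star: "C_star_seminorm hom_seminorm"
  unfolding C_star_seminorm_def hom_seminorm_def
proof (intro conjI ballI allI)
  fix x assume x: "x \<in> carrier A"
  note h = involutive_homsD[OF hom]
  show "0 \<le> N (phi x)" using x h(3) by (intro B.N_nonneg)
  show "N (phi (c \<odot> x)) = cmod c * N (phi x)" for c using x h(3) by (simp add: h(7) B.N_smult)
  show "N (phi (x \<otimes> star A x)) = (N (phi x))\<^sup>2" using x h(3) by (simp add: h(5,8) B.N_star_mult)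
  fix y assume y: "y \<in> carrier A"
  show "N (phi (x \<oplus> y)) \<le> N (phi x) + N (phi y)" using x y h(3) by (simp add: h(4) B.N_add)
  show "N (phi (x \<otimes> y)) \<le> N (phi x) * N (phi y)" using x y h(3) by (simp add: h(5) B.N_mult)
qed

lemma phi_zero: "phi \<zero> = \<zero>\<^bsub>B\<^esub>"
proof -
  have "phi (0 \<odot> \<zero>) = 0 \<odot>\<^bsub>B\<^esub> phi \<zero>" by (rule involutive_homsD(7)[OF hom]) simp
  then show ?thesis using involutive_homsD(3)[OF hom, of \<zero>] by simp
qed

lemma hom_seminorm_continuous: "zero_nbhd A {x\<in>carrier A. hom_seminorm x < 1}"
proof -
  have "openin (topol A) {x\<in>topspace (topol A). phi x \<in> MB.mball \<zero>\<^bsub>B\<^esub> 1}"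
    using involutive_homsD(2)[OF hom] unfolding topol
    by (rule openin_continuous_map_preimage) (rule MB.openin_mball)
  moreover have "{x\<in>topspace (topol A). phi x \<in> MB.mball \<zero>\<^bsub>B\<^esub> 1} = {x\<in>carrier A. hom_seminorm x < 1}"
  proof -
    have "norm_dist B N \<zero>\<^bsub>B\<^esub> (phi x) = N (phi x)" if "x \<in> carrier A" for x
      using that involutive_homsD(3)[OF hom] B.d_commute[of "\<zero>\<^bsub>B\<^esub>" "phi x"] by (simp add: B.d_eq B.minus_zero a_minus_def B.minus_eq)
    then show ?thesis using involutive_homsD(3)[OF hom] by (auto simp: hom_seminorm_def)
  qed
  moreover have "hom_seminorm \<zero> < 1" using B.N_eq_0[OF B.zero_closed] by (simp add: hom_seminorm_def phi_zero)
  ultimately show ?thesis unfolding zero_nbhd_def by auto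
qed

definition hom_chars where "hom_chars = char_ball hom_seminorm"

lemma hom_chars_compact: "compactin (Spec A) hom_chars"
  unfolding hom_chars_def by (rule compactin_char_ball[OF hom_seminorm_C_star hom_seminorm_continuous])

lemma hom_chars_subset: "hom_chars \<subseteq> H"
  unfolding hom_chars_def char_ball_def by blast

lemma phi_dist_le:
  assumes "x \<in> carrier A" "y \<in> carrier A" "0 \<le> e" "\<forall>t\<in>hom_chars. cmod (t x - t y) \<le> e"
  shows "norm_dist B N (phi x) (phi y) \<le> e"
proof -
  have "hom_seminorm (x \<ominus> y) \<le> e"
  proof (rule p_le_of_char_ball[OF hom_seminorm_C_star hom_seminorm_continuous _ assms(3)])
    show "\<forall>t\<in>char_ball hom_seminorm. cmod (t (x \<ominus> y)) \<le> e"
      using assms hom_chars_subset by (auto simp: hom_chars_def[symmetric] character_minus subset_iff)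
  qed (use assms in simp)
  then show ?thesis
    using assms involutive_homsD(3)[OF hom] by (simp add: hom_seminorm_def phi_diff B.d_eq)
qed

definition limit_at :: "(('a \<Rightarrow> complex) \<Rightarrow> complex) \<Rightarrow> 'b \<Rightarrow> bool" where
  "limit_at f b \<longleftrightarrow> b \<in> carrier B \<and>
     (\<forall>r>0. \<exists>x\<in>carrier A. (\<forall>t\<in>hom_chars. cmod (t x - f t) \<le> r) \<and> norm_dist B N (phi x) b \<le> r)"

lemma limit_atD:
  assumes "limit_at f b" "r > 0"
  obtains x where "x \<in> carrier A" "\<forall>t\<in>hom_chars. cmod (t x - f t) \<le> r" "norm_dist B N (phi x) b \<le> r"
  using assms unfolding limit_at_def by blast

text \<open>One estimate with two uses: \<open>e = 0\<close> gives uniqueness of the limit, and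
  small \<open>e\<close> gives continuity of the extension in \<open>f\<close>.\<close>

lemma limit_at_dist:
  assumes b: "limit_at f b" and c: "limit_at g c" and e: "0 \<le> e" "\<forall>t\<in>hom_chars. cmod (f t - g t) \<le> e"
  shows "norm_dist B N b c \<le> e"
proof (rule field_le_epsilon)
  fix \<eta> :: real assume eta: "\<eta> > 0"
  \<comment> \<open>Four errors of \<open>\<eta>/4\<close>: two on the characters, for
    \<open>x\<close> and \<open>y\<close>, and two in \<open>B\<close>, for the distances to
    \<open>b\<close> and \<open>c\<close>.\<close>
  have e4: "\<eta>/4 > 0" using eta by simp
  obtain x where x: "x \<in> carrier A" "\<forall>t\<in>hom_chars. cmod (t x - f t) \<le> \<eta>/4" "norm_dist B N (phi x) b \<le> \<eta>/4"
    using limit_atD[OF b e4] .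
  obtain y where y: "y \<in> carrier A" "\<forall>t\<in>hom_chars. cmod (t y - g t) \<le> \<eta>/4" "norm_dist B N (phi y) c \<le> \<eta>/4"
    using limit_atD[OF c e4] .
  have bB: "b \<in> carrier B" and cB: "c \<in> carrier B" using b c by (auto simp: limit_at_def)
  have xB: "phi x \<in> carrier B" and yB: "phi y \<in> carrier B" using x y involutive_homsD(3)[OF hom] by auto
  have "cmod (t x - t y) \<le> e + \<eta>/2" if t: "t \<in> hom_chars" for t
  proof -
    have "t x - t y = (t x - f t) + (f t - g t) - (t y - g t)" by simp
    also have "cmod \<dots> \<le> cmod ((t x - f t) + (f t - g t)) + cmod (t y - g t)" by (rule norm_triangle_ineq4)
    also have "cmod ((t x - f t) + (f t - g t)) \<le> cmod (t x - f t) + cmod (f t - g t)" by (rule norm_triangle_ineq)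
    finally show ?thesis using x(2) y(2) e(2) t by fastforce
  qed
  then have "norm_dist B N (phi x) (phi y) \<le> e + \<eta>/2" using x y e eta by (intro phi_dist_le) auto
  moreover have "norm_dist B N b c \<le> norm_dist B N b (phi x) + norm_dist B N (phi x) c"
    by (rule B.d_triangle[OF bB xB cB])
  moreover have "norm_dist B N (phi x) c \<le> norm_dist B N (phi x) (phi y) + norm_dist B N (phi y) c"
    by (rule B.d_triangle[OF xB yB cB])
  ultimately show "norm_dist B N b c \<le> e + \<eta>"
    using x(3) y(3) B.d_commute[of b "phi x"] by simp
qed

lemma limit_at_unique:
  assumes b: "limit_at f b" and c: "limit_at f c" shows "b = c"
proof -
  have "norm_dist B N b c \<le> 0" by (rule limit_at_dist[OF b c]) simp_all
  then have "norm_dist B N b c = 0" using MB.nonneg[of b c] by simp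
  then show ?thesis using b c by (simp add: limit_at_def)
qed

text \<open>Elements of \<open>A\<close> approximate \<open>f\<close> on the compact set
  \<open>hom_chars\<close>. By \<open>phi_dist_le\<close> their images form a Cauchy sequence, and
  \<open>B\<close> is complete.\<close>

lemma limit_at_exists:
  assumes f: "f \<in> CF"
  shows "\<exists>b. limit_at f b"
proof -
  have "\<forall>n. \<exists>x. x \<in> carrier A \<and> (\<forall>t\<in>hom_chars. cmod (t x - f t) < inverse (real (Suc n)))"
  proof
    fix n :: nat
    have "inverse (real (Suc n)) > 0" by simp
    from gelfand_transform_approximates[OF hom_chars_compact continuous_map_from_subtopology[OF continuous_functionsD(1)[OF f]] this]
    show "\<exists>x. x \<in> carrier A \<and> (\<forall>t\<in>hom_chars. cmod (t x - f t) < inverse (real (Suc n)))" by metis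
  qed
  then obtain x where x: "\<And>n. x n \<in> carrier A" "\<And>n. \<forall>t\<in>hom_chars. cmod (t (x n) - f t) < inverse (real (Suc n))" by metis
  have xB: "phi (x n) \<in> carrier B" for n using x(1) involutive_homsD(3)[OF hom] by auto
  have dist: "norm_dist B N (phi (x m)) (phi (x n)) \<le> inverse (real (Suc m)) + inverse (real (Suc n))" for m n
  proof (rule phi_dist_le[OF x(1) x(1)])
    show "\<forall>t\<in>hom_chars. cmod (t (x m) - t (x n)) \<le> inverse (real (Suc m)) + inverse (real (Suc n))"
    proof
      fix t assume t: "t \<in> hom_chars"
      have "cmod (t (x m) - t (x n)) = cmod ((t (x m) - f t) - (t (x n) - f t))" by simp
      also have "\<dots> \<le> cmod (t (x m) - f t) + cmod (t (x n) - f t)" by (rule norm_triangle_ineq4)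
      finally show "cmod (t (x m) - t (x n)) \<le> inverse (real (Suc m)) + inverse (real (Suc n))"
        using x(2)[of m] x(2)[of n] t by fastforce
    qed
  qed simp
  have lim0: "(\<lambda>n. inverse (real (Suc n))) \<longlonglongrightarrow> 0" by (rule LIMSEQ_inverse_real_of_nat)
  have small: "\<exists>M. \<forall>n\<ge>M. inverse (real (Suc n)) < e" if "e > 0" for e
    using order_tendstoD(2)[OF lim0 that] by (simp add: eventually_sequentially)
  have "MB.MCauchy (\<lambda>n. phi (x n))"
    unfolding MB.MCauchy_def
  proof (intro conjI allI impI)
    show "range (\<lambda>n. phi (x n)) \<subseteq> carrier B" using xB by blast
    fix e :: real assume "e > 0"
    then have "e/2 > 0" by simp
    from small[OF this] obtain M where M: "\<forall>n\<ge>M. inverse (real (Suc n)) < e/2" by blast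
    have "norm_dist B N (phi (x m)) (phi (x n)) < e" if "M \<le> m" "M \<le> n" for m n
      using dist[of m n] M[rule_format, OF that(1)] M[rule_format, OF that(2)] by linarith
    then show "\<exists>M. \<forall>m n. M \<le> m \<longrightarrow> M \<le> n \<longrightarrow> norm_dist B N (phi (x m)) (phi (x n)) < e" by blast
  qed
  then obtain b where b: "limitin MB.mtopology (\<lambda>n. phi (x n)) b sequentially"
    using complete unfolding MB.mcomplete_def by blast
  have bB: "b \<in> carrier B" using b by (simp add: MB.limitin_metric)
  have "\<exists>y\<in>carrier A. (\<forall>t\<in>hom_chars. cmod (t y - f t) \<le> r) \<and> norm_dist B N (phi y) b \<le> r" if d: "r > 0" for r
  proof -
    obtain M1 where M1: "\<forall>n\<ge>M1. inverse (real (Suc n)) < r" using small[OF d] by blast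
    have "\<forall>\<^sub>F n in sequentially. phi (x n) \<in> carrier B \<and> norm_dist B N (phi (x n)) b < r"
      using b d by (simp add: MB.limitin_metric)
    then obtain M2 where M2: "\<forall>n\<ge>M2. norm_dist B N (phi (x n)) b < r" unfolding eventually_sequentially by blast
    let ?n = "max M1 M2"
    have "inverse (real (Suc ?n)) < r" using M1[rule_format, of ?n] by simp
    then have "\<forall>t\<in>hom_chars. cmod (t (x ?n) - f t) \<le> r" using x(2)[of ?n] by fastforce
    moreover have "norm_dist B N (phi (x ?n)) b \<le> r" using M2[rule_format, of ?n] by simp
    ultimately show ?thesis using x(1)[of ?n] by blast
  qed
  then show ?thesis unfolding limit_at_def using bB by blast
qed

lemma limit_at_gelfand:
  assumes x: "x \<in> carrier A" shows "limit_at (\<G> x) (phi x)"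
  unfolding limit_at_def
proof (intro conjI allI impI bexI[OF _ x])
  show xB: "phi x \<in> carrier B" using x involutive_homsD(3)[OF hom] by auto
  show "\<forall>t\<in>hom_chars. cmod (t x - \<G> x t) \<le> r" if "r > 0" for r
    using that x hom_chars_subset by (auto simp: subset_iff)
  show "norm_dist B N (phi x) (phi x) \<le> r" if "r > 0" for r using that xB by simp
qed

lemma limit_at_add:
  assumes b: "limit_at f b" and c: "limit_at g c" shows "limit_at (\<lambda>t\<in>H. f t + g t) (b \<oplus>\<^bsub>B\<^esub> c)"
  unfolding limit_at_def
proof (intro conjI allI impI)
  have bB: "b \<in> carrier B" and cB: "c \<in> carrier B" using b c by (auto simp: limit_at_def)
  then show "b \<oplus>\<^bsub>B\<^esub> c \<in> carrier B" by simp
  fix r :: real assume d: "r > 0"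
  then have e: "r/2 > 0" by simp
  obtain x where x: "x \<in> carrier A" "\<forall>t\<in>hom_chars. cmod (t x - f t) \<le> r/2" "norm_dist B N (phi x) b \<le> r/2"
    using limit_atD[OF b e] .
  obtain y where y: "y \<in> carrier A" "\<forall>t\<in>hom_chars. cmod (t y - g t) \<le> r/2" "norm_dist B N (phi y) c \<le> r/2"
    using limit_atD[OF c e] .
  show "\<exists>x\<in>carrier A. (\<forall>t\<in>hom_chars. cmod (t x - (\<lambda>t\<in>H. f t + g t) t) \<le> r) \<and> norm_dist B N (phi x) (b \<oplus>\<^bsub>B\<^esub> c) \<le> r"
  proof (intro bexI conjI ballI)
    show "x \<oplus> y \<in> carrier A" using x y by simp
    fix t assume t: "t \<in> hom_chars"
    then have tH: "t \<in> H" using hom_chars_subset by blast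
    have "cmod (t (x \<oplus> y) - (\<lambda>t\<in>H. f t + g t) t) = cmod ((t x - f t) + (t y - g t))"
      using tH x y by (simp add: character algebra_simps)
    also have "\<dots> \<le> cmod (t x - f t) + cmod (t y - g t)" by (rule norm_triangle_ineq)
    finally show "cmod (t (x \<oplus> y) - (\<lambda>t\<in>H. f t + g t) t) \<le> r" using x(2) y(2) t by fastforce
  next
    have "norm_dist B N (phi x \<oplus>\<^bsub>B\<^esub> phi y) (b \<oplus>\<^bsub>B\<^esub> c) \<le> norm_dist B N (phi x) b + norm_dist B N (phi y) c"
      using x y bB cB involutive_homsD(3)[OF hom] by (intro B.d_add) auto
    then show "norm_dist B N (phi (x \<oplus> y)) (b \<oplus>\<^bsub>B\<^esub> c) \<le> r"
      using x y involutive_homsD(4)[OF hom] by simp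
  qed
qed

lemma limit_at_star:
  assumes b: "limit_at f b" shows "limit_at (\<lambda>t\<in>H. cnj (f t)) (star B b)"
  unfolding limit_at_def
proof (intro conjI allI impI)
  have bB: "b \<in> carrier B" using b by (auto simp: limit_at_def)
  then show "star B b \<in> carrier B" by simp
  fix r :: real assume d: "r > 0"
  obtain x where x: "x \<in> carrier A" "\<forall>t\<in>hom_chars. cmod (t x - f t) \<le> r" "norm_dist B N (phi x) b \<le> r"
    using limit_atD[OF b d] .
  show "\<exists>x\<in>carrier A. (\<forall>t\<in>hom_chars. cmod (t x - (\<lambda>t\<in>H. cnj (f t)) t) \<le> r) \<and> norm_dist B N (phi x) (star B b) \<le> r"
  proof (intro bexI conjI ballI)
    show "star A x \<in> carrier A" using x by simp
    fix t assume t: "t \<in> hom_chars"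
    then have tH: "t \<in> H" using hom_chars_subset by blast
    have "cmod (t (star A x) - (\<lambda>t\<in>H. cnj (f t)) t) = cmod (cnj (t x - f t))"
      using tH x by (simp add: character)
    then show "cmod (t (star A x) - (\<lambda>t\<in>H. cnj (f t)) t) \<le> r" using x(2) t by (simp only: complex_mod_cnj)
  next
    show "norm_dist B N (phi (star A x)) (star B b) \<le> r"
      using x bB involutive_homsD(3,8)[OF hom] by (simp add: B.d_star)
  qed
qed

lemma limit_at_mult:
  assumes f: "f \<in> CF" and g: "g \<in> CF"
    and b: "limit_at f b" and c: "limit_at g c" shows "limit_at (\<lambda>t\<in>H. f t * g t) (b \<otimes>\<^bsub>B\<^esub> c)"
  unfolding limit_at_def
proof (intro conjI allI impI)
  have bB: "b \<in> carrier B" and cB: "c \<in> carrier B" using b c by (auto simp: limit_at_def)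
  then show "b \<otimes>\<^bsub>B\<^esub> c \<in> carrier B" by simp
  obtain F where F: "F > 0" "\<And>t. t \<in> hom_chars \<Longrightarrow> cmod (f t) \<le> F" using continuous_functions_bounded[OF f hom_chars_compact] by blast
  obtain G where G: "G > 0" "\<And>t. t \<in> hom_chars \<Longrightarrow> cmod (g t) \<le> G" using continuous_functions_bounded[OF g hom_chars_compact] by blast
  fix r :: real assume d: "r > 0"
  \<comment> \<open>\<open>S\<close> dominates the factors of both product estimates:
    \<open>F + 1\<close> bounds \<open>t x\<close>, and \<open>N b + 1\<close> bounds
    \<open>N (phi x)\<close>, as long as the error \<open>e\<close> is at most one.\<close>
  define S where "S = F + 1 + G + N b + N c"
  have Nb: "0 \<le> N b" "0 \<le> N c" using bB cB B.N_nonneg by auto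
  have S: "S > 0" using F G Nb unfolding S_def by linarith
  define e where "e = min 1 (r / S)"
  have e: "e > 0" "e \<le> 1" using d S by (auto simp: e_def)
  have Se: "S * e \<le> r"
  proof -
    have "S * e \<le> S * (r / S)" using S by (intro mult_left_mono) (auto simp: e_def)
    then show ?thesis using S by simp
  qed
  obtain x where x: "x \<in> carrier A" "\<forall>t\<in>hom_chars. cmod (t x - f t) \<le> e" "norm_dist B N (phi x) b \<le> e"
    using limit_atD[OF b e(1)] .
  obtain y where y: "y \<in> carrier A" "\<forall>t\<in>hom_chars. cmod (t y - g t) \<le> e" "norm_dist B N (phi y) c \<le> e"
    using limit_atD[OF c e(1)] .
  have xB: "phi x \<in> carrier B" and yB: "phi y \<in> carrier B" using x y involutive_homsD(3)[OF hom] by auto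
  show "\<exists>x\<in>carrier A. (\<forall>t\<in>hom_chars. cmod (t x - (\<lambda>t\<in>H. f t * g t) t) \<le> r) \<and> norm_dist B N (phi x) (b \<otimes>\<^bsub>B\<^esub> c) \<le> r"
  proof (intro bexI conjI ballI)
    show "x \<otimes> y \<in> carrier A" using x y by simp
    fix t assume t: "t \<in> hom_chars"
    then have tH: "t \<in> H" using hom_chars_subset by blast
    have tx: "cmod (t x) \<le> F + 1"
      using norm_triangle_ineq2[of "t x" "f t"] F(2)[OF t] x(2) t e(2) by fastforce
    have "cmod (t (x \<otimes> y) - (\<lambda>t\<in>H. f t * g t) t) = cmod (t x * (t y - g t) + (t x - f t) * g t)"
      using tH x y by (simp add: character algebra_simps)
    also have "\<dots> \<le> cmod (t x) * cmod (t y - g t) + cmod (t x - f t) * cmod (g t)"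
      using norm_triangle_ineq[of "t x * (t y - g t)" "(t x - f t) * g t"] by (simp add: norm_mult)
    also have "\<dots> \<le> (F + 1) * e + e * G"
      using tx x(2) y(2) t G(2)[OF t] F e by (intro add_mono mult_mono) auto
    also have "\<dots> \<le> S * e"
    proof -
      have "F + 1 + G \<le> S" using Nb by (simp add: S_def)
      then have "(F + 1 + G) * e \<le> S * e" using e by (intro mult_right_mono) auto
      then show ?thesis by (simp add: algebra_simps)
    qed
    finally show "cmod (t (x \<otimes> y) - (\<lambda>t\<in>H. f t * g t) t) \<le> r" using Se by simp
  next
    have z: "norm_dist B N u \<zero>\<^bsub>B\<^esub> = N u" if "u \<in> carrier B" for u
      using that by (simp add: B.d_eq B.minus_smult)
    have "N (phi x) \<le> N b + 1"
      using B.d_triangle[OF xB bB B.zero_closed] x(3) e(2) xB bB by (simp add: z)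
    have "norm_dist B N (phi x \<otimes>\<^bsub>B\<^esub> phi y) (b \<otimes>\<^bsub>B\<^esub> c) \<le> N (phi x) * norm_dist B N (phi y) c + norm_dist B N (phi x) b * N c"
      by (rule B.d_mult[OF xB yB bB cB])
    also have "\<dots> \<le> (N b + 1) * e + e * N c"
      using \<open>N (phi x) \<le> N b + 1\<close> x(3) y(3) Nb e by (intro add_mono mult_mono) auto
    also have "\<dots> \<le> S * e"
    proof -
      have "N b + 1 + N c \<le> S" using F G by (simp add: S_def)
      then have "(N b + 1 + N c) * e \<le> S * e" using e by (intro mult_right_mono) auto
      then show ?thesis by (simp add: algebra_simps)
    qed
    finally show "norm_dist B N (phi (x \<otimes> y)) (b \<otimes>\<^bsub>B\<^esub> c) \<le> r"
      using x y Se involutive_homsD(5)[OF hom] by simp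
  qed
qed

text \<open>Multiplication by the scalar \<open>c\<close> is multiplication by the transform of
  \<open>c \<odot> \<one>\<close>, so products already cover this case.\<close>

lemma limit_at_smult:
  assumes f: "f \<in> CF" and b: "limit_at f b"
  shows "limit_at (\<lambda>t\<in>H. c * f t) (c \<odot>\<^bsub>B\<^esub> b)"
proof -
  have bB: "b \<in> carrier B" using b by (simp add: limit_at_def)
  have c1: "c \<odot> \<one> \<in> carrier A" by simp
  have "phi (c \<odot> \<one>) \<otimes>\<^bsub>B\<^esub> b = c \<odot>\<^bsub>B\<^esub> b"
    using bB involutive_homsD(6,7)[OF hom] by (simp add: B.smult_mult_left)
  moreover have "(\<lambda>t\<in>H. \<G> (c \<odot> \<one>) t * f t) = (\<lambda>t\<in>H. c * f t)"
    by (rule restrict_ext) (simp add: character)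
  ultimately show ?thesis
    using limit_at_mult[OF gelfand_transform_in[OF c1] f limit_at_gelfand[OF c1] b] by (simp only:)
qed

lemma C_star_morphism_extends:
  "\<exists>phi'\<in>involutive_homs CH B. \<forall>x\<in>carrier A. phi' (\<G> x) = phi x"
proof -
  let ?C = "CF"
  define F where "F = (\<lambda>f\<in>?C. SOME b. limit_at f b)"
  have F: "limit_at f (F f)" if "f \<in> ?C" for f
    using someI_ex[OF limit_at_exists[OF that]] that by (simp add: F_def)
  have F_eq: "F f = b" if "f \<in> ?C" "limit_at f b" for f b
    by (rule limit_at_unique[OF F[OF that(1)] that(2)])
  have FB: "F f \<in> carrier B" if "f \<in> ?C" for f using F[OF that] by (simp add: limit_at_def)
  have G: "F (\<G> x) = phi x" if "x \<in> carrier A" for x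
    by (rule F_eq[OF gelfand_transform_in[OF that] limit_at_gelfand[OF that]])
  have "F \<in> involutive_homs CH B"
  proof (rule involutive_homsI)
    show "F \<in> extensional (carrier CH)" by (simp add: F_def)
    show "F f \<in> carrier B" if "f \<in> carrier CH" for f using that FB by simp
    show "continuous_map (topol CH) (topol B) F"
      unfolding topol MB.continuous_map_to_metric
    proof (intro ballI allI impI)
      fix f and e :: real assume "f \<in> topspace (topol CH)" and e: "e > 0"
      then have f: "f \<in> ?C" by simp
      have e2: "e/2 > 0" using e by simp
      obtain U where U: "openin (topol CH) U" "f \<in> U"
        "\<And>g. g \<in> U \<Longrightarrow> g \<in> ?C" "\<And>g t. g \<in> U \<Longrightarrow> t \<in> hom_chars \<Longrightarrow> cmod (g t - f t) < e/2"
        using openin_function_ball[OF hom_chars_compact f e2] by metis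
      have "F g \<in> MB.mball (F f) e" if g: "g \<in> U" for g
      proof -
        have "norm_dist B N (F f) (F g) \<le> e/2"
          by (rule limit_at_dist[OF F[OF f] F[OF U(3)[OF g]]])
            (use U(4)[OF g] e in \<open>auto simp: norm_minus_commute intro: less_imp_le\<close>)
        then show ?thesis using e FB[OF f] FB[OF U(3)[OF g]] by simp
      qed
      then show "\<exists>U. openin (topol CH) U \<and> f \<in> U \<and> (\<forall>g\<in>U. F g \<in> MB.mball (F f) e)"
        using U(1,2) by blast
    qed
  next
    have "\<G> \<one> = \<one>\<^bsub>CH\<^esub>"
      by (rule involutive_homsD(6)[OF gelfand_transform_hom])
    then show "F \<one>\<^bsub>CH\<^esub> = \<one>\<^bsub>B\<^esub>"
      using G[of \<one>] involutive_homsD(6)[OF hom] by simp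
  next
    fix f c assume "f \<in> carrier CH"
    then have f: "f \<in> ?C" by simp
    show "F (c \<odot>\<^bsub>CH\<^esub> f) = c \<odot>\<^bsub>B\<^esub> F f"
      using F_eq[OF continuous_functions_smult[OF f]] limit_at_smult[OF f F[OF f], of c] by simp
  next
    fix f assume "f \<in> carrier CH"
    then have f: "f \<in> ?C" by simp
    show "F (star CH f) = star B (F f)"
      using F_eq[OF continuous_functions_cnj[OF f]] limit_at_star[OF F[OF f]] by simp
  next
    fix f g assume "f \<in> carrier CH" "g \<in> carrier CH"
    then have f: "f \<in> ?C" and g: "g \<in> ?C" by simp_all
    show "F (f \<oplus>\<^bsub>CH\<^esub> g) = F f \<oplus>\<^bsub>B\<^esub> F g"
      using F_eq[OF continuous_functions_add[OF f g]] limit_at_add[OF F[OF f] F[OF g]] by simp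
    show "F (f \<otimes>\<^bsub>CH\<^esub> g) = F f \<otimes>\<^bsub>B\<^esub> F g"
      using F_eq[OF continuous_functions_mult[OF f g]] limit_at_mult[OF f g F[OF f] F[OF g]] by simp
  qed
  then show ?thesis using G by blast
qed

end

text \<open>Continuous maps into a Hausdorff space that agree on a dense set are equal. Both the
  epimorphism property and the uniqueness of extensions rest on this.\<close>

lemma hom_eq_of_gelfand:
  assumes B: "Hausdorff_space (topol B)"
    and f: "f \<in> involutive_homs CH B" and g: "g \<in> involutive_homs CH B"
    and eq: "\<And>x. x \<in> carrier A \<Longrightarrow> f (\<G> x) = g (\<G> x)"
  shows "f = g"
proof (rule extensionalityI[OF involutive_homsD(1)[OF f] involutive_homsD(1)[OF g]])
  fix h assume "h \<in> carrier CH"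
  then have "h \<in> topol CH closure_of (\<G> ` carrier A)"
    by (simp only: gelfand_transform_dense)
  then show "f h = g h"
    by (rule forall_in_closure_of_eq[OF _ B involutive_homsD(2)[OF f] involutive_homsD(2)[OF g]]) (use eq in auto)
qed

end

subsection \<open>Function algebras on compact spaces\<close>

text \<open>The algebraic half of \<open>ialg_inverse_isos\<close>. For copies of
  \<open>C(K)\<close> the topological half is derived once, from the transported metric.\<close>

definition ialg_bijection :: "'a ialg \<Rightarrow> 'b ialg \<Rightarrow> ('a \<Rightarrow> 'b) \<Rightarrow> ('b \<Rightarrow> 'a) \<Rightarrow> bool" where
  "ialg_bijection B Z f g \<longleftrightarrow>
     f \<in> carrier B \<rightarrow> carrier Z \<and> g \<in> carrier Z \<rightarrow> carrier B \<and>
     (\<forall>x\<in>carrier B. g (f x) = x) \<and> (\<forall>z\<in>carrier Z. f (g z) = z) \<and>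
     f \<zero>\<^bsub>B\<^esub> = \<zero>\<^bsub>Z\<^esub> \<and> f \<one>\<^bsub>B\<^esub> = \<one>\<^bsub>Z\<^esub> \<and>
     (\<forall>x\<in>carrier B. \<forall>y\<in>carrier B. f (x \<oplus>\<^bsub>B\<^esub> y) = f x \<oplus>\<^bsub>Z\<^esub> f y) \<and>
     (\<forall>x\<in>carrier B. \<forall>y\<in>carrier B. f (x \<otimes>\<^bsub>B\<^esub> y) = f x \<otimes>\<^bsub>Z\<^esub> f y) \<and>
     (\<forall>c. \<forall>x\<in>carrier B. f (c \<odot>\<^bsub>B\<^esub> x) = c \<odot>\<^bsub>Z\<^esub> f x) \<and>
     (\<forall>x\<in>carrier B. f (star B x) = star Z (f x))"

lemma ialg_inverse_isosI:
  assumes "ialg_bijection B Z f g" "topspace (topol Z) = carrier Z"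
    "continuous_map (topol B) (topol Z) f" "continuous_map (topol Z) (topol B) g"
  shows "ialg_inverse_isos B Z f g"
  using assms unfolding ialg_inverse_isos_def ialg_bijection_def by simp

lemma ialg_inverse_isos_homs:
  assumes i: "ialg_inverse_isos B Z f g" and B: "ring B" "complex_lcs B" "star_algebra B"
  shows "restrict f (carrier B) \<in> involutive_homs B Z" "restrict g (carrier Z) \<in> involutive_homs Z B"
proof -
  interpret B: ring B by (rule B)
  interpret L: complex_lcs B by (rule B)
  have st: "star B x \<in> carrier B" if "x \<in> carrier B" for x using B(3) that by (auto simp: star_algebra_def Pi_iff)
  note I = iso_carrier[OF i] iso_inverse[OF i] iso_zero[OF i] iso_one[OF i] iso_ops[OF i]
  have tB: "topspace (topol B) = carrier B" by simp
  show "restrict f (carrier B) \<in> involutive_homs B Z"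
    by (rule involutive_homsI)
      (use continuous_map_eq[OF iso_continuous(1)[OF i], of "restrict f (carrier B)"] in
        \<open>simp_all add: I iso_smult[OF i] iso_star[OF i] st tB\<close>)
  have "star Z z \<in> carrier Z" if "z \<in> carrier Z" for z using that by (simp add: I st)
  then show "restrict g (carrier Z) \<in> involutive_homs Z B"
    by (intro involutive_homsI)
      (use continuous_map_eq[OF iso_continuous(2)[OF i], of "restrict g (carrier Z)"] in \<open>simp_all add: I st iso_topspace[OF i]\<close>)
qed

lemma compose_involutive_homs:
  assumes f: "f \<in> involutive_homs A B" and g: "g \<in> involutive_homs B C"
    and A: "complex_lcs A" "ring A" "star_algebra A"
  shows "compose (carrier A) g f \<in> involutive_homs A C"
proof -
  interpret A: complex_lcs A by (rule A)
  interpret R: ring A by (rule A)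
  have st: "star A x \<in> carrier A" if "x \<in> carrier A" for x using A(3) that by (auto simp: star_algebra_def Pi_iff)
  note F = involutive_homsD[OF f] and G = involutive_homsD[OF g]
  have "continuous_map (topol A) (topol C) (g \<circ> f)" by (rule continuous_map_compose[OF F(2) G(2)])
  then have "continuous_map (topol A) (topol C) (compose (carrier A) g f)"
    by (rule continuous_map_eq) (simp add: compose_def)
  then show ?thesis
    by (intro involutive_homsI) (simp_all add: compose_def F(3-8) G(3-8) st)
qed

lemma restrict_function_hom:
  assumes L: "L \<subseteq> topspace M"
  shows "(\<lambda>f\<in>continuous_functions M. restrict f L) \<in> involutive_homs (function_algebra M) (function_algebra (subtopology M L))"
proof (rule involutive_homsI)
  let ?r = "\<lambda>f\<in>continuous_functions M. restrict f L"
  have top: "topspace (subtopology M L) = L" using L by auto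
  have r: "restrict f L \<in> continuous_functions (subtopology M L)" if "f \<in> continuous_functions M" for f
    using restrict_in_continuous_functions[OF continuous_map_from_subtopology[OF continuous_functionsD(1)[OF that], of L]]
    unfolding top .
  show "?r \<in> extensional (carrier (function_algebra M))" by simp
  show "?r f \<in> carrier (function_algebra (subtopology M L))" if "f \<in> carrier (function_algebra M)" for f
    using r that by simp
  show "continuous_map (topol (function_algebra M)) (topol (function_algebra (subtopology M L))) ?r"
    unfolding function_algebra_simps(7)[of "subtopology M L"] continuous_map_into_uniform
  proof (intro conjI ballI allI impI)
    show "?r \<in> topspace (topol (function_algebra M)) \<rightarrow> continuous_functions (subtopology M L)" using r by simp
    fix f K and e :: real assume "f \<in> topspace (topol (function_algebra M))"
      and "K \<in> {K. compactin (subtopology M L) K}" and e: "e > 0"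
    then have f: "f \<in> continuous_functions M" and K: "compactin M K" "K \<subseteq> L" by (auto simp: compactin_subtopology)
    obtain U where U: "openin (topol (function_algebra M)) U" "f \<in> U"
        "\<And>g. g \<in> U \<Longrightarrow> g \<in> continuous_functions M" "\<And>g t. g \<in> U \<Longrightarrow> t \<in> K \<Longrightarrow> cmod (g t - f t) < e"
      using openin_function_ball[OF K(1) f e] by metis
    have "dist (?r g t) (?r f t) < e" if "g \<in> U" "t \<in> K" for g t
      using U(3,4)[OF that(1)] that K(2) f by (auto simp: dist_norm)
    then show "\<exists>N. openin (topol (function_algebra M)) N \<and> f \<in> N \<and> (\<forall>y\<in>N. \<forall>s\<in>K. dist (?r y s) (?r f s) < e)"
      using U(1,2) by blast
  qed
  fix f assume "f \<in> carrier (function_algebra M)"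
  then have f: "f \<in> continuous_functions M" by simp
  show "?r (c \<odot>\<^bsub>function_algebra M\<^esub> f) = c \<odot>\<^bsub>function_algebra (subtopology M L)\<^esub> ?r f" for c
    using f L unfolding function_algebra_simps top by (auto simp: continuous_functions_smult intro!: ext)
  show "?r (star (function_algebra M) f) = star (function_algebra (subtopology M L)) (?r f)"
    using f L unfolding function_algebra_simps top by (auto simp: continuous_functions_cnj intro!: ext)
  fix g assume "g \<in> carrier (function_algebra M)"
  then have g: "g \<in> continuous_functions M" by simp
  show "?r (f \<oplus>\<^bsub>function_algebra M\<^esub> g) = ?r f \<oplus>\<^bsub>function_algebra (subtopology M L)\<^esub> ?r g"
    using f g L unfolding function_algebra_simps top by (auto simp: continuous_functions_add intro!: ext)
  show "?r (f \<otimes>\<^bsub>function_algebra M\<^esub> g) = ?r f \<otimes>\<^bsub>function_algebra (subtopology M L)\<^esub> ?r g"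
    using f g L unfolding function_algebra_simps top by (auto simp: continuous_functions_mult intro!: ext)
next
  show "(\<lambda>f\<in>continuous_functions M. restrict f L) \<one>\<^bsub>function_algebra M\<^esub> = \<one>\<^bsub>function_algebra (subtopology M L)\<^esub>"
    using L by (auto simp: const_in_continuous_functions intro!: ext)
qed

text \<open>The function \<open>h\<close> expresses compatibility: the value at \<open>t\<close>
  does not depend on \<open>K\<close>. Continuity at a point is read off from a compact
  neighbourhood, and continuity into \<open>C(M)\<close> from one compact set at a time. The
  algebraic laws are pointwise, so the one-point sets suffice for them.\<close>

lemma glue_homs:
  assumes lc: "locally_compact_space M" and X: "complex_lcs X" "ring X" "star_algebra X"
    and \<theta>: "\<And>K. compactin M K \<Longrightarrow> \<theta> K \<in> involutive_homs X (function_algebra (subtopology M K))"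
    and h: "\<And>K t y. compactin M K \<Longrightarrow> t \<in> K \<Longrightarrow> y \<in> carrier X \<Longrightarrow> \<theta> K y t = h y t"
  shows "(\<lambda>y\<in>carrier X. \<lambda>t\<in>topspace M. h y t) \<in> involutive_homs X (function_algebra M)"
proof -
  interpret X: complex_lcs X by (rule X)
  interpret R: ring X by (rule X)
  have st: "star X x \<in> carrier X" if "x \<in> carrier X" for x using X(3) that by (auto simp: star_algebra_def Pi_iff)
  let ?h = "\<lambda>y\<in>carrier X. \<lambda>t\<in>topspace M. h y t"
  have top: "topspace (subtopology M K) = K" if "compactin M K" for K
    using compactin_subset_topspace[OF that] by auto
  have hC: "?h y \<in> continuous_functions M" if y: "y \<in> carrier X" for y
  proof -
    have "continuous_map M euclidean (\<lambda>t. h y t)"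
      unfolding continuous_map_into_complex
    proof (intro ballI allI impI)
      fix t and e :: real assume t: "t \<in> topspace M" and e: "e > 0"
      obtain U K where UK: "openin M U" "compactin M K" "t \<in> U" "U \<subseteq> K"
        using lc t unfolding locally_compact_space_def by blast
      have "\<theta> K y \<in> continuous_functions (subtopology M K)" using involutive_homsD(3)[OF \<theta>[OF UK(2)] y] by simp
      then have "continuous_map (subtopology M K) euclidean (\<theta> K y)" by (rule continuous_functionsD)
      moreover have "t \<in> topspace (subtopology M K)" using top[OF UK(2)] UK(3,4) by blast
      ultimately obtain N where N: "openin (subtopology M K) N" "t \<in> N" "\<forall>s\<in>N. dist (\<theta> K y s) (\<theta> K y t) < e"
        using e unfolding continuous_map_into_complex by blast
      obtain N' where N': "openin M N'" "N = N' \<inter> K" using N(1) unfolding openin_subtopology by blast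
      have "dist (h y s) (h y t) < e" if s: "s \<in> N' \<inter> U" for s
      proof -
        have "s \<in> N" "s \<in> K" "t \<in> K" using s N'(2) UK(3,4) by auto
        then show ?thesis using N(3) h[OF UK(2) _ y] by metis
      qed
      then show "\<exists>N. openin M N \<and> t \<in> N \<and> (\<forall>s\<in>N. dist (h y s) (h y t) < e)"
        using N' N(2) UK by (intro exI[of _ "N' \<inter> U"]) auto
    qed
    then show ?thesis using y restrict_in_continuous_functions by simp
  qed
  have pt: "compactin M {t}" if "t \<in> topspace M" for t using that by simp
  have h_eq: "h y t = \<theta> {t} y t" if "t \<in> topspace M" "y \<in> carrier X" for y t
    using h[OF pt[OF that(1)] _ that(2), of t] by simp
  show ?thesis
  proof (rule involutive_homsI)
    show "?h \<in> extensional (carrier X)" by simp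
    show "?h y \<in> carrier (function_algebra M)" if "y \<in> carrier X" for y using hC[OF that] by simp
    show "continuous_map (topol X) (topol (function_algebra M)) ?h"
      unfolding function_algebra_simps(7) continuous_map_into_uniform
    proof (intro conjI ballI allI impI)
      show "?h \<in> topspace (topol X) \<rightarrow> continuous_functions M" using hC by simp
      fix y K and e :: real assume y': "y \<in> topspace (topol X)" and K': "K \<in> {K. compactin M K}" and e: "e > 0"
      then have y: "y \<in> carrier X" and K: "compactin M K" by simp_all
      have KM: "K \<subseteq> topspace M" by (rule compactin_subset_topspace[OF K])
      have "continuous_map (topol X) (topol (function_algebra (subtopology M K))) (\<theta> K)"
        by (rule involutive_homsD(2)[OF \<theta>[OF K]])
      then have "\<forall>x\<in>topspace (topol X). \<forall>S\<in>{L. compactin (subtopology M K) L}. \<forall>e>0.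
         \<exists>N. openin (topol X) N \<and> x \<in> N \<and> (\<forall>y\<in>N. \<forall>s\<in>S. dist (\<theta> K y s) (\<theta> K x s) < e)"
        unfolding function_algebra_simps(7) continuous_map_into_uniform by (rule conjunct2)
      from this[rule_format, OF y', of K e] K e
      obtain N where N: "openin (topol X) N" "y \<in> N" "\<forall>z\<in>N. \<forall>s\<in>K. dist (\<theta> K z s) (\<theta> K y s) < e"
        by (auto simp: compactin_subtopology)
      have "dist (?h z s) (?h y s) < e" if z: "z \<in> N" and s: "s \<in> K" for z s
      proof -
        have zX: "z \<in> carrier X" using z openin_subset[OF N(1)] by auto
        show ?thesis using N(3)[rule_format, OF z s] h[OF K s zX] h[OF K s y] zX y s KM by auto
      qed
      then show "\<exists>N. openin (topol X) N \<and> y \<in> N \<and> (\<forall>z\<in>N. \<forall>s\<in>K. dist (?h z s) (?h y s) < e)"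
        using N by blast
    qed
  next
    have "h \<one>\<^bsub>X\<^esub> t = 1" if t: "t \<in> topspace M" for t
      using h_eq[OF t, of "\<one>\<^bsub>X\<^esub>"] involutive_homsD(6)[OF \<theta>[OF pt[OF t]]] t by simp
    then show "?h \<one>\<^bsub>X\<^esub> = \<one>\<^bsub>function_algebra M\<^esub>" by (auto intro!: restrict_ext)
  next
    fix y c assume y: "y \<in> carrier X"
    have "h (c \<odot>\<^bsub>X\<^esub> y) t = c * h y t" if t: "t \<in> topspace M" for t
      using h_eq[OF t] involutive_homsD(7)[OF \<theta>[OF pt[OF t]] y] t y by simp
    then show "?h (c \<odot>\<^bsub>X\<^esub> y) = c \<odot>\<^bsub>function_algebra M\<^esub> ?h y" using y by (auto intro!: restrict_ext)
  next
    fix y assume y: "y \<in> carrier X"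
    have "h (star X y) t = cnj (h y t)" if t: "t \<in> topspace M" for t
      using h_eq[OF t] involutive_homsD(8)[OF \<theta>[OF pt[OF t]] y] t y st by simp
    then show "?h (star X y) = star (function_algebra M) (?h y)" using y st by (auto intro!: restrict_ext)
  next
    fix y z assume y: "y \<in> carrier X" and z: "z \<in> carrier X"
    have "h (y \<oplus>\<^bsub>X\<^esub> z) t = h y t + h z t" if t: "t \<in> topspace M" for t
      using h_eq[OF t] involutive_homsD(4)[OF \<theta>[OF pt[OF t]] y z] t y z by simp
    then show "?h (y \<oplus>\<^bsub>X\<^esub> z) = ?h y \<oplus>\<^bsub>function_algebra M\<^esub> ?h z" using y z by (auto intro!: restrict_ext)
    have "h (y \<otimes>\<^bsub>X\<^esub> z) t = h y t * h z t" if t: "t \<in> topspace M" for t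
      using h_eq[OF t] involutive_homsD(5)[OF \<theta>[OF pt[OF t]] y z] t y z by simp
    then show "?h (y \<otimes>\<^bsub>X\<^esub> z) = ?h y \<otimes>\<^bsub>function_algebra M\<^esub> ?h z" using y z by (auto intro!: restrict_ext)
  qed
qed

lemma compact_imp_paracompact_space:
  assumes "compact_space M" "Hausdorff_space M" shows "paracompact_space M"
  unfolding paracompact_space_def
proof (intro conjI allI impI)
  fix \<U> assume U: "(\<forall>U\<in>\<U>. openin M U) \<and> \<Union>\<U> = topspace M"
  have "compactin M (topspace M)" using assms(1) by (simp add: compact_space_def)
  from compactinD[OF this, of \<U>] U obtain \<F> where F: "finite \<F>" "\<F> \<subseteq> \<U>" "topspace M \<subseteq> \<Union>\<F>" by auto
  have FU: "\<Union>\<F> \<subseteq> topspace M" using F(2) U by blast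
  show "\<exists>\<V>. (\<forall>V\<in>\<V>. openin M V) \<and> \<Union>\<V> = topspace M \<and> (\<forall>V\<in>\<V>. \<exists>U\<in>\<U>. V \<subseteq> U) \<and> locally_finite_in M \<V>"
  proof (intro exI[of _ \<F>] conjI)
    show "locally_finite_in M \<F>"
      unfolding locally_finite_in_def using F(1) FU openin_topspace by (intro conjI ballI exI[of _ "topspace M"]) auto
  qed (use F U FU in auto)
qed (rule assms)

section \<open>\<open>C(M)\<close> as a C*-algebra for compact \<open>M\<close>\<close>

locale compact_function_space =
  fixes M :: "'m topology"
  assumes compact: "compact_space M" and Hausdorff: "Hausdorff_space M"
begin

abbreviation "CM \<equiv> function_algebra M"

abbreviation "C \<equiv> continuous_functions M"

definition metric_CM :: "('m \<Rightarrow> complex) metric" where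
  "metric_CM = cfunspace M euclidean_metric"

abbreviation "D \<equiv> mdist metric_CM"

lemma compactin_topspace: "compactin M (topspace M)"
  using compact by (simp add: compact_space_def)

lemma mspace_CM [simp]: "mspace metric_CM = C"
  unfolding metric_CM_def compactin_mspace_cfunspace[OF compactin_topspace] continuous_functions_def by auto

sublocale D: Metric_space "C" D
  using Metric_space_mspace_mdist[of metric_CM] by simp

lemma D_le:
  assumes "0 \<le> b" "\<And>t. t \<in> topspace M \<Longrightarrow> cmod (f t - g t) \<le> b" shows "D f g \<le> b"
  unfolding metric_CM_def by (rule mdist_cfunspace_le) (use assms in \<open>auto simp: dist_norm\<close>)

lemma le_D:
  assumes "f \<in> C" "g \<in> C" "t \<in> topspace M"
  shows "cmod (f t - g t) \<le> D f g"
proof -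
  have "f \<in> mspace (cfunspace M euclidean_metric)" "g \<in> mspace (cfunspace M euclidean_metric)"
    using assms(1,2) mspace_CM unfolding metric_CM_def by (simp_all only:)
  from mdist_cfunspace_imp_mdist_le[OF this order_refl assms(3)]
  show ?thesis unfolding metric_CM_def by (simp add: dist_norm)
qed

lemma mcomplete_D: "D.mcomplete"
proof -
  have "Metric_space.mcomplete (UNIV::complex set) dist" using complete_UNIV by simp
  from Metric_space.mcomplete_cfunspace[OF Met_TC.Metric_space_axioms this, of M]
  have "mcomplete_of metric_CM"
    by (simp add: metric_CM_def euclidean_metric_def Metric_space.Self_def[OF Met_TC.Metric_space_axioms])
  then show ?thesis by (simp add: mcomplete_of_def)
qed

lemma involutive_stereotype_CM: "involutive_stereotype_algebra CM"
  by (intro involutive_stereotype_function_algebra compact_imp_locally_compact_space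
      compact_imp_paracompact_space compact Hausdorff)

text \<open>Defining the norm through the metric \<open>D\<close> makes completeness available and
  leaves no separate case for empty \<open>M\<close>.\<close>

definition norm_CM :: "('m \<Rightarrow> complex) \<Rightarrow> real" where
  "norm_CM f = D f \<zero>\<^bsub>CM\<^esub>"

lemma zero_CM: "\<zero>\<^bsub>CM\<^esub> \<in> C"
  using const_in_continuous_functions[where c = 0] by simp

lemma norm_CM_le: "0 \<le> b \<Longrightarrow> (\<And>t. t \<in> topspace M \<Longrightarrow> cmod (f t) \<le> b) \<Longrightarrow> norm_CM f \<le> b"
  unfolding norm_CM_def by (rule D_le) auto

lemma le_norm_CM: "f \<in> C \<Longrightarrow> t \<in> topspace M \<Longrightarrow> cmod (f t) \<le> norm_CM f"
  unfolding norm_CM_def using le_D[OF _ zero_CM, of f t] by simp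

lemma norm_CM_nonneg: "0 \<le> norm_CM f"
  by (simp add: norm_CM_def)

lemma C_star_norm_CM: "C_star_norm CM norm_CM"
  unfolding C_star_norm_def
proof (intro conjI ballI allI)
  fix f assume "f \<in> carrier CM"
  then have f: "f \<in> C" by simp
  show "0 \<le> norm_CM f" by (rule norm_CM_nonneg)
  show "(norm_CM f = 0) = (f = \<zero>\<^bsub>CM\<^esub>)" unfolding norm_CM_def using D.zero[OF f zero_CM] .
  have le: "norm_CM (c \<odot>\<^bsub>CM\<^esub> g) \<le> cmod c * norm_CM g" if "g \<in> C" for c g
    by (rule norm_CM_le) (use that in \<open>simp_all add: norm_CM_nonneg norm_mult mult_left_mono le_norm_CM\<close>)
  show "norm_CM (c \<odot>\<^bsub>CM\<^esub> f) = cmod c * norm_CM f" for c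
  proof (cases "c = 0")
    case True
    then show ?thesis using le[OF f, of 0] norm_CM_nonneg[of "0 \<odot>\<^bsub>CM\<^esub> f"] by simp
  next
    case False
    have "inverse c \<odot>\<^bsub>CM\<^esub> (c \<odot>\<^bsub>CM\<^esub> f) = f"
      unfolding function_algebra_simps by (rule restrict_continuous_functions_eq[OF f]) (use False in simp)
    moreover have cf: "c \<odot>\<^bsub>CM\<^esub> f \<in> C" using continuous_functions_smult[OF f] by simp
    ultimately have "norm_CM f \<le> cmod (inverse c) * norm_CM (c \<odot>\<^bsub>CM\<^esub> f)"
      using le[OF cf, of "inverse c"] by (simp only:)
    then have "norm_CM f \<le> inverse (cmod c) * norm_CM (c \<odot>\<^bsub>CM\<^esub> f)" by (simp only: norm_inverse)
    then have "cmod c * norm_CM f \<le> cmod c * (inverse (cmod c) * norm_CM (c \<odot>\<^bsub>CM\<^esub> f))"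
      by (rule mult_left_mono) simp
    also have "\<dots> = norm_CM (c \<odot>\<^bsub>CM\<^esub> f)" using False by (simp only: mult.assoc[symmetric]) simp
    finally show ?thesis using le[OF f, of c] by (rule antisym[rotated])
  qed
  let ?ff = "f \<otimes>\<^bsub>CM\<^esub> star CM f"
  have ff: "?ff \<in> C"
    using continuous_functions_mult[OF f continuous_functions_cnj[OF f]] by simp
  have ff_t: "cmod (?ff t) = (cmod (f t))\<^sup>2" if "t \<in> topspace M" for t
    using that by (simp add: norm_mult power2_eq_square)
  show "norm_CM ?ff = (norm_CM f)\<^sup>2"
  proof (rule antisym)
    show "norm_CM ?ff \<le> (norm_CM f)\<^sup>2"
      by (rule norm_CM_le) (simp_all only: ff_t zero_le_power2 power_mono le_norm_CM[OF f] norm_ge_zero)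
    \<comment> \<open>The norm is handled only through pointwise majorants. The majorant of
      \<open>?ff\<close> becomes one of \<open>f\<close> after taking square roots, and the
      inequality is squared afterwards.\<close>
    have "norm_CM f \<le> sqrt (norm_CM ?ff)"
    proof (rule norm_CM_le)
      fix t assume t: "t \<in> topspace M"
      have "(cmod (f t))\<^sup>2 \<le> norm_CM ?ff" using le_norm_CM[OF ff t] ff_t[OF t] by (simp only:)
      then show "cmod (f t) \<le> sqrt (norm_CM ?ff)" by (rule real_le_rsqrt)
    qed (simp add: norm_CM_nonneg)
    then have "(norm_CM f)\<^sup>2 \<le> (sqrt (norm_CM ?ff))\<^sup>2" by (rule power_mono) (rule norm_CM_nonneg)
    then show "(norm_CM f)\<^sup>2 \<le> norm_CM ?ff" using norm_CM_nonneg[of ?ff] by (simp only: real_sqrt_pow2)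
  qed
  fix g assume "g \<in> carrier CM"
  then have g: "g \<in> C" by simp
  show "norm_CM (f \<oplus>\<^bsub>CM\<^esub> g) \<le> norm_CM f + norm_CM g"
  proof (rule norm_CM_le)
    fix t assume t: "t \<in> topspace M"
    have "cmod (f t + g t) \<le> cmod (f t) + cmod (g t)" by (rule norm_triangle_ineq)
    also have "\<dots> \<le> norm_CM f + norm_CM g" using t f g by (intro add_mono le_norm_CM)
    finally show "cmod ((f \<oplus>\<^bsub>CM\<^esub> g) t) \<le> norm_CM f + norm_CM g" using t by simp
  qed (simp add: norm_CM_nonneg)
  show "norm_CM (f \<otimes>\<^bsub>CM\<^esub> g) \<le> norm_CM f * norm_CM g"
  proof (rule norm_CM_le)
    fix t assume t: "t \<in> topspace M"
    have "cmod (f t) * cmod (g t) \<le> norm_CM f * norm_CM g"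
      using t f g by (intro mult_mono le_norm_CM norm_CM_nonneg norm_ge_zero)
    then show "cmod ((f \<otimes>\<^bsub>CM\<^esub> g) t) \<le> norm_CM f * norm_CM g" using t by (simp add: norm_mult)
  qed (simp add: norm_CM_nonneg)
qed

sublocale CS: C_star_algebra_norm CM norm_CM
  by (rule C_star_algebra_norm.intro[OF star_algebra_function_algebra C_star_norm_CM])

lemma D_eq_norm:
  assumes f: "f \<in> C" and g: "g \<in> C"
  shows "norm_CM (f \<ominus>\<^bsub>CM\<^esub> g) = D f g"
proof -
  have m: "f \<ominus>\<^bsub>CM\<^esub> g = f \<oplus>\<^bsub>CM\<^esub> (-1) \<odot>\<^bsub>CM\<^esub> g" using g by (intro CS.minus_smult) simp
  have t: "(f \<ominus>\<^bsub>CM\<^esub> g) t = f t - g t" if "t \<in> topspace M" for t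
    unfolding m using that by simp
  have "f \<ominus>\<^bsub>CM\<^esub> g \<in> carrier CM" using f g by (intro CS.minus_closed) simp_all
  then have mC: "f \<ominus>\<^bsub>CM\<^esub> g \<in> C" by simp
  show ?thesis
  proof (rule antisym)
    show "norm_CM (f \<ominus>\<^bsub>CM\<^esub> g) \<le> D f g" by (rule norm_CM_le) (use f g in \<open>simp_all add: t le_D\<close>)
    show "D f g \<le> norm_CM (f \<ominus>\<^bsub>CM\<^esub> g)"
      by (rule D_le[OF norm_CM_nonneg]) (use le_norm_CM[OF mC] t in simp)
  qed
qed

text \<open>The target \<open>Z\<close> below is a copy of \<open>C(M)\<close> on another type, with the metric carried over.\<close>

context
  fixes Z :: "'z ialg" and \<Psi> \<Gamma> and dz
  assumes bij: "ialg_bijection CM Z \<Psi> \<Gamma>"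
    and dz: "\<And>x y. dz x y = (if x \<in> carrier Z \<and> y \<in> carrier Z then D (\<Gamma> x) (\<Gamma> y) else 0)"
    and topol: "topol Z = Metric_space.mtopology (carrier Z) dz"
begin

lemma \<Gamma>_in: "z \<in> carrier Z \<Longrightarrow> \<Gamma> z \<in> C"
  and \<Psi>_in: "f \<in> C \<Longrightarrow> \<Psi> f \<in> carrier Z"
  and \<Gamma>\<Psi>: "f \<in> C \<Longrightarrow> \<Gamma> (\<Psi> f) = f"
  and \<Psi>\<Gamma>: "z \<in> carrier Z \<Longrightarrow> \<Psi> (\<Gamma> z) = z"
  using bij unfolding ialg_bijection_def by (auto simp: Pi_iff)

lemma metric_copy: "Metric_space (carrier Z) dz"
proof
  show "0 \<le> dz x y" for x y by (simp add: dz)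
  show "dz x y = dz y x" for x y by (simp add: dz D.commute)
  show "(dz x y = 0) = (x = y)" if "x \<in> carrier Z" "y \<in> carrier Z" for x y
    using that \<Psi>\<Gamma> \<Gamma>_in by (metis dz D.zero)
  show "dz x z \<le> dz x y + dz y z" if "x \<in> carrier Z" "y \<in> carrier Z" "z \<in> carrier Z" for x y z
    using that \<Gamma>_in D.triangle by (simp add: dz)
qed

interpretation Z: Metric_space "carrier Z" dz
  by (rule metric_copy)

lemma copy_inverse_isos: "ialg_inverse_isos CM Z \<Psi> \<Gamma>"
proof (rule ialg_inverse_isosI[OF bij])
  show "topspace (topol Z) = carrier Z" unfolding topol by simp
  show "continuous_map (topol CM) (topol Z) \<Psi>"
    unfolding topol Z.continuous_map_to_metric
  proof (intro ballI allI impI)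
    fix f and e :: real assume "f \<in> topspace (topol CM)" and e: "e > 0"
    then have f: "f \<in> C" by simp
    have e2: "e/2 > 0" using e by simp
    obtain U where U: "openin (topol CM) U" "f \<in> U" "\<And>g. g \<in> U \<Longrightarrow> g \<in> C"
      "\<And>g t. g \<in> U \<Longrightarrow> t \<in> topspace M \<Longrightarrow> cmod (g t - f t) < e/2"
      using openin_function_ball[OF compactin_topspace f e2] by metis
    have "\<Psi> g \<in> Z.mball (\<Psi> f) e" if g: "g \<in> U" for g
    proof -
      have "D f g \<le> e/2"
        by (rule D_le) (use U(4)[OF g] e in \<open>auto simp: norm_minus_commute intro: less_imp_le\<close>)
      then show ?thesis using e f U(3)[OF g] by (simp add: dz \<Psi>_in \<Gamma>\<Psi>)
    qed
    then show "\<exists>U. openin (topol CM) U \<and> f \<in> U \<and> (\<forall>g\<in>U. \<Psi> g \<in> Z.mball (\<Psi> f) e)" using U(1,2) by blast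
  qed
  show "continuous_map (topol Z) (topol CM) \<Gamma>"
    unfolding topol function_algebra_simps(7) continuous_map_into_uniform
  proof (intro conjI ballI allI impI)
    show "\<Gamma> \<in> topspace Z.mtopology \<rightarrow> C" using \<Gamma>_in by simp
    fix z K and e :: real assume "z \<in> topspace Z.mtopology" and K: "K \<in> {K. compactin M K}" and e: "e > 0"
    then have z: "z \<in> carrier Z" by simp
    have KM: "K \<subseteq> topspace M" using K compactin_subset_topspace by blast
    have "dist (\<Gamma> w t) (\<Gamma> z t) < e" if w: "w \<in> Z.mball z e" and t: "t \<in> K" for w t
    proof -
      have wZ: "w \<in> carrier Z" and "D (\<Gamma> z) (\<Gamma> w) < e" using w z by (auto simp: dz)
      moreover have "cmod (\<Gamma> z t - \<Gamma> w t) \<le> D (\<Gamma> z) (\<Gamma> w)"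
        using t KM by (intro le_D \<Gamma>_in z wZ) blast
      ultimately show ?thesis by (simp add: dist_norm norm_minus_commute)
    qed
    then show "\<exists>N. openin Z.mtopology N \<and> z \<in> N \<and> (\<forall>y\<in>N. \<forall>s\<in>K. dist (\<Gamma> y s) (\<Gamma> z s) < e)"
      using z e by (intro exI[of _ "Z.mball z e"]) auto
  qed
qed

lemma involutive_stereotype_copy: "involutive_stereotype_algebra Z"
  by (rule involutive_stereotype_algebra_transport[OF copy_inverse_isos involutive_stereotype_CM])

lemma mcomplete_copy: "Z.mcomplete"
  unfolding Z.mcomplete_def
proof (intro allI impI)
  fix s assume s: "Z.MCauchy s"
  then have sZ: "s n \<in> carrier Z" for n by (auto simp: Z.MCauchy_def)
  have "D.MCauchy (\<lambda>n. \<Gamma> (s n))"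
    using s sZ \<Gamma>_in unfolding Z.MCauchy_def D.MCauchy_def by (auto simp: dz)
  then obtain f where f: "limitin D.mtopology (\<lambda>n. \<Gamma> (s n)) f sequentially"
    using mcomplete_D unfolding D.mcomplete_def by blast
  then have "limitin Z.mtopology s (\<Psi> f) sequentially"
    unfolding D.limitin_metric Z.limitin_metric by (simp add: dz sZ \<Psi>_in \<Gamma>\<Psi> \<Gamma>_in)
  then show "\<exists>x. limitin Z.mtopology s x sequentially" by blast
qed

lemma C_star_algebra_copy: "C_star_algebra Z"
  unfolding C_star_algebra_def
proof (intro conjI exI)
  note I = iso_carrier[OF copy_inverse_isos] iso_inverse[OF copy_inverse_isos] iso_zero[OF copy_inverse_isos]
    iso_ops[OF copy_inverse_isos]
  show sZ: "star_algebra Z"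
    by (rule star_algebra_transport[OF copy_inverse_isos star_algebra_function_algebra])
  have G: "\<Gamma> (z \<oplus>\<^bsub>Z\<^esub> w) = \<Gamma> z \<oplus>\<^bsub>CM\<^esub> \<Gamma> w" "\<Gamma> (z \<otimes>\<^bsub>Z\<^esub> w) = \<Gamma> z \<otimes>\<^bsub>CM\<^esub> \<Gamma> w"
    "\<Gamma> (c \<odot>\<^bsub>Z\<^esub> z) = c \<odot>\<^bsub>CM\<^esub> \<Gamma> z" "\<Gamma> (star Z z) = star CM (\<Gamma> z)"
    if "z \<in> carrier Z" "w \<in> carrier Z" for z w c
    using I(2)[OF that(1)] I(2)[OF that(2)]
    by (simp_all only: I(6-9)[OF that] I(3) CS.a_closed CS.m_closed CS.smult_cclosed CS.star_closed)
  have G0: "\<Gamma> \<zero>\<^bsub>Z\<^esub> = \<zero>\<^bsub>CM\<^esub>" using I(3,5) CS.zero_closed by metis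
  show norm: "C_star_norm Z (norm_CM \<circ> \<Gamma>)"
    unfolding C_star_norm_def o_def
  proof (intro conjI ballI allI)
    fix z assume z: "z \<in> carrier Z"
    note gz = I(2)[OF z]
    show "0 \<le> norm_CM (\<Gamma> z)" by (rule norm_CM_nonneg)
    show "(norm_CM (\<Gamma> z) = 0) = (z = \<zero>\<^bsub>Z\<^esub>)" using CS.N_eq_0[OF gz] G0 I(4,5) z by metis
    show "norm_CM (\<Gamma> (c \<odot>\<^bsub>Z\<^esub> z)) = cmod c * norm_CM (\<Gamma> z)" for c using CS.N_smult[OF gz] G(3)[OF z z] by (simp only:)
    show "norm_CM (\<Gamma> (z \<otimes>\<^bsub>Z\<^esub> star Z z)) = (norm_CM (\<Gamma> z))\<^sup>2"
    proof -
      have "star Z z \<in> carrier Z" using sZ z by (auto simp: star_algebra_def)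
      then show ?thesis using CS.N_star_mult[OF gz] G(2)[OF z] G(4)[OF z z] by (simp only:)
    qed
    fix w assume w: "w \<in> carrier Z"
    show "norm_CM (\<Gamma> (z \<oplus>\<^bsub>Z\<^esub> w)) \<le> norm_CM (\<Gamma> z) + norm_CM (\<Gamma> w)"
      using CS.N_add[OF gz I(2)[OF w]] G(1)[OF z w] by (simp only:)
    show "norm_CM (\<Gamma> (z \<otimes>\<^bsub>Z\<^esub> w)) \<le> norm_CM (\<Gamma> z) * norm_CM (\<Gamma> w)"
      using CS.N_mult[OF gz I(2)[OF w]] G(2)[OF z w] by (simp only:)
  qed
  interpret ZN: C_star_algebra_norm Z "norm_CM \<circ> \<Gamma>" by (rule C_star_algebra_norm.intro[OF sZ norm])
  have "norm_dist Z (norm_CM \<circ> \<Gamma>) x y = dz x y" for x y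
  proof (cases "x \<in> carrier Z \<and> y \<in> carrier Z")
    case True
    then have x: "x \<in> carrier Z" and y: "y \<in> carrier Z" by simp_all
    have "\<Gamma> (x \<ominus>\<^bsub>Z\<^esub> y) = \<Gamma> x \<oplus>\<^bsub>CM\<^esub> (-1) \<odot>\<^bsub>CM\<^esub> \<Gamma> y"
      unfolding ZN.minus_smult[OF y] using G(1)[OF x ZN.smult_cclosed[OF y]] G(3)[OF y y] by (simp only:)
    also have "\<dots> = \<Gamma> x \<ominus>\<^bsub>CM\<^esub> \<Gamma> y" by (rule CS.minus_smult[OF I(2)[OF y], symmetric])
    finally show ?thesis using x y D_eq_norm[OF \<Gamma>_in[OF x] \<Gamma>_in[OF y]] by (simp only: norm_dist_def dz o_apply if_True simp_thms)
  qed (auto simp: norm_dist_def dz)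
  then have eq: "norm_dist Z (norm_CM \<circ> \<Gamma>) = dz" by (intro ext)
  show "Metric_space.mcomplete (carrier Z) (norm_dist Z (norm_CM \<circ> \<Gamma>))" unfolding eq by (rule mcomplete_copy)
  show "topol Z = Metric_space.mtopology (carrier Z) (norm_dist Z (norm_CM \<circ> \<Gamma>))" unfolding eq by (rule topol)
qed

end

end

subsection \<open>Envelopes with respect to C*-algebras\<close>

text \<open>A copy of \<open>B\<close> inside the type over which the universal properties quantify.
  Its topology is described by the transported distance, in the form in which
  \<open>compact_function_space\<close> treats copies.\<close>

definition image_algebra :: "('b \<Rightarrow> 'u) \<Rightarrow> 'b ialg \<Rightarrow> ('b \<Rightarrow> 'b \<Rightarrow> real) \<Rightarrow> 'u ialg" where
  "image_algebra e B d =
     \<lparr>carrier = e ` carrier B,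
      mult = \<lambda>x y. e (inv_into UNIV e x \<otimes>\<^bsub>B\<^esub> inv_into UNIV e y),
      one = e \<one>\<^bsub>B\<^esub>,
      zero = e \<zero>\<^bsub>B\<^esub>,
      add = \<lambda>x y. e (inv_into UNIV e x \<oplus>\<^bsub>B\<^esub> inv_into UNIV e y),
      smult = \<lambda>c x. e (c \<odot>\<^bsub>B\<^esub> inv_into UNIV e x),
      topol = Metric_space.mtopology (e ` carrier B)
        (\<lambda>x y. if x \<in> e ` carrier B \<and> y \<in> e ` carrier B then d (inv_into UNIV e x) (inv_into UNIV e y) else 0),
      star = \<lambda>x. e (star B (inv_into UNIV e x))\<rparr>"

lemma (in compact_function_space) C_star_algebra_image:
  assumes e: "inj e"
  shows "C_star_algebra (image_algebra e CM D)" "involutive_stereotype_algebra (image_algebra e CM D)"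
    "ialg_inverse_isos CM (image_algebra e CM D) e (inv_into UNIV e)"
proof -
  have bij: "ialg_bijection CM (image_algebra e CM D) e (inv_into UNIV e)"
    using inv_f_f[OF e] unfolding ialg_bijection_def image_algebra_def by auto
  have dz: "(\<lambda>x y. if x \<in> e ` carrier CM \<and> y \<in> e ` carrier CM then D (inv_into UNIV e x) (inv_into UNIV e y) else 0) x y =
    (if x \<in> carrier (image_algebra e CM D) \<and> y \<in> carrier (image_algebra e CM D) then D (inv_into UNIV e x) (inv_into UNIV e y) else 0)" for x y
    unfolding image_algebra_def by (simp only: partial_object.simps)
  have topol: "topol (image_algebra e CM D) = Metric_space.mtopology (carrier (image_algebra e CM D))
      (\<lambda>x y. if x \<in> e ` carrier CM \<and> y \<in> e ` carrier CM then D (inv_into UNIV e x) (inv_into UNIV e y) else 0)"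
    unfolding image_algebra_def by (simp only: partial_object.simps lcs.simps)
  note c = bij dz topol
  show "C_star_algebra (image_algebra e CM D)" by (rule C_star_algebra_copy[OF c])
  show "involutive_stereotype_algebra (image_algebra e CM D)" by (rule involutive_stereotype_copy[OF c])
  show "ialg_inverse_isos CM (image_algebra e CM D) e (inv_into UNIV e)" by (rule copy_inverse_isos[OF c])
qed

text \<open>The extension property is at hand only for algebras on the quantified type, such as
  \<open>Z\<close>. Composition with the isomorphism and its inverse carries existence and
  uniqueness over to \<open>B\<close>.\<close>

lemma unique_extension_of_iso:
  assumes \<sigma>: "morphism A X \<sigma>" and iso: "ialg_inverse_isos B Z f g"
    and B: "involutive_stereotype_algebra B" and Z: "involutive_stereotype_algebra Z"
    and ex: "\<And>phi. morphism A Z phi \<Longrightarrow> \<exists>!phi'. morphism X Z phi' \<and> phi = compose (carrier A) phi' \<sigma>"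
    and phi: "phi \<in> involutive_homs A B"
  shows "\<exists>!\<theta>. \<theta> \<in> involutive_homs X B \<and> (\<forall>x\<in>carrier A. \<theta> (\<sigma> x) = phi x)"
proof -
  have A: "involutive_stereotype_algebra A" and X: "involutive_stereotype_algebra X" and hom: "\<sigma> \<in> involutive_homs A X"
    using \<sigma> by (simp_all add: morphism_def)
  note AD = involutive_stereotype_algebraD[OF A] and BD = involutive_stereotype_algebraD[OF B]
    and XD = involutive_stereotype_algebraD[OF X]
  note fg = ialg_inverse_isos_homs[OF iso BD(2,1,3)]
  let ?f = "restrict f (carrier B)" and ?g = "restrict g (carrier Z)"
  have "morphism A Z (compose (carrier A) ?f phi)"
    unfolding morphism_def using A Z compose_involutive_homs[OF phi fg(1) AD(1-3)] by simp
  from ex[OF this] obtain psi where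
    psi: "morphism X Z psi" "compose (carrier A) ?f phi = compose (carrier A) psi \<sigma>"
    and uniq: "\<And>psi'. morphism X Z psi' \<Longrightarrow> compose (carrier A) ?f phi = compose (carrier A) psi' \<sigma> \<Longrightarrow> psi' = psi"
    by blast
  have psih: "psi \<in> involutive_homs X Z" using psi(1) by (simp add: morphism_def)
  show ?thesis
  proof (rule ex1I)
    show "compose (carrier X) ?g psi \<in> involutive_homs X B \<and> (\<forall>x\<in>carrier A. compose (carrier X) ?g psi (\<sigma> x) = phi x)"
    proof (intro conjI ballI)
      show "compose (carrier X) ?g psi \<in> involutive_homs X B" by (rule compose_involutive_homs[OF psih fg(2) XD(1-3)])
      fix x assume x: "x \<in> carrier A"
      have sx: "\<sigma> x \<in> carrier X" and px: "phi x \<in> carrier B"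
        using involutive_homsD(3)[OF hom x] involutive_homsD(3)[OF phi x] .
      have "psi (\<sigma> x) = f (phi x)" using fun_cong[OF psi(2), of x] x px by (simp add: compose_def)
      then show "compose (carrier X) ?g psi (\<sigma> x) = phi x"
        using sx px iso_inverse(1)[OF iso px] iso_carrier(1)[OF iso px] by (simp add: compose_def)
    qed
    fix \<theta> assume \<theta>: "\<theta> \<in> involutive_homs X B \<and> (\<forall>x\<in>carrier A. \<theta> (\<sigma> x) = phi x)"
    then have \<theta>h: "\<theta> \<in> involutive_homs X B" and \<theta>e: "\<And>x. x \<in> carrier A \<Longrightarrow> \<theta> (\<sigma> x) = phi x" by simp_all
    have "compose (carrier X) ?f \<theta> = psi"
    proof (rule uniq)
      show "morphism X Z (compose (carrier X) ?f \<theta>)"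
        unfolding morphism_def using X Z compose_involutive_homs[OF \<theta>h fg(1) XD(1-3)] by simp
      show "compose (carrier A) ?f phi = compose (carrier A) (compose (carrier X) ?f \<theta>) \<sigma>"
        using \<theta>e involutive_homsD(3)[OF hom] by (auto simp: compose_def intro!: restrict_ext)
    qed
    then have psie: "psi y = f (\<theta> y)" if "y \<in> carrier X" for y
      using that involutive_homsD(3)[OF \<theta>h that] by (auto simp: compose_def)
    show "\<theta> = compose (carrier X) ?g psi"
    proof (rule extensionalityI[OF involutive_homsD(1)[OF \<theta>h]])
      fix y assume y: "y \<in> carrier X"
      have ty: "\<theta> y \<in> carrier B" by (rule involutive_homsD(3)[OF \<theta>h y])
      show "\<theta> y = compose (carrier X) ?g psi y"
        using y psie[OF y] iso_inverse(1)[OF iso ty] iso_carrier(1)[OF iso ty] by (simp add: compose_def)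
    qed simp
  qed
qed

lemma subtopology_compact_function_space:
  assumes "Hausdorff_space M" "compactin M K" shows "compact_function_space (subtopology M K)"
  using assms by (intro compact_function_space.intro compact_space_subtopology Hausdorff_space_subtopology)

lemma compose_restrict_function_hom:
  assumes \<theta>: "\<theta> \<in> involutive_homs X (function_algebra (subtopology M K))" and L: "L \<subseteq> K" "K \<subseteq> topspace M"
    and X: "complex_lcs X" "ring X" "star_algebra X"
  shows "(\<lambda>y\<in>carrier X. restrict (\<theta> y) L) \<in> involutive_homs X (function_algebra (subtopology M L))"
proof -
  have L': "L \<subseteq> topspace (subtopology M K)" and s: "subtopology (subtopology M K) L = subtopology M L"
    using L by (auto simp: subtopology_subtopology Int_absorb1)
  have "compose (carrier X) (\<lambda>f\<in>continuous_functions (subtopology M K). restrict f L) \<theta> =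
      (\<lambda>y\<in>carrier X. restrict (\<theta> y) L)"
    unfolding compose_def using involutive_homsD(3)[OF \<theta>] by (intro restrict_ext) simp
  then show ?thesis using compose_involutive_homs[OF \<theta> restrict_function_hom[OF L'] X] unfolding s by simp
qed

section \<open>Factorisation of the Gelfand transform through an extension\<close>

context commutative_stereotype_algebra
begin

lemma Hausdorff_Spec: "Hausdorff_space (Spec A)"
  unfolding Spec_def
  by (rule Hausdorff_uniform_topology[of _ "carrier A"]) (use totally_bounded_singleton character(1) in \<open>auto simp: extensional_def\<close>)

lemma gelfand_restrict_hom:
  assumes K: "K \<subseteq> H"
  shows "(\<lambda>x\<in>carrier A. restrict (\<G> x) K) \<in> involutive_homs A (CK K)"
proof -
  have G: "\<G> \<in> involutive_homs A (function_algebra (subtopology (Spec A) H))"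
    using gelfand_transform_hom subtopology_topspace[of "Spec A"] by simp
  show ?thesis
    by (rule compose_restrict_function_hom[OF G K]) (simp_all add: star_algebra ring_axioms complex_lcs_axioms)
qed

lemma restrict_gelfand_transform: "x \<in> carrier A \<Longrightarrow> restrict (\<G> x) H = \<G> x"
  by (rule ext) (simp add: gelfand_transform_def restrict_def)

text \<open>\<open>C(K)\<close> has a C*-algebra copy on \<open>'u\<close>, to which the extension
  property of \<open>\<sigma>\<close> applies; the morphism to be extended is the Gelfand transform
  restricted to \<open>K\<close>.\<close>

lemma factor_through_compact:
  fixes X :: "'u ialg" and e :: "(('a \<Rightarrow> complex) \<Rightarrow> complex) \<Rightarrow> 'u"
  assumes e: "inj e" and \<sigma>: "morphism A X \<sigma>"
    and ex: "\<And>(B :: 'u ialg) phi. C_star_algebra B \<Longrightarrow> morphism A B phi \<Longrightarrow>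
        \<exists>!phi'. morphism X B phi' \<and> phi = compose (carrier A) phi' \<sigma>"
    and K: "compactin (Spec A) K"
  shows "\<exists>!\<theta>. \<theta> \<in> involutive_homs X (CK K) \<and>
     (\<forall>x\<in>carrier A. \<theta> (\<sigma> x) = restrict (\<G> x) K)"
proof -
  interpret KS: compact_function_space "subtopology (Spec A) K"
    by (rule subtopology_compact_function_space[OF Hausdorff_Spec K])
  have KH: "K \<subseteq> H" using compactin_subset_topspace[OF K] by simp
  note I = KS.C_star_algebra_image[OF e]
  from unique_extension_of_iso[OF \<sigma> I(3) KS.involutive_stereotype_CM I(2) ex[OF I(1)] gelfand_restrict_hom[OF KH]]
  show ?thesis by simp
qed

text \<open>Each restricted transform factors uniquely through \<open>X\<close>. Uniqueness over
  one-point sets makes these factors agree where their domains overlap, so they glue to a morphism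
  into \<open>C(M)\<close>. Uniqueness of the glued morphism also comes from one-point sets, and the
  argument is the same for all three classes of morphisms.\<close>

lemma factor_gelfand_transform:
  fixes X :: "'u ialg" and e :: "(('a \<Rightarrow> complex) \<Rightarrow> complex) \<Rightarrow> 'u"
  assumes e: "inj e" and \<sigma>: "morphism A X \<sigma>" and lc: "locally_compact_space (Spec A)"
    and ex: "\<And>(B :: 'u ialg) phi. C_star_algebra B \<Longrightarrow> morphism A B phi \<Longrightarrow>
        \<exists>!phi'. morphism X B phi' \<and> phi = compose (carrier A) phi' \<sigma>"
  shows "\<exists>!\<upsilon>. \<upsilon> \<in> involutive_homs X CH \<and> \<G> = compose (carrier A) \<upsilon> \<sigma>"
proof -
  have X: "involutive_stereotype_algebra X" and hom: "\<sigma> \<in> involutive_homs A X"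
    using \<sigma> by (simp_all add: morphism_def)
  note XD = involutive_stereotype_algebraD[OF X]
  define P where "P = (\<lambda>K \<theta>. \<theta> \<in> involutive_homs X (CK K) \<and>
     (\<forall>x\<in>carrier A. \<theta> (\<sigma> x) = restrict (\<G> x) K))"
  define \<theta> where "\<theta> = (\<lambda>K. THE t. P K t)"
  have ex1: "\<exists>!t. P K t" if "compactin (Spec A) K" for K
    unfolding P_def by (rule factor_through_compact[OF e \<sigma> ex that])
  have \<theta>: "P K (\<theta> K)" if "compactin (Spec A) K" for K unfolding \<theta>_def by (rule theI'[OF ex1[OF that]])
  have pt: "compactin (Spec A) {t}" if "t \<in> H" for t using that by simp
  \<comment> \<open>Stated for an arbitrary set \<open>K\<close> of characters: compact
    \<open>K\<close> gives the compatibility of the factors, and \<open>K = H\<close> gives the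
    uniqueness of \<open>\<upsilon>\<close>.\<close>
  have \<theta>_pt: "t' y t = \<theta> {t} y t" if K: "K \<subseteq> H" "t \<in> K" and y: "y \<in> carrier X" and t': "P K t'" for K t y t'
  proof -
    have tH: "t \<in> H" using K by blast
    have h: "(\<lambda>y\<in>carrier X. restrict (t' y) {t}) \<in> involutive_homs X (CK {t})"
      by (rule compose_restrict_function_hom[of t' X "Spec A" K "{t}", OF _ _ _ XD(1-3)])
        (use t' K in \<open>simp_all add: P_def\<close>)
    have "P {t} (\<lambda>y\<in>carrier X. restrict (t' y) {t})"
      unfolding P_def
    proof (intro conjI ballI h)
      fix x assume x: "x \<in> carrier A"
      have "t' (\<sigma> x) = restrict (\<G> x) K" using t' x by (simp add: P_def)
      then show "(\<lambda>y\<in>carrier X. restrict (t' y) {t}) (\<sigma> x) = restrict (\<G> x) {t}"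
        using involutive_homsD(3)[OF hom x] K(2) by (auto intro!: ext)
    qed
    then have "(\<lambda>y\<in>carrier X. restrict (t' y) {t}) = \<theta> {t}"
      using ex1[OF pt[OF tH]] \<theta>[OF pt[OF tH]] by blast
    from fun_cong[OF fun_cong[OF this, of y], of t] show ?thesis using y by simp
  qed
  let ?u = "\<lambda>y\<in>carrier X. \<lambda>t\<in>topspace (Spec A). \<theta> {t} y t"
  show ?thesis
  proof (intro ex1I conjI)
    show "?u \<in> involutive_homs X CH"
    proof (rule glue_homs[OF lc XD(1-3), of \<theta>])
      show "\<theta> K \<in> involutive_homs X (CK K)" if "compactin (Spec A) K" for K
        using \<theta>[OF that] by (simp add: P_def)
      show "\<theta> K y t = \<theta> {t} y t" if K: "compactin (Spec A) K" and t: "t \<in> K" and y: "y \<in> carrier X" for K t y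
        using \<theta>_pt[OF _ t y \<theta>[OF K]] compactin_subset_topspace[OF K] by simp
    qed
    show "\<G> = compose (carrier A) ?u \<sigma>"
    proof
      fix x
      show "\<G> x = compose (carrier A) ?u \<sigma> x"
      proof (cases "x \<in> carrier A")
        case x: True
        have "\<theta> {t} (\<sigma> x) t = \<G> x t" if "t \<in> H" for t
          using \<theta>[OF pt[OF that]] x by (simp add: P_def)
        then have "(\<lambda>t\<in>H. \<theta> {t} (\<sigma> x) t) = (\<lambda>t\<in>H. \<G> x t)" by (intro restrict_ext)
        also have "\<dots> = \<G> x" by (rule restrict_gelfand_transform[OF x])
        finally show ?thesis using x involutive_homsD(3)[OF hom x] by (simp only: compose_def restrict_apply' topspace_Spec)
      qed (simp add: compose_def gelfand_transform_def)
    qed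
    fix u assume u: "u \<in> involutive_homs X CH \<and> \<G> = compose (carrier A) u \<sigma>"
    then have uh: "u \<in> involutive_homs X CH" and ue: "\<G> = compose (carrier A) u \<sigma>" by simp_all
    have "P H u"
    proof -
      have "u (\<sigma> x) = restrict (\<G> x) H" if x: "x \<in> carrier A" for x
      proof -
        have "u (\<sigma> x) = \<G> x" using fun_cong[OF ue, of x] x by (simp add: compose_def)
        also have "\<dots> = restrict (\<G> x) H" by (rule restrict_gelfand_transform[OF x, symmetric])
        finally show ?thesis .
      qed
      then show ?thesis using uh subtopology_topspace[of "Spec A"] by (simp add: P_def)
    qed
    show "u = ?u"
    proof (rule extensionalityI[OF involutive_homsD(1)[OF uh]])
      fix y assume y: "y \<in> carrier X"
      have uy: "u y \<in> extensional H" using involutive_homsD(3)[OF uh y] by (simp add: continuous_functions_def)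
      have eq: "u y t = \<theta> {t} y t" if "t \<in> H" for t by (rule \<theta>_pt[OF subset_refl that y \<open>P H u\<close>])
      show "u y = ?u y"
        by (rule extensionalityI[OF uy]) (use eq y in auto)
    qed simp
  qed
qed

text \<open>Density of the image puts the transform into each of the three classes. Of the class of
  an extension only the fact is used that its members are morphisms, which allows a common
  proof.\<close>

lemma C_star_envelope_gelfand:
  fixes e :: "(('a \<Rightarrow> complex) \<Rightarrow> complex) \<Rightarrow> 'u"
  assumes e: "inj e" and lc: "locally_compact_space (Spec A)" and pc: "paracompact_space (Spec A)"
    and A: "involutive_stereotype_algebra A"
  shows "C_star_envelope TYPE('u) \<Omega> A CH (\<G>)"
proof -
  let ?C = "CH" and ?G = "\<G>"
  have C: "involutive_stereotype_algebra ?C" by (rule involutive_stereotype_function_algebra[OF lc pc])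
  have mor: "morphism A ?C ?G" unfolding morphism_def using A C gelfand_transform_hom by simp
  have eqI: "f = g" if f: "morphism ?C B f" and g: "morphism ?C B g"
    and eq: "compose (carrier A) f ?G = compose (carrier A) g ?G" for B :: "'u ialg" and f g
  proof (rule hom_eq_of_gelfand)
    show "Hausdorff_space (topol B)" using f by (simp add: morphism_def involutive_stereotype_algebraD)
    show "f (?G x) = g (?G x)" if "x \<in> carrier A" for x using fun_cong[OF eq, of x] that by (simp add: compose_def)
  qed (use f g in \<open>simp_all add: morphism_def\<close>)
  have "in_class TYPE('u) \<Omega> A ?C ?G"
  proof (cases \<Omega>)
    case Epi
    have "epimorphism TYPE('u) A ?C ?G" unfolding epimorphism_def using mor eqI by blast
    then show ?thesis by (simp add: in_class_def Epi)
  next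
    case DEpi
    have "dense_morphism A ?C ?G" unfolding dense_morphism_def using mor gelfand_transform_dense by (rule conjI)
    then show ?thesis by (simp add: in_class_def DEpi)
  qed (simp add: in_class_def mor)
  moreover have "\<exists>!phi'. morphism ?C B phi' \<and> phi = compose (carrier A) phi' ?G"
    if B: "C_star_algebra B" and phi: "morphism A B phi" for B :: "'u ialg" and phi
  proof -
    have phih: "phi \<in> involutive_homs A B" and Bs: "involutive_stereotype_algebra B" using phi by (simp_all add: morphism_def)
    obtain N where N: "C_star_norm B N" "Metric_space.mcomplete (carrier B) (norm_dist B N)"
      "topol B = Metric_space.mtopology (carrier B) (norm_dist B N)" and sB: "star_algebra B"
      using B unfolding C_star_algebra_def by blast
    obtain f where f: "f \<in> involutive_homs ?C B" "\<forall>x\<in>carrier A. f (?G x) = phi x"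
      using C_star_morphism_extends[OF sB N phih] by blast
    have "phi = compose (carrier A) f ?G"
      by (rule extensionalityI[OF involutive_homsD(1)[OF phih]]) (use f(2) in \<open>auto simp: compose_def\<close>)
    then have "morphism ?C B f \<and> phi = compose (carrier A) f ?G" using f(1) C Bs by (simp add: morphism_def)
    then show ?thesis using eqI by (metis (no_types))
  qed
  ultimately have "C_star_extension TYPE('u) \<Omega> A ?C ?G" unfolding C_star_extension_def by blast
  moreover have "\<exists>!\<upsilon>. morphism X ?C \<upsilon> \<and> ?G = compose (carrier A) \<upsilon> \<sigma>"
    if \<sigma>: "C_star_extension TYPE('u) \<Omega> A X \<sigma>" for X :: "'u ialg" and \<sigma>
  proof -
    have m: "morphism A X \<sigma>"
      using \<sigma> unfolding C_star_extension_def in_class_def epimorphism_def dense_morphism_def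
      by (cases \<Omega>) simp_all
    have "\<exists>!phi'. morphism X B phi' \<and> phi = compose (carrier A) phi' \<sigma>"
      if "C_star_algebra B" "morphism A B phi" for B :: "'u ialg" and phi
      using \<sigma> that unfolding C_star_extension_def by blast
    from factor_gelfand_transform[OF e m lc this] show ?thesis
      using m C unfolding morphism_def by simp
  qed
  ultimately show ?thesis unfolding C_star_envelope_def by blast
qed

end

subsection \<open>The seminorm of a C*-neighbourhood\<close>

text \<open>Submultiplicativity is automatic for a seminorm with the C*-identity: for self-adjoint \<open>h\<close> and \<open>k\<close>
  the identity \<open>4 h k = (h + k)\<^sup>2 - (h - k)\<^sup>2\<close> bounds \<open>h k\<close> up to the factor 2, and the factor disappears
  on passing to the powers \<open>(h k)\<^bsup>2^n\<^esup>\<close>.\<close>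

lemma (in comm_star_algebra) C_star_seminormI:
  assumes nonneg: "\<And>x. x \<in> carrier A \<Longrightarrow> 0 \<le> p x"
    and add: "\<And>x y. x \<in> carrier A \<Longrightarrow> y \<in> carrier A \<Longrightarrow> p (x \<oplus> y) \<le> p x + p y"
    and smult: "\<And>c x. x \<in> carrier A \<Longrightarrow> p (c \<odot> x) = cmod c * p x"
    and C_star: "\<And>x. x \<in> carrier A \<Longrightarrow> p (x \<otimes> star A x) = (p x)\<^sup>2"
  shows "C_star_seminorm p"
proof -
  have sq: "p (h \<otimes> h) = (p h)\<^sup>2" if "h \<in> carrier A" "star A h = h" for h
    using C_star[OF that(1)] that(2) by simp
  have le2: "p (h \<otimes> k) \<le> 2"
    if h: "h \<in> carrier A" "star A h = h" "p h \<le> 1" and k: "k \<in> carrier A" "star A k = k" "p k \<le> 1" for h k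
  proof -
    let ?a = "h \<oplus> k" and ?b = "h \<oplus> (-1) \<odot> k"
    have a: "?a \<in> carrier A" "star A ?a = ?a" and b: "?b \<in> carrier A" "star A ?b = ?b"
      using h k by (simp_all add: star_add star_smult)
    have pa: "p ?a \<le> 2" using add[OF h(1) k(1)] h(3) k(3) by simp
    have pb: "p ?b \<le> 2" using add[of h "(-1) \<odot> k"] smult[of k "-1"] h k by simp
    have "?a \<otimes> ?a \<oplus> (-1) \<odot> (?b \<otimes> ?b) = 4 \<odot> (h \<otimes> k)"
    proof -
      have e: "(h \<otimes> h \<oplus> h \<otimes> k) \<oplus> (h \<otimes> k \<oplus> k \<otimes> k) \<oplus>
         (((-1) \<odot> (h \<otimes> h) \<oplus> h \<otimes> k) \<oplus> (h \<otimes> k \<oplus> (-1) \<odot> (k \<otimes> k))) = 4 \<odot> (h \<otimes> k)"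
        (is "?E = _")
      proof -
        have 4: "4 \<odot> (h \<otimes> k) = ((h \<otimes> k \<oplus> h \<otimes> k) \<oplus> (h \<otimes> k \<oplus> h \<otimes> k))"
          using smult_add_left[of "h \<otimes> k" 2 2] smult_add_left[of "h \<otimes> k" 1 1] h(1) k(1) by simp
        have "?E = ((h \<otimes> k \<oplus> h \<otimes> k) \<oplus> (h \<otimes> k \<oplus> h \<otimes> k)) \<oplus> ((h \<otimes> h \<oplus> (-1) \<odot> (h \<otimes> h)) \<oplus> (k \<otimes> k \<oplus> (-1) \<odot> (k \<otimes> k)))"
          using h(1) k(1) by (simp add: a_ac)
        also have "\<dots> = 4 \<odot> (h \<otimes> k)" using h(1) k(1) by (simp add: 4 smult_minus_one r_neg)
        finally show ?thesis .
      qed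
      have aa: "?a \<otimes> ?a = (h \<otimes> h \<oplus> h \<otimes> k) \<oplus> (h \<otimes> k \<oplus> k \<otimes> k)"
        using h(1) k(1) by (simp add: l_distr r_distr m_comm)
      have "?b \<otimes> ?b = (h \<otimes> h \<oplus> (-1) \<odot> (h \<otimes> k)) \<oplus> ((-1) \<odot> (h \<otimes> k) \<oplus> k \<otimes> k)"
        using h(1) k(1) by (simp add: l_distr r_distr m_comm smult_mult_left smult_mult_right smult_smult)
      then have bb: "(-1) \<odot> (?b \<otimes> ?b) = ((-1) \<odot> (h \<otimes> h) \<oplus> h \<otimes> k) \<oplus> (h \<otimes> k \<oplus> (-1) \<odot> (k \<otimes> k))"
        using h(1) k(1) by (simp add: smult_add_right smult_smult)
      show ?thesis unfolding aa bb by (rule e)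
    qed
    then have "4 * p (h \<otimes> k) = p (?a \<otimes> ?a \<oplus> (-1) \<odot> (?b \<otimes> ?b))" using smult[of "h \<otimes> k" 4] h k by simp
    also have "\<dots> \<le> (p ?a)\<^sup>2 + (p ?b)\<^sup>2"
      using add[of "?a \<otimes> ?a" "(-1) \<odot> (?b \<otimes> ?b)"] smult[of "?b \<otimes> ?b" "-1"] sq[OF a] sq[OF b] a b by simp
    also have "\<dots> \<le> 2\<^sup>2 + 2\<^sup>2" using pa pb nonneg a b by (intro add_mono power_mono) auto
    finally show ?thesis by simp
  qed
  have pow: "p (h \<otimes> k) ^ (2 ^ n) \<le> 2"
    if "h \<in> carrier A" "star A h = h" "p h \<le> 1" "k \<in> carrier A" "star A k = k" "p k \<le> 1" for n h k
    using that
  proof (induction n arbitrary: h k)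
    case 0
    then show ?case using le2 by simp
  next
    case (Suc n)
    have hh: "h \<otimes> h \<in> carrier A" "star A (h \<otimes> h) = h \<otimes> h" "p (h \<otimes> h) \<le> 1"
      using Suc.prems sq[of h] nonneg[of h] by (simp_all add: star_mult power_le_one)
    have kk: "k \<otimes> k \<in> carrier A" "star A (k \<otimes> k) = k \<otimes> k" "p (k \<otimes> k) \<le> 1"
      using Suc.prems sq[of k] nonneg[of k] by (simp_all add: star_mult power_le_one)
    have hk: "h \<otimes> k \<in> carrier A" "star A (h \<otimes> k) = h \<otimes> k" using Suc.prems by (simp_all add: star_mult m_comm)
    have "(h \<otimes> k) \<otimes> (h \<otimes> k) = (h \<otimes> h) \<otimes> (k \<otimes> k)" using Suc.prems by (simp add: m_ac)
    then have "p ((h \<otimes> h) \<otimes> (k \<otimes> k)) = (p (h \<otimes> k))\<^sup>2" using sq[OF hk] by simp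
    then have "p (h \<otimes> k) ^ (2 ^ Suc n) = p ((h \<otimes> h) \<otimes> (k \<otimes> k)) ^ (2 ^ n)" by (simp add: power_mult)
    also have "\<dots> \<le> 2" by (rule Suc.IH[OF hh kk])
    finally show ?case .
  qed
  have le1: "p (h \<otimes> k) \<le> 1"
    if "h \<in> carrier A" "star A h = h" "p h \<le> 1" "k \<in> carrier A" "star A k = k" "p k \<le> 1" for h k
  proof (rule ccontr)
    assume "\<not> p (h \<otimes> k) \<le> 1"
    then have g1: "1 < p (h \<otimes> k)" by simp
    from real_arch_pow[OF this, of 2] obtain n where n: "2 < p (h \<otimes> k) ^ n" by blast
    have "n \<le> 2 ^ n" by (rule less_imp_le) (rule less_exp)
    then have "p (h \<otimes> k) ^ n \<le> p (h \<otimes> k) ^ (2 ^ n)" using g1 by (intro power_increasing) auto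
    also have "\<dots> \<le> 2" by (rule pow[OF that])
    finally show False using n by simp
  qed
  \<comment> \<open>The normalised inequality is rescaled with positive majorants \<open>a\<close>
    and \<open>b\<close>, since \<open>p h\<close> and \<open>p k\<close> themselves may
    vanish.\<close>
  have sa: "p (h \<otimes> k) \<le> a * b"
    if h: "h \<in> carrier A" "star A h = h" "p h \<le> a" "0 < a" and k: "k \<in> carrier A" "star A k = k" "p k \<le> b" "0 < b" for h k a b
  proof -
    let ?h = "of_real (inverse a) \<odot> h" and ?k = "of_real (inverse b) \<odot> k"
    have scaled: "p (of_real (inverse c) \<odot> x) = inverse c * p x" if "x \<in> carrier A" "0 < c" for x c
      using smult[OF that(1), of "complex_of_real (inverse c)"] that(2) by (simp only: norm_of_real) simp
    have "p ?h \<le> 1" "p ?k \<le> 1"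
      unfolding scaled[OF h(1,4)] scaled[OF k(1,4)] using h(3,4) k(3,4) by (simp_all add: field_simps)
    then have "p (?h \<otimes> ?k) \<le> 1" using h k by (intro le1) (simp_all add: star_smult)
    moreover have "?h \<otimes> ?k = complex_of_real (inverse (a * b)) \<odot> (h \<otimes> k)"
      using h k by (simp add: smult_mult_left smult_mult_right smult_smult mult.commute)
    ultimately have "inverse (a * b) * p (h \<otimes> k) \<le> 1"
      using scaled[of "h \<otimes> k" "a * b"] h k by (simp only: m_closed mult_pos_pos)
    then show ?thesis using h(4) k(4) by (simp add: field_simps)
  qed
  \<comment> \<open>The C*-identity reduces arbitrary factors to the self-adjoint elements
    \<open>x \<otimes> star A x\<close> and \<open>y \<otimes> star A y\<close>. The number
    \<open>e\<close> keeps the majorants positive and tends to zero at the end.\<close>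
  have mult: "p (x \<otimes> y) \<le> p x * p y" if x: "x \<in> carrier A" and y: "y \<in> carrier A" for x y
  proof -
    have le: "p (x \<otimes> y) \<le> (p x + e) * (p y + e)" if e: "e > 0" for e
    proof -
      have pos: "0 < p x + e" "0 < p y + e" using nonneg x y e by (simp_all add: add_nonneg_pos)
      have sqle: "(p x)\<^sup>2 \<le> (p x + e)\<^sup>2" "(p y)\<^sup>2 \<le> (p y + e)\<^sup>2" using nonneg x y e by (simp_all add: power_mono)
      have "(x \<otimes> y) \<otimes> star A (x \<otimes> y) = (x \<otimes> star A x) \<otimes> (y \<otimes> star A y)"
        using x y by (simp add: star_mult m_ac)
      then have "(p (x \<otimes> y))\<^sup>2 = p ((x \<otimes> star A x) \<otimes> (y \<otimes> star A y))" using C_star[of "x \<otimes> y"] x y by simp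
      also have "\<dots> \<le> (p x + e)\<^sup>2 * (p y + e)\<^sup>2"
        using x y pos sqle by (intro sa) (simp_all add: star_mult C_star)
      also have "\<dots> = ((p x + e) * (p y + e))\<^sup>2" by (simp add: power_mult_distrib)
      finally show ?thesis by (rule power2_le_imp_le) (use pos in simp)
    qed
    have "((\<lambda>e. (p x + e) * (p y + e)) \<longlongrightarrow> (p x + 0) * (p y + 0)) (at_right 0)" by (intro tendsto_intros)
    moreover have "\<forall>\<^sub>F e in at_right 0. p (x \<otimes> y) \<le> (p x + e) * (p y + e)"
      using le by (auto simp: eventually_at_right_field intro: exI[of _ 1])
    ultimately have "p (x \<otimes> y) \<le> (p x + 0) * (p y + 0)" by (rule tendsto_lowerbound) simp
    then show ?thesis by simp
  qed
  show ?thesis unfolding C_star_seminorm_def by (intro conjI ballI allI nonneg add smult mult C_star)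
qed

section \<open>Minkowski functionals and normed quotients\<close>

context commutative_stereotype_algebra
begin

context
  fixes U assumes U: "zero_nbhd A U"
begin

lemma gauge_set:
  assumes x: "x \<in> carrier A"
  shows "{t. t > 0 \<and> (\<exists>u\<in>U. x = of_real t \<odot> u)} = {t. t > 0 \<and> of_real (inverse t) \<odot> x \<in> U}"
proof -
  have 1: "of_real (inverse t) \<odot> (of_real t \<odot> u) = u" if "t > 0" "u \<in> U" for t u
    using that zero_nbhd_subset[OF U] by (auto simp: smult_smult subset_iff simp flip: of_real_mult)
  have 2: "x = of_real t \<odot> (of_real (inverse t) \<odot> x)" if "t > 0" for t
    using that x by (simp add: smult_smult flip: of_real_mult)
  show ?thesis using 1 2 by (metis (lifting))
qed

lemma gauge_le:
  assumes "x \<in> carrier A" "t > 0" "of_real (inverse t) \<odot> x \<in> U" shows "minkowski A U x \<le> t"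
  unfolding minkowski_def gauge_set[OF assms(1)]
  by (rule cInf_lower) (use assms in \<open>auto intro!: bdd_belowI[of _ 0]\<close>)

lemma gauge_nonempty:
  assumes x: "x \<in> carrier A" shows "\<exists>t>0. of_real (inverse t) \<odot> x \<in> U"
proof -
  obtain r where r: "r > 0" "\<And>c. cmod c < r \<Longrightarrow> c \<odot> x \<in> U" using zero_nbhd_absorbing[OF U x] by blast
  have "complex_of_real (inverse (2 / r)) \<odot> x \<in> U" by (rule r(2)) (use r(1) in \<open>simp add: norm_divide\<close>)
  moreover have "2 / r > 0" using r(1) by simp
  ultimately show ?thesis by blast
qed

lemma gauge_nonneg: "x \<in> carrier A \<Longrightarrow> 0 \<le> minkowski A U x"
  unfolding minkowski_def gauge_set using gauge_nonempty by (intro cInf_greatest) auto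

end

context
  fixes U assumes U: "C_star_nbhd A U"
begin

abbreviation (input) "pU \<equiv> minkowski A U"

lemma U_zero_nbhd: "zero_nbhd A U"
  and U_convex: "x \<in> U \<Longrightarrow> y \<in> U \<Longrightarrow> cmod a + cmod b \<le> 1 \<Longrightarrow> a \<odot> x \<oplus> b \<odot> y \<in> U"
  and minkowski_C_star: "x \<in> carrier A \<Longrightarrow> pU (x \<otimes> star A x) = (pU x)\<^sup>2"
  using U by (auto simp: C_star_nbhd_def absolutely_convex_in_def)

lemma U_carrier: "U \<subseteq> carrier A"
  using U_zero_nbhd by (rule zero_nbhd_subset)

lemma U_smult: "x \<in> U \<Longrightarrow> cmod a \<le> 1 \<Longrightarrow> a \<odot> x \<in> U"
  using U_convex[of x x a 0] U_carrier by (auto simp: subset_iff)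

lemmas minkowski_le = gauge_le[OF U_zero_nbhd]
  and minkowski_nonempty = gauge_nonempty[OF U_zero_nbhd]
  and minkowski_set = gauge_set[OF U_zero_nbhd]
  and minkowski_nonneg = gauge_nonneg[OF U_zero_nbhd]

text \<open>By the definition of the infimum some smaller scale \<open>s\<close> is admissible, and
  the absolutely convex set \<open>U\<close> is stable under the contraction by
  \<open>s / t\<close>.\<close>

lemma minkowski_less:
  assumes x: "x \<in> carrier A" and t: "pU x < t" shows "of_real (inverse t) \<odot> x \<in> U"
proof -
  have "{t. t > 0 \<and> of_real (inverse t) \<odot> x \<in> U} \<noteq> {}" using minkowski_nonempty[OF x] by blast
  from cInf_lessD[OF this, of t] t obtain s where s: "0 < s" "of_real (inverse s) \<odot> x \<in> U" "s < t"
    unfolding minkowski_def minkowski_set[OF x] by blast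
  have "of_real (s / t) \<odot> (of_real (inverse s) \<odot> x) \<in> U"
    by (rule U_smult[OF s(2)]) (use s in \<open>simp add: norm_divide\<close>)
  moreover have "complex_of_real (s / t) * complex_of_real (inverse s) = complex_of_real (inverse t)"
    unfolding of_real_mult[symmetric] using s by (simp add: field_simps)
  ultimately show ?thesis using x by (simp only: smult_smult)
qed

lemma minkowski_add:
  assumes x: "x \<in> carrier A" and y: "y \<in> carrier A" shows "pU (x \<oplus> y) \<le> pU x + pU y"
proof (rule field_le_epsilon)
  fix e :: real assume e: "e > 0"
  define s where "s = pU x + e/2"
  define t where "t = pU y + e/2"
  have st: "0 < s" "0 < t" "pU x < s" "pU y < t"
    using e minkowski_nonneg[OF x] minkowski_nonneg[OF y] by (simp_all add: s_def t_def)
  have xs: "of_real (inverse s) \<odot> x \<in> U" and yt: "of_real (inverse t) \<odot> y \<in> U"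
    using minkowski_less x y st by blast+
  have "s / (s + t) + t / (s + t) = 1" using st by (simp add: add_divide_distrib[symmetric])
  then have "complex_of_real (s / (s + t)) \<odot> (of_real (inverse s) \<odot> x) \<oplus>
     complex_of_real (t / (s + t)) \<odot> (of_real (inverse t) \<odot> y) \<in> U"
    by (intro U_convex xs yt) (use st in \<open>simp only: norm_of_real, simp\<close>)
  moreover have "complex_of_real (s / (s + t)) * complex_of_real (inverse s) = complex_of_real (inverse (s + t))"
    "complex_of_real (t / (s + t)) * complex_of_real (inverse t) = complex_of_real (inverse (s + t))"
    unfolding of_real_mult[symmetric] using st by (simp_all add: field_simps)
  ultimately have "complex_of_real (inverse (s + t)) \<odot> (x \<oplus> y) \<in> U"
    using x y by (simp only: smult_smult smult_add_right)
  then have "pU (x \<oplus> y) \<le> s + t" using x y st by (intro minkowski_le) simp_all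
  then show "pU (x \<oplus> y) \<le> pU x + pU y + e" by (simp add: s_def t_def)
qed

lemma minkowski_smult:
  assumes x: "x \<in> carrier A" shows "pU (c \<odot> x) = cmod c * pU x"
proof -
  have le: "pU (c \<odot> y) \<le> cmod c * pU y" if y: "y \<in> carrier A" for c y
  proof (cases "c = 0")
    case True
    have "pU \<zero> \<le> e" if "e > 0" for e
      by (rule minkowski_le) (use that zero_nbhd_zero[OF U_zero_nbhd] in simp_all)
    then have "pU \<zero> \<le> 0" by (metis field_le_epsilon add_0)
    then show ?thesis using True y by simp
  next
    case False
    show ?thesis
    proof (rule field_le_epsilon)
      fix e :: real assume e: "e > 0"
      define t where "t = pU y + e / cmod c"
      have t: "pU y < t" "0 < t" using e False minkowski_nonneg[OF y] by (simp_all add: t_def add_nonneg_pos)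
      have "(c / complex_of_real (cmod c)) \<odot> (of_real (inverse t) \<odot> y) \<in> U"
        by (rule U_smult[OF minkowski_less[OF y t(1)]]) (simp add: norm_divide)
      moreover have "(c / complex_of_real (cmod c)) * complex_of_real (inverse t) = complex_of_real (inverse (cmod c * t)) * c"
        by (simp add: field_simps)
      ultimately have "complex_of_real (inverse (cmod c * t)) \<odot> (c \<odot> y) \<in> U" using y by (simp only: smult_smult)
      then have "pU (c \<odot> y) \<le> cmod c * t" using y t False by (intro minkowski_le) simp_all
      then show "pU (c \<odot> y) \<le> cmod c * pU y + e" using False by (simp add: t_def distrib_left)
    qed
  qed
  show ?thesis
  proof (cases "c = 0")
    case True
    then show ?thesis using le[OF x, of 0] minkowski_nonneg[of "0 \<odot> x"] x by simp
  next
    case False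
    have "inverse c \<odot> (c \<odot> x) = x" using False x by (simp add: smult_smult)
    then have "pU x \<le> cmod (inverse c) * pU (c \<odot> x)" using le[of "c \<odot> x" "inverse c"] x by simp
    then have "cmod c * pU x \<le> pU (c \<odot> x)" using False by (simp add: norm_divide field_simps)
    then show ?thesis using le[OF x, of c] by simp
  qed
qed

lemma C_star_seminorm_minkowski: "C_star_seminorm pU"
  by (rule C_star_seminormI; rule minkowski_nonneg minkowski_add minkowski_smult minkowski_C_star; assumption)

lemma minkowski_le_1: "x \<in> U \<Longrightarrow> pU x \<le> 1"
  using minkowski_le[of x 1] U_carrier by (auto simp: subset_iff)

lemma minkowski_zero_nbhd: "zero_nbhd A {x\<in>carrier A. pU x < 1}"
proof (rule zero_nbhd_mono[OF zero_nbhd_smult[OF U_zero_nbhd, of 2]])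
  have "pU x < 1" if x: "x \<in> carrier A" "2 \<odot> x \<in> U" for x
  proof -
    have "pU (2 \<odot> x) = 2 * pU x" using minkowski_smult[OF x(1), of 2] by simp
    then show ?thesis using minkowski_le_1[OF x(2)] by simp
  qed
  then show "{x\<in>carrier A. 2 \<odot> x \<in> U} \<subseteq> {x\<in>carrier A. pU x < 1}" by blast
qed auto

lemma in_Ker_iff: "x \<in> Ker A U \<longleftrightarrow> x \<in> carrier A \<and> pU x = 0"
proof
  assume x: "x \<in> Ker A U"
  then have "\<exists>u\<in>U. x = of_real e \<odot> u" if "e > 0" for e
    using that by (auto simp: Ker_def)
  note K = this
  have xA: "x \<in> carrier A" using K[of 1] U_carrier by auto
  have "pU x \<le> e" if e: "e > 0" for e
  proof -
    obtain u where u: "u \<in> U" "x = of_real e \<odot> u" using K[OF e] by blast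
    then have "pU x = e * pU u" using minkowski_smult[of u "complex_of_real e"] U_carrier e by auto
    also have "\<dots> \<le> e * 1" using minkowski_le_1[OF u(1)] e by (intro mult_left_mono) auto
    finally show ?thesis by simp
  qed
  then have "pU x \<le> 0" by (metis field_le_epsilon add_0)
  then show "x \<in> carrier A \<and> pU x = 0" using xA minkowski_nonneg[OF xA] by simp
next
  assume x: "x \<in> carrier A \<and> pU x = 0"
  show "x \<in> Ker A U"
    unfolding Ker_def
  proof (rule INT_I)
    fix e :: real assume e: "e \<in> {0<..}"
    have "of_real (inverse e) \<odot> x \<in> U" by (rule minkowski_less) (use x e in auto)
    moreover have "x = of_real e \<odot> (of_real (inverse e) \<odot> x)"
      using x e by (simp add: smult_smult flip: of_real_mult)
    ultimately show "x \<in> (\<lambda>u. of_real e \<odot> u) ` U" by (rule image_eqI[rotated])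
  qed
qed

lemma minkowski_minus: "x \<in> carrier A \<Longrightarrow> pU (\<ominus> x) = pU x"
  using minkowski_smult[of x "-1"] by (simp add: smult_minus_one)

text \<open>The kernel is the null set of the gauge. Submultiplicativity, which
  \<open>C_star_seminormI\<close> derives from the C*-identity, makes it an ideal.\<close>

lemma ideal_Ker: "ideal (Ker A U) A"
proof (rule idealI[OF ring_axioms])
  have mult: "x \<in> carrier A \<Longrightarrow> y \<in> carrier A \<Longrightarrow> pU (x \<otimes> y) \<le> pU x * pU y" for x y
    using C_star_seminorm_minkowski by (simp add: C_star_seminorm_def)
  have "pU \<zero> = 0" using minkowski_smult[of \<zero> 0] by simp
  moreover have "pU (x \<oplus> y) = 0" if "x \<in> carrier A" "y \<in> carrier A" "pU x = 0" "pU y = 0" for x y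
    using minkowski_add[OF that(1,2)] minkowski_nonneg[of "x \<oplus> y"] that by simp
  ultimately have K: "\<zero> \<in> Ker A U" "\<And>x y. x \<in> Ker A U \<Longrightarrow> y \<in> Ker A U \<Longrightarrow> x \<oplus> y \<in> Ker A U"
    "\<And>x. x \<in> Ker A U \<Longrightarrow> \<ominus> x \<in> Ker A U" "Ker A U \<subseteq> carrier A"
    by (auto simp: in_Ker_iff minkowski_minus)
  have ne: "Ker A U \<noteq> {}" using K(1) by blast
  show "subgroup (Ker A U) (add_monoid A)"
    by (rule add.subgroupI[OF K(4) ne]) (use K(2,3) in \<open>simp_all flip: a_inv_def\<close>)
  fix a x assume "a \<in> Ker A U" "x \<in> carrier A"
  then have a: "a \<in> carrier A" "pU a = 0" "x \<in> carrier A" by (simp_all add: in_Ker_iff)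
  have "pU (x \<otimes> a) = 0" using mult[of x a] minkowski_nonneg[of "x \<otimes> a"] a by simp
  then show "x \<otimes> a \<in> Ker A U" "a \<otimes> x \<in> Ker A U" using a by (simp_all add: in_Ker_iff m_comm)
qed

lemma coset_eq_iff:
  assumes x: "x \<in> carrier A" and y: "y \<in> carrier A"
  shows "Ker A U +> x = Ker A U +> y \<longleftrightarrow> pU (x \<ominus> y) = 0"
proof -
  interpret I: ideal "Ker A U" A by (rule ideal_Ker)
  have yx: "y \<in> Ker A U +> x \<longleftrightarrow> pU (y \<ominus> x) = 0"
  proof
    assume "y \<in> Ker A U +> x"
    then obtain h where "h \<in> Ker A U" "y = h \<oplus> x" by (auto simp: a_r_coset_def')
    then show "pU (y \<ominus> x) = 0" using x by (simp add: in_Ker_iff a_minus_def a_assoc r_neg)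
  next
    assume "pU (y \<ominus> x) = 0"
    then have "y \<ominus> x \<in> Ker A U" using x y by (simp add: in_Ker_iff)
    moreover have "y = (y \<ominus> x) \<oplus> x" using x y by (simp add: a_minus_def a_assoc l_neg)
    ultimately show "y \<in> Ker A U +> x" unfolding a_r_coset_def' by blast
  qed
  have "Ker A U +> x = Ker A U +> y \<longleftrightarrow> y \<in> Ker A U +> x"
  proof
    show "y \<in> Ker A U +> x" if "Ker A U +> x = Ker A U +> y" by (rule I.a_repr_independenceD[OF y that])
    show "Ker A U +> x = Ker A U +> y" if "y \<in> Ker A U +> x" by (rule I.a_repr_independence'[OF that x])
  qed
  moreover have "\<ominus> (x \<ominus> y) = y \<ominus> x" using x y by (simp add: a_minus_def minus_add a_comm)
  then have "pU (y \<ominus> x) = pU (x \<ominus> y)" using minkowski_minus[of "x \<ominus> y"] x y by simp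
  ultimately show ?thesis using yx by simp
qed

text \<open>The gauge is constant on the cosets of its null set, so replacing elements by cosets
  admits no smaller scale \<open>t\<close>.\<close>

lemma quotient_norm_coset:
  assumes x: "x \<in> carrier A" shows "quotient_norm A U (Ker A U +> x) = pU x"
proof (rule antisym)
  let ?T = "{t. t > 0 \<and> (\<exists>u\<in>U. Ker A U +> x = Ker A U +> (of_real t \<odot> u))}"
  have bdd: "bdd_below ?T" by (rule bdd_belowI[of _ 0]) auto
  have T: "t \<in> ?T" if t: "pU x < t" for t
  proof -
    have pos: "t > 0" using t minkowski_nonneg[OF x] by simp
    have "x = of_real t \<odot> (of_real (inverse t) \<odot> x)"
      using x pos by (simp add: smult_smult flip: of_real_mult)
    then have "Ker A U +> x = Ker A U +> (of_real t \<odot> (of_real (inverse t) \<odot> x))" by simp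
    then have "\<exists>u\<in>U. Ker A U +> x = Ker A U +> (of_real t \<odot> u)"
      by (rule bexI[of _ "of_real (inverse t) \<odot> x", OF _ minkowski_less[OF x t]])
    with pos show ?thesis by (simp only: mem_Collect_eq)
  qed
  show "quotient_norm A U (Ker A U +> x) \<le> pU x"
  proof (rule dense_ge)
    fix t assume "pU x < t"
    then show "quotient_norm A U (Ker A U +> x) \<le> t" unfolding quotient_norm_def by (intro cInf_lower T bdd)
  qed
  show "pU x \<le> quotient_norm A U (Ker A U +> x)"
    unfolding quotient_norm_def
  proof (rule cInf_greatest)
    show "?T \<noteq> {}"
    proof
      assume "?T = {}"
      with T[OF less_add_one] show False by (simp only: empty_iff)
    qed
    fix t assume "t \<in> ?T"
    then have t: "t > 0" and "\<exists>u\<in>U. Ker A U +> x = Ker A U +> (of_real t \<odot> u)" by (simp_all only: mem_Collect_eq)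
    then obtain u where u: "u \<in> U" "Ker A U +> x = Ker A U +> (of_real t \<odot> u)" by (elim bexE)
    have uA: "u \<in> carrier A" using u(1) U_carrier by blast
    let ?v = "of_real t \<odot> u"
    have "pU (x \<ominus> ?v) = 0" using u(2) uA x coset_eq_iff by simp
    moreover have "x = (x \<ominus> ?v) \<oplus> ?v" using x uA by (simp add: a_minus_def a_assoc l_neg)
    ultimately have "pU x \<le> pU ?v" using minkowski_add[of "x \<ominus> ?v" ?v] x uA by simp
    also have "\<dots> \<le> t * 1" using minkowski_smult[OF uA, of "complex_of_real t"] minkowski_le_1[OF u(1)] t by simp
    finally show "pU x \<le> t" by simp
  qed
qed

lemma quotient_algebra_cosets:
  shows "carrier (quotient_algebra A U) = (\<lambda>x. Ker A U +> x) ` carrier A"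
    and "x \<in> carrier A \<Longrightarrow> y \<in> carrier A \<Longrightarrow>
      (Ker A U +> x) \<oplus>\<^bsub>quotient_algebra A U\<^esub> (Ker A U +> y) = Ker A U +> (x \<oplus> y)"
    and "x \<in> carrier A \<Longrightarrow> y \<in> carrier A \<Longrightarrow>
      (Ker A U +> x) \<otimes>\<^bsub>quotient_algebra A U\<^esub> (Ker A U +> y) = Ker A U +> (x \<otimes> y)"
    and "\<zero>\<^bsub>quotient_algebra A U\<^esub> = Ker A U +> \<zero>" and "\<one>\<^bsub>quotient_algebra A U\<^esub> = Ker A U +> \<one>"
    and "x \<in> carrier A \<Longrightarrow> c \<odot>\<^bsub>quotient_algebra A U\<^esub> (Ker A U +> x) = Ker A U +> (c \<odot> x)"
    and "x \<in> carrier A \<Longrightarrow> star (quotient_algebra A U) (Ker A U +> x) = Ker A U +> star A x"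
    and "x \<in> carrier A \<Longrightarrow> y \<in> carrier A \<Longrightarrow>
      norm_dist (quotient_algebra A U) (quotient_norm A U) (Ker A U +> x) (Ker A U +> y) = pU (x \<ominus> y)"
proof -
  have I: "ideal (Ker A U) A" by (rule ideal_Ker)
  have h: "ring_hom_ring A (A Quot Ker A U) ((+>) (Ker A U))" by (rule ideal.rcos_ring_hom_ring[OF I])
  note hom = ring_hom_ring.homh[OF h]
  have sel: "add (quotient_algebra A U) = add (A Quot Ker A U)" "mult (quotient_algebra A U) = mult (A Quot Ker A U)"
    "zero (quotient_algebra A U) = zero (A Quot Ker A U)" "one (quotient_algebra A U) = one (A Quot Ker A U)"
    "carrier (quotient_algebra A U) = carrier (A Quot Ker A U)"
    "smult (quotient_algebra A U) = (\<lambda>c X. \<Union>x\<in>X. Ker A U +> (c \<odot> x))"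
    "star (quotient_algebra A U) = (\<lambda>X. \<Union>x\<in>X. Ker A U +> star A x)"
    unfolding quotient_algebra_def by simp_all
  have "carrier (A Quot Ker A U) = a_rcosets (Ker A U)" by (simp only: FactRing_def partial_object.simps)
  also have "\<dots> = (\<lambda>x. Ker A U +> x) ` carrier A" by (simp only: A_RCOSETS_def' UNION_singleton_eq_range)
  finally show carrier: "carrier (quotient_algebra A U) = (\<lambda>x. Ker A U +> x) ` carrier A" unfolding sel .
  show "\<zero>\<^bsub>quotient_algebra A U\<^esub> = Ker A U +> \<zero>"
    unfolding sel by (rule ring_hom_zero[OF hom ring_axioms ideal.quotient_is_ring[OF I], symmetric])
  show "\<one>\<^bsub>quotient_algebra A U\<^esub> = Ker A U +> \<one>" unfolding sel by (rule ring_hom_one[OF hom, symmetric])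
  show "(Ker A U +> x) \<oplus>\<^bsub>quotient_algebra A U\<^esub> (Ker A U +> y) = Ker A U +> (x \<oplus> y)"
    "(Ker A U +> x) \<otimes>\<^bsub>quotient_algebra A U\<^esub> (Ker A U +> y) = Ker A U +> (x \<otimes> y)"
    if "x \<in> carrier A" "y \<in> carrier A"
    unfolding sel using ring_hom_add[OF hom that] ring_hom_mult[OF hom that] by simp_all
  have in_coset: "y \<in> carrier A \<and> pU (y \<ominus> x) = 0" if "y \<in> Ker A U +> x" "x \<in> carrier A" for x y
    using that by (auto simp: a_r_coset_def' in_Ker_iff a_minus_def a_assoc r_neg)
  \<comment> \<open>The operations on cosets are unions over all representatives. Such a union
    collapses to one coset as soon as the operation respects the null set of the gauge.\<close>
  have UN: "(\<Union>y\<in>Ker A U +> x. Ker A U +> f y) = Ker A U +> f x"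
    if x: "x \<in> carrier A" and f: "\<And>y. y \<in> carrier A \<Longrightarrow> f y \<in> carrier A"
      "\<And>y. y \<in> carrier A \<Longrightarrow> pU (y \<ominus> x) = 0 \<Longrightarrow> pU (f y \<ominus> f x) = 0" for f x
  proof -
    have "Ker A U +> f y = Ker A U +> f x" if "y \<in> Ker A U +> x" for y
      using in_coset[OF that x] f x by (simp add: coset_eq_iff)
    moreover have "x \<in> Ker A U +> x" by (rule abelian_subgroup.a_rcos_self[OF abelian_subgroupI3[OF ideal.axioms(1)[OF I] abelian_group_axioms] x])
    ultimately show ?thesis by blast
  qed
  show "c \<odot>\<^bsub>quotient_algebra A U\<^esub> (Ker A U +> x) = Ker A U +> (c \<odot> x)" if x: "x \<in> carrier A"
  proof -
    have "c \<odot> y \<ominus> c \<odot> x = c \<odot> (y \<ominus> x)" if "y \<in> carrier A" for y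
      using that x by (simp add: a_minus_def smult_add_right smult_smult flip: smult_minus_one)
    then have "(\<Union>y\<in>Ker A U +> x. Ker A U +> (c \<odot> y)) = Ker A U +> (c \<odot> x)"
      using x by (intro UN) (simp_all add: minkowski_smult)
    then show ?thesis unfolding sel .
  qed
  show "star (quotient_algebra A U) (Ker A U +> x) = Ker A U +> star A x" if x: "x \<in> carrier A"
  proof -
    \<comment> \<open>Commutativity identifies \<open>y \<otimes> star A y\<close> with
      \<open>star A y \<otimes> y\<close>, and the C*-identity then gives equal values.\<close>
    have pstar: "pU (star A y) = pU y" if y: "y \<in> carrier A" for y
    proof -
      have "(pU (star A y))\<^sup>2 = (pU y)\<^sup>2"
        using minkowski_C_star[of y] minkowski_C_star[of "star A y"] y by (simp add: m_comm)
      then show ?thesis using minkowski_nonneg y by simp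
    qed
    have "star A y \<ominus> star A x = star A (y \<ominus> x)" if "y \<in> carrier A" for y
      using that x by (simp add: a_minus_def star_add star_smult flip: smult_minus_one)
    then have "(\<Union>y\<in>Ker A U +> x. Ker A U +> star A y) = Ker A U +> star A x"
      using x by (intro UN) (simp_all add: pstar)
    then show ?thesis unfolding sel .
  qed
  show "norm_dist (quotient_algebra A U) (quotient_norm A U) (Ker A U +> x) (Ker A U +> y) = pU (x \<ominus> y)"
    if x: "x \<in> carrier A" and y: "y \<in> carrier A"
  proof -
    \<comment> \<open>Subtraction depends only on the carrier, the addition and the zero, which the
      two records share.\<close>
    have "(Ker A U +> x) \<ominus>\<^bsub>quotient_algebra A U\<^esub> (Ker A U +> y) = (Ker A U +> x) \<ominus>\<^bsub>A Quot Ker A U\<^esub> (Ker A U +> y)"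
      unfolding a_minus_def a_inv_def m_inv_def quotient_algebra_def by simp
    also have "\<dots> = Ker A U +> (x \<ominus> y)"
    proof -
      let ?Q = "A Quot Ker A U"
      have Q: "ring ?Q" by (rule ideal.quotient_is_ring[OF I])
      have "(Ker A U +> (\<ominus> y)) \<oplus>\<^bsub>?Q\<^esub> (Ker A U +> y) = \<zero>\<^bsub>?Q\<^esub>"
        using ring_hom_add[OF hom a_inv_closed[OF y] y] ring_hom_zero[OF hom ring_axioms Q] y by (simp add: l_neg)
      then have "\<ominus>\<^bsub>?Q\<^esub> (Ker A U +> y) = Ker A U +> (\<ominus> y)"
        using ring_hom_closed[OF hom] y by (intro abelian_group.minus_equality[OF ring.is_abelian_group[OF Q]]) auto
      then show ?thesis unfolding a_minus_def using ring_hom_add[OF hom x a_inv_closed[OF y]] by simp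
    qed
    finally show ?thesis using quotient_norm_coset[of "x \<ominus> y"] x y by (simp add: norm_dist_def carrier)
  qed
qed

end

end

subsection \<open>Completions as function algebras\<close>

lemma UN_eq_const: "S \<noteq> {} \<Longrightarrow> (\<And>s. s \<in> S \<Longrightarrow> F s = c) \<Longrightarrow> (\<Union>s\<in>S. F s) = c"
  by auto

text \<open>The map \<open>j\<close> embeds \<open>Q\<close> isometrically and densely into the
  complete algebra \<open>C(M)\<close>. The algebra of classes of Cauchy sequences is then studied
  through the limits of these sequences in \<open>C(M)\<close>.\<close>

locale function_completion = compact_function_space M for M :: "'m topology" +
  fixes Q :: "'q ialg" and N :: "'q \<Rightarrow> real" and j :: "'q \<Rightarrow> 'm \<Rightarrow> complex"
  assumes j_in: "x \<in> carrier Q \<Longrightarrow> j x \<in> continuous_functions M"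
    and j_dist: "x \<in> carrier Q \<Longrightarrow> y \<in> carrier Q \<Longrightarrow> norm_dist Q N x y = mdist (cfunspace M euclidean_metric) (j x) (j y)"
    and j_inj: "inj_on j (carrier Q)"
    and j_zero: "\<zero>\<^bsub>Q\<^esub> \<in> carrier Q" "j \<zero>\<^bsub>Q\<^esub> = \<zero>\<^bsub>function_algebra M\<^esub>"
    and j_one: "\<one>\<^bsub>Q\<^esub> \<in> carrier Q" "j \<one>\<^bsub>Q\<^esub> = \<one>\<^bsub>function_algebra M\<^esub>"
    and j_add: "x \<in> carrier Q \<Longrightarrow> y \<in> carrier Q \<Longrightarrow> x \<oplus>\<^bsub>Q\<^esub> y \<in> carrier Q \<and> j (x \<oplus>\<^bsub>Q\<^esub> y) = j x \<oplus>\<^bsub>function_algebra M\<^esub> j y"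
    and j_mult: "x \<in> carrier Q \<Longrightarrow> y \<in> carrier Q \<Longrightarrow> x \<otimes>\<^bsub>Q\<^esub> y \<in> carrier Q \<and> j (x \<otimes>\<^bsub>Q\<^esub> y) = j x \<otimes>\<^bsub>function_algebra M\<^esub> j y"
    and j_smult: "x \<in> carrier Q \<Longrightarrow> c \<odot>\<^bsub>Q\<^esub> x \<in> carrier Q \<and> j (c \<odot>\<^bsub>Q\<^esub> x) = c \<odot>\<^bsub>function_algebra M\<^esub> j x"
    and j_star: "x \<in> carrier Q \<Longrightarrow> star Q x \<in> carrier Q \<and> j (star Q x) = star (function_algebra M) (j x)"
    and j_dense: "f \<in> continuous_functions M \<Longrightarrow> e > 0 \<Longrightarrow>
      \<exists>x\<in>carrier Q. \<forall>t\<in>topspace M. cmod (j x t - f t) < e"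
begin

abbreviation "dQ \<equiv> norm_dist Q N"

lemma dQ: "x \<in> carrier Q \<Longrightarrow> y \<in> carrier Q \<Longrightarrow> dQ x y = D (j x) (j y)"
  using j_dist by (simp add: metric_CM_def)

lemma metric_Q: "Metric_space (carrier Q) dQ"
proof
  have out: "dQ x y = 0" if "\<not> (x \<in> carrier Q \<and> y \<in> carrier Q)" for x y using that by (auto simp: norm_dist_def)
  show "0 \<le> dQ x y" for x y using out by (cases "x \<in> carrier Q \<and> y \<in> carrier Q") (auto simp: dQ)
  show "dQ x y = dQ y x" for x y
    using out by (cases "x \<in> carrier Q \<and> y \<in> carrier Q") (auto simp: dQ D.commute)
  show "(dQ x y = 0) = (x = y)" if "x \<in> carrier Q" "y \<in> carrier Q" for x y
    using that j_in inj_onD[OF j_inj] by (auto simp: dQ)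
  show "dQ x z \<le> dQ x y + dQ y z" if "x \<in> carrier Q" "y \<in> carrier Q" "z \<in> carrier Q" for x y z
    using that j_in D.triangle by (simp add: dQ)
qed

lemma norm_dist_CM: "f \<in> C \<Longrightarrow> g \<in> C \<Longrightarrow> norm_dist CM norm_CM f g = D f g"
  using CS.d_eq[of f g] D_eq_norm[of f g] by simp

text \<open>The point of the completion that belongs to \<open>f\<close>, described by its limit
  instead of by a representative sequence.\<close>

definition limit_class :: "('m \<Rightarrow> complex) \<Rightarrow> (nat \<Rightarrow> 'q) set" where
  "limit_class f = {s. (\<forall>n. s n \<in> carrier Q) \<and> (\<lambda>n. D (j (s n)) f) \<longlonglongrightarrow> 0}"

lemma limit_classD:
  assumes "s \<in> limit_class f" shows "s n \<in> carrier Q" "j (s n) \<in> C" "(\<lambda>n. D (j (s n)) f) \<longlonglongrightarrow> 0"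
  using assms j_in by (simp_all add: limit_class_def)

lemma limit_classI:
  assumes "\<And>n. s n \<in> carrier Q" "\<And>n. D (j (s n)) f \<le> b n" "b \<longlonglongrightarrow> 0"
  shows "s \<in> limit_class f"
  unfolding limit_class_def using assms by (auto intro: tendsto_sandwich[OF _ _ tendsto_const assms(3)])

lemma const_limit_class: "x \<in> carrier Q \<Longrightarrow> (\<lambda>_. x) \<in> limit_class (j x)"
  by (rule limit_classI[of _ _ "\<lambda>_. 0"]) (use j_in in simp_all)

lemma limit_class_nonempty:
  assumes f: "f \<in> C" shows "limit_class f \<noteq> {}"
proof -
  have "\<exists>x\<in>carrier Q. D (j x) f \<le> inverse (real (Suc n))" for n
  proof -
    obtain x where x: "x \<in> carrier Q" "\<forall>t\<in>topspace M. cmod (j x t - f t) < inverse (real (Suc n))"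
      using j_dense[OF f, of "inverse (real (Suc n))"] by auto
    have "D (j x) f \<le> inverse (real (Suc n))" by (rule D_le) (use x(2) in \<open>auto intro: less_imp_le\<close>)
    then show ?thesis using x(1) by blast
  qed
  then obtain s where "\<And>n. s n \<in> carrier Q" "\<And>n. D (j (s n)) f \<le> inverse (real (Suc n))" by metis
  from limit_classI[OF this LIMSEQ_inverse_real_of_nat] show ?thesis by blast
qed

text \<open>The distance is Lipschitz in both arguments, and \<open>j\<close> is isometric. Hence
  the distance of two classes is the distance of their limits, whatever the representatives.\<close>

lemma limit_class_dist:
  assumes s: "s \<in> limit_class f" and t: "t \<in> limit_class g"
    and f: "f \<in> C" and g: "g \<in> C"
  shows "(\<lambda>n. dQ (s n) (t n)) \<longlonglongrightarrow> D f g"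
proof -
  note S = limit_classD[OF s] and T = limit_classD[OF t]
  have b: "\<bar>D (j (s n)) (j (t n)) - D f g\<bar> \<le> D (j (s n)) f + D (j (t n)) g" for n
    using D.triangle[OF S(2) f T(2), of n n] D.triangle[OF f g T(2), of n] D.triangle[OF f S(2) g, of n]
      D.triangle[OF S(2) T(2) g, of n n] D.commute[of f "j (s n)"] D.commute[of g "j (t n)"] by linarith
  have "(\<lambda>n. D (j (s n)) f + D (j (t n)) g) \<longlonglongrightarrow> 0" using tendsto_add[OF S(3) T(3)] by simp
  then have "(\<lambda>n. D (j (s n)) (j (t n)) - D f g) \<longlonglongrightarrow> 0"
    by (rule Lim_null_comparison[rotated]) (simp add: b)
  then show ?thesis by (simp add: dQ S(1) T(1) LIM_zero_iff)
qed

lemma cauchy_seqs_iff: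
  "s \<in> cauchy_seqs Q N \<longleftrightarrow> (\<forall>n. s n \<in> carrier Q) \<and> D.MCauchy (\<lambda>n. j (s n))"
  unfolding cauchy_seqs_def mem_Collect_eq Metric_space.MCauchy_def[OF metric_Q] D.MCauchy_def
  using j_in by (auto simp: dQ image_subset_iff)

lemma limit_class_cauchy:
  assumes s: "s \<in> limit_class f" and f: "f \<in> C" shows "s \<in> cauchy_seqs Q N"
proof -
  note S = limit_classD[OF s]
  have "limitin D.mtopology (\<lambda>n. j (s n)) f sequentially"
    unfolding D.limitin_metric_dist_null using S f by simp
  then have "D.MCauchy (\<lambda>n. j (s n))" using S(2) by (intro D.convergent_imp_MCauchy) auto
  then show ?thesis using S(1) by (simp add: cauchy_seqs_iff)
qed

lemma cauchy_limit_class: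
  assumes s: "s \<in> cauchy_seqs Q N" obtains f where "f \<in> C" "s \<in> limit_class f"
proof -
  have sQ: "s n \<in> carrier Q" for n using s by (simp add: cauchy_seqs_iff)
  obtain f where "limitin D.mtopology (\<lambda>n. j (s n)) f sequentially"
    using s mcomplete_D unfolding cauchy_seqs_iff D.mcomplete_def by blast
  then have "f \<in> C" "s \<in> limit_class f"
    unfolding D.limitin_metric_dist_null limit_class_def using sQ by simp_all
  then show thesis by (rule that)
qed

lemma limit_class_inj:
  assumes "s \<in> limit_class f" "s \<in> limit_class g" "f \<in> C" "g \<in> C"
  shows "f = g"
proof -
  have sQ: "s n \<in> carrier Q" for n by (rule limit_classD(1)[OF assms(1)])
  have "(\<lambda>n. dQ (s n) (s n)) = (\<lambda>_. 0)" by (intro ext) (simp add: dQ[OF sQ sQ] j_in[OF sQ])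
  then have "D f g = 0" using limit_class_dist[OF assms] LIMSEQ_unique tendsto_const by metis
  then show ?thesis using assms by simp
qed

text \<open>Every Cauchy sequence has a limit in \<open>C(M)\<close>, and the termwise distance of
  two of them tends to zero exactly when these limits coincide.\<close>

lemma cauchy_class_eq:
  assumes s: "s \<in> limit_class f" and f: "f \<in> C"
  shows "cauchy_class Q N s = limit_class f"
proof (intro subset_antisym subsetI)
  fix t assume "t \<in> cauchy_class Q N s"
  then have t: "t \<in> cauchy_seqs Q N" and st: "(\<lambda>n. dQ (s n) (t n)) \<longlonglongrightarrow> 0" by (simp_all add: cauchy_class_def)
  obtain g where g: "g \<in> C" "t \<in> limit_class g" using cauchy_limit_class[OF t] .
  have "D f g = 0" by (rule LIMSEQ_unique[OF limit_class_dist[OF s g(2) f g(1)] st])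
  then show "t \<in> limit_class f" using f g by simp
next
  fix t assume t: "t \<in> limit_class f"
  show "t \<in> cauchy_class Q N s"
    unfolding cauchy_class_def using limit_class_cauchy[OF t f] limit_class_dist[OF s t f f] f by simp
qed

abbreviation "QC \<equiv> completion Q N"

lemma completion_carrier: "cauchy_class Q N ` cauchy_seqs Q N = limit_class ` C"
proof (intro subset_antisym subsetI)
  fix X assume "X \<in> cauchy_class Q N ` cauchy_seqs Q N"
  then obtain s where s: "s \<in> cauchy_seqs Q N" "X = cauchy_class Q N s" by blast
  obtain f where f: "f \<in> C" "s \<in> limit_class f" using cauchy_limit_class[OF s(1)] .
  show "X \<in> limit_class ` C"
    by (rule image_eqI[OF _ f(1)]) (simp only: s(2) cauchy_class_eq[OF f(2,1)])
next
  fix X assume "X \<in> limit_class ` C"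
  then obtain f where f: "f \<in> C" "X = limit_class f" by blast
  obtain s where s: "s \<in> limit_class f" using limit_class_nonempty[OF f(1)] by blast
  show "X \<in> cauchy_class Q N ` cauchy_seqs Q N"
    by (rule image_eqI[OF _ limit_class_cauchy[OF s f(1)]]) (simp only: f(2) cauchy_class_eq[OF s f(1)])
qed

lemma carrier_QC: "carrier QC = limit_class ` C"
  by (simp add: completion_def completion_carrier)

definition limit_of :: "(nat \<Rightarrow> 'q) set \<Rightarrow> 'm \<Rightarrow> complex" where
  "limit_of = inv_into C limit_class"

lemma limit_of: "f \<in> C \<Longrightarrow> limit_of (limit_class f) = f"
  unfolding limit_of_def
proof (rule inv_into_f_f)
  show "inj_on limit_class C"
  proof (rule inj_onI)
    fix f g assume f: "f \<in> C" and g: "g \<in> C" and eq: "limit_class f = limit_class g"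
    obtain s where s: "s \<in> limit_class f" using limit_class_nonempty[OF f] by blast
    then show "f = g" using limit_class_inj[OF s _ f g] eq by simp
  qed
qed

lemma completion_dist_eq:
  "completion_dist Q N X Y = (if X \<in> carrier QC \<and> Y \<in> carrier QC then D (limit_of X) (limit_of Y) else 0)"
proof (cases "X \<in> carrier QC \<and> Y \<in> carrier QC")
  case True
  then obtain f g where f: "f \<in> C" "X = limit_class f"
    and g: "g \<in> C" "Y = limit_class g" unfolding carrier_QC by blast
  obtain s t where st: "s \<in> X" "t \<in> Y" using limit_class_nonempty f g by blast
  have lim: "(\<lambda>n. dQ (s n) (t n)) \<longlonglongrightarrow> D f g" if "s \<in> X" "t \<in> Y" for s t
    using that limit_class_dist f g by simp
  have "(THE r. \<forall>s\<in>X. \<forall>t\<in>Y. (\<lambda>n. dQ (s n) (t n)) \<longlonglongrightarrow> r) = D f g"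
  proof (rule the_equality)
    show "\<forall>s\<in>X. \<forall>t\<in>Y. (\<lambda>n. dQ (s n) (t n)) \<longlonglongrightarrow> D f g" using lim by blast
    fix r assume "\<forall>s\<in>X. \<forall>t\<in>Y. (\<lambda>n. dQ (s n) (t n)) \<longlonglongrightarrow> r"
    then have "(\<lambda>n. dQ (s n) (t n)) \<longlonglongrightarrow> r" using st by blast
    then show "r = D f g" by (rule LIMSEQ_unique) (rule lim[OF st])
  qed
  then show ?thesis using True f g limit_of unfolding completion_dist_def completion_carrier carrier_QC by simp
next
  case False
  then show ?thesis unfolding completion_dist_def completion_carrier carrier_QC by (simp only: if_False)
qed

text \<open>The operations of the completion are unions over all pairs of representatives. If the
  termwise operation commutes with limits, every set in the union is the same class;
  \<open>limit_class_nonempty\<close> excludes an empty union.\<close>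

lemma completion_op2:
  assumes f: "f \<in> C" and g: "g \<in> C" and h: "h \<in> C"
    and lim: "\<And>s t. s \<in> limit_class f \<Longrightarrow> t \<in> limit_class g \<Longrightarrow> (\<lambda>n. op (s n) (t n)) \<in> limit_class h"
  shows "(\<Union>s\<in>limit_class f. \<Union>t\<in>limit_class g. cauchy_class Q N (\<lambda>n. op (s n) (t n))) = limit_class h"
  by (intro UN_eq_const limit_class_nonempty f g cauchy_class_eq lim h)

lemma completion_op1:
  assumes f: "f \<in> C" and h: "h \<in> C"
    and lim: "\<And>s. s \<in> limit_class f \<Longrightarrow> (\<lambda>n. op (s n)) \<in> limit_class h"
  shows "(\<Union>s\<in>limit_class f. cauchy_class Q N (\<lambda>n. op (s n))) = limit_class h"
  by (intro UN_eq_const limit_class_nonempty f cauchy_class_eq lim h)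

lemma ialg_bijection_completion: "ialg_bijection CM QC limit_class limit_of"
  unfolding ialg_bijection_def
proof (intro conjI ballI allI)
  show "limit_class \<in> carrier CM \<rightarrow> carrier QC" "limit_of \<in> carrier QC \<rightarrow> carrier CM"
    by (auto simp: carrier_QC limit_of)
  show "limit_of (limit_class f) = f" if "f \<in> carrier CM" for f using that by (simp add: limit_of)
  show "limit_class (limit_of z) = z" if "z \<in> carrier QC" for z using that by (auto simp: carrier_QC limit_of)
  have cl: "x \<oplus>\<^bsub>CM\<^esub> y \<in> C" "x \<otimes>\<^bsub>CM\<^esub> y \<in> C"
    "c \<odot>\<^bsub>CM\<^esub> x \<in> C" "star CM x \<in> C"
    if "x \<in> C" "y \<in> C" for x y c
    using CS.a_closed[of x y] CS.m_closed[of x y] CS.smult_cclosed[of x c] CS.star_closed[of x] that by simp_all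
  have one_CM: "\<one>\<^bsub>CM\<^esub> \<in> C" using CS.one_closed by simp
  have "limit_class \<zero>\<^bsub>CM\<^esub> = cauchy_class Q N (\<lambda>_. \<zero>\<^bsub>Q\<^esub>)"
    using cauchy_class_eq[OF const_limit_class[OF j_zero(1)] j_in[OF j_zero(1)]] by (simp only: j_zero(2))
  then show "limit_class \<zero>\<^bsub>CM\<^esub> = \<zero>\<^bsub>QC\<^esub>" unfolding completion_def by simp
  have "limit_class \<one>\<^bsub>CM\<^esub> = cauchy_class Q N (\<lambda>_. \<one>\<^bsub>Q\<^esub>)"
    using cauchy_class_eq[OF const_limit_class[OF j_one(1)] j_in[OF j_one(1)]] by (simp only: j_one(2))
  then show "limit_class \<one>\<^bsub>CM\<^esub> = \<one>\<^bsub>QC\<^esub>" unfolding completion_def by simp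
  fix f assume "f \<in> carrier CM"
  then have f: "f \<in> C" by simp
  {
    fix c
    have "(\<Union>s\<in>limit_class f. cauchy_class Q N (\<lambda>n. c \<odot>\<^bsub>Q\<^esub> s n)) = limit_class (c \<odot>\<^bsub>CM\<^esub> f)"
    proof (rule completion_op1[OF f cl(3)[OF f f]])
      fix s assume "s \<in> limit_class f"
      note S = limit_classD[OF this]
      show "(\<lambda>n. c \<odot>\<^bsub>Q\<^esub> s n) \<in> limit_class (c \<odot>\<^bsub>CM\<^esub> f)"
      proof (rule limit_classI)
        show "(\<lambda>n. cmod c * D (j (s n)) f) \<longlonglongrightarrow> 0" using tendsto_mult_left[OF S(3), of "cmod c"] by simp
        show "D (j (c \<odot>\<^bsub>Q\<^esub> s n)) (c \<odot>\<^bsub>CM\<^esub> f) \<le> cmod c * D (j (s n)) f" for n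
          using CS.d_smult[of "j (s n)" f c] j_smult[OF S(1), of c n] S(2)[of n] f cl(3)[OF f f] cl(3)[OF S(2) S(2)]
          by (simp only: norm_dist_CM function_algebra_simps(1))
      qed (use S j_smult in blast)
    qed
    then show "limit_class (c \<odot>\<^bsub>CM\<^esub> f) = c \<odot>\<^bsub>QC\<^esub> limit_class f" unfolding completion_def by simp
  }
  have "(\<Union>s\<in>limit_class f. cauchy_class Q N (\<lambda>n. star Q (s n))) = limit_class (star CM f)"
  proof (rule completion_op1[OF f cl(4)[OF f f]])
    fix s assume "s \<in> limit_class f"
    note S = limit_classD[OF this]
    show "(\<lambda>n. star Q (s n)) \<in> limit_class (star CM f)"
    proof (rule limit_classI[OF _ _ S(3)])
      show "D (j (star Q (s n))) (star CM f) \<le> D (j (s n)) f" for n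
        using CS.d_star[of "j (s n)" f] j_star[OF S(1), of n] S(2)[of n] f cl(4)[OF f f] cl(4)[OF S(2) S(2)]
        by (simp only: norm_dist_CM function_algebra_simps(1))
    qed (use S j_star in blast)
  qed
  then show "limit_class (star CM f) = star QC (limit_class f)" unfolding completion_def by simp
  fix g assume "g \<in> carrier CM"
  then have g: "g \<in> C" by simp
  have "(\<Union>s\<in>limit_class f. \<Union>t\<in>limit_class g. cauchy_class Q N (\<lambda>n. s n \<oplus>\<^bsub>Q\<^esub> t n)) = limit_class (f \<oplus>\<^bsub>CM\<^esub> g)"
  proof (rule completion_op2[OF f g cl(1)[OF f g]])
    fix s t assume "s \<in> limit_class f" "t \<in> limit_class g"
    note S = limit_classD[OF this(1)] and T = limit_classD[OF this(2)]
    show "(\<lambda>n. s n \<oplus>\<^bsub>Q\<^esub> t n) \<in> limit_class (f \<oplus>\<^bsub>CM\<^esub> g)"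
    proof (rule limit_classI)
      show "(\<lambda>n. D (j (s n)) f + D (j (t n)) g) \<longlonglongrightarrow> 0" using tendsto_add[OF S(3) T(3)] by simp
      show "D (j (s n \<oplus>\<^bsub>Q\<^esub> t n)) (f \<oplus>\<^bsub>CM\<^esub> g) \<le> D (j (s n)) f + D (j (t n)) g" for n
        using CS.d_add[of "j (s n)" "j (t n)" f g] j_add[OF S(1) T(1), of n n] S(2)[of n] T(2)[of n] f g
          cl(1)[OF f g] cl(1)[OF S(2) T(2), of n n]
        by (simp only: norm_dist_CM function_algebra_simps(1))
    qed (use S T j_add in blast)
  qed
  then show "limit_class (f \<oplus>\<^bsub>CM\<^esub> g) = limit_class f \<oplus>\<^bsub>QC\<^esub> limit_class g" unfolding completion_def by simp
  have "(\<Union>s\<in>limit_class f. \<Union>t\<in>limit_class g. cauchy_class Q N (\<lambda>n. s n \<otimes>\<^bsub>Q\<^esub> t n)) = limit_class (f \<otimes>\<^bsub>CM\<^esub> g)"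
  proof (rule completion_op2[OF f g cl(2)[OF f g]])
    fix s t assume "s \<in> limit_class f" "t \<in> limit_class g"
    note S = limit_classD[OF this(1)] and T = limit_classD[OF this(2)]
    \<comment> \<open>In the product estimate the norm of \<open>j (s n)\<close> varies with
      \<open>n\<close>; it is replaced by the norm of the limit plus the distance from it.\<close>
    let ?b = "\<lambda>n. (norm_CM f + D (j (s n)) f) * D (j (t n)) g + D (j (s n)) f * norm_CM g"
    show "(\<lambda>n. s n \<otimes>\<^bsub>Q\<^esub> t n) \<in> limit_class (f \<otimes>\<^bsub>CM\<^esub> g)"
    proof (rule limit_classI)
      have "?b \<longlonglongrightarrow> (norm_CM f + 0) * 0 + 0 * norm_CM g" by (intro tendsto_intros S(3) T(3))
      then show "?b \<longlonglongrightarrow> 0" by simp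
      fix n
      have "norm_CM (j (s n)) \<le> norm_CM f + D (j (s n)) f"
        unfolding norm_CM_def using D.triangle[OF S(2) f zero_CM, of n] by linarith
      then have "norm_CM (j (s n)) * D (j (t n)) g \<le> (norm_CM f + D (j (s n)) f) * D (j (t n)) g"
        by (rule mult_right_mono) simp
      moreover have "D (j (s n \<otimes>\<^bsub>Q\<^esub> t n)) (f \<otimes>\<^bsub>CM\<^esub> g) \<le> norm_CM (j (s n)) * D (j (t n)) g + D (j (s n)) f * norm_CM g"
        using CS.d_mult[of "j (s n)" "j (t n)" f g] j_mult[OF S(1) T(1), of n n] S(2)[of n] T(2)[of n] f g
          cl(2)[OF f g] cl(2)[OF S(2) T(2), of n n]
        by (simp only: norm_dist_CM function_algebra_simps(1))
      ultimately show "D (j (s n \<otimes>\<^bsub>Q\<^esub> t n)) (f \<otimes>\<^bsub>CM\<^esub> g) \<le> ?b n" by linarith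
    qed (use S T j_mult in blast)
  qed
  then show "limit_class (f \<otimes>\<^bsub>CM\<^esub> g) = limit_class f \<otimes>\<^bsub>QC\<^esub> limit_class g" unfolding completion_def by simp
qed

lemma topol_QC: "topol QC = Metric_space.mtopology (carrier QC) (completion_dist Q N)"
  by (simp add: completion_def)

lemmas completion_inverse_isos = copy_inverse_isos[OF ialg_bijection_completion completion_dist_eq topol_QC]

lemmas involutive_stereotype_completion = involutive_stereotype_copy[OF ialg_bijection_completion completion_dist_eq topol_QC]

end

subsection \<open>The Kuznetsova envelope\<close>

context commutative_stereotype_algebra
begin

definition nbhd_chars :: "'a set \<Rightarrow> ('a \<Rightarrow> complex) set" where
  "nbhd_chars U = char_ball (minkowski A U)"

definition coset_fun :: "'a set \<Rightarrow> 'a set \<Rightarrow> ('a \<Rightarrow> complex) \<Rightarrow> complex" where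
  "coset_fun U X = restrict (\<G> (SOME x. x \<in> carrier A \<and> X = Ker A U +> x)) (nbhd_chars U)"

abbreviation "chars_space U \<equiv> subtopology (Spec A) (nbhd_chars U)"

abbreviation "CU U \<equiv> function_algebra (chars_space U)"

abbreviation "Gres U x \<equiv> restrict (\<G> x) (nbhd_chars U)"

lemma nbhd_charsD: "t \<in> nbhd_chars U \<Longrightarrow> t \<in> H" "t \<in> nbhd_chars U \<Longrightarrow> x \<in> carrier A \<Longrightarrow> cmod (t x) \<le> minkowski A U x"
  by (simp_all add: nbhd_chars_def char_ball_def)

lemma nbhd_chars_subset: "nbhd_chars U \<subseteq> H"
  using nbhd_charsD(1) by blast

lemma topspace_chars_space [simp]: "topspace (chars_space U) = nbhd_chars U"
  using nbhd_chars_subset by auto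

context
  fixes U assumes U: "C_star_nbhd A U"
begin

lemma compactin_nbhd_chars: "compactin (Spec A) (nbhd_chars U)"
  unfolding nbhd_chars_def by (rule compactin_char_ball[OF C_star_seminorm_minkowski[OF U] minkowski_zero_nbhd[OF U]])

lemma compact_chars_space: "compact_function_space (chars_space U)"
  by (rule subtopology_compact_function_space[OF Hausdorff_Spec compactin_nbhd_chars])

text \<open>Two representatives of a coset differ by an element of gauge zero, on which all
  characters in \<open>nbhd_chars U\<close> vanish, so the choice in the definition does not
  matter.\<close>

lemma coset_fun:
  assumes x: "x \<in> carrier A"
  shows "coset_fun U (Ker A U +> x) = Gres U x"
proof -
  define y where "y = (SOME y. y \<in> carrier A \<and> Ker A U +> x = Ker A U +> y)"
  have y: "y \<in> carrier A \<and> Ker A U +> x = Ker A U +> y"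
    unfolding y_def by (rule someI[of _ x]) (use x in simp)
  have "minkowski A U (x \<ominus> y) = 0" using coset_eq_iff[OF U x conjunct1[OF y]] conjunct2[OF y] by (rule iffD1)
  then have eq: "t x = t y" if "t \<in> nbhd_chars U" for t
    using nbhd_charsD(2)[OF that, of "x \<ominus> y"] character_minus[OF nbhd_charsD(1)[OF that] x] x y by simp
  show ?thesis
    unfolding coset_fun_def y_def[symmetric]
  proof (rule restrict_ext)
    fix t assume t: "t \<in> nbhd_chars U"
    show "\<G> y t = \<G> x t" using x y nbhd_charsD(1)[OF t] eq[OF t] by simp
  qed
qed

lemma restrict_gelfand_in:
  "x \<in> carrier A \<Longrightarrow> Gres U x \<in> continuous_functions (chars_space U)"
  using involutive_homsD(3)[OF gelfand_restrict_hom[OF nbhd_chars_subset], of x] by simp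

text \<open>One inequality is the domination of the characters by the gauge, the other the recovery
  of the gauge from its characters. It is the isometry needed for the completion.\<close>

lemma coset_fun_dist:
  assumes x: "x \<in> carrier A" and y: "y \<in> carrier A"
  shows "mdist (cfunspace (chars_space U) euclidean_metric) (Gres U x)
     (Gres U y) = minkowski A U (x \<ominus> y)"
    (is "?d = _")
proof -
  interpret C: compact_function_space "chars_space U" by (rule compact_chars_space)
  have t: "Gres U x t - Gres U y t = t (x \<ominus> y)"
    if "t \<in> nbhd_chars U" for t
    using that x y nbhd_charsD(1)[OF that] character_minus by simp
  have xy: "x \<ominus> y \<in> carrier A" using x y by simp
  have d: "?d = C.D (Gres U x) (Gres U y)"
    by (simp only: C.metric_CM_def)
  show ?thesis
  proof (rule antisym)
    show "?d \<le> minkowski A U (x \<ominus> y)"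
      unfolding d by (rule C.D_le[OF minkowski_nonneg[OF U xy]])
        (simp only: topspace_chars_space t nbhd_charsD(2)[OF _ xy])
    show "minkowski A U (x \<ominus> y) \<le> ?d"
    proof (rule p_le_of_char_ball[OF C_star_seminorm_minkowski[OF U] minkowski_zero_nbhd[OF U] xy])
      show "0 \<le> ?d" unfolding d by (rule C.D.nonneg)
      show "\<forall>t\<in>char_ball (minkowski A U). cmod (t (x \<ominus> y)) \<le> ?d"
      proof
        fix s assume "s \<in> char_ball (minkowski A U)"
        then have s: "s \<in> nbhd_chars U" by (simp add: nbhd_chars_def)
        show "cmod (s (x \<ominus> y)) \<le> ?d"
          unfolding d t[OF s, symmetric] by (rule C.le_D[OF restrict_gelfand_in[OF x] restrict_gelfand_in[OF y]]) (use s nbhd_charsD(1)[OF s] in simp)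
      qed
    qed
  qed
qed

text \<open>This turns the completed quotient into \<open>C(nbhd_chars U)\<close>: the embedding of
  cosets is isometric by \<open>coset_fun_dist\<close>, and Stone-Weierstrass on the compact set of
  characters makes it dense.\<close>

lemma function_completion_quotient:
  "function_completion (chars_space U) (quotient_algebra A U) (quotient_norm A U) (coset_fun U)"
proof (rule function_completion.intro[OF compact_chars_space])
  let ?Q = "quotient_algebra A U"
  define h where "h = (\<lambda>x\<in>carrier A. Gres U x)"
  have hom: "h \<in> involutive_homs A (CU U)"
    unfolding h_def by (rule gelfand_restrict_hom[OF nbhd_chars_subset])
  note q = quotient_algebra_cosets[OF U] and hD = involutive_homsD[OF hom]
  have j: "coset_fun U (Ker A U +> x) = h x" if "x \<in> carrier A" for x using coset_fun[OF that] that by (simp add: h_def)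
  have Q: "\<exists>x\<in>carrier A. X = Ker A U +> x" if "X \<in> carrier ?Q" for X using that unfolding q(1) by blast
  have coset_in: "Ker A U +> x \<in> carrier ?Q" if "x \<in> carrier A" for x using that unfolding q(1) by blast
  have dist: "norm_dist ?Q (quotient_norm A U) (Ker A U +> x) (Ker A U +> y) =
      mdist (cfunspace (chars_space U) euclidean_metric) (h x) (h y)" if "x \<in> carrier A" "y \<in> carrier A" for x y
    using q(8)[OF that] coset_fun_dist[OF that] that by (simp only: h_def restrict_apply')
  show "function_completion_axioms (chars_space U) ?Q (quotient_norm A U) (coset_fun U)"
  proof (rule function_completion_axioms.intro)
    show "coset_fun U X \<in> continuous_functions (chars_space U)" if "X \<in> carrier ?Q" for X
      using Q[OF that] hD(3) j by auto
    show "norm_dist ?Q (quotient_norm A U) X Y = mdist (cfunspace (chars_space U) euclidean_metric) (coset_fun U X) (coset_fun U Y)"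
      if "X \<in> carrier ?Q" "Y \<in> carrier ?Q" for X Y
      using Q[OF that(1)] Q[OF that(2)] dist j by metis
    show "inj_on (coset_fun U) (carrier ?Q)"
    proof (rule inj_onI)
      fix X Y assume XY: "X \<in> carrier ?Q" "Y \<in> carrier ?Q" and eq: "coset_fun U X = coset_fun U Y"
      obtain x y where x: "x \<in> carrier A" "X = Ker A U +> x" and y: "y \<in> carrier A" "Y = Ker A U +> y"
        using Q[OF XY(1)] Q[OF XY(2)] by blast
      interpret C: compact_function_space "chars_space U" by (rule compact_chars_space)
      have "Gres U x = Gres U y"
        using eq x y coset_fun by simp
      then have "minkowski A U (x \<ominus> y) = 0"
        using coset_fun_dist[OF x(1) y(1)] C.D.mdist_zero[OF restrict_gelfand_in[OF y(1)]] by (simp only: C.metric_CM_def)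
      then show "X = Y" using coset_eq_iff[OF U x(1) y(1)] x y by simp
    qed
    show "\<zero>\<^bsub>?Q\<^esub> \<in> carrier ?Q" "\<one>\<^bsub>?Q\<^esub> \<in> carrier ?Q" unfolding q(4,5) by (simp_all add: coset_in)
    have "h \<zero> = \<zero>\<^bsub>CU U\<^esub>"
      unfolding h_def function_algebra_simps using character_zero nbhd_charsD(1) by (auto intro!: restrict_ext)
    then show "coset_fun U \<zero>\<^bsub>?Q\<^esub> = \<zero>\<^bsub>CU U\<^esub>" unfolding q(4) by (simp only: j zero_closed)
    show "coset_fun U \<one>\<^bsub>?Q\<^esub> = \<one>\<^bsub>CU U\<^esub>" unfolding q(5) by (simp only: j one_closed hD(6))
    show "X \<oplus>\<^bsub>?Q\<^esub> Y \<in> carrier ?Q \<and> coset_fun U (X \<oplus>\<^bsub>?Q\<^esub> Y) = coset_fun U X \<oplus>\<^bsub>CU U\<^esub> coset_fun U Y"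
      "X \<otimes>\<^bsub>?Q\<^esub> Y \<in> carrier ?Q \<and> coset_fun U (X \<otimes>\<^bsub>?Q\<^esub> Y) = coset_fun U X \<otimes>\<^bsub>CU U\<^esub> coset_fun U Y"
      if XY: "X \<in> carrier ?Q" "Y \<in> carrier ?Q" for X Y
    proof -
      obtain x y where x: "x \<in> carrier A" "X = Ker A U +> x" and y: "y \<in> carrier A" "Y = Ker A U +> y"
        using Q[OF XY(1)] Q[OF XY(2)] by blast
      show "X \<oplus>\<^bsub>?Q\<^esub> Y \<in> carrier ?Q \<and> coset_fun U (X \<oplus>\<^bsub>?Q\<^esub> Y) = coset_fun U X \<oplus>\<^bsub>CU U\<^esub> coset_fun U Y"
        unfolding x(2) y(2) q(2)[OF x(1) y(1)] j[OF x(1)] j[OF y(1)] j[OF a_closed[OF x(1) y(1)]] hD(4)[OF x(1) y(1)]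
        using coset_in[OF a_closed[OF x(1) y(1)]] by (rule conjI) (rule refl)
      show "X \<otimes>\<^bsub>?Q\<^esub> Y \<in> carrier ?Q \<and> coset_fun U (X \<otimes>\<^bsub>?Q\<^esub> Y) = coset_fun U X \<otimes>\<^bsub>CU U\<^esub> coset_fun U Y"
        unfolding x(2) y(2) q(3)[OF x(1) y(1)] j[OF x(1)] j[OF y(1)] j[OF m_closed[OF x(1) y(1)]] hD(5)[OF x(1) y(1)]
        using coset_in[OF m_closed[OF x(1) y(1)]] by (rule conjI) (rule refl)
    qed
    show "c \<odot>\<^bsub>?Q\<^esub> X \<in> carrier ?Q \<and> coset_fun U (c \<odot>\<^bsub>?Q\<^esub> X) = c \<odot>\<^bsub>CU U\<^esub> coset_fun U X"
      "star ?Q X \<in> carrier ?Q \<and> coset_fun U (star ?Q X) = star (CU U) (coset_fun U X)"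
      if X: "X \<in> carrier ?Q" for X c
    proof -
      obtain x where x: "x \<in> carrier A" "X = Ker A U +> x" using Q[OF X] by blast
      show "c \<odot>\<^bsub>?Q\<^esub> X \<in> carrier ?Q \<and> coset_fun U (c \<odot>\<^bsub>?Q\<^esub> X) = c \<odot>\<^bsub>CU U\<^esub> coset_fun U X"
        unfolding x(2) q(6)[OF x(1)] j[OF x(1)] j[OF smult_cclosed[OF x(1)]] hD(7)[OF x(1)]
        using coset_in[OF smult_cclosed[OF x(1)]] by (rule conjI) (rule refl)
      show "star ?Q X \<in> carrier ?Q \<and> coset_fun U (star ?Q X) = star (CU U) (coset_fun U X)"
        unfolding x(2) q(7)[OF x(1)] j[OF x(1)] j[OF star_closed[OF x(1)]] hD(8)[OF x(1)]
        using coset_in[OF star_closed[OF x(1)]] by (rule conjI) (rule refl)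
    qed
    show "\<exists>X\<in>carrier ?Q. \<forall>t\<in>topspace (chars_space U). cmod (coset_fun U X t - f t) < e"
      if f: "f \<in> continuous_functions (chars_space U)" and e: "e > 0" for f e
    proof -
      obtain x where x: "x \<in> carrier A" "\<forall>t\<in>nbhd_chars U. cmod (t x - f t) < e"
        using gelfand_transform_approximates[OF compactin_nbhd_chars continuous_functionsD(1)[OF f] e] .
      have "coset_fun U (Ker A U +> x) t = t x" if "t \<in> nbhd_chars U" for t
        using coset_fun[OF x(1)] nbhd_charsD(1)[OF that] that x(1) by simp
      then show ?thesis using x(2) coset_in[OF x(1)] by (intro bexI[of _ "Ker A U +> x"]) simp_all
    qed
  qed
qed

end

definition quot_iso :: "'a set \<Rightarrow> (('a \<Rightarrow> complex) \<Rightarrow> complex) \<Rightarrow> (nat \<Rightarrow> 'a set) set" where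
  "quot_iso U = function_completion.limit_class (chars_space U) (quotient_algebra A U) (coset_fun U)"

definition quot_inv :: "'a set \<Rightarrow> (nat \<Rightarrow> 'a set) set \<Rightarrow> ('a \<Rightarrow> complex) \<Rightarrow> complex" where
  "quot_inv U = function_completion.limit_of (chars_space U) (quotient_algebra A U) (coset_fun U)"

lemma
  assumes U: "C_star_nbhd A U"
  shows quot_isos: "ialg_inverse_isos (CU U) (C_star_quotient A U) (quot_iso U) (quot_inv U)"
    and involutive_stereotype_C_star_quotient: "involutive_stereotype_algebra (C_star_quotient A U)"
  unfolding quot_iso_def quot_inv_def C_star_quotient_def
  by (rule function_completion.completion_inverse_isos[OF function_completion_quotient[OF U]]
      function_completion.involutive_stereotype_completion[OF function_completion_quotient[OF U]])+

lemma C_star_quotient_map_eq: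
  assumes U: "C_star_nbhd A U" and x: "x \<in> carrier A"
  shows "C_star_quotient_map A U x = quot_iso U (Gres U x)"
proof -
  interpret F: function_completion "chars_space U" "quotient_algebra A U" "quotient_norm A U" "coset_fun U"
    by (rule function_completion_quotient[OF U])
  have X: "Ker A U +> x \<in> carrier (quotient_algebra A U)" using x unfolding quotient_algebra_cosets(1)[OF U] by blast
  show ?thesis
    using F.cauchy_class_eq[OF F.const_limit_class[OF X] F.j_in[OF X]] x
    by (simp only: C_star_quotient_map_def quot_iso_def restrict_apply' coset_fun[OF U x])
qed

lemma minkowski_antimono:
  assumes U: "C_star_nbhd A U" and V: "C_star_nbhd A V" and VU: "V \<subseteq> U" and x: "x \<in> carrier A"
  shows "minkowski A U x \<le> minkowski A V x"
proof (rule dense_ge)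
  fix t assume t: "minkowski A V x < t"
  then have "0 < t" using minkowski_nonneg[OF V x] by simp
  then show "minkowski A U x \<le> t" using minkowski_less[OF V x t] VU by (intro minkowski_le[OF U x]) auto
qed

lemma nbhd_chars_antimono:
  assumes U: "C_star_nbhd A U" and V: "C_star_nbhd A V" and VU: "V \<subseteq> U"
  shows "nbhd_chars U \<subseteq> nbhd_chars V"
  using minkowski_antimono[OF assms] unfolding nbhd_chars_def char_ball_def by (blast intro: order_trans)

text \<open>For \<open>V \<subseteq> U\<close> the smaller kernel is absorbed by the larger one. The
  termwise rule in the connecting map therefore keeps the representative and only enlarges its
  coset.\<close>

lemma Ker_set_add_coset:
  assumes U: "C_star_nbhd A U" and V: "C_star_nbhd A V" and VU: "V \<subseteq> U" and x: "x \<in> carrier A"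
  shows "Ker A U <+> (Ker A V +> x) = Ker A U +> x"
proof -
  interpret I: ideal "Ker A U" A by (rule ideal_Ker[OF U])
  have sub: "Ker A V \<subseteq> Ker A U" using VU unfolding Ker_def by blast
  have "\<zero> \<in> Ker A V" by (rule additive_subgroup.zero_closed[OF ideal.axioms(1)[OF ideal_Ker[OF V]]])
  then have "h \<oplus> x \<in> Ker A U <+> (Ker A V +> x)" if "h \<in> Ker A U" for h
    using that x unfolding set_add_def' a_r_coset_def' by force
  moreover have "h \<oplus> (k \<oplus> x) \<in> Ker A U +> x" if h: "h \<in> Ker A U" and k: "k \<in> Ker A V" for h k
  proof -
    have kU: "k \<in> Ker A U" using sub k by blast
    have "h \<oplus> (k \<oplus> x) = (h \<oplus> k) \<oplus> x" using I.a_Hcarr[OF h] I.a_Hcarr[OF kU] x by (simp add: a_assoc)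
    then show ?thesis using I.a_closed[OF h kU] unfolding a_r_coset_def' by blast
  qed
  ultimately show ?thesis unfolding set_add_def' a_r_coset_def' by blast
qed

text \<open>Restriction to the smaller set of characters does not increase the uniform distance, so
  sequences with limit \<open>f\<close> are carried to sequences with the restricted limit. In terms
  of function algebras the projective system consists of restriction maps.\<close>

lemma C_star_connecting_map_eq:
  assumes U: "C_star_nbhd A U" and V: "C_star_nbhd A V" and VU: "V \<subseteq> U"
    and f: "f \<in> continuous_functions (chars_space V)"
  shows "C_star_connecting_map A V U (quot_iso V f) = quot_iso U (restrict f (nbhd_chars U))"
proof -
  interpret FU: function_completion "chars_space U" "quotient_algebra A U" "quotient_norm A U" "coset_fun U"
    by (rule function_completion_quotient[OF U])
  interpret FV: function_completion "chars_space V" "quotient_algebra A V" "quotient_norm A V" "coset_fun V"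
    by (rule function_completion_quotient[OF V])
  have K: "nbhd_chars U \<subseteq> nbhd_chars V" by (rule nbhd_chars_antimono[OF U V VU])
  have sub: "subtopology (chars_space V) (nbhd_chars U) = chars_space U"
    using K by (simp add: subtopology_subtopology Int_absorb1)
  have fU: "restrict f (nbhd_chars U) \<in> continuous_functions (chars_space U)"
    using involutive_homsD(3)[OF restrict_function_hom[of "nbhd_chars U" "chars_space V"], of f] K f sub nbhd_chars_subset by simp
  have "(\<Union>s\<in>quot_iso V f. cauchy_class (quotient_algebra A U) (quotient_norm A U) (\<lambda>n. Ker A U <+> s n)) =
      quot_iso U (restrict f (nbhd_chars U))"
    unfolding quot_iso_def
  proof (rule UN_eq_const[OF FV.limit_class_nonempty[OF f] FU.cauchy_class_eq[OF _ fU]])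
    fix s assume "s \<in> FV.limit_class f"
    note S = FV.limit_classD[OF this]
    have "\<exists>x\<in>carrier A. s n = Ker A V +> x" for n using S(1) unfolding quotient_algebra_cosets(1)[OF V] by blast
    then obtain x where x: "\<And>n. x n \<in> carrier A" "\<And>n. s n = Ker A V +> x n" by metis
    have s': "Ker A U <+> s n = Ker A U +> x n" for n
      unfolding x(2) by (rule Ker_set_add_coset[OF U V VU x(1)])
    show "(\<lambda>n. Ker A U <+> s n) \<in> FU.limit_class (restrict f (nbhd_chars U))"
    proof (rule FU.limit_classI[OF _ _ S(3)])
      show "Ker A U <+> s n \<in> carrier (quotient_algebra A U)" for n
        unfolding s' quotient_algebra_cosets(1)[OF U] using x(1) by blast
      show "FU.D (coset_fun U (Ker A U <+> s n)) (restrict f (nbhd_chars U)) \<le> FV.D (coset_fun V (s n)) f" for n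
      proof (rule FU.D_le[OF FV.D.nonneg])
        fix t assume "t \<in> topspace (chars_space U)"
        then have t: "t \<in> nbhd_chars U" "t \<in> nbhd_chars V" using K by auto
        have "coset_fun U (Ker A U <+> s n) = Gres U (x n)"
          by (simp only: s' coset_fun[OF U x(1)])
        moreover have "coset_fun V (s n) = Gres V (x n)"
          by (simp only: x(2) coset_fun[OF V x(1)])
        ultimately have "coset_fun U (Ker A U <+> s n) t = coset_fun V (s n) t" using t by simp
        then show "cmod (coset_fun U (Ker A U <+> s n) t - restrict f (nbhd_chars U) t) \<le> FV.D (coset_fun V (s n)) f"
          using FV.le_D[OF S(2) f, of t n] t nbhd_charsD(1)[OF t(2)] by simp
      qed
    qed
  qed
  moreover have "quot_iso V f \<in> carrier (C_star_quotient A V)" using iso_carrier(1)[OF quot_isos[OF V], of f] f by simp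
  ultimately show ?thesis by (simp add: C_star_connecting_map_def)
qed

subsubsection \<open>The neighbourhood of a compact set of characters\<close>

definition chars_polar :: "('a \<Rightarrow> complex) set \<Rightarrow> 'a set" where
  "chars_polar K = {x\<in>carrier A. \<forall>t\<in>K. cmod (t x) \<le> 1}"

text \<open>The gauge of the polar is the supremum of \<open>cmod (t x)\<close> over
  \<open>t\<close> in \<open>K\<close>, expressed by \<open>le\<close> and \<open>ge\<close>, and it
  inherits the C*-identity from the characters. Equicontinuity of \<open>K\<close> makes the polar a
  neighbourhood of zero. Consequently every compact set of characters is contained in one that
  belongs to a C*-neighbourhood.\<close>

lemma
  assumes K: "compactin (Spec A) K"
  shows C_star_nbhd_chars_polar: "C_star_nbhd A (chars_polar K)"
    and subset_nbhd_chars_polar: "K \<subseteq> nbhd_chars (chars_polar K)"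
proof -
  let ?U = "chars_polar K"
  have KH: "t \<in> H" if "t \<in> K" for t using compactin_subset_topspace[OF K] that by auto
  obtain W where W: "zero_nbhd A W" "\<forall>x\<in>W. \<forall>t\<in>K. cmod (t x) < 1"
    using compact_characters_equicontinuous[OF K zero_less_one] .
  have nb: "zero_nbhd A ?U"
    by (rule zero_nbhd_mono[OF W(1)])
      (use W(2) zero_nbhd_subset[OF W(1)] in \<open>auto simp: chars_polar_def intro: less_imp_le\<close>)
  have le: "cmod (t x) \<le> minkowski A ?U x" if t: "t \<in> K" and x: "x \<in> carrier A" for t x
    unfolding minkowski_def gauge_set[OF nb x]
  proof (rule cInf_greatest)
    show "{t. 0 < t \<and> of_real (inverse t) \<odot> x \<in> ?U} \<noteq> {}" using gauge_nonempty[OF nb x] by blast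
    fix r assume "r \<in> {t. 0 < t \<and> of_real (inverse t) \<odot> x \<in> ?U}"
    then have r: "0 < r" "cmod (t (of_real (inverse r) \<odot> x)) \<le> 1" using t by (auto simp: chars_polar_def)
    have "cmod (complex_of_real (inverse r) * t x) \<le> 1" using r(2) character(6)[OF KH[OF t] x] by simp
    then have "inverse r * cmod (t x) \<le> 1" using r(1) by (simp only: norm_mult norm_of_real) simp
    then show "cmod (t x) \<le> r" using r(1) by (simp add: field_simps)
  qed
  have ge: "minkowski A ?U x \<le> r" if x: "x \<in> carrier A" and r: "0 \<le> r" "\<And>t. t \<in> K \<Longrightarrow> cmod (t x) \<le> r" for x r
  proof (rule dense_ge)
    fix s assume s: "r < s"
    have "cmod (t (of_real (inverse s) \<odot> x)) \<le> 1" if t: "t \<in> K" for t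
    proof -
      have "cmod (t x) \<le> s" using r(2)[OF t] s by simp
      then have "inverse s * cmod (t x) \<le> 1" using r(1) s by (simp add: field_simps)
      then show ?thesis
        unfolding character(6)[OF KH[OF t] x] using r(1) s by (simp only: norm_mult norm_of_real) simp
    qed
    then have "of_real (inverse s) \<odot> x \<in> ?U" using x by (simp add: chars_polar_def)
    then show "minkowski A ?U x \<le> s" using r(1) s x by (intro gauge_le[OF nb]) auto
  qed
  have "closedin (topol A) {x \<in> topspace (topol A). t x \<in> cball 0 1}" if "t \<in> K" for t
    by (rule closedin_continuous_map_preimage[OF character(2)[OF KH[OF that]]]) simp
  then have "closedin (topol A) (\<Inter>(insert (topspace (topol A)) ((\<lambda>t. {x \<in> topspace (topol A). t x \<in> cball 0 1}) ` K)))"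
    using closedin_topspace[of "topol A"] by (intro closedin_Inter) auto
  moreover have "\<Inter>(insert (topspace (topol A)) ((\<lambda>t. {x \<in> topspace (topol A). t x \<in> cball 0 1}) ` K)) = ?U"
    by (auto simp: chars_polar_def)
  ultimately have cl: "closedin (topol A) ?U" by simp
  have "a \<odot> x \<oplus> b \<odot> y \<in> ?U" if x: "x \<in> ?U" and y: "y \<in> ?U" and ab: "cmod a + cmod b \<le> 1" for x y a b
  proof -
    have xy: "x \<in> carrier A" "y \<in> carrier A" using x y by (simp_all add: chars_polar_def)
    have "cmod (t (a \<odot> x \<oplus> b \<odot> y)) \<le> 1" if t: "t \<in> K" for t
    proof -
      have "cmod (t (a \<odot> x \<oplus> b \<odot> y)) \<le> cmod a * cmod (t x) + cmod b * cmod (t y)"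
        using norm_triangle_ineq[of "a * t x" "b * t y"] xy character[OF KH[OF t]] by (simp add: norm_mult)
      also have "\<dots> \<le> cmod a * 1 + cmod b * 1"
        using x y t by (intro add_mono mult_left_mono) (auto simp: chars_polar_def)
      finally show ?thesis using ab by simp
    qed
    then show ?thesis using xy by (simp add: chars_polar_def)
  qed
  then have ac: "absolutely_convex_in A ?U" unfolding absolutely_convex_in_def by blast
  have sq: "cmod (t (x \<otimes> star A x)) = (cmod (t x))\<^sup>2" if "t \<in> K" "x \<in> carrier A" for t x
    using character[OF KH[OF that(1)]] that(2) by (simp add: norm_mult power2_eq_square)
  have "minkowski A ?U (x \<otimes> star A x) = (minkowski A ?U x)\<^sup>2" if x: "x \<in> carrier A" for x
  proof (rule antisym)
    have xx: "x \<otimes> star A x \<in> carrier A" using x by simp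
    show "minkowski A ?U (x \<otimes> star A x) \<le> (minkowski A ?U x)\<^sup>2"
      by (rule ge[OF xx zero_le_power2]) (simp add: sq x power_mono le)
    have "minkowski A ?U x \<le> sqrt (minkowski A ?U (x \<otimes> star A x))"
    proof (rule ge[OF x])
      show "0 \<le> sqrt (minkowski A ?U (x \<otimes> star A x))" using gauge_nonneg[OF nb xx] by simp
      show "cmod (t x) \<le> sqrt (minkowski A ?U (x \<otimes> star A x))" if "t \<in> K" for t
        using le[OF that xx] sq[OF that x] by (intro real_le_rsqrt) simp
    qed
    then have "(minkowski A ?U x)\<^sup>2 \<le> (sqrt (minkowski A ?U (x \<otimes> star A x)))\<^sup>2"
      by (rule power_mono) (rule gauge_nonneg[OF nb x])
    then show "(minkowski A ?U x)\<^sup>2 \<le> minkowski A ?U (x \<otimes> star A x)"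
      using gauge_nonneg[OF nb xx] by simp
  qed
  then show "C_star_nbhd A ?U" unfolding C_star_nbhd_def using nb cl ac by blast
  show "K \<subseteq> nbhd_chars ?U" unfolding nbhd_chars_def char_ball_def using KH le by blast
qed

text \<open>Together with \<open>subset_nbhd_chars_polar\<close> this makes
  \<open>chars_polar {t}\<close> the largest C*-neighbourhood whose characters include
  \<open>t\<close>, hence a common target for connecting maps.\<close>

lemma subset_chars_polar:
  assumes U: "C_star_nbhd A U" and t: "t \<in> nbhd_chars U" shows "U \<subseteq> chars_polar {t}"
proof
  fix x assume x: "x \<in> U"
  then have xA: "x \<in> carrier A" using U_carrier[OF U] by blast
  show "x \<in> chars_polar {t}"
    using nbhd_charsD(2)[OF t xA] minkowski_le_1[OF U x] xA by (simp add: chars_polar_def)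
qed

subsubsection \<open>The projective limit\<close>

definition limit_map :: "'a set \<Rightarrow> (('a \<Rightarrow> complex) \<Rightarrow> complex) \<Rightarrow> (nat \<Rightarrow> 'a set) set" where
  "limit_map U = (\<lambda>f\<in>CF. quot_iso U (restrict f (nbhd_chars U)))"

lemma restrict_nbhd_chars_in:
  "f \<in> CF \<Longrightarrow> restrict f (nbhd_chars U) \<in> continuous_functions (chars_space U)"
  using involutive_homsD(3)[OF restrict_function_hom[of "nbhd_chars U" "Spec A"], of f] nbhd_chars_subset by simp

lemma limit_map_hom:
  assumes U: "C_star_nbhd A U"
  shows "limit_map U \<in> involutive_homs CH (C_star_quotient A U)"
proof -
  interpret C: compact_function_space "chars_space U" by (rule compact_chars_space[OF U])
  note isos = ialg_inverse_isos_homs[OF quot_isos[OF U] involutive_stereotype_algebraD(2,1,3)[OF C.involutive_stereotype_CM]]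
  have r: "(\<lambda>f\<in>CF. restrict f (nbhd_chars U)) \<in>
      involutive_homs CH (CU U)"
    by (rule restrict_function_hom) (simp add: nbhd_chars_subset)
  have sa: "star_algebra CH" by (rule star_algebra_function_algebra)
  have "compose (carrier CH) (restrict (quot_iso U) (carrier (CU U)))
      (\<lambda>f\<in>CF. restrict f (nbhd_chars U)) = limit_map U"
    unfolding compose_def limit_map_def using restrict_nbhd_chars_in by (auto intro!: restrict_ext)
  moreover have "ring CH" using sa by (simp add: star_algebra_def)
  moreover have "complex_lcs CH" by (intro complex_lcsI lcs_function_algebra)
  ultimately show ?thesis using compose_involutive_homs[OF r isos(1) _ _ sa] by simp
qed

context
  assumes lc: "locally_compact_space (Spec A)" and pc: "paracompact_space (Spec A)"
begin

lemma limit_map_cone: "C_star_cone A CH limit_map"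
  unfolding C_star_cone_def
proof (intro conjI allI impI)
  fix U assume U: "C_star_nbhd A U"
  show "morphism CH (C_star_quotient A U) (limit_map U)"
    unfolding morphism_def
    using involutive_stereotype_function_algebra[OF lc pc] involutive_stereotype_C_star_quotient[OF U] limit_map_hom[OF U] by blast
next
  fix U V assume "C_star_nbhd A U \<and> C_star_nbhd A V \<and> V \<subseteq> U"
  then have U: "C_star_nbhd A U" and V: "C_star_nbhd A V" and VU: "V \<subseteq> U" by simp_all
  have "C_star_connecting_map A V U (limit_map V f) = limit_map U f" if f: "f \<in> CF" for f
  proof -
    have "restrict (restrict f (nbhd_chars V)) (nbhd_chars U) = restrict f (nbhd_chars U)"
      using nbhd_chars_antimono[OF U V VU] by (intro restrict_ext) auto
    then show ?thesis
      using C_star_connecting_map_eq[OF U V VU restrict_nbhd_chars_in[OF f]] f by (simp add: limit_map_def)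
  qed
  then show "compose (carrier CH) (C_star_connecting_map A V U) (limit_map V) = limit_map U"
    by (intro extensionalityI[of _ "CF"]) (simp_all add: compose_def limit_map_def)
qed

text \<open>Under the isomorphisms \<open>quot_iso\<close> a cone becomes a family of morphisms into
  the algebras \<open>C(nbhd_chars U)\<close>. Their values at a character \<open>t\<close> are
  compared through \<open>chars_polar {t}\<close>, which contains every \<open>U\<close> concerned,
  rather than through a common refinement. Uniqueness is tested at the same neighbourhoods.\<close>

lemma C_star_cone_factors:
  fixes X :: "'u ialg"
  assumes X: "involutive_stereotype_algebra X" and cone: "C_star_cone A X \<tau>"
  shows "\<exists>!h. morphism X CH h \<and> (\<forall>U. C_star_nbhd A U \<longrightarrow> compose (carrier X) (limit_map U) h = \<tau> U)"
proof -
  let ?C = "CH"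
  note XD = involutive_stereotype_algebraD[OF X]
  have C: "involutive_stereotype_algebra ?C" by (rule involutive_stereotype_function_algebra[OF lc pc])
  have \<tau>: "\<tau> U \<in> involutive_homs X (C_star_quotient A U)" if "C_star_nbhd A U" for U
    using cone that by (simp add: C_star_cone_def morphism_def)
  have \<tau>_conn: "C_star_connecting_map A V U (\<tau> V y) = \<tau> U y"
    if "C_star_nbhd A U" "C_star_nbhd A V" "V \<subseteq> U" "y \<in> carrier X" for U V y
  proof -
    have "compose (carrier X) (C_star_connecting_map A V U) (\<tau> V) = \<tau> U" using cone that(1-3) by (simp add: C_star_cone_def)
    from fun_cong[OF this, of y] show ?thesis using that(4) by (simp add: compose_def)
  qed
  define \<theta> where "\<theta> = (\<lambda>U. \<lambda>y\<in>carrier X. quot_inv U (\<tau> U y))"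
  have \<theta>: "\<theta> U \<in> involutive_homs X (CU U)" if U: "C_star_nbhd A U" for U
  proof -
    interpret CS: compact_function_space "chars_space U" by (rule compact_chars_space[OF U])
    note isos = ialg_inverse_isos_homs[OF quot_isos[OF U] involutive_stereotype_algebraD(2,1,3)[OF CS.involutive_stereotype_CM]]
    have "compose (carrier X) (restrict (quot_inv U) (carrier (C_star_quotient A U))) (\<tau> U) = \<theta> U"
      unfolding compose_def \<theta>_def using involutive_homsD(3)[OF \<tau>[OF U]] by (intro restrict_ext) simp
    then show ?thesis using compose_involutive_homs[OF \<tau>[OF U] isos(2) XD(1-3)] by simp
  qed
  have \<theta>_in: "\<theta> U y \<in> continuous_functions (chars_space U)" if "C_star_nbhd A U" "y \<in> carrier X" for U y
    using involutive_homsD(3)[OF \<theta>[OF that(1)] that(2)] by simp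
  have \<tau>_eq: "\<tau> U y = quot_iso U (\<theta> U y)" if "C_star_nbhd A U" "y \<in> carrier X" for U y
    using iso_inverse(2)[OF quot_isos[OF that(1)] involutive_homsD(3)[OF \<tau>[OF that(1)] that(2)]] that(2)
    by (simp add: \<theta>_def)
  have quot_inj: "f = g" if "C_star_nbhd A U" "f \<in> continuous_functions (chars_space U)"
    "g \<in> continuous_functions (chars_space U)" "quot_iso U f = quot_iso U g" for U f g
  proof -
    have "f = quot_inv U (quot_iso U f)" by (rule iso_inverse(1)[OF quot_isos[OF that(1)], symmetric]) (use that(2) in simp)
    also have "\<dots> = quot_inv U (quot_iso U g)" by (simp only: that(4))
    also have "\<dots> = g" by (rule iso_inverse(1)[OF quot_isos[OF that(1)]]) (use that(3) in simp)
    finally show ?thesis .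
  qed
  have pt: "C_star_nbhd A (chars_polar {t})" "t \<in> nbhd_chars (chars_polar {t})" if "t \<in> H" for t
    using C_star_nbhd_chars_polar[of "{t}"] subset_nbhd_chars_polar[of "{t}"] that by simp_all
  have \<theta>_pt: "\<theta> U y t = \<theta> (chars_polar {t}) y t" if U: "C_star_nbhd A U" and t: "t \<in> nbhd_chars U" and y: "y \<in> carrier X" for U t y
  proof -
    let ?W = "chars_polar {t}"
    have tH: "t \<in> H" by (rule nbhd_charsD(1)[OF t])
    note W = pt[OF tH]
    have sub: "U \<subseteq> ?W" by (rule subset_chars_polar[OF U t])
    have K: "nbhd_chars ?W \<subseteq> nbhd_chars U" by (rule nbhd_chars_antimono[OF W(1) U sub])
    have s: "subtopology (chars_space U) (nbhd_chars ?W) = chars_space ?W"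
      using K by (simp add: subtopology_subtopology Int_absorb1)
    have r: "restrict (\<theta> U y) (nbhd_chars ?W) \<in> continuous_functions (chars_space ?W)"
      using involutive_homsD(3)[OF restrict_function_hom[of "nbhd_chars ?W" "chars_space U"], of "\<theta> U y"] K \<theta>_in[OF U y] s
        nbhd_chars_subset by simp
    have "quot_iso ?W (restrict (\<theta> U y) (nbhd_chars ?W)) = quot_iso ?W (\<theta> ?W y)"
      using C_star_connecting_map_eq[OF W(1) U sub \<theta>_in[OF U y]] \<tau>_conn[OF W(1) U sub y] \<tau>_eq[OF U y] \<tau>_eq[OF W(1) y] by simp
    from fun_cong[OF quot_inj[OF W(1) r \<theta>_in[OF W(1) y] this], of t] show ?thesis using W(2) by simp
  qed
  let ?h = "\<lambda>y\<in>carrier X. \<lambda>t\<in>topspace (Spec A). \<theta> (chars_polar {t}) y t"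
  \<comment> \<open>For compact \<open>K\<close> the member of the family at
    \<open>chars_polar K\<close> is used; its set of characters contains \<open>K\<close>, to which
    it is then restricted.\<close>
  have hh: "?h \<in> involutive_homs X ?C"
  proof (rule glue_homs[OF lc XD(1-3), of "\<lambda>K. \<lambda>y\<in>carrier X. restrict (\<theta> (chars_polar K) y) K"])
    fix K assume K: "compactin (Spec A) K"
    note N = C_star_nbhd_chars_polar[OF K] subset_nbhd_chars_polar[OF K]
    show "(\<lambda>y\<in>carrier X. restrict (\<theta> (chars_polar K) y) K) \<in> involutive_homs X (CK K)"
      by (rule compose_restrict_function_hom[OF \<theta>[OF N(1)] N(2) _ XD(1-3)]) (simp add: nbhd_chars_subset)
    show "(\<lambda>y\<in>carrier X. restrict (\<theta> (chars_polar K) y) K) y t = \<theta> (chars_polar {t}) y t"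
      if t: "t \<in> K" and y: "y \<in> carrier X" for t y
      using \<theta>_pt[OF N(1) _ y, of t] N(2) t y by auto
  qed
  show ?thesis
  proof (intro ex1I conjI allI impI)
    show "morphism X ?C ?h" unfolding morphism_def using X C hh by blast
    fix U assume U: "C_star_nbhd A U"
    show "compose (carrier X) (limit_map U) ?h = \<tau> U"
    proof (rule extensionalityI[OF _ involutive_homsD(1)[OF \<tau>[OF U]]])
      fix y assume y: "y \<in> carrier X"
      have "?h y \<in> CF" using involutive_homsD(3)[OF hh y] by simp
      moreover have "restrict (?h y) (nbhd_chars U) = \<theta> U y"
      proof (rule extensionalityI[of _ "nbhd_chars U"])
        show "\<theta> U y \<in> extensional (nbhd_chars U)" using \<theta>_in[OF U y] unfolding continuous_functions_def topspace_chars_space by blast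
        show "restrict (?h y) (nbhd_chars U) t = \<theta> U y t" if "t \<in> nbhd_chars U" for t
          using \<theta>_pt[OF U that y] nbhd_charsD(1)[OF that] that y by simp
      qed simp
      ultimately show "compose (carrier X) (limit_map U) ?h y = \<tau> U y"
        using \<tau>_eq[OF U y] y by (simp only: compose_def limit_map_def restrict_apply')
    qed (simp add: compose_def)
  next
    fix g assume g: "morphism X ?C g \<and> (\<forall>U. C_star_nbhd A U \<longrightarrow> compose (carrier X) (limit_map U) g = \<tau> U)"
    then have gh: "g \<in> involutive_homs X ?C" by (simp add: morphism_def)
    show "g = ?h"
    proof (rule extensionalityI[OF involutive_homsD(1)[OF gh]])
      fix y assume y: "y \<in> carrier X"
      have gy: "g y \<in> CF" using involutive_homsD(3)[OF gh y] by simp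
      have "g y t = \<theta> (chars_polar {t}) y t" if t: "t \<in> H" for t
      proof -
        note W = pt[OF t]
        have "compose (carrier X) (limit_map (chars_polar {t})) g = \<tau> (chars_polar {t})" using g W(1) by blast
        from fun_cong[OF this, of y] have "quot_iso (chars_polar {t}) (restrict (g y) (nbhd_chars (chars_polar {t}))) =
            quot_iso (chars_polar {t}) (\<theta> (chars_polar {t}) y)"
          using \<tau>_eq[OF W(1) y] y gy by (simp add: compose_def limit_map_def)
        from fun_cong[OF quot_inj[OF W(1) restrict_nbhd_chars_in[OF gy] \<theta>_in[OF W(1) y] this], of t]
        show ?thesis using W(2) by simp
      qed
      then show "g y = ?h y"
        using gy y by (intro extensionalityI[of _ H]) (simp_all add: continuous_functions_def)
    qed simp
  qed
qed

lemma kuznetsova_envelope_gelfand: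
  "kuznetsova_envelope TYPE('u) A CH (\<G>)"
  unfolding kuznetsova_envelope_def
proof (intro exI[of _ limit_map] conjI allI impI)
  have C: "involutive_stereotype_algebra CH"
    by (rule involutive_stereotype_function_algebra[OF lc pc])
  show "projective_limit TYPE('u) A CH limit_map"
    unfolding projective_limit_def using C limit_map_cone C_star_cone_factors by blast
  show "morphism A CH (\<G>)"
    unfolding morphism_def using A C gelfand_transform_hom by blast
  fix U assume U: "C_star_nbhd A U"
  show "compose (carrier A) (limit_map U) (\<G>) = C_star_quotient_map A U"
  proof (rule extensionalityI[of _ "carrier A"])
    show "C_star_quotient_map A U \<in> extensional (carrier A)" by (simp add: C_star_quotient_map_def)
    show "compose (carrier A) (limit_map U) (\<G>) x = C_star_quotient_map A U x" if x: "x \<in> carrier A" for x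
      using C_star_quotient_map_eq[OF U x] gelfand_transform_in[OF x] x
      by (simp only: compose_def limit_map_def restrict_apply')
  qed (simp add: compose_def)
qed

end

end

text \<open>The test objects of the universal properties live on \<open>'u\<close>. The injection
  \<open>e\<close> ensures that there are C*-algebras among them isomorphic to \<open>C(K)\<close>
  for every compact set \<open>K\<close> of characters, and these are the algebras on which an
  extension of \<open>A\<close> is tested.\<close>

theorem theorem0p3p38:
  fixes A :: "'a ialg"
    and e :: "(('a \<Rightarrow> complex) \<Rightarrow> complex) \<Rightarrow> 'u"
  assumes universe: "inj e"
    and A: "involutive_stereotype_algebra A"
    and commutative: "commutative_algebra A"
    and paracompact: "paracompact_space (Spec A)"
    and locally_compact: "locally_compact_space (Spec A)"
  shows "C_star_envelope TYPE('u) DEpi A (function_algebra (Spec A)) (gelfand_transform A) \<and>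
         C_star_envelope TYPE('u) Epi A (function_algebra (Spec A)) (gelfand_transform A) \<and>
         C_star_envelope TYPE('u) All_Mor A (function_algebra (Spec A)) (gelfand_transform A) \<and>
         kuznetsova_envelope TYPE('u) A (function_algebra (Spec A)) (gelfand_transform A)"
proof -
  interpret commutative_stereotype_algebra A
    by (rule commutative_stereotype_algebra.intro[OF A commutative])
  show ?thesis
    by (intro conjI C_star_envelope_gelfand[OF universe locally_compact paracompact A]
        kuznetsova_envelope_gelfand[OF locally_compact paracompact])
qed

end
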